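(* Let $N$ be a connected finite regular CW complex and $\mathfrak p$ a perversity. Let $V$ be a finite dimensional real vector space with the trivial representation $\rho_0$. Let $n_\bullet$ be the graded standard basis and $h_\bullet$ any other graded basis for the homology of $C_\bullet(N;V_{\rho_0})$. Then the torsion of the cellular intersection chain complex $I^{\mathfrak p}C_\bullet(C(N);V_{\rho_0})$ of the cone $C(N)$, with the natural graded chain basis $I^{\mathfrak p}\dot c_\bullet$ and the graded homology basis $I^{\mathfrak p}\dot h_\bullet$, is well defined and given by $$\tau_{\rm R}(I^{\mathfrak p}C_\bullet(C(N);V_{\rho_0});I^{\mathfrak p}\dot c_\bullet,I^{\mathfrak p}\dot h_\bullet)=\prod_{q=0}^{\mathfrak a-2}|\det(h_q/n_q)|^{(-1)^q}\prod_{q=0}^{\mathfrak a-2}\big(\#TH_q(N;\mathbb Z)\big)^{(-1)^q}.$$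
   Context: Let $m=\dim N$. A perversity is a sequence of integers $\mathfrak p=\{\mathfrak p_j\}_{j=2}^{n}$ with $\mathfrak p_2=0$ and $\mathfrak p_{j+1}\in\{\mathfrak p_j,\mathfrak p_j+1\}$; here $n=m+1$ and $\mathfrak a=n-\mathfrak p_n$. $C_\bullet(N;V_{\rho_0})=V\otimes C_\bullet(N;\mathbb Z)$ is the cellular complex. $C(N)$ is the cone over $N$ with vertex $v$ and cells $v$, $e$ and $[v,e]$ (the cone on $e$), for $e$ a cell of $N$. $I^{\mathfrak p}C(N)_{(q)}$ is the subcomplex of the $q$-skeleton formed by the cells $e$ with $\dim(\bar e\cap\{v\})\le q-n+\mathfrak p_n$ (with $\dim\emptyset=-\infty$); it equals $N_{(q)}$ for $q<\mathfrak a$ and $C(N)_{(q)}$ for $q\ge\mathfrak a$. $I^{\mathfrak p}C_q(C(N);\mathbb Z)=H_q(I^{\mathfrak p}C(N)_{(q)},I^{\mathfrak p}C(N)_{(q-1)})$, with the boundary operators of the filtration, and $I^{\mathfrak p}C_\bullet(C(N);V_{\rho_0})=V\otimes I^{\mathfrak p}C_\bullet(C(N);\mathbb Z)$. Its homology is $H_q(N;V)$ for $q\le\mathfrak a-2$ and $0$ for $q\ge\mathfrak a-1$. Chain basis $I^{\mathfrak p}\dot c_q$ (tensored with a fixed basis of $V$): the $q$-cells of $N$ for $q\le\mathfrak a-1$; for $q=\mathfrak a$, the $\mathfrak a$-cells of $N$ together with the cones over any $\mathbb Z$-basis of the cellular cycles $\ker(\partial_{\mathfrak a-1}:C_{\mathfrak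 a-1}(N;\mathbb Z)\to C_{\mathfrak a-2}(N;\mathbb Z))$; the $q$-cells of $C(N)$ for $q\ge\mathfrak a+1$. Homology basis: $I^{\mathfrak p}\dot h_q=h_q$ for $q\le\mathfrak a-2$, empty for $q\ge\mathfrak a-1$. The standard basis $n_q$ is the one induced by a $\mathbb Z$-basis of the free part of $H_q(N;\mathbb Z)$ (and the fixed basis of $V$). $TH_q$ is the torsion subgroup of $H_q$. For a finite complex $D_\bullet$ of finite dimensional real vector spaces with bases $c_q$ of $D_q$ and $h_q$ of $H_q(D_\bullet)$, $\tau_{\rm R}(D_\bullet;c_\bullet,h_\bullet)=\prod_q|\det(\partial_{q+1}(b_{q+1})\hat h_qb_q/c_q)|^{(-1)^q}$, where $b_q\subset D_q$ is mapped bijectively by $\partial_q$ onto a basis of ${\rm im}\,\partial_q$, $\hat h_q$ is a lift of $h_q$ to cycles, and $(y/x)$ is the change of basis matrix from $x$ to $y$.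
   Formalization: The factor #TH_q(N;Z) is replaced by (#TH_q(N;Z))^{dim V}, since the printed formula fails for dim V > 1 (e.g. N = RP^2, V = R^2, p = 0, h = n: the torsion is 1/4, not 1/2); for dim V = 1 the two formulas agree. *)

theory Defs
  imports
    "HOL-Homology.Homology"
    "HOL-Library.Function_Algebras"
    "Jordan_Normal_Form.Determinant"
begin

section \<open>Finite regular CW complexes\<close>

definition cell_ball :: "nat \<Rightarrow> (nat \<Rightarrow> real) topology" where
  "cell_ball q = subtopology (Euclidean_space q) {x. (\<Sum>i<q. (x i)\<^sup>2) \<le> 1}"

definition open_cell_ball :: "nat \<Rightarrow> (nat \<Rightarrow> real) set" where
  "open_cell_ball q = {x \<in> topspace (Euclidean_space q). (\<Sum>i<q. (x i)\<^sup>2) < 1}"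

text \<open>A cell structure is given by the sets \<open>E q\<close> of open \<open>q\<close>-cells.  Regularity: the
  characteristic map of every cell is an embedding of the closed ball.  Closure finiteness and
  the weak topology are automatic, since there are finitely many cells.\<close>

definition regular_CW_complex :: "'a topology \<Rightarrow> (nat \<Rightarrow> 'a set set) \<Rightarrow> bool" where
  "regular_CW_complex X E \<longleftrightarrow>
     Hausdorff_space X \<and>
     finite {(q, e). e \<in> E q} \<and>
     (\<Union>q. \<Union>(E q)) = topspace X \<and>
     (\<forall>j k e f. e \<in> E j \<longrightarrow> f \<in> E k \<longrightarrow> (j, e) \<noteq> (k, f) \<longrightarrow> e \<inter> f = {}) \<and>
     (\<forall>q. \<forall>e\<in>E q. \<exists>\<phi>. embedding_map (cell_ball q) X \<phi> \<and>
        \<phi> ` open_cell_ball q = e \<and>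
        \<phi> ` (topspace (cell_ball q) - open_cell_ball q) \<subseteq> (\<Union>k<q. \<Union>(E k)))"

definition cw_dim :: "(nat \<Rightarrow> 'a set set) \<Rightarrow> nat" where
  "cw_dim E = Max {q. E q \<noteq> {}}"

definition skeleton :: "(nat \<Rightarrow> 'a set set) \<Rightarrow> int \<Rightarrow> 'a set" where
  "skeleton E k = \<Union>{e. \<exists>q. int q \<le> k \<and> e \<in> E q}"


section \<open>The chain complex of a filtered space\<close>

text \<open>The groups \<open>H\<^sub>q(F\<^sub>q, F\<^sub>q\<^sub>-\<^sub>1)\<close> (singular homology, integer coefficients, written
  multiplicatively) with the boundary operators of the triples \<open>(F\<^sub>q, F\<^sub>q\<^sub>-\<^sub>1, F\<^sub>q\<^sub>-\<^sub>2)\<close>.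
  For the filtration by skeleta this is the cellular chain complex.\<close>

definition filt_group :: "'a topology \<Rightarrow> (int \<Rightarrow> 'a set) \<Rightarrow> int \<Rightarrow> 'a chain set monoid" where
  "filt_group X F q = relative_homology_group q (subtopology X (F q)) (F (q - 1))"

definition filt_boundary ::
    "'a topology \<Rightarrow> (int \<Rightarrow> 'a set) \<Rightarrow> int \<Rightarrow> 'a chain set \<Rightarrow> 'a chain set" where
  "filt_boundary X F q = hom_relboundary q (subtopology X (F q)) (F (q - 1)) (F (q - 2))"

definition filt_cycles :: "'a topology \<Rightarrow> (int \<Rightarrow> 'a set) \<Rightarrow> int \<Rightarrow> 'a chain set set" where
  "filt_cycles X F q = kernel (filt_group X F q) (filt_group X F (q - 1)) (filt_boundary X F q)"

definition filt_homology ::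
    "'a topology \<Rightarrow> (int \<Rightarrow> 'a set) \<Rightarrow> int \<Rightarrow> 'a chain set set monoid" where
  "filt_homology X F q =
     subgroup_generated (filt_group X F q) (filt_cycles X F q)
       Mod (filt_boundary X F (q + 1) ` carrier (filt_group X F (q + 1)))"

text \<open>An oriented \<open>q\<close>-cell is the image of a generator of \<open>H\<^sub>q\<close> of the closed cell modulo its
  boundary; it is determined by the cell up to sign.\<close>

definition oriented_cell ::
    "'a topology \<Rightarrow> (int \<Rightarrow> 'a set) \<Rightarrow> int \<Rightarrow> 'a set \<Rightarrow> 'a chain set \<Rightarrow> bool" where
  "oriented_cell X F q e s \<longleftrightarrow>
     (let K = X closure_of e; G = relative_homology_group q (subtopology X K) (K - e) in
      \<exists>g \<in> carrier G. generate G {g} = carrier G \<and>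
        s = hom_induced q (subtopology X K) (K - e) (subtopology X (F q)) (F (q - 1)) id g)"

definition oriented_cells ::
    "'a topology \<Rightarrow> (int \<Rightarrow> 'a set) \<Rightarrow> int \<Rightarrow> 'a set set \<Rightarrow> 'a chain set list \<Rightarrow> bool" where
  "oriented_cells X F q A ss \<longleftrightarrow>
     (\<exists>es. distinct es \<and> set es = A \<and> list_all2 (oriented_cell X F q) es ss)"


section \<open>Integral bases and torsion subgroups\<close>

definition int_comb :: "('g, 'm) monoid_scheme \<Rightarrow> 'g list \<Rightarrow> int list \<Rightarrow> 'g" where
  "int_comb G xs k = finprod G (\<lambda>i. (xs ! i) [^]\<^bsub>G\<^esub> (k ! i)) {..<length xs}"

definition int_basis :: "('g, 'm) monoid_scheme \<Rightarrow> 'g set \<Rightarrow> 'g list \<Rightarrow> bool" where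
  "int_basis G K xs \<longleftrightarrow> set xs \<subseteq> K \<and>
     (\<forall>x\<in>K. \<exists>!k. length k = length xs \<and> x = int_comb G xs k)"

definition torsion_subgroup :: "('g, 'm) monoid_scheme \<Rightarrow> 'g set" where
  "torsion_subgroup G = {x \<in> carrier G. \<exists>k::nat. k > 0 \<and> x [^]\<^bsub>G\<^esub> k = \<one>\<^bsub>G\<^esub>}"

text \<open>\<open>xs\<close> is a basis of a free subgroup \<open>L\<close> such that \<open>G\<close> is the direct sum of \<open>L\<close> and the
  torsion subgroup.\<close>

definition free_part_basis :: "('g, 'm) monoid_scheme \<Rightarrow> 'g list \<Rightarrow> bool" where
  "free_part_basis G xs \<longleftrightarrow> set xs \<subseteq> carrier G \<and>
     (\<forall>x\<in>carrier G. \<exists>!(k, t). length k = length xs \<and> t \<in> torsion_subgroup G \<and>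
        x = int_comb G xs k \<otimes>\<^bsub>G\<^esub> t)"


section \<open>The tensor product of a real vector space and an abelian group\<close>

instantiation "fun" :: (type, real_vector) real_vector
begin

definition scaleR_fun :: "real \<Rightarrow> ('a \<Rightarrow> 'b) \<Rightarrow> 'a \<Rightarrow> 'b" where
  "scaleR_fun r f = (\<lambda>x. r *\<^sub>R f x)"

instance
  by standard (simp_all add: scaleR_fun_def fun_eq_iff algebra_simps)

end

text \<open>\<open>V \<otimes>\<^sub>\<int> G\<close> is a real vector space whose linear forms are the functions
  \<open>V \<times> G \<rightarrow> \<real>\<close> that are linear in \<open>V\<close> and additive in \<open>G\<close>.  It is realised as a subspace of its
  double dual: \<open>v \<otimes> g\<close> is the evaluation of such forms at \<open>(v, g)\<close>.\<close>

type_synonym ('v, 'g) tensor = "('v \<Rightarrow> 'g \<Rightarrow> real) \<Rightarrow> real"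

definition bilinear_forms ::
    "('g, 'm) monoid_scheme \<Rightarrow> ('v::real_vector \<Rightarrow> 'g \<Rightarrow> real) set" where
  "bilinear_forms G = {\<beta>. (\<forall>g\<in>carrier G. linear (\<lambda>v. \<beta> v g)) \<and>
     (\<forall>v. \<forall>g\<in>carrier G. \<forall>h\<in>carrier G. \<beta> v (g \<otimes>\<^bsub>G\<^esub> h) = \<beta> v g + \<beta> v h)}"

definition pure_tensor ::
    "('g, 'm) monoid_scheme \<Rightarrow> 'v::real_vector \<Rightarrow> 'g \<Rightarrow> ('v, 'g) tensor" where
  "pure_tensor G v g = (\<lambda>\<beta>. if \<beta> \<in> bilinear_forms G then \<beta> v g else 0)"

definition tensor_space ::
    "('g, 'm) monoid_scheme \<Rightarrow> ('v::real_vector, 'g) tensor set" where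
  "tensor_space G = span {pure_tensor G v g | v g. g \<in> carrier G}"

text \<open>\<open>id\<^sub>V \<otimes> \<phi>\<close> for a homomorphism \<open>\<phi>\<close> with codomain \<open>H\<close>.\<close>

definition tensor_map ::
    "('h, 'm) monoid_scheme \<Rightarrow> ('g \<Rightarrow> 'h) \<Rightarrow> ('v::real_vector, 'g) tensor \<Rightarrow> ('v, 'h) tensor" where
  "tensor_map H \<phi> T = (\<lambda>\<beta>. if \<beta> \<in> bilinear_forms H then T (\<lambda>v g. \<beta> v (\<phi> g)) else 0)"

definition tensor_basis ::
    "('g, 'm) monoid_scheme \<Rightarrow> 'v::real_vector list \<Rightarrow> 'g list \<Rightarrow> ('v, 'g) tensor list" where
  "tensor_basis G vs ss = [pure_tensor G v s. s \<leftarrow> ss, v \<leftarrow> vs]"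

definition filt_space ::
    "'a topology \<Rightarrow> (int \<Rightarrow> 'a set) \<Rightarrow> nat \<Rightarrow> ('v::real_vector, 'a chain set) tensor set" where
  "filt_space X F q = tensor_space (filt_group X F (int q))"

definition filt_diff ::
    "'a topology \<Rightarrow> (int \<Rightarrow> 'a set) \<Rightarrow> nat \<Rightarrow>
       ('v::real_vector, 'a chain set) tensor \<Rightarrow> ('v, 'a chain set) tensor" where
  "filt_diff X F q = tensor_map (filt_group X F (int q - 1)) (filt_boundary X F (int q))"


section \<open>Torsion of finite complexes of real vector spaces\<close>

definition real_basis :: "'w::real_vector set \<Rightarrow> 'w list \<Rightarrow> bool" where
  "real_basis W bs \<longleftrightarrow> distinct bs \<and> independent (set bs) \<and> span (set bs) = W"

text \<open>A complex is graded by the naturals; \<open>d q\<close> maps \<open>D q\<close> to \<open>D (q - 1)\<close>, and \<open>d 0\<close> vanishes.\<close>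

definition real_complex ::
    "(nat \<Rightarrow> 'w::real_vector set) \<Rightarrow> (nat \<Rightarrow> 'w \<Rightarrow> 'w) \<Rightarrow> bool" where
  "real_complex D d \<longleftrightarrow>
     finite {q. D q \<noteq> {0}} \<and>
     (\<forall>q. \<exists>bs. real_basis (D q) bs) \<and>
     (\<forall>q. \<forall>x\<in>D q. \<forall>y\<in>D q. d q (x + y) = d q x + d q y) \<and>
     (\<forall>q r. \<forall>x\<in>D q. d q (r *\<^sub>R x) = r *\<^sub>R d q x) \<and>
     (\<forall>x\<in>D 0. d 0 x = 0) \<and>
     (\<forall>q. \<forall>x\<in>D (Suc q). d (Suc q) x \<in> D q \<and> d q (d (Suc q) x) = 0)"

definition cycles :: "(nat \<Rightarrow> 'w::real_vector set) \<Rightarrow> (nat \<Rightarrow> 'w \<Rightarrow> 'w) \<Rightarrow> nat \<Rightarrow> 'w set" where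
  "cycles D d q = {x \<in> D q. d q x = 0}"

definition boundaries :: "(nat \<Rightarrow> 'w::real_vector set) \<Rightarrow> (nat \<Rightarrow> 'w \<Rightarrow> 'w) \<Rightarrow> nat \<Rightarrow> 'w set" where
  "boundaries D d q = d (Suc q) ` D (Suc q)"

definition homology_class ::
    "(nat \<Rightarrow> 'w::real_vector set) \<Rightarrow> (nat \<Rightarrow> 'w \<Rightarrow> 'w) \<Rightarrow> nat \<Rightarrow> 'w \<Rightarrow> 'w set" where
  "homology_class D d q z = (\<lambda>b. z + b) ` boundaries D d q"

text \<open>\<open>zs\<close> is a list of representatives of the classes \<open>hs\<close>.\<close>

definition lift :: "'w list \<Rightarrow> 'w set list \<Rightarrow> bool" where
  "lift zs hs \<longleftrightarrow> list_all2 (\<in>) zs hs"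

definition homology_basis ::
    "(nat \<Rightarrow> 'w::real_vector set) \<Rightarrow> (nat \<Rightarrow> 'w \<Rightarrow> 'w) \<Rightarrow> nat \<Rightarrow> 'w set list \<Rightarrow> bool" where
  "homology_basis D d q hs \<longleftrightarrow>
     set hs \<subseteq> homology_class D d q ` cycles D d q \<and>
     (\<forall>zs. lift zs hs \<longrightarrow> (\<forall>z \<in> cycles D d q. \<exists>!r. length r = length zs \<and>
        z - (\<Sum>i<length zs. (r ! i) *\<^sub>R (zs ! i)) \<in> boundaries D d q))"

text \<open>The matrix \<open>(ys / xs)\<close>, in the quotient by the subspace \<open>B\<close>: column \<open>j\<close> consists of the
  coordinates of \<open>ys ! j\<close> with respect to \<open>xs\<close>.\<close>

definition coordinates_mod :: "'w::real_vector set \<Rightarrow> 'w list \<Rightarrow> 'w \<Rightarrow> real list" where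
  "coordinates_mod B xs y =
     (THE r. length r = length xs \<and> y - (\<Sum>i<length xs. (r ! i) *\<^sub>R (xs ! i)) \<in> B)"

definition base_change :: "'w::real_vector set \<Rightarrow> 'w list \<Rightarrow> 'w list \<Rightarrow> real mat" where
  "base_change B ys xs =
     mat (length xs) (length ys) (\<lambda>(i, j). coordinates_mod B xs (ys ! j) ! i)"

definition homology_base_change ::
    "(nat \<Rightarrow> 'w::real_vector set) \<Rightarrow> (nat \<Rightarrow> 'w \<Rightarrow> 'w) \<Rightarrow> nat \<Rightarrow> 'w set list \<Rightarrow> 'w set list \<Rightarrow>
       real mat" where
  "homology_base_change D d q hs ns =
     base_change (boundaries D d q) (map (\<lambda>C. SOME z. z \<in> C) hs) (map (\<lambda>C. SOME z. z \<in> C) ns)"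

text \<open>\<open>t\<close> is the value of the torsion for some choice of the \<open>b q\<close> and of the lifts \<open>l q\<close>.\<close>

definition torsion_value ::
    "(nat \<Rightarrow> 'w::real_vector set) \<Rightarrow> (nat \<Rightarrow> 'w \<Rightarrow> 'w) \<Rightarrow>
       (nat \<Rightarrow> 'w list) \<Rightarrow> (nat \<Rightarrow> 'w set list) \<Rightarrow> real \<Rightarrow> bool" where
  "torsion_value D d c h t \<longleftrightarrow>
     (\<exists>b l. (\<forall>q. set (b q) \<subseteq> D q \<and> real_basis (d q ` D q) (map (d q) (b q))) \<and>
            (\<forall>q. lift (l q) (h q)) \<and>
            t = (\<Prod>q | D q \<noteq> {0}.
                  \<bar>det (base_change {0} (map (d (Suc q)) (b (Suc q)) @ l q @ b q) (c q))\<bar>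
                    powi ((-1) ^ q)))"

definition R_torsion ::
    "(nat \<Rightarrow> 'w::real_vector set) \<Rightarrow> (nat \<Rightarrow> 'w \<Rightarrow> 'w) \<Rightarrow>
       (nat \<Rightarrow> 'w list) \<Rightarrow> (nat \<Rightarrow> 'w set list) \<Rightarrow> real" where
  "R_torsion D d c h = (THE t. torsion_value D d c h t)"


section \<open>The standard homology basis\<close>

definition standard_basis ::
    "'v::real_vector list \<Rightarrow> 'a topology \<Rightarrow> (int \<Rightarrow> 'a set) \<Rightarrow> nat \<Rightarrow>
       ('v, 'a chain set) tensor set list \<Rightarrow> bool" where
  "standard_basis vs X F q ns \<longleftrightarrow>
     (\<exists>us. free_part_basis (filt_homology X F (int q)) us \<and>
        ns = [homology_class (filt_space X F) (filt_diff X F) q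
                (pure_tensor (filt_group X F (int q)) v (SOME z. z \<in> u)). u \<leftarrow> us, v \<leftarrow> vs])"


section \<open>The cone\<close>

definition apex :: "'a \<times> real" where
  "apex = (undefined, 0)"

definition cone_map :: "'a \<times> real \<Rightarrow> 'a \<times> real" where
  "cone_map z = (if snd z = 0 then apex else z)"

text \<open>The quotient topology of \<open>X \<times> [0, 1]\<close> by \<open>X \<times> {0}\<close>.\<close>

definition cone_topology :: "'a topology \<Rightarrow> ('a \<times> real) topology" where
  "cone_topology X =
     (let P = prod_topology X (top_of_set {0..1}) in
      topology (\<lambda>U. U \<subseteq> cone_map ` topspace P \<and> openin P {z \<in> topspace P. cone_map z \<in> U}))"

lemma openin_cone_topology:
  "openin (cone_topology X) U \<longleftrightarrow>
     U \<subseteq> cone_map ` topspace (prod_topology X (top_of_set {0..1::real})) \<and>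
     openin (prod_topology X (top_of_set {0..1}))
       {z \<in> topspace (prod_topology X (top_of_set {0..1})). cone_map z \<in> U}"
proof -
  define P where "P = prod_topology X (top_of_set {0..1::real})"
  define Q where "Q = (\<lambda>U. U \<subseteq> cone_map ` topspace P \<and> openin P {z \<in> topspace P. cone_map z \<in> U})"
  have "istopology Q"
    unfolding istopology_def
  proof (intro conjI allI impI)
    fix S T assume "Q S" "Q T"
    moreover have "{z \<in> topspace P. cone_map z \<in> S \<inter> T} =
        {z \<in> topspace P. cone_map z \<in> S} \<inter> {z \<in> topspace P. cone_map z \<in> T}"
      by blast
    ultimately show "Q (S \<inter> T)"
      unfolding Q_def by (simp add: openin_Int le_infI1)
  next
    fix \<U> assume U: "\<forall>K\<in>\<U>. Q K"
    have "{z \<in> topspace P. cone_map z \<in> \<Union>\<U>} = (\<Union>K\<in>\<U>. {z \<in> topspace P. cone_map z \<in> K})"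
      by blast
    moreover have "openin P (\<Union>K\<in>\<U>. {z \<in> topspace P. cone_map z \<in> K})"
      using U unfolding Q_def by (intro openin_Union) blast
    moreover have "\<Union>\<U> \<subseteq> cone_map ` topspace P"
      using U unfolding Q_def by (intro Union_least) blast
    ultimately show "Q (\<Union>\<U>)"
      unfolding Q_def by simp
  qed
  then have "openin (topology Q) U \<longleftrightarrow> Q U"
    by (simp add: topology_inverse')
  then show ?thesis
    by (simp add: cone_topology_def Q_def P_def Let_def)
qed

lemma quotient_map_cone:
  "quotient_map (prod_topology X (top_of_set {0..1})) (cone_topology X) cone_map"
proof -
  have top: "topspace (cone_topology X) =
      cone_map ` topspace (prod_topology X (top_of_set {0..1::real}))" (is "_ = cone_map ` ?P")
  proof
    show "topspace (cone_topology X) \<subseteq> cone_map ` ?P"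
      using openin_cone_topology[of X "topspace (cone_topology X)"] by blast
    have "{z \<in> ?P. cone_map z \<in> cone_map ` ?P} = ?P"
      by blast
    then have "openin (cone_topology X) (cone_map ` ?P)"
      unfolding openin_cone_topology by (simp only: openin_topspace order_refl simp_thms)
    then show "cone_map ` ?P \<subseteq> topspace (cone_topology X)"
      by (rule openin_subset)
  qed
  then show ?thesis
    unfolding quotient_map_def by (simp only: openin_cone_topology) blast
qed

definition base_incl :: "'a \<Rightarrow> 'a \<times> real" where
  "base_incl x = (x, 1)"

definition cone_cell :: "'a set \<Rightarrow> ('a \<times> real) set" where
  "cone_cell e = e \<times> {0<..<1}"

definition cone_cells :: "(nat \<Rightarrow> 'a set set) \<Rightarrow> nat \<Rightarrow> ('a \<times> real) set set" where
  "cone_cells E q =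
     (if q = 0 then {{apex}} else cone_cell ` E (q - 1)) \<union> image base_incl ` E q"


section \<open>Perversities and the cellular intersection chain complex of the cone\<close>

definition perversity :: "nat \<Rightarrow> (nat \<Rightarrow> int) \<Rightarrow> bool" where
  "perversity n p \<longleftrightarrow> 2 \<le> n \<and> p 2 = 0 \<and> (\<forall>j. 2 \<le> j \<and> j < n \<longrightarrow> p (Suc j) \<in> {p j, p j + 1})"

text \<open>The dimension of the intersection of a closed cell with the apex is \<open>0\<close> or \<open>-\<infinity>\<close>.\<close>

definition intersection_skeleton ::
    "'a topology \<Rightarrow> (nat \<Rightarrow> 'a set set) \<Rightarrow> (nat \<Rightarrow> int) \<Rightarrow> int \<Rightarrow> ('a \<times> real) set" where
  "intersection_skeleton X E p q =
     (let n = cw_dim E + 1 in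
      \<Union>{c. \<exists>k. c \<in> cone_cells E k \<and> int k \<le> q \<and>
          (apex \<in> cone_topology X closure_of c \<longrightarrow> 0 \<le> q - int n + p n)})"

definition cut_degree :: "(nat \<Rightarrow> 'a set set) \<Rightarrow> (nat \<Rightarrow> int) \<Rightarrow> nat" where
  "cut_degree E p = (let n = cw_dim E + 1 in nat (int n - p n))"

text \<open>The map from the chains of \<open>N\<close> to the intersection chains of \<open>C(N)\<close> induced by the inclusion
  of the base, in degrees \<open>q\<close> below \<open>cut_degree\<close>, where it is an identification.\<close>

definition base_hom ::
    "'a topology \<Rightarrow> (nat \<Rightarrow> 'a set set) \<Rightarrow> (nat \<Rightarrow> int) \<Rightarrow> int \<Rightarrow>
       'a chain set \<Rightarrow> ('a \<times> real) chain set" where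
  "base_hom X E p q =
     hom_induced q (subtopology X (skeleton E q)) (skeleton E (q - 1))
       (subtopology (cone_topology X) (intersection_skeleton X E p q))
       (intersection_skeleton X E p (q - 1)) base_incl"

text \<open>\<open>w\<close> is the cone over the cellular \<open>q\<close>-cycle \<open>z\<close> of \<open>N\<close>, where \<open>q = \<aa> - 1\<close>: it comes from the
  class of \<open>H\<^sub>q\<^sub>+\<^sub>1(C(N\<^sub>q), N\<^sub>q)\<close> whose boundary is \<open>z\<close>, where \<open>N\<^sub>q\<close> is the \<open>q\<close>-skeleton.\<close>

definition cone_over_cycle ::
    "'a topology \<Rightarrow> (nat \<Rightarrow> 'a set set) \<Rightarrow> (nat \<Rightarrow> int) \<Rightarrow> int \<Rightarrow>
       'a chain set \<Rightarrow> ('a \<times> real) chain set \<Rightarrow> bool" where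
  "cone_over_cycle X E p q z w \<longleftrightarrow>
     (let C = subtopology (cone_topology X) (cone_map ` (skeleton E q \<times> {0..1}));
          B = base_incl ` skeleton E q;
          I = intersection_skeleton X E p in
      \<exists>u \<in> carrier (relative_homology_group (q + 1) C B).
        hom_relboundary (q + 1) C B (base_incl ` skeleton E (q - 1)) u = base_hom X E p q z \<and>
        w = hom_induced (q + 1) C B (subtopology (cone_topology X) (I (q + 1))) (I q) id u)"

text \<open>The integral chain bases, up to the orientation and the order of the cells.\<close>

definition intersection_int_basis ::
    "'a topology \<Rightarrow> (nat \<Rightarrow> 'a set set) \<Rightarrow> (nat \<Rightarrow> int) \<Rightarrow> nat \<Rightarrow>
       ('a \<times> real) chain set list \<Rightarrow> bool" where
  "intersection_int_basis X E p q ss \<longleftrightarrow>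
     (let Y = cone_topology X; I = intersection_skeleton X E p; a = cut_degree E p in
      if q < a then oriented_cells Y I (int q) (image base_incl ` E q) ss
      else if q = a then
        (\<exists>ss' zs ws. ss = ss' @ ws \<and>
           oriented_cells Y I (int q) (image base_incl ` E q) ss' \<and>
           int_basis (filt_group X (skeleton E) (int q - 1))
             (filt_cycles X (skeleton E) (int q - 1)) zs \<and>
           list_all2 (cone_over_cycle X E p (int q - 1)) zs ws)
      else oriented_cells Y I (int q) (cone_cells E q) ss)"

definition intersection_chain_basis ::
    "'v::real_vector list \<Rightarrow> 'a topology \<Rightarrow> (nat \<Rightarrow> 'a set set) \<Rightarrow> (nat \<Rightarrow> int) \<Rightarrow> nat \<Rightarrow>
       ('v, ('a \<times> real) chain set) tensor list \<Rightarrow> bool" where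
  "intersection_chain_basis vs X E p q cs \<longleftrightarrow>
     (\<exists>ss. intersection_int_basis X E p q ss \<and>
        cs = tensor_basis (filt_group (cone_topology X) (intersection_skeleton X E p) (int q)) vs ss)"

definition intersection_homology_basis ::
    "'a topology \<Rightarrow> (nat \<Rightarrow> 'a set set) \<Rightarrow> (nat \<Rightarrow> int) \<Rightarrow>
       (nat \<Rightarrow> ('v::real_vector, 'a chain set) tensor set list) \<Rightarrow>
       nat \<Rightarrow> ('v, ('a \<times> real) chain set) tensor set list" where
  "intersection_homology_basis X E p h q =
     (if q + 2 \<le> cut_degree E p
      then map (image (tensor_map
             (filt_group (cone_topology X) (intersection_skeleton X E p) (int q))
             (base_hom X E p (int q)))) (h q)
      else [])"

end

theory Submission
  imports Defs
begin

text \<open>The inclusion of the base identifies the two complexes below degree \<open>\<aa>\<close>, and the intersection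
  complex is exact from degree \<open>\<aa> - 1\<close> on, because each term of the filtration lies in a
  contractible cone that is contained in the next one.  In degree \<open>\<aa>\<close> the cones over a basis of
  the cycles bound exactly this basis, so every boundary matrix of the intersection complex is the
  matrix of a homomorphism of free abelian groups with respect to integral bases.  Choosing bases
  adapted to the boundaries and the cycles, the determinant in degree \<open>q\<close> becomes a product of the index of
  the boundaries in their saturation, which is the order of the torsion of \<open>H\<^sub>q\<close>, of the base
  change from \<open>n\<^sub>q\<close> to \<open>h\<^sub>q\<close>, and of factors that cancel between neighbouring degrees.\<close>

section \<open>Bases and torsion of real complexes\<close>

text \<open>The torsion of a complex is defined through arbitrary lifts, so one reference basis is
  fixed in every degree and all other choices are measured against it. The reference basis consists
  of tensors of integral chains but need not come from an integral basis: these chains span a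
  subgroup of finite index, whose cosets are represented by torsion classes. A triangular basis of
  this subgroup turns the index into a count of points in a box. Tensoring with \<open>V\<close>
  replaces an integer matrix by its Kronecker product with an identity, which is why torsion orders
  appear to the power \<open>dim V\<close>. The formula is proved for every integral chain basis, so
  orientations, orders and the basis of the cycles do not matter.

  The topological obstacle is the step into degree \<open>a\<close>: it adds the apex and the cones
  on cells of many dimensions at once, so the relative group is not spanned by cells. Inserting the
  cone over the \<open>(a - 1)\<close>-skeleton between the two terms separates the cones over
  cycles from the new \<open>a\<close>-cells. Beyond this degree ordinary cell attachment applies,
  but only once the cone on a closed cell is known to be a ball; an explicit chart serves for
  that.\<close>

definition list_comb :: "'w::real_vector list \<Rightarrow> (nat \<Rightarrow> real) \<Rightarrow> 'w" where
  "list_comb xs f = (\<Sum>i<length xs. f i *\<^sub>R (xs ! i))"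

text \<open>A property of the list and not of its set of entries, so that a repeated vector counts
  as a dependence: columns of matrices are indexed by positions.\<close>

definition indep_list :: "'w::real_vector list \<Rightarrow> bool" where
  "indep_list xs \<longleftrightarrow> (\<forall>f. list_comb xs f = 0 \<longrightarrow> (\<forall>i<length xs. f i = 0))"

lemma list_comb_cong: "(\<And>i. i < length xs \<Longrightarrow> f i = g i) \<Longrightarrow> list_comb xs f = list_comb xs g"
  unfolding list_comb_def by (rule sum.cong) auto

lemma list_comb_Nil [simp]: "list_comb [] f = 0"
  by (simp add: list_comb_def)

lemma list_comb_zero [simp]: "list_comb xs (\<lambda>i. 0) = 0"
  by (simp add: list_comb_def)

lemma list_comb_add: "list_comb xs (\<lambda>i. f i + g i) = list_comb xs f + list_comb xs g"
  by (simp add: list_comb_def scaleR_add_left sum.distrib)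

lemma list_comb_diff: "list_comb xs (\<lambda>i. f i - g i) = list_comb xs f - list_comb xs g"
  by (simp add: list_comb_def scaleR_diff_left sum_subtractf)

lemma list_comb_scaleR: "list_comb xs (\<lambda>i. r * f i) = r *\<^sub>R list_comb xs f"
  by (simp add: list_comb_def scaleR_sum_right)

lemma list_comb_sum: "list_comb xs (\<lambda>i. \<Sum>j\<in>J. f j i) = (\<Sum>j\<in>J. list_comb xs (f j))"
  unfolding list_comb_def by (simp add: scaleR_sum_left) (rule sum.swap)

lemma list_comb_delta: "j < length xs \<Longrightarrow> list_comb xs (\<lambda>i. if i = j then 1 else 0) = xs ! j"
  unfolding list_comb_def by (subst sum.remove[of _ j]) auto

lemma sum_lessThan_split:
  fixes g :: "nat \<Rightarrow> 'b::comm_monoid_add"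
  shows "sum g {..<m + n} = sum g {..<m} + (\<Sum>i<n. g (m + i))"
  by (induction n) (auto simp: add.assoc)

lemma list_comb_append:
  "list_comb (xs @ ys) f = list_comb xs f + list_comb ys (\<lambda>i. f (length xs + i))"
  by (simp add: list_comb_def sum_lessThan_split nth_append)

lemma list_comb_append':
  "list_comb xs f + list_comb ys g = list_comb (xs @ ys) (\<lambda>i. if i < length xs then f i else g (i - length xs))"
  by (simp add: list_comb_append cong: list_comb_cong)

lemma span_set_list: "span (set xs) = range (list_comb xs)"
proof
  show "range (list_comb xs) \<subseteq> span (set xs)"
    by (auto simp: list_comb_def intro!: span_sum span_scale intro: span_base)
  have "subspace (range (list_comb xs))"
  proof (rule subspaceI)
    show "0 \<in> range (list_comb xs)"
      by (metis list_comb_zero rangeI)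
    show "x + y \<in> range (list_comb xs)" if "x \<in> range (list_comb xs)" "y \<in> range (list_comb xs)" for x y
      using that by (auto simp flip: list_comb_add)
    show "c *\<^sub>R x \<in> range (list_comb xs)" if "x \<in> range (list_comb xs)" for c x
      using that by (auto simp flip: list_comb_scaleR)
  qed
  moreover have "set xs \<subseteq> range (list_comb xs)"
    by (auto simp: in_set_conv_nth simp flip: list_comb_delta)
  ultimately show "span (set xs) \<subseteq> range (list_comb xs)"
    by (rule span_minimal[rotated])
qed

lemma indep_list_iff: "indep_list xs \<longleftrightarrow> distinct xs \<and> independent (set xs)"
proof
  assume I: "indep_list xs"
  have d: "distinct xs"
  proof (rule ccontr)
    assume "\<not> distinct xs"
    then obtain i j where ij: "i < length xs" "j < length xs" "i \<noteq> j" "xs ! i = xs ! j"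
      by (auto simp: distinct_conv_nth)
    have "list_comb xs (\<lambda>k. (if k = i then 1 else 0) - (if k = j then 1 else 0)) = 0"
      using ij by (simp add: list_comb_diff list_comb_delta)
    then show False
      using I ij unfolding indep_list_def by fastforce
  qed
  have "independent (set xs)"
  proof (rule independent_if_scalars_zero)
    fix f x assume s: "(\<Sum>x\<in>set xs. f x *\<^sub>R x) = 0" and x: "x \<in> set xs"
    have "list_comb xs (\<lambda>i. f (xs ! i)) = (\<Sum>x\<in>set xs. f x *\<^sub>R x)"
      unfolding list_comb_def
      by (rule sum.reindex_bij_betw[OF bij_betw_nth]) (use d in auto)
    then show "f x = 0"
      using I s x unfolding indep_list_def by (metis in_set_conv_nth)
  qed auto
  with d show "distinct xs \<and> independent (set xs)" ..
next
  assume A: "distinct xs \<and> independent (set xs)"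
  show "indep_list xs"
    unfolding indep_list_def
  proof (intro allI impI)
    fix f i assume l: "list_comb xs f = 0" and i: "i < length xs"
    \<comment> \<open>Coefficients are moved from positions to entries, which distinctness makes
      possible.\<close>
    define g where "g = (\<lambda>x. f (the_inv_into {..<length xs} ((!) xs) x))"
    have b: "bij_betw ((!) xs) {..<length xs} (set xs)"
      by (rule bij_betw_nth) (use A in auto)
    have g: "g (xs ! k) = f k" if "k < length xs" for k
      using that b unfolding g_def by (simp add: the_inv_into_f_f bij_betw_def)
    have "(\<Sum>x\<in>set xs. g x *\<^sub>R x) = (\<Sum>k<length xs. g (xs ! k) *\<^sub>R (xs ! k))"
      by (rule sum.reindex_bij_betw[OF b, symmetric])
    also have "\<dots> = 0"
      using l g by (simp add: list_comb_def)
    finally have "g (xs ! i) = 0"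
      using A i by (intro independentD[of "set xs" "set xs"]) auto
    with g i show "f i = 0" by simp
  qed
qed

lemma real_basis_iff: "real_basis W xs \<longleftrightarrow> indep_list xs \<and> range (list_comb xs) = W"
  by (simp add: real_basis_def indep_list_iff span_set_list)

lemma real_basis_subspace: "real_basis W xs \<Longrightarrow> subspace W"
  using subspace_span unfolding real_basis_def by blast

lemma real_basis_nth_mem: "real_basis W xs \<Longrightarrow> set xs \<subseteq> W"
  unfolding real_basis_def using span_superset by blast

lemma list_comb_mem: "subspace W \<Longrightarrow> set xs \<subseteq> W \<Longrightarrow> list_comb xs f \<in> W"
  unfolding list_comb_def by (intro subspace_sum subspace_scale) (auto dest: nth_mem)

lemma real_basis_lengths:
  assumes "real_basis W xs" "real_basis W ys"
  shows "length xs = length ys"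
  using assms unfolding real_basis_def
  by (metis List.finite_set distinct_card dim_eq_card_independent dim_span)

lemma real_basis_singleton_0: "real_basis {0} xs \<Longrightarrow> xs = []"
  by (metis list.set_intros(1) neq_Nil_conv real_basis_def independent_empty dependent_zero real_basis_nth_mem singletonD subsetD)

section \<open>Coordinates and base change matrices\<close>

lemma indep_list_unique:
  assumes "indep_list xs" "list_comb xs f = list_comb xs g" "i < length xs"
  shows "f i = g i"
proof -
  have "list_comb xs (\<lambda>i. f i - g i) = 0"
    using assms(2) by (simp add: list_comb_diff)
  then have "f i - g i = 0"
    using assms(1,3) unfolding indep_list_def by blast
  then show ?thesis by simp
qed

text \<open>The description has a value as soon as \<open>xs\<close> is independent modulo
  \<open>B\<close>. With the boundaries for \<open>B\<close> it gives coordinates in homology, with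
  the zero space ordinary ones.\<close>

lemma coordinates_mod_eqI:
  assumes "\<And>g. (list_comb xs g) \<in> B \<Longrightarrow> (\<forall>i<length xs. g i = 0)"
    and "subspace B" and "y - list_comb xs f \<in> B"
  shows "coordinates_mod B xs y = map f [0..<length xs]"
  unfolding coordinates_mod_def
proof (rule the_equality)
  show "length (map f [0..<length xs]) = length xs \<and>
    y - (\<Sum>i<length xs. map f [0..<length xs] ! i *\<^sub>R xs ! i) \<in> B"
    using assms(3) by (simp add: list_comb_def)
  fix r assume r: "length r = length xs \<and> y - (\<Sum>i<length xs. r ! i *\<^sub>R xs ! i) \<in> B"
  then have "y - list_comb xs ((!) r) \<in> B"
    by (simp add: list_comb_def)
  then have "(y - list_comb xs f) - (y - list_comb xs ((!) r)) \<in> B"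
    using assms(2,3) subspace_diff by blast
  then have "list_comb xs (\<lambda>i. r ! i - f i) \<in> B"
    by (simp add: list_comb_diff)
  then have "\<forall>i<length xs. r ! i - f i = 0"
    by (rule assms(1))
  with r show "r = map f [0..<length xs]"
    by (intro nth_equalityI) auto
qed

lemma base_change_eqI:
  assumes "indep_list xs" "A \<in> carrier_mat (length xs) (length ys)"
    and "\<And>j. j < length ys \<Longrightarrow> ys ! j = list_comb xs (\<lambda>i. A $$ (i, j))"
  shows "base_change {0} ys xs = A"
proof -
  have "coordinates_mod {0} xs (ys ! j) = map (\<lambda>i. A $$ (i, j)) [0..<length xs]" if "j < length ys" for j
    by (rule coordinates_mod_eqI) (use assms that in \<open>auto simp: indep_list_def\<close>)
  then show ?thesis
    using assms(2) unfolding base_change_def by (intro eq_matI) auto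
qed

lemma base_change_nth:
  assumes "real_basis W xs" "ys ! j \<in> W" "j < length ys"
  shows "ys ! j = list_comb xs (\<lambda>i. base_change {0} ys xs $$ (i, j))"
proof -
  obtain f where f: "ys ! j = list_comb xs f"
    using assms real_basis_iff by (metis rangeE)
  have "coordinates_mod {0} xs (ys ! j) = map f [0..<length xs]"
    by (rule coordinates_mod_eqI) (use assms f in \<open>auto simp: indep_list_def real_basis_iff\<close>)
  then show ?thesis
    using assms by (auto simp: base_change_def f intro!: list_comb_cong)
qed

lemma base_change_carrier [simp]: "base_change B ys xs \<in> carrier_mat (length xs) (length ys)"
  by (simp add: base_change_def)

lemma list_comb_list_comb:
  assumes "\<And>j. j < length ys \<Longrightarrow> ys ! j = list_comb xs (\<lambda>i. A i j)"
  shows "list_comb ys f = list_comb xs (\<lambda>i. \<Sum>j<length ys. A i j * f j)"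
proof -
  have "list_comb ys f = (\<Sum>j<length ys. f j *\<^sub>R list_comb xs (\<lambda>i. A i j))"
    unfolding list_comb_def[of ys] using assms by (intro sum.cong) auto
  also have "\<dots> = list_comb xs (\<lambda>i. \<Sum>j<length ys. A i j * f j)"
    by (simp add: list_comb_sum flip: list_comb_scaleR) (simp add: mult.commute)
  finally show ?thesis .
qed

text \<open>Chain rule for coordinates. The list \<open>zs\<close> only has to lie in
  \<open>W\<close>: it stands for lists that are not yet known to be bases.\<close>

lemma base_change_mult:
  assumes xs: "real_basis W xs" and ys: "real_basis W ys" and zs: "set zs \<subseteq> W"
  shows "base_change {0} zs xs = base_change {0} ys xs * base_change {0} zs ys"
proof (rule base_change_eqI)
  show "indep_list xs" using xs by (simp add: real_basis_iff)
  show "base_change {0} ys xs * base_change {0} zs ys \<in> carrier_mat (length xs) (length zs)"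
    by (rule mult_carrier_mat[OF base_change_carrier base_change_carrier])
  fix j assume j: "j < length zs"
  have "zs ! j = list_comb ys (\<lambda>i. base_change {0} zs ys $$ (i, j))"
    using ys zs j by (intro base_change_nth) auto
  also have "\<dots> = list_comb xs (\<lambda>i. \<Sum>k<length ys. base_change {0} ys xs $$ (i, k) * base_change {0} zs ys $$ (k, j))"
    by (rule list_comb_list_comb) (rule base_change_nth[OF xs], use ys real_basis_nth_mem in force)
  also have "\<dots> = list_comb xs (\<lambda>i. (base_change {0} ys xs * base_change {0} zs ys) $$ (i, j))"
    using j by (intro list_comb_cong) (simp add: base_change_def scalar_prod_def lessThan_atLeast0)
  finally show "zs ! j = list_comb xs (\<lambda>i. (base_change {0} ys xs * base_change {0} zs ys) $$ (i, j))" .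
qed

lemma base_change_self: "indep_list xs \<Longrightarrow> base_change {0} xs xs = 1\<^sub>m (length xs)"
proof (rule base_change_eqI)
  fix j assume "j < length xs"
  then show "xs ! j = list_comb xs (\<lambda>i. 1\<^sub>m (length xs) $$ (i, j))"
    by (subst list_comb_delta[symmetric], assumption) (rule list_comb_cong, simp)
qed auto

lemma det_base_change_nonzero:
  assumes xs: "real_basis W xs" and ys: "real_basis W ys"
  shows "det (base_change {0} ys xs) \<noteq> 0"
proof -
  note l = real_basis_lengths[OF assms]
  have "base_change {0} ys xs * base_change {0} xs ys = 1\<^sub>m (length xs)"
    using base_change_mult[OF xs ys real_basis_nth_mem[OF xs]] base_change_self[of xs] xs
    by (simp add: real_basis_iff)
  then have "det (base_change {0} ys xs) * det (base_change {0} xs ys) = 1"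
    using l by (subst det_mult[symmetric, of _ "length xs"]) (auto simp: base_change_def)
  then show ?thesis by auto
qed

section \<open>Block determinants and alternating products\<close>

lemma det_lower_left_zero:
  fixes M :: "real mat"
  assumes "M \<in> carrier_mat (n + m) (n + m)" "\<And>i j. n \<le> i \<Longrightarrow> i < n + m \<Longrightarrow> j < n \<Longrightarrow> M $$ (i, j) = 0"
  shows "det M = det (mat n n (\<lambda>(i, j). M $$ (i, j))) * det (mat m m (\<lambda>(i, j). M $$ (n + i, n + j)))"
proof -
  have "M = four_block_mat (mat n n (\<lambda>(i, j). M $$ (i, j))) (mat n m (\<lambda>(i, j). M $$ (i, n + j)))
      (0\<^sub>m m n) (mat m m (\<lambda>(i, j). M $$ (n + i, n + j)))"
    using assms by (intro eq_matI) (auto simp: four_block_mat_def Let_def)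
  then show ?thesis
    by (metis det_four_block_mat_lower_left_zero mat_carrier)
qed

text \<open>Replacing the lift \<open>b q\<close> changes the determinants in degrees
  \<open>q\<close> and \<open>q - 1\<close> by the same factor \<open>u q\<close>. The two exponents
  are opposite, so only the ends survive.\<close>

lemma prod_telescope_powi:
  fixes u :: "nat \<Rightarrow> real"
  assumes "\<And>q. u q \<noteq> 0"
  shows "(\<Prod>q\<le>N. (u (Suc q) * u q) powi ((-1) ^ q)) = u 0 * u (Suc N) powi ((-1) ^ N)"
proof (induction N)
  case (Suc N)
  have "u (Suc N) powi ((-1) ^ N) * u (Suc N) powi (- ((-1) ^ N)) = 1"
    using assms[of "Suc N"] by (simp add: power_int_minus)
  then show ?case
    using Suc by (simp add: power_int_mult_distrib mult_ac)
qed (simp add: power_int_mult_distrib)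

lemma indep_list_append:
  assumes "indep_list (xs @ ys)"
  shows "indep_list xs" "indep_list ys"
  using assms independent_mono[of "set xs \<union> set ys"] unfolding indep_list_iff by auto

lemma indep_list_append_eqD:
  assumes "indep_list (xs @ ys)" "list_comb xs f + list_comb ys g = list_comb xs f' + list_comb ys g'"
  shows "\<And>i. i < length xs \<Longrightarrow> f i = f' i" "\<And>i. i < length ys \<Longrightarrow> g i = g' i"
proof -
  note u = indep_list_unique[OF assms(1) assms(2)[unfolded list_comb_append']]
  show "f i = f' i" if "i < length xs" for i
    using u[of i] that by simp
  show "g i = g' i" if "i < length ys" for i
    using u[of "length xs + i"] that by simp
qed

text \<open>A reference basis of each degree in three blocks: boundaries, cycles standing for
  homology, and lifts of the boundaries one degree lower. That \<open>l0\<close> represents a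
  homology basis is a consequence. Degree 0 consists of cycles, so its third block is empty.\<close>

locale split_complex =
  fixes D :: "nat \<Rightarrow> 'w::real_vector set" and d :: "nat \<Rightarrow> 'w \<Rightarrow> 'w"
    and b0 l0 :: "nat \<Rightarrow> 'w list"
  assumes rc: "real_complex D d"
    and basis: "\<And>q. real_basis (D q) (map (d (Suc q)) (b0 (Suc q)) @ l0 q @ b0 q)"
    and b0_0: "b0 0 = []"
    and cyc: "\<And>q x. x \<in> set (l0 q) \<Longrightarrow> d q x = 0"
begin

abbreviation "db q \<equiv> map (d q) (b0 q)"
abbreviation "R q \<equiv> db (Suc q) @ l0 q @ b0 q"

lemma subspace_D: "subspace (D q)"
  using basis real_basis_subspace by blast

lemma d_add: "x \<in> D q \<Longrightarrow> y \<in> D q \<Longrightarrow> d q (x + y) = d q x + d q y"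
  and d_scale: "x \<in> D q \<Longrightarrow> d q (r *\<^sub>R x) = r *\<^sub>R d q x"
  using rc unfolding real_complex_def by auto

lemma d_zero: "d q 0 = 0"
  using d_scale[of 0 q 0] subspace_0[OF subspace_D] by simp

lemma dd: "x \<in> D (Suc q) \<Longrightarrow> d (Suc q) x \<in> D q \<and> d q (d (Suc q) x) = 0"
  using rc unfolding real_complex_def by auto

lemma d_comb:
  assumes "set xs \<subseteq> D q"
  shows "d q (list_comb xs f) = list_comb (map (d q) xs) f"
proof -
  have "(\<Sum>i<n. f i *\<^sub>R xs ! i) \<in> D q \<and> d q (\<Sum>i<n. f i *\<^sub>R xs ! i) = (\<Sum>i<n. f i *\<^sub>R d q (xs ! i))"
    if "n \<le> length xs" for n
    using that
  proof (induction n)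
    case 0
    then show ?case using subspace_0[OF subspace_D] by (simp add: d_zero)
  next
    case (Suc n)
    then have "xs ! n \<in> D q" using assms by (simp add: subset_iff)
    with Suc show ?case
      by (simp add: d_add d_scale subspace_add[OF subspace_D] subspace_scale[OF subspace_D])
  qed
  from this[of "length xs"] show ?thesis by (simp add: list_comb_def)
qed

lemma R_D: "set (db (Suc q)) \<subseteq> D q" "set (l0 q) \<subseteq> D q" "set (b0 q) \<subseteq> D q"
  using real_basis_nth_mem[OF basis[of q]] by auto

lemma indep_R: "indep_list (R q)"
  using basis real_basis_iff by blast

lemma D_eq: "D q = range (list_comb (R q))"
  using basis real_basis_iff by blast

lemma R_comb: "list_comb (R q) f = list_comb (db (Suc q)) f +
   (list_comb (l0 q) (\<lambda>i. f (length (b0 (Suc q)) + i)) +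
    list_comb (b0 q) (\<lambda>i. f (length (b0 (Suc q)) + (length (l0 q) + i))))"
  by (simp add: list_comb_append add.assoc)

text \<open>The differential kills the first two blocks and only sees the coefficients of the third;
  cycles and boundaries are read off from this.\<close>

lemma d_R_comb: "d q (list_comb (R q) f) =
    list_comb (db q) (\<lambda>i. f (length (b0 (Suc q)) + (length (l0 q) + i)))"
proof -
  have 1: "list_comb (map (d q) (db (Suc q))) g = 0" for g
    unfolding list_comb_def using R_D(3)[of "Suc q"] dd by (intro sum.neutral) (auto simp: subset_iff)
  have 2: "list_comb (map (d q) (l0 q)) g = 0" for g
    unfolding list_comb_def using cyc by (intro sum.neutral) auto
  show ?thesis
    using R_D by (subst d_comb) (auto simp: list_comb_append add.assoc 1[simplified] 2)
qed

lemma indep_db: "indep_list (db q)"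
proof (cases q)
  case 0
  then show ?thesis by (simp add: b0_0 indep_list_def)
next
  case (Suc p)
  then show ?thesis using indep_R[of p] indep_list_append by blast
qed

lemma image_eq: "d q ` D q = range (list_comb (db q))"
proof -
  have "list_comb (db q) f \<in> d q ` D q" for f
    using d_comb[OF R_D(3)] list_comb_mem[OF subspace_D R_D(3)] by (metis image_eqI)
  then show ?thesis
    by (auto simp: D_eq d_R_comb)
qed

lemma boundaries_eq: "boundaries D d q = range (list_comb (db (Suc q)))"
  unfolding boundaries_def by (rule image_eq)

lemma basis_image: "real_basis (d q ` D q) (db q)"
  by (simp add: real_basis_iff image_eq indep_db)

lemma subspace_boundaries: "subspace (boundaries D d q)"
  by (metis basis_image boundaries_def real_basis_subspace)

text \<open>The third block of a cycle vanishes because \<open>db q\<close> is independent, being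
  empty or a part of the reference basis one degree lower.\<close>

lemma cycles_eq: "z \<in> cycles D d q \<longleftrightarrow> (\<exists>f g. z = list_comb (db (Suc q)) f + list_comb (l0 q) g)"
proof
  assume z: "z \<in> cycles D d q"
  then obtain f where f: "z = list_comb (R q) f"
    unfolding cycles_def D_eq by auto
  have "list_comb (db q) (\<lambda>i. f (length (b0 (Suc q)) + (length (l0 q) + i))) = 0"
    using z d_R_comb f by (simp add: cycles_def)
  then have "\<forall>i<length (b0 q). f (length (b0 (Suc q)) + (length (l0 q) + i)) = 0"
    using indep_db[of q] unfolding indep_list_def by (simp only: length_map) blast
  then have "list_comb (b0 q) (\<lambda>i. f (length (b0 (Suc q)) + (length (l0 q) + i))) = 0"
    by (simp add: list_comb_def)
  with f show "\<exists>f g. z = list_comb (db (Suc q)) f + list_comb (l0 q) g"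
    by (auto simp: R_comb)
next
  assume "\<exists>f g. z = list_comb (db (Suc q)) f + list_comb (l0 q) g"
  then obtain f g where z: "z = list_comb (db (Suc q)) f + list_comb (l0 q) g" by blast
  have "list_comb (b0 q) (\<lambda>i. 0) = 0" by simp
  then have "z = list_comb (R q) (\<lambda>i. if i < length (b0 (Suc q)) then f i
      else if i < length (b0 (Suc q)) + length (l0 q) then g (i - length (b0 (Suc q))) else 0)"
    unfolding R_comb z by (simp cong: list_comb_cong) (rule list_comb_cong, simp)
  then show "z \<in> cycles D d q"
    unfolding cycles_def by (simp add: D_eq d_R_comb)
qed

text \<open>The coefficients in the block \<open>l0\<close> are therefore the coordinates of the
  homology class of \<open>z\<close>.\<close>

lemma cycles_minus_boundary_iff:
  assumes "z = list_comb (db (Suc q)) f + list_comb (l0 q) g"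
  shows "z - list_comb (l0 q) r \<in> boundaries D d q \<longleftrightarrow> (\<forall>i<length (l0 q). r i = g i)"
proof
  assume "z - list_comb (l0 q) r \<in> boundaries D d q"
  then obtain f' where "z - list_comb (l0 q) r = list_comb (db (Suc q)) f'"
    unfolding boundaries_eq by auto
  then have e: "list_comb (db (Suc q)) f + list_comb (l0 q) g = list_comb (db (Suc q)) f' + list_comb (l0 q) r"
    using assms by (simp add: algebra_simps)
  have i: "indep_list (db (Suc q) @ l0 q)"
    using indep_list_append(1)[of "db (Suc q) @ l0 q" "b0 q"] indep_R[of q] by simp
  show "\<forall>i<length (l0 q). r i = g i"
    using indep_list_append_eqD(2)[OF i e] by simp
next
  assume "\<forall>i<length (l0 q). r i = g i"
  then have "list_comb (l0 q) r = list_comb (l0 q) g"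
    by (intro list_comb_cong) auto
  then show "z - list_comb (l0 q) r \<in> boundaries D d q"
    by (simp add: assms boundaries_eq)
qed

text \<open>Relative to \<open>R q\<close> the list \<open>e @ l @ b\<close> has a block upper
  triangular matrix: boundaries involve the first block, representatives of homology classes the
  first two, and the third diagonal block becomes visible after applying \<open>d q\<close>.\<close>

lemma det_degree:
  assumes e: "real_basis (boundaries D d q) e"
    and b: "set b \<subseteq> D q" "real_basis (d q ` D q) (map (d q) b)"
    and l: "length l = length (l0 q)" "H \<in> carrier_mat (length (l0 q)) (length (l0 q))"
    "\<And>j. j < length (l0 q) \<Longrightarrow> l ! j - list_comb (l0 q) (\<lambda>i. H $$ (i, j)) \<in> boundaries D d q"
  shows "det (base_change {0} (e @ l @ b) (R q)) = det (base_change {0} e (db (Suc q))) *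
     (det H * det (base_change {0} (map (d q) b) (db q)))"
proof -
  define n1 n2 n3 where n: "n1 = length (b0 (Suc q))" "n2 = length (l0 q)" "n3 = length (b0 q)"
  have len: "length e = n1" "length l = n2" "length b = n3"
    using real_basis_lengths[OF e basis_image[of "Suc q", folded boundaries_def]]
      real_basis_lengths[OF b(2) basis_image] l(1) by (auto simp: n)
  define Q where "Q = e @ l @ b"
  have lenQ: "length Q = n1 + n2 + n3" by (simp add: Q_def len)
  define M where "M = base_change {0} Q (R q)"
  have lenR: "length (R q) = n1 + n2 + n3" by (simp add: n)
  have Mc: "M \<in> carrier_mat (n1 + (n2 + n3)) (n1 + (n2 + n3))"
    unfolding M_def using base_change_carrier[of "{0}" Q "R q"] lenQ lenR by (simp add: add.assoc)
  have bD: "boundaries D d q \<subseteq> D q"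
    using dd by (auto simp: boundaries_def)
  have eD: "set e \<subseteq> D q"
    using real_basis_nth_mem[OF e] bD by auto
  have lD: "set l \<subseteq> D q"
  proof
    fix x assume "x \<in> set l"
    then obtain j where j: "j < length (l0 q)" "x = l ! j"
      using l(1) by (metis in_set_conv_nth)
    have "l ! j - list_comb (l0 q) (\<lambda>i. H $$ (i, j)) + list_comb (l0 q) (\<lambda>i. H $$ (i, j)) \<in> D q"
      by (rule subspace_add[OF subspace_D]) (use l(3)[OF j(1)] bD list_comb_mem[OF subspace_D R_D(2)] in auto)
    then show "x \<in> D q" using j by simp
  qed
  have Qn: "Q ! j = list_comb (R q) (\<lambda>i. M $$ (i, j))" if "j < n1 + n2 + n3" for j
    unfolding M_def by (rule base_change_nth[OF basis])
      (use that lenQ eD lD b(1) in \<open>auto simp: Q_def intro!: subsetD[OF _ nth_mem]\<close>)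
  define P where "P = base_change {0} e (db (Suc q))"
  define P' where "P' = base_change {0} (map (d q) b) (db q)"
  \<comment> \<open>First block column: \<open>e\<close> consists of boundaries, so nothing appears
    below the first block.\<close>
  have M1: "M $$ (i, j) = (if i < n1 then P $$ (i, j) else 0)" if "j < n1" "i < n1 + n2 + n3" for i j
  proof -
    have "Q ! j = e ! j" using that len by (simp add: Q_def nth_append)
    also have "\<dots> = list_comb (db (Suc q)) (\<lambda>i. P $$ (i, j))"
      unfolding P_def using that len real_basis_nth_mem[OF e]
      by (intro base_change_nth[OF basis_image[of "Suc q", folded boundaries_def]]) (auto simp: subset_iff)
    also have "\<dots> = list_comb (R q) (\<lambda>i. if i < n1 then P $$ (i, j) else 0)"
      unfolding R_comb by (simp add: n) (rule list_comb_cong, simp)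
    finally have "list_comb (R q) (\<lambda>i. M $$ (i, j)) = list_comb (R q) (\<lambda>i. if i < n1 then P $$ (i, j) else 0)"
      using Qn[of j] that by simp
    from indep_list_unique[OF indep_R this, of i] show ?thesis
      using that lenR by simp
  qed
  \<comment> \<open>The boundary by which \<open>l ! j\<close> deviates from its combination of
    \<open>l0 q\<close> only fills the block above \<open>H\<close>.\<close>
  have M2: "M $$ (n1 + i, n1 + j) = (if i < n2 then H $$ (i, j) else 0)" if "j < n2" "i < n2 + n3" for i j
  proof -
    have "Q ! (n1 + j) = l ! j" using that len by (simp add: Q_def nth_append)
    moreover obtain x where "l ! j - list_comb (l0 q) (\<lambda>i. H $$ (i, j)) = list_comb (db (Suc q)) x"
      using l(3)[of j, unfolded boundaries_eq] \<open>j < n2\<close> unfolding n by blast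
    ultimately have "Q ! (n1 + j) = list_comb (db (Suc q)) x + list_comb (l0 q) (\<lambda>i. H $$ (i, j))"
      by (simp add: algebra_simps)
    also have "\<dots> = list_comb (R q) (\<lambda>i. if i < n1 then x i else if i < n1 + n2 then H $$ (i - n1, j) else 0)"
      unfolding R_comb by (simp add: n cong: list_comb_cong) (rule list_comb_cong, simp)
    finally have "list_comb (R q) (\<lambda>i. M $$ (i, n1 + j)) = \<dots>"
      using Qn[of "n1 + j"] that by simp
    from indep_list_unique[OF indep_R this, of "n1 + i"] show ?thesis
      using that lenR by simp
  qed
  \<comment> \<open>The upper blocks of these columns remain unknown; \<open>d q\<close> forgets
    them and turns the third block into coordinates with respect to \<open>db q\<close>.\<close>
  have M3: "M $$ (n1 + (n2 + i), n1 + (n2 + j)) = P' $$ (i, j)" if "j < n3" "i < n3" for i j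
  proof -
    have "d q (Q ! (n1 + (n2 + j))) = map (d q) b ! j" using that len by (simp add: Q_def nth_append)
    also have "\<dots> = list_comb (db q) (\<lambda>i. P' $$ (i, j))"
      unfolding P'_def using that len b by (intro base_change_nth[OF basis_image]) (auto simp: subset_iff)
    finally have "list_comb (db q) (\<lambda>i. M $$ (n1 + (n2 + i), n1 + (n2 + j))) = list_comb (db q) (\<lambda>i. P' $$ (i, j))"
      using Qn[of "n1 + (n2 + j)"] that d_R_comb by (simp add: n)
    from indep_list_unique[OF indep_db this, of i] show ?thesis
      using that by (simp add: n)
  qed
  define N where "N = mat (n2 + n3) (n2 + n3) (\<lambda>(i, j). M $$ (n1 + i, n1 + j))"
  have "det M = det (mat n1 n1 (\<lambda>(i, j). M $$ (i, j))) * det N"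
    unfolding N_def by (rule det_lower_left_zero[OF Mc]) (simp add: M1)
  also have "mat n1 n1 (\<lambda>(i, j). M $$ (i, j)) = P"
    by (rule eq_matI) (auto simp: M1 P_def base_change_def len n)
  also have "det N = det (mat n2 n2 (\<lambda>(i, j). N $$ (i, j))) * det (mat n3 n3 (\<lambda>(i, j). N $$ (n2 + i, n2 + j)))"
  proof (rule det_lower_left_zero)
    show "N $$ (i, j) = 0" if "n2 \<le> i" "i < n2 + n3" "j < n2" for i j
      using that M2[of j i] by (simp add: N_def)
  qed (simp add: N_def)
  also have "mat n2 n2 (\<lambda>(i, j). N $$ (i, j)) = H"
    using l(2) by (intro eq_matI) (auto simp: M2[unfolded n] N_def n)
  also have "mat n3 n3 (\<lambda>(i, j). N $$ (n2 + i, n2 + j)) = P'"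
    by (intro eq_matI) (auto simp: M3[unfolded n] N_def n P'_def base_change_def len)
  finally show ?thesis
    by (simp add: M_def P_def P'_def Q_def)
qed

lemma b0_trivial: "D q = {0} \<Longrightarrow> b0 (Suc q) = [] \<and> b0 q = [] \<and> l0 q = []"
  using real_basis_singleton_0[of "R q"] basis[of q] by auto

text \<open>The right side contains neither \<open>b\<close> nor the representatives
  \<open>l\<close>, so this is the independence of all choices: every lift of \<open>h q\<close> has
  the same coordinate matrix \<open>H q\<close> modulo boundaries, and the factors coming from
  \<open>b\<close> telescope.\<close>

lemma torsion_value_eq:
  assumes c: "\<And>q. real_basis (D q) (c q)"
    and h: "\<And>q zs. lift zs (h q) \<Longrightarrow> length zs = length (l0 q) \<and>
       (\<forall>j<length (l0 q). zs ! j - list_comb (l0 q) (\<lambda>i. H q $$ (i, j)) \<in> boundaries D d q)"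
    and H: "\<And>q. H q \<in> carrier_mat (length (l0 q)) (length (l0 q))"
    and t: "torsion_value D d c h t"
  shows "t = (\<Prod>q | D q \<noteq> {0}. (\<bar>det (base_change {0} (R q) (c q))\<bar> * \<bar>det (H q)\<bar>) powi ((-1) ^ q))"
proof -
  obtain b l where b: "\<And>q. set (b q) \<subseteq> D q" "\<And>q. real_basis (d q ` D q) (map (d q) (b q))"
    and l: "\<And>q. lift (l q) (h q)"
    and t: "t = (\<Prod>q | D q \<noteq> {0}.
       \<bar>det (base_change {0} (map (d (Suc q)) (b (Suc q)) @ l q @ b q) (c q))\<bar> powi ((-1) ^ q))"
    using t unfolding torsion_value_def by auto
  define u where "u = (\<lambda>q. \<bar>det (base_change {0} (map (d q) (b q)) (db q))\<bar>)"
  have u0: "u q \<noteq> 0" for q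
    unfolding u_def using det_base_change_nonzero[OF basis_image b(2)] by simp
  have len_b: "length (b q) = length (b0 q)" for q
    using real_basis_lengths[OF b(2) basis_image] by simp
  have u1: "u q = 1" if "b0 q = []" for q
    using len_b[of q] that by (simp add: u_def base_change_def)
  have e: "real_basis (boundaries D d q) (map (d (Suc q)) (b (Suc q)))" for q
    using b(2) by (simp add: boundaries_def)
  have det: "\<bar>det (base_change {0} (map (d (Suc q)) (b (Suc q)) @ l q @ b q) (c q))\<bar> =
     \<bar>det (base_change {0} (R q) (c q))\<bar> * \<bar>det (H q)\<bar> * (u (Suc q) * u q)" for q
  proof -
    let ?Q = "map (d (Suc q)) (b (Suc q)) @ l q @ b q"
    have lq: "length (l q) = length (l0 q)"
      "\<And>j. j < length (l0 q) \<Longrightarrow> l q ! j - list_comb (l0 q) (\<lambda>i. H q $$ (i, j)) \<in> boundaries D d q"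
      using h[OF l] by auto
    have bD: "boundaries D d q \<subseteq> D q"
      using dd by (auto simp: boundaries_def)
    have lD: "set (l q) \<subseteq> D q"
    proof
      fix x assume "x \<in> set (l q)"
      then obtain j where j: "j < length (l0 q)" "x = l q ! j"
        using lq(1) by (metis in_set_conv_nth)
      have "l q ! j - list_comb (l0 q) (\<lambda>i. H q $$ (i, j)) + list_comb (l0 q) (\<lambda>i. H q $$ (i, j)) \<in> D q"
        by (rule subspace_add[OF subspace_D]) (use lq(2)[OF j(1)] bD list_comb_mem[OF subspace_D R_D(2)] in auto)
      then show "x \<in> D q" using j by simp
    qed
    have "set ?Q \<subseteq> D q"
      using lD b(1)[of q] b(1)[of "Suc q"] dd by auto
    then have "base_change {0} ?Q (c q) = base_change {0} (R q) (c q) * base_change {0} ?Q (R q)"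
      by (rule base_change_mult[OF c basis])
    moreover have "length ?Q = length (R q)"
      using len_b lq(1) by simp
    moreover have "length (R q) = length (c q)"
      by (rule real_basis_lengths[OF basis c])
    ultimately have "det (base_change {0} ?Q (c q)) = det (base_change {0} (R q) (c q)) * det (base_change {0} ?Q (R q))"
      by (metis base_change_carrier det_mult)
    also have "det (base_change {0} ?Q (R q)) = det (base_change {0} (map (d (Suc q)) (b (Suc q))) (db (Suc q))) *
     (det (H q) * det (base_change {0} (map (d q) (b q)) (db q)))"
      by (rule det_degree[OF e b(1) b(2) lq(1) H lq(2)])
    finally show ?thesis
      by (simp add: u_def abs_mult)
  qed
  have fin: "finite {q. D q \<noteq> {0}}"
    using rc by (simp add: real_complex_def)
  then obtain N where N: "{q. D q \<noteq> {0}} \<subseteq> {..N}"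
    using finite_nat_iff_bounded_le by blast
  \<comment> \<open>The product is extended to an initial segment that ends one degree beyond the
    last nonzero group. Then both ends of the telescope are 1: \<open>u 0\<close> since
    \<open>b0 0\<close> is empty, and the last factor since \<open>D (Suc N)\<close>
    vanishes.\<close>
  have "(\<Prod>q | D q \<noteq> {0}. (u (Suc q) * u q) powi ((-1) ^ q)) = (\<Prod>q\<le>Suc N. (u (Suc q) * u q) powi ((-1) ^ q))"
  proof (rule prod.mono_neutral_left)
    show "{q. D q \<noteq> {0}} \<subseteq> {..Suc N}" using N by (auto simp: subset_iff le_SucI)
    show "\<forall>i\<in>{..Suc N} - {q. D q \<noteq> {0}}. (u (Suc i) * u i) powi (- 1) ^ i = 1"
      using b0_trivial by (auto simp: u1)
  qed simp
  also have "\<dots> = u 0 * u (Suc (Suc N)) powi ((-1) ^ Suc N)"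
    by (rule prod_telescope_powi[OF u0])
  also have "D (Suc N) = {0}"
    using N by (metis (mono_tags, lifting) atMost_iff mem_Collect_eq not_less_eq_eq order_refl subsetD)
  then have "u (Suc (Suc N)) = 1"
    using b0_trivial u1 by blast
  finally have "(\<Prod>q | D q \<noteq> {0}. (u (Suc q) * u q) powi ((-1) ^ q)) = 1"
    by (simp add: u1 b0_0)
  then show ?thesis
    unfolding t det by (simp add: power_int_mult_distrib prod.distrib)
qed

text \<open>The reference lifts \<open>b0\<close> serve as the choice of \<open>b\<close>; only
  representatives of \<open>h\<close> have to be supplied.\<close>

lemma torsion_value_ex:
  assumes "\<And>q. \<exists>zs. lift zs (h q)"
  shows "\<exists>t. torsion_value D d c h t"
proof -
  obtain l where "\<And>q. lift (l q) (h q)"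
    using assms by metis
  then show ?thesis
    unfolding torsion_value_def using R_D(3) basis_image by blast
qed

end

section \<open>Lattices and determinants\<close>

text \<open>Vectors of all dimensions share one type and the dimension is a condition on the
  support, so that slices and inductions on \<open>n\<close> need no change of type.\<close>

definition int_space :: "nat \<Rightarrow> (nat \<Rightarrow> int) set" where
  "int_space n = {v. \<forall>i\<ge>n. v i = 0}"

definition lattice_in :: "nat \<Rightarrow> (nat \<Rightarrow> int) set \<Rightarrow> bool" where
  "lattice_in n L \<longleftrightarrow> L \<subseteq> int_space n \<and> (\<lambda>i. 0) \<in> L \<and> (\<forall>v\<in>L. \<forall>w\<in>L. (\<lambda>i. v i - w i) \<in> L)"

definition lattice_comb :: "(nat \<Rightarrow> nat \<Rightarrow> int) \<Rightarrow> nat \<Rightarrow> (nat \<Rightarrow> int) \<Rightarrow> nat \<Rightarrow> int" where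
  "lattice_comb y m c = (\<lambda>i. \<Sum>j<m. c j * y j i)"

definition lattice_basis :: "(nat \<Rightarrow> int) set \<Rightarrow> nat \<Rightarrow> (nat \<Rightarrow> nat \<Rightarrow> int) \<Rightarrow> bool" where
  "lattice_basis L m y \<longleftrightarrow> (\<forall>j<m. y j \<in> L) \<and> (\<forall>v\<in>L. \<exists>c. v = lattice_comb y m c) \<and>
     (\<forall>c. lattice_comb y m c = (\<lambda>i. 0) \<longrightarrow> (\<forall>j<m. c j = 0))"

lemma lattice_diff: "lattice_in n L \<Longrightarrow> v \<in> L \<Longrightarrow> w \<in> L \<Longrightarrow> (\<lambda>i. v i - w i) \<in> L"
  by (simp add: lattice_in_def)

lemma lattice_zero: "lattice_in n L \<Longrightarrow> (\<lambda>i. 0) \<in> L"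
  by (simp add: lattice_in_def)

lemma lattice_add:
  assumes "lattice_in n L" "v \<in> L" "w \<in> L"
  shows "(\<lambda>i. v i + w i) \<in> L"
proof -
  have "(\<lambda>i. v i - (0 - w i)) \<in> L"
    by (intro lattice_diff[OF assms(1)] lattice_zero[OF assms(1)] assms)
  then show ?thesis by simp
qed

lemma lattice_scale:
  assumes L: "lattice_in n L" and v: "v \<in> L"
  shows "(\<lambda>i. k * v i) \<in> L"
proof (induction k rule: int_induct[of _ 0])
  case base
  then show ?case using L by (simp add: lattice_in_def)
next
  case (step1 k)
  from lattice_add[OF L step1(2) v] show ?case by (simp add: algebra_simps)
next
  case (step2 k)
  from lattice_diff[OF L step2(2) v] show ?case by (simp add: left_diff_distrib)
qed

lemma lattice_comb_Suc:
  "lattice_comb y (Suc m) c = (\<lambda>i. lattice_comb y m c i + c m * y m i)"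
  by (simp add: lattice_comb_def)

lemma lattice_comb_mem:
  assumes L: "lattice_in n L" and "\<forall>j<m. y j \<in> L"
  shows "lattice_comb y m c \<in> L"
  using assms(2)
proof (induction m)
  case 0
  then show ?case using L by (simp add: lattice_comb_def lattice_in_def)
next
  case (Suc m)
  then show ?case
    unfolding lattice_comb_Suc by (intro lattice_add[OF L] lattice_scale[OF L]) auto
qed

lemma lattice_comb_cong: "(\<And>j. j < m \<Longrightarrow> c j = c' j \<and> y j = y' j) \<Longrightarrow> lattice_comb y m c = lattice_comb y' m c'"
  unfolding lattice_comb_def by (intro ext sum.cong) auto

lemma lattice_slice: "lattice_in (Suc n) L \<Longrightarrow> lattice_in n {v \<in> L. v n = 0}"
proof -
  assume L: "lattice_in (Suc n) L"
  have "v i = 0" if "v \<in> L" "v n = 0" "n \<le> i" for v i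
  proof (cases "i = n")
    case False
    then have "Suc n \<le> i" using that by simp
    then show ?thesis using L that(1) by (auto simp: lattice_in_def int_space_def)
  qed (use that in simp)
  then show ?thesis
    using L by (auto simp: lattice_in_def int_space_def)
qed

text \<open>The last coordinates form a nonzero ideal of the integers. The vector \<open>w\<close>
  realises its positive generator, and division with remainder clears the last coordinate of any
  other vector.\<close>

lemma lattice_last_coordinate:
  assumes L: "lattice_in (Suc n) L" and v: "v \<in> L" "v n \<noteq> 0"
  obtains w where "w \<in> L" "w n > 0" "\<forall>v\<in>L. \<exists>k. (\<lambda>i. v i - k * w i) \<in> {v \<in> L. v n = 0}"
proof -
  define S where "S = {v \<in> L. v n > 0}"
  have "(\<lambda>i. -1 * v i) \<in> L" using lattice_scale[OF L v(1)] .
  then have "v \<in> S \<or> (\<lambda>i. -1 * v i) \<in> S"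
    using v by (auto simp: S_def)
  then have "S \<noteq> {}" by blast
  then obtain w where w: "w \<in> S" "\<And>u. u \<in> S \<Longrightarrow> nat (w n) \<le> nat (u n)"
    using ex_has_least_nat[of "\<lambda>w. w \<in> S" _ "\<lambda>w. nat (w n)"] by blast
  have "(\<lambda>i. u i - (u n div w n) * w i) \<in> {v \<in> L. v n = 0}" if u: "u \<in> L" for u
  proof -
    let ?r = "\<lambda>i. u i - (u n div w n) * w i"
    have r: "?r \<in> L"
      by (intro lattice_diff[OF L u] lattice_scale[OF L]) (use w(1) in \<open>simp add: S_def\<close>)
    have rn: "?r n = u n mod w n"
      by (simp add: minus_div_mult_eq_mod)
    then have "0 \<le> ?r n" "?r n < w n"
      using w(1) by (auto simp: S_def)
    with w(2)[of ?r] r have "?r n = 0"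
      unfolding S_def by force
    with r show ?thesis by simp
  qed
  then show ?thesis
    using that[of w] w(1) unfolding S_def by blast
qed

text \<open>Induction on the dimension: a basis of the slice with last coordinate 0 is enlarged by
  one vector with minimal last coordinate, unless the slice is everything.\<close>

lemma lattice_basis_ex:
  assumes "lattice_in n L"
  shows "\<exists>m y. lattice_basis L m y"
  using assms
proof (induction n arbitrary: L)
  case 0
  then have "L = {\<lambda>i. 0}"
    unfolding lattice_in_def int_space_def by auto
  then have "lattice_basis L 0 (\<lambda>_. undefined)"
    by (auto simp: lattice_basis_def lattice_comb_def)
  then show ?case by blast
next
  case (Suc n)
  let ?L0 = "{v \<in> L. v n = 0}"
  obtain m y where y: "lattice_basis ?L0 m y"
    using Suc.IH[OF lattice_slice[OF Suc.prems]] by blast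
  show ?case
  proof (cases "?L0 = L")
    case True
    then show ?thesis using y by auto
  next
    case False
    then obtain v where "v \<in> L" "v n \<noteq> 0" by blast
    then obtain w where w: "w \<in> L" "w n > 0" and k: "\<forall>v\<in>L. \<exists>k. (\<lambda>i. v i - k * w i) \<in> ?L0"
      using lattice_last_coordinate[OF Suc.prems] by blast
    have yc: "lattice_comb (y(m := w)) (Suc m) c = (\<lambda>i. lattice_comb y m c i + c m * w i)" for c
      unfolding lattice_comb_Suc by (simp cong: lattice_comb_cong)
    have y0: "lattice_comb y m c n = 0" for c
      using y unfolding lattice_basis_def lattice_comb_def by (auto intro!: sum.neutral)
    have "lattice_basis L (Suc m) (y(m := w))"
      unfolding lattice_basis_def
    proof (intro conjI ballI allI impI)
      show "(y(m := w)) j \<in> L" if "j < Suc m" for j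
        using that w(1) y unfolding lattice_basis_def by (auto simp: less_Suc_eq)
      show "\<exists>c. v = lattice_comb (y(m := w)) (Suc m) c" if v: "v \<in> L" for v
      proof -
        obtain k where "(\<lambda>i. v i - k * w i) \<in> ?L0" using k v by blast
        then obtain c where c: "(\<lambda>i. v i - k * w i) = lattice_comb y m c"
          using y unfolding lattice_basis_def by blast
        have "v i = lattice_comb y m (c(m := k)) i + k * w i" for i
          using fun_cong[OF c, of i] lattice_comb_cong[of m c "c(m := k)" y y] by simp
        then show ?thesis unfolding yc by (intro exI[of _ "c(m := k)"]) auto
      qed
      fix c j assume c: "lattice_comb (y(m := w)) (Suc m) c = (\<lambda>i. 0)" and j: "j < Suc m"
      have cm: "c m = 0"
        using fun_cong[OF c, of n] w(2) unfolding yc by (simp add: y0)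
      have "lattice_comb y m c = (\<lambda>i. 0)"
        using c unfolding yc by (simp add: cm)
      then show "c j = 0"
        using y j cm unfolding lattice_basis_def by (auto simp: less_Suc_eq)
    qed
    then show ?thesis by blast
  qed
qed

text \<open>Hermite normal form. Since the lattice has full rank, each slice has a vector with
  nonzero last coordinate, so exactly one vector is added per dimension, and \<open>y j\<close> ends
  at coordinate \<open>j\<close>.\<close>

lemma hermite_basis:
  assumes "lattice_in n L" "\<forall>v\<in>int_space n. \<exists>k>0. (\<lambda>i. k * v i) \<in> L"
  shows "\<exists>y. (\<forall>j<n. y j \<in> L \<and> y j j > 0 \<and> (\<forall>i>j. y j i = 0)) \<and> (\<forall>v\<in>L. \<exists>c. v = lattice_comb y n c)"
  using assms
proof (induction n arbitrary: L)
  case 0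
  then show ?case
    unfolding lattice_in_def int_space_def by (auto simp: lattice_comb_def)
next
  case (Suc n)
  let ?L0 = "{v \<in> L. v n = 0}"
  have "\<forall>v\<in>int_space n. \<exists>k>0. (\<lambda>i. k * v i) \<in> ?L0"
    using Suc.prems(2) by (auto simp: int_space_def)
  then obtain y where y: "\<And>j. j < n \<Longrightarrow> y j \<in> L \<and> y j j > 0 \<and> (\<forall>i>j. y j i = 0)"
      "\<forall>v\<in>?L0. \<exists>c. v = lattice_comb y n c"
    using Suc.IH[OF lattice_slice[OF Suc.prems(1)]] by blast
  \<comment> \<open>Full rank is applied to the last unit vector, a positive multiple of which lies
    in \<open>L\<close>.\<close>
  have "(\<lambda>i. if i = n then 1 else 0) \<in> int_space (Suc n)"
    by (auto simp: int_space_def)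
  from bspec[OF Suc.prems(2) this] obtain k :: int
    where k: "k > 0" "(\<lambda>i. k * (if i = n then 1 else 0)) \<in> L"
    by (elim exE conjE)
  define u where "u = (\<lambda>i. k * (if i = n then 1 else 0))"
  have "u \<in> L" "u n \<noteq> 0" using k by (simp_all add: u_def)
  then obtain w where w: "w \<in> L" "w n > 0" and k: "\<forall>v\<in>L. \<exists>k. (\<lambda>i. v i - k * w i) \<in> ?L0"
    using lattice_last_coordinate[OF Suc.prems(1)] by blast
  have yc: "lattice_comb (y(n := w)) (Suc n) c = (\<lambda>i. lattice_comb y n c i + c n * w i)" for c
    unfolding lattice_comb_Suc by (simp cong: lattice_comb_cong)
  show ?case
  proof (intro exI[of _ "y(n := w)"] conjI allI impI ballI)
    fix j assume "j < Suc n"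
    then show "(y(n := w)) j \<in> L" "(y(n := w)) j j > 0"
      using w y by (auto simp: less_Suc_eq)
    show "(y(n := w)) j i = 0" if "j < i" for i
      using that y w(1) Suc.prems(1) \<open>j < Suc n\<close> unfolding lattice_in_def int_space_def by (auto simp: less_Suc_eq)
  next
    fix v assume v: "v \<in> L"
    obtain k where "(\<lambda>i. v i - k * w i) \<in> ?L0" using k v by blast
    then obtain c where c: "(\<lambda>i. v i - k * w i) = lattice_comb y n c"
      using y(2) by blast
    have "v i = lattice_comb y n (c(n := k)) i + k * w i" for i
      using fun_cong[OF c, of i] lattice_comb_cong[of n c "c(n := k)" y y] by simp
    then show "\<exists>c. v = lattice_comb (y(n := w)) (Suc n) c"
      unfolding yc by (intro exI[of _ "c(n := k)"]) auto
  qed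
qed

section \<open>Fundamental domain of a triangular lattice\<close>

definition int_box :: "nat \<Rightarrow> (nat \<Rightarrow> int) \<Rightarrow> (nat \<Rightarrow> int) set" where
  "int_box n D = {r. (\<forall>i<n. 0 \<le> r i \<and> r i < D i) \<and> (\<forall>i\<ge>n. r i = 0)}"

lemma card_int_box: "finite (int_box n D) \<and> card (int_box n D) = (\<Prod>i<n. nat (D i))"
proof -
  define P where "P = (\<Pi>\<^sub>E i\<in>{..<n}. {0..<D i})"
  have b: "bij_betw (\<lambda>f i. if i < n then f i else 0) P (int_box n D)"
  proof (rule bij_betw_byWitness[where f' = "\<lambda>f. restrict f {..<n}"])
    show "\<forall>a\<in>P. restrict (\<lambda>i. if i < n then a i else 0) {..<n} = a"
    proof
      fix a assume "a \<in> P"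
      then show "restrict (\<lambda>i. if i < n then a i else 0) {..<n} = a"
        unfolding P_def by (intro extensionalityI[of _ "{..<n}"]) (simp_all add: PiE_iff)
    qed
    show "\<forall>a'\<in>int_box n D. (\<lambda>i. if i < n then restrict a' {..<n} i else 0) = a'"
      by (simp add: int_box_def fun_eq_iff)
    show "(\<lambda>f i. if i < n then f i else 0) ` P \<subseteq> int_box n D"
      by (rule image_subsetI) (simp add: int_box_def P_def PiE_iff)
    show "(\<lambda>f. restrict f {..<n}) ` int_box n D \<subseteq> P"
      by (rule image_subsetI) (simp add: int_box_def P_def PiE_iff)
  qed
  have "finite P" "card P = (\<Prod>i<n. nat (D i))"
    by (auto simp: P_def card_PiE intro!: finite_PiE)
  then show ?thesis
    using bij_betw_same_card[OF b] bij_betw_finite[OF b] by simp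
qed

text \<open>Coordinates are reduced from the last one downwards: subtracting a multiple of
  \<open>y n\<close> does not disturb the coordinates above \<open>n\<close>.\<close>

lemma int_box_ex:
  assumes "\<forall>j<n. y j j > 0 \<and> (\<forall>i>j. y j i = 0)" "v \<in> int_space n"
  shows "\<exists>r\<in>int_box n (\<lambda>i. y i i). \<exists>c. (\<lambda>i. v i - r i) = lattice_comb y n c"
  using assms
proof (induction n arbitrary: v)
  case 0
  then show ?case
    by (intro bexI[of _ v]) (auto simp: int_box_def int_space_def lattice_comb_def)
next
  case (Suc n)
  define q where "q = v n div y n n"
  define v' where "v' = (\<lambda>i. if i = n then 0 else v i - q * y n i)"
  have "v' \<in> int_space n"
    using Suc.prems by (auto simp: v'_def int_space_def)
  then obtain r c where r: "r \<in> int_box n (\<lambda>i. y i i)" and c: "(\<lambda>i. v' i - r i) = lattice_comb y n c"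
    using Suc.IH[of v'] Suc.prems(1) by auto
  have "r(n := v n mod y n n) \<in> int_box (Suc n) (\<lambda>i. y i i)"
    using r Suc.prems(1) by (auto simp: int_box_def less_Suc_eq)
  moreover have "v i - (r(n := v n mod y n n)) i = lattice_comb y (Suc n) (c(n := q)) i" for i
  proof -
    have "lattice_comb y (Suc n) (c(n := q)) i = v' i - r i + q * y n i"
      unfolding lattice_comb_Suc c[THEN fun_cong, symmetric, of i]
      using lattice_comb_cong[of n "c(n := q)" c y y] fun_cong[OF c, of i] by simp
    moreover have "r n = 0" using r by (simp add: int_box_def)
    ultimately show ?thesis
      by (auto simp: v'_def q_def minus_mod_eq_div_mult)
  qed
  ultimately show ?case by blast
qed

text \<open>The last coordinates differ by a multiple of the last diagonal entry that is smaller
  than this entry in absolute value, hence by 0; the argument repeats one dimension lower.\<close>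

lemma int_box_unique:
  assumes "\<forall>j<n. y j j > 0 \<and> (\<forall>i>j. y j i = 0)"
    and "r \<in> int_box n (\<lambda>i. y i i)" "r' \<in> int_box n (\<lambda>i. y i i)"
    and "(\<lambda>i. r i - r' i) = lattice_comb y n c"
  shows "r = r'"
  using assms
proof (induction n arbitrary: r r')
  case 0
  then show ?case by (auto simp: int_box_def)
next
  case (Suc n)
  have 0: "lattice_comb y n c n = 0"
    using Suc.prems(1) by (auto simp: lattice_comb_def)
  have e: "r n - r' n = c n * y n n"
    using fun_cong[OF Suc.prems(4), of n] by (simp add: lattice_comb_Suc 0)
  moreover have "0 \<le> r n \<and> r n < y n n" "0 \<le> r' n \<and> r' n < y n n"
    using Suc.prems(2,3) unfolding int_box_def by blast+
  then have "\<bar>r n - r' n\<bar> < y n n" by linarith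
  moreover have ynn: "y n n > 0" using Suc.prems(1) by simp
  ultimately have "\<bar>c n\<bar> * y n n < 1 * y n n"
    by (simp add: abs_mult)
  then have "\<bar>c n\<bar> < 1"
    using ynn mult_less_cancel_right_pos by blast
  then have cn: "c n = 0" by simp
  have rn: "r n = r' n" using e cn by simp
  have "r(n := 0) = r'(n := 0)"
  proof (rule Suc.IH)
    show "r(n := 0) \<in> int_box n (\<lambda>i. y i i)" "r'(n := 0) \<in> int_box n (\<lambda>i. y i i)"
      using Suc.prems(2,3) by (auto simp: int_box_def)
    show "(\<lambda>i. (r(n := 0)) i - (r'(n := 0)) i) = lattice_comb y n c"
      using Suc.prems(4) rn by (auto simp: lattice_comb_Suc cn fun_eq_iff 0)
  qed (use Suc.prems in auto)
  then have "r i = r' i" for i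
    using rn by (cases "i = n") (auto dest: fun_cong[of _ _ i])
  then show ?case by blast
qed

text \<open>The Kronecker product with the identity of size \<open>d\<close> on the right: the
  matrix of a homomorphism after each integral basis element has been tensored with \<open>d\<close>
  vectors. An index \<open>i\<close> encodes the pair \<open>(i div d, i mod d)\<close>, in the
  order used by \<open>tensor_basis\<close>.\<close>

definition kron :: "nat \<Rightarrow> 'a::comm_ring_1 mat \<Rightarrow> 'a mat" where
  "kron d A = mat (dim_row A * d) (dim_col A * d)
     (\<lambda>(i, j). if i mod d = j mod d then A $$ (i div d, j div d) else 0)"

lemma kron_carrier [simp]: "A \<in> carrier_mat n m \<Longrightarrow> kron d A \<in> carrier_mat (n * d) (m * d)"
  by (auto simp: kron_def)

lemma sum_lessThan_mult:
  fixes f :: "nat \<Rightarrow> 'a::comm_monoid_add"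
  shows "sum f {..<m * d} = (\<Sum>a<m. \<Sum>b<d. f (a * d + b))"
  by (induction m) (simp_all add: sum_lessThan_split add.commute[of d])

lemma kron_mult:
  assumes A: "A \<in> carrier_mat n m" and B: "B \<in> carrier_mat m p"
  shows "kron d (A * B) = kron d A * kron d B"
proof (rule eq_matI)
  show "dim_row (kron d (A * B)) = dim_row (kron d A * kron d B)"
    "dim_col (kron d (A * B)) = dim_col (kron d A * kron d B)"
    by (simp_all add: kron_def)
  fix i j assume "i < dim_row (kron d A * kron d B)" "j < dim_col (kron d A * kron d B)"
  then have ij: "i < n * d" "j < p * d" using A B by (auto simp: kron_def)
  then have d: "d > 0" by (cases d) auto
  have lt: "i div d < n" "j div d < p" "i mod d < d" "j mod d < d"
    using ij d by (auto simp: less_mult_imp_div_less)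
  have "(kron d A * kron d B) $$ (i, j) = (\<Sum>k<m * d. kron d A $$ (i, k) * kron d B $$ (k, j))"
    using A B ij by (simp add: scalar_prod_def kron_def lessThan_atLeast0)
  also have "\<dots> = (\<Sum>a<m. \<Sum>b<d. kron d A $$ (i, a * d + b) * kron d B $$ (a * d + b, j))"
    by (rule sum_lessThan_mult)
  also have "\<dots> = (\<Sum>a<m. \<Sum>b<d. (if i mod d = b \<and> b = j mod d then A $$ (i div d, a) * B $$ (a, j div d) else 0))"
  proof (intro sum.cong refl)
    fix a b assume "a \<in> {..<m}" "b \<in> {..<d}"
    then have "a * d + b < m * d" "(a * d + b) div d = a" "(a * d + b) mod d = b"
      using mult_le_mono1[of "Suc a" m d] by auto
    then show "kron d A $$ (i, a * d + b) * kron d B $$ (a * d + b, j) =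
        (if i mod d = b \<and> b = j mod d then A $$ (i div d, a) * B $$ (a, j div d) else 0)"
      using A B ij by (auto simp: kron_def)
  qed
  also have "\<dots> = (\<Sum>a<m. if i mod d = j mod d then A $$ (i div d, a) * B $$ (a, j div d) else 0)"
  proof (intro sum.cong refl)
    fix a
    have "(\<Sum>b<d. if i mod d = b \<and> b = j mod d then A $$ (i div d, a) * B $$ (a, j div d) else 0) =
      (\<Sum>b<d. if b = i mod d then (if i mod d = j mod d then A $$ (i div d, a) * B $$ (a, j div d) else 0) else 0)"
      by (intro sum.cong refl) auto
    then show "(\<Sum>b<d. if i mod d = b \<and> b = j mod d then A $$ (i div d, a) * B $$ (a, j div d) else 0) =
        (if i mod d = j mod d then A $$ (i div d, a) * B $$ (a, j div d) else 0)"
      using lt by simp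
  qed
  also have "\<dots> = kron d (A * B) $$ (i, j)"
    using A B ij lt by (auto simp: kron_def scalar_prod_def lessThan_atLeast0)
  finally show "kron d (A * B) $$ (i, j) = (kron d A * kron d B) $$ (i, j)" by simp
qed

text \<open>Triangularity is inherited, and each diagonal entry occurs \<open>d\<close> times. The
  triangular case suffices because any lattice basis differs from a triangular one by a unimodular
  factor.\<close>

lemma det_kron_upper_triangular:
  assumes A: "A \<in> carrier_mat n n" and u: "upper_triangular A"
  shows "det (kron d A) = (\<Prod>i<n. A $$ (i, i)) ^ d"
proof -
  have "upper_triangular (kron d A)"
  proof (rule upper_triangularI)
    fix i j assume j: "j < i" and i: "i < dim_row (kron d A)"
    then have ij: "i < n * d" "j < n * d" "d > 0" using A by (auto simp: kron_def) (metis gr0I mult_0_right not_less_zero)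
    have "j div d \<le> i div d" using j by (simp add: div_le_mono)
    moreover have "j div d \<noteq> i div d" if "i mod d = j mod d"
      using that j by (metis div_mult_mod_eq less_irrefl)
    moreover have "i div d < n" using ij by (simp add: less_mult_imp_div_less)
    ultimately show "kron d A $$ (i, j) = 0"
      using A u ij by (auto simp: kron_def upper_triangular_def)
  qed
  then have "det (kron d A) = prod_list (diag_mat (kron d A))"
    using A by (intro det_upper_triangular[of _ "n * d"]) auto
  also have "\<dots> = (\<Prod>i<n * d. A $$ (i div d, i div d))"
    unfolding prod_list_diag_prod using A by (intro prod.cong) (auto simp: kron_def)
  also have "\<dots> = (\<Prod>i<n. A $$ (i, i)) ^ d"
  proof (induction n)
    case (Suc n)
    have sp: "prod g {..<a + b} = prod g {..<a} * (\<Prod>i<b. g (a + i))" for g :: "nat \<Rightarrow> 'a" and a b :: nat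
      by (induction b) (auto simp: mult.assoc)
    have "(\<Prod>i<d. A $$ ((n * d + i) div d, (n * d + i) div d)) = (\<Prod>i<d. A $$ (n, n))"
      by (intro prod.cong) auto
    then show ?case
      using Suc by (simp add: sp add.commute[of d] power_mult_distrib)
  qed simp
  finally show ?thesis .
qed

lemma upper_triangular_index:
  assumes n: "\<forall>j<n. y j j > 0 \<and> (\<forall>i>j. y j i = (0::int))"
  shows "det (kron d (mat n n (\<lambda>(i, j). y j i))) = int (card (int_box n (\<lambda>i. y i i))) ^ d"
proof -
  have "det (kron d (mat n n (\<lambda>(i, j). y j i))) = (\<Prod>i<n. y i i) ^ d"
    using n by (subst det_kron_upper_triangular[of _ n]) auto
  also have "(\<Prod>i<n. y i i) = (\<Prod>i<n. int (nat (y i i)))"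
    using n by (intro prod.cong) (auto simp: less_imp_le)
  also have "\<dots> = int (card (int_box n (\<lambda>i. y i i)))"
    by (simp only: card_int_box of_nat_prod)
  finally show ?thesis .
qed

section \<open>Comparison of lattice bases and the index of a lattice\<close>

lemma lattice_comb_comb:
  assumes "\<And>j. j < m \<Longrightarrow> y j = lattice_comb z n (W j)"
  shows "lattice_comb y m c = lattice_comb z n (\<lambda>i. \<Sum>j<m. c j * W j i)"
proof
  fix i
  have "lattice_comb y m c i = (\<Sum>j<m. c j * (\<Sum>k<n. W j k * z k i))"
    unfolding lattice_comb_def using assms by (intro sum.cong) (auto simp: lattice_comb_def)
  also have "\<dots> = (\<Sum>k<n. \<Sum>j<m. c j * W j k * z k i)"
    by (simp add: sum_distrib_left mult.assoc) (rule sum.swap)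
  also have "\<dots> = lattice_comb z n (\<lambda>i. \<Sum>j<m. c j * W j i) i"
    by (simp add: lattice_comb_def sum_distrib_right)
  finally show "lattice_comb y m c i = lattice_comb z n (\<lambda>i. \<Sum>j<m. c j * W j i) i" .
qed

text \<open>Expanding \<open>z\<close> through \<open>y\<close> and back gives a second expansion of
  \<open>z\<close> in itself; independence identifies it with the trivial one.\<close>

lemma lattice_basis_transition:
  assumes y: "lattice_basis L m y" and z: "lattice_basis L n z"
    and W: "\<And>j. j < m \<Longrightarrow> y j = lattice_comb z n (W j)" and U: "\<And>j. j < n \<Longrightarrow> z j = lattice_comb y m (U j)"
    and ij: "i < n" "j < n"
  shows "(\<Sum>k<m. U j k * W k i) = (if i = j then 1 else 0)"
proof -
  have "z j = lattice_comb z n (\<lambda>i. \<Sum>k<m. U j k * W k i)"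
    using U[OF ij(2)] lattice_comb_comb[of m y z n W, OF W] by simp
  moreover have "z j = lattice_comb z n (\<lambda>i. if i = j then 1 else 0)"
    using ij by (auto simp: lattice_comb_def fun_eq_iff if_distrib[of "\<lambda>x. x * _"] cong: if_cong)
  ultimately have "lattice_comb z n (\<lambda>i. (\<Sum>k<m. U j k * W k i) - (if i = j then 1 else 0)) = (\<lambda>i. 0)"
    by (auto simp: lattice_comb_def left_diff_distrib sum_subtractf fun_eq_iff)
  then have "(\<Sum>k<m. U j k * W k i) - (if i = j then 1 else 0) = 0"
    using z ij unfolding lattice_basis_def by blast
  then show ?thesis by simp
qed

lemma lattice_basisD:
  assumes "lattice_basis L m y"
  shows "\<forall>j<m. y j \<in> L" "\<forall>v\<in>L. \<exists>c. v = lattice_comb y m c"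
    "\<And>c j. lattice_comb y m c = (\<lambda>i. 0) \<Longrightarrow> j < m \<Longrightarrow> c j = 0"
  using assms by (simp_all add: lattice_basis_def)

lemma lattice_coefficients:
  assumes "\<forall>j<m. y j \<in> L" "\<forall>v\<in>L. \<exists>c. v = lattice_comb z n c"
  shows "\<exists>W. \<forall>j. j < m \<longrightarrow> y j = lattice_comb z n (W j)"
  by (rule choice) (use assms in simp)

text \<open>Equality of the traces of \<open>U W\<close> and \<open>W U\<close>, where \<open>U\<close> and \<open>W\<close> are the transition matrices.\<close>

lemma lattice_basis_card_unique:
  assumes y: "lattice_basis L m y" and z: "lattice_basis L n z"
  shows "m = n"
proof -
  from lattice_coefficients[OF lattice_basisD(1)[OF y] lattice_basisD(2)[OF z]] obtain W
    where "\<forall>j. j < m \<longrightarrow> y j = lattice_comb z n (W j)" ..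
  then have W: "\<And>j. j < m \<Longrightarrow> y j = lattice_comb z n (W j)" by simp
  from lattice_coefficients[OF lattice_basisD(1)[OF z] lattice_basisD(2)[OF y]] obtain U
    where "\<forall>j. j < n \<longrightarrow> z j = lattice_comb y m (U j)" ..
  then have U: "\<And>j. j < n \<Longrightarrow> z j = lattice_comb y m (U j)" by simp
  have "int n = (\<Sum>j<n. \<Sum>k<m. U j k * W k j)"
    using lattice_basis_transition[OF y z W U] by simp
  also have "\<dots> = (\<Sum>k<m. \<Sum>j<n. W k j * U j k)"
    by (subst sum.swap) (simp add: mult.commute)
  also have "\<dots> = int m"
    using lattice_basis_transition[OF z y U W] by simp
  finally show ?thesis by simp
qed

text \<open>A triangular basis gives the index by counting its box, and an arbitrary basis differs
  from it by an invertible integer matrix. The cosets are labelled by an abstract set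
  \<open>T\<close> with representatives \<open>f\<close>, because later the labels are torsion
  elements of a homology group.\<close>

theorem lattice_index:
  assumes L: "lattice_in n L" and full: "\<forall>v\<in>int_space n. \<exists>k>0. (\<lambda>i. k * v i) \<in> L"
    and z: "lattice_basis L m z"
    and f: "f ` T \<subseteq> int_space n" "\<forall>v\<in>int_space n. \<exists>!t. t \<in> T \<and> (\<lambda>i. v i - f t i) \<in> L"
  shows "m = n" "finite T" "\<bar>det (kron d (mat n n (\<lambda>(i, j). z j i)))\<bar> = int (card T) ^ d"
proof -
  obtain y where yj: "\<forall>j<n. y j \<in> L \<and> y j j > 0 \<and> (\<forall>i>j. y j i = 0)"
    and yL: "\<forall>v\<in>L. \<exists>c. v = lattice_comb y n c"
    using hermite_basis[OF L full] by blast
  have tri: "\<forall>j<n. y j j > 0 \<and> (\<forall>i>j. y j i = 0)" using yj by blast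
  let ?B = "int_box n (\<lambda>i. y i i)"
  have Y: "det (kron d (mat n n (\<lambda>(i, j). y j i))) = int (card ?B) ^ d" for d
    by (rule upper_triangular_index[OF tri])
  have pos: "card ?B > 0"
    using tri by (simp add: card_int_box prod_pos)
  have yb: "lattice_basis L n y"
    unfolding lattice_basis_def
  proof (intro conjI allI impI)
    fix c j assume c: "lattice_comb y n c = (\<lambda>i. 0)" and j: "j < n"
    \<comment> \<open>Back substitution from the last index: coordinate \<open>j\<close> only
      involves the vectors \<open>y i\<close> with \<open>i \<ge> j\<close>.\<close>
    have "c j = 0" if "k \<le> n" "n - k \<le> j" "j < n" for j k
      using that
    proof (induction k arbitrary: j)
      case (Suc k)
      show ?case
      proof (cases "n - k \<le> j")
        case False
        have "0 = lattice_comb y n c j" using c by simp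
        also have "\<dots> = (\<Sum>i\<in>{j}. c i * y i j)"
          unfolding lattice_comb_def
        proof (rule sum.mono_neutral_right)
          show "\<forall>i\<in>{..<n} - {j}. c i * y i j = 0"
          proof
            fix i assume i: "i \<in> {..<n} - {j}"
            show "c i * y i j = 0"
            proof (cases "i < j")
              case True then show ?thesis using tri i by simp
            next
              case False
              then have "c i = 0" using Suc.IH[of i] Suc.prems i \<open>\<not> n - k \<le> j\<close> by auto
              then show ?thesis by simp
            qed
          qed
        qed (use Suc.prems in auto)
        finally show ?thesis using tri Suc.prems by (auto dest!: spec[of _ j])
      qed (use Suc in auto)
    qed simp
    from this[of n j] j show "c j = 0" by simp
  qed (use yj yL in auto)
  show mn: "m = n" by (rule lattice_basis_card_unique[OF z yb])
  from lattice_coefficients[OF lattice_basisD(1)[OF z, unfolded mn] yL] obtain W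
    where "\<forall>j. j < n \<longrightarrow> z j = lattice_comb y n (W j)" ..
  then have W: "\<And>j. j < n \<Longrightarrow> z j = lattice_comb y n (W j)" by simp
  from lattice_coefficients[OF lattice_basisD(1)[OF yb] lattice_basisD(2)[OF z, unfolded mn]] obtain U
    where "\<forall>j. j < n \<longrightarrow> y j = lattice_comb z n (U j)" ..
  then have U: "\<And>j. j < n \<Longrightarrow> y j = lattice_comb z n (U j)" by simp
  define MY MZ MW MU where "MY = mat n n (\<lambda>(i, j). y j i)" "MZ = mat n n (\<lambda>(i, j). z j i)"
    "MW = mat n n (\<lambda>(i, j). W j i)" "MU = mat n n (\<lambda>(i, j). U j i)"
  note defs = MY_MZ_MW_MU_def
  have car: "MY \<in> carrier_mat n n" "MZ \<in> carrier_mat n n" "MW \<in> carrier_mat n n" "MU \<in> carrier_mat n n"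
    by (auto simp: defs)
  have 1: "MZ = MY * MW"
    by (rule eq_matI) (auto simp: defs scalar_prod_def W lattice_comb_def mult.commute lessThan_atLeast0)
  have 2: "MY = MZ * MU"
    by (rule eq_matI) (auto simp: defs scalar_prod_def U lattice_comb_def mult.commute lessThan_atLeast0)
  have k: "kron d A \<in> carrier_mat (n * d) (n * d)" if "A \<in> carrier_mat n n" for A :: "int mat"
    using that by simp
  have d1: "det (kron d MZ) = det (kron d MY) * det (kron d MW)"
    unfolding 1 by (simp only: kron_mult[OF car(1,3)] det_mult[OF k[OF car(1)] k[OF car(3)]])
  have "det (kron d MY) = det (kron d MZ) * det (kron d MU)"
    by (subst 2) (simp only: kron_mult[OF car(2,4)] det_mult[OF k[OF car(2)] k[OF car(4)]])
  \<comment> \<open>Substituting one transition into the other and cancelling the nonzero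
    \<open>det (kron d MY)\<close> makes \<open>det (kron d MW)\<close> a unit of the
    integers.\<close>
  then have "det (kron d MY) * (det (kron d MW) * det (kron d MU)) = det (kron d MY) * 1"
    using d1 by (simp add: mult_ac)
  moreover have "det (kron d MY) \<noteq> 0"
    using Y pos by (simp add: defs)
  ultimately have "det (kron d MW) * det (kron d MU) = 1"
    by (simp only: mult_cancel_left) simp
  then have "\<bar>det (kron d MW)\<bar> = 1"
    by (metis dvd_triv_left zdvd1_eq)
  then have Z: "\<bar>det (kron d MZ)\<bar> = int (card ?B) ^ d"
    using d1 Y by (simp add: abs_mult defs)
  \<comment> \<open>The box and \<open>T\<close> both label the cosets, so sending a box point to
    the label of its coset is a bijection.\<close>
  define g where "g = (\<lambda>v. THE t. t \<in> T \<and> (\<lambda>i. v i - f t i) \<in> L)"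
  have g: "g v \<in> T \<and> (\<lambda>i. v i - f (g v) i) \<in> L" if "v \<in> int_space n" for v
    unfolding g_def using theI'[OF bspec[OF f(2) that]] .
  have gI: "g v = t" if "v \<in> int_space n" "t \<in> T" "(\<lambda>i. v i - f t i) \<in> L" for v t
    using bspec[OF f(2) that(1)] g[OF that(1)] that(2,3) by (elim ex1E) metis
  have Bsp: "?B \<subseteq> int_space n" by (auto simp: int_box_def int_space_def)
  have "bij_betw g ?B T"
    unfolding bij_betw_def
  proof
    show "inj_on g ?B"
    proof (rule inj_onI)
      fix r r' assume r: "r \<in> ?B" "r' \<in> ?B" "g r = g r'"
      have "(\<lambda>i. (r i - f (g r) i) - (r' i - f (g r) i)) \<in> L"
        by (rule lattice_diff[OF L]) (use g[of r] g[of r'] r Bsp in auto)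
      then have "(\<lambda>i. r i - r' i) \<in> L" by simp
      then obtain c where "(\<lambda>i. r i - r' i) = lattice_comb y n c" using yL by blast
      then show "r = r'" using int_box_unique[OF tri r(1,2)] by blast
    qed
    show "g ` ?B = T"
    proof
      show "g ` ?B \<subseteq> T" using g Bsp by blast
      show "T \<subseteq> g ` ?B"
      proof
        fix t assume t: "t \<in> T"
        then obtain r c where r: "r \<in> ?B" "(\<lambda>i. f t i - r i) = lattice_comb y n c"
          using int_box_ex[OF tri, of "f t"] f(1) by blast
        have "lattice_comb y n c \<in> L" using yj by (intro lattice_comb_mem[OF L]) auto
        then have "(\<lambda>i. 0 - (f t i - r i)) \<in> L"
          unfolding r(2)[symmetric] by (rule lattice_diff[OF L lattice_zero[OF L]])
        then have "(\<lambda>i. r i - f t i) \<in> L" by simp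
        then have "g r = t" using gI r(1) Bsp t by blast
        then show "t \<in> g ` ?B" using r(1) by blast
      qed
    qed
  qed
  then have "card ?B = card T" "finite T"
    using bij_betw_same_card bij_betw_finite card_int_box by blast+
  then show "finite T" by blast
  note \<open>card ?B = card T\<close>
  then show "\<bar>det (kron d (mat n n (\<lambda>(i, j). z j i)))\<bar> = int (card T) ^ d"
    using Z by (simp add: defs)
qed

section \<open>Integral bases of abelian groups\<close>

text \<open>The same combination as \<open>int_comb\<close>, but with a coefficient function, so
  that index shifts and case distinctions are terms rather than list operations.\<close>

definition gcomb :: "('g, 'm) monoid_scheme \<Rightarrow> 'g list \<Rightarrow> (nat \<Rightarrow> int) \<Rightarrow> 'g" where
  "gcomb G xs c = finprod G (\<lambda>i. (xs ! i) [^]\<^bsub>G\<^esub> c i) {..<length xs}"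

lemma int_comb_eq_gcomb: "int_comb G xs k = gcomb G xs ((!) k)"
  by (simp add: int_comb_def gcomb_def)

definition int_indep :: "('g, 'm) monoid_scheme \<Rightarrow> 'g list \<Rightarrow> bool" where
  "int_indep G xs \<longleftrightarrow> (\<forall>c. gcomb G xs c = \<one>\<^bsub>G\<^esub> \<longrightarrow> (\<forall>i<length xs. c i = 0))"

context comm_group
begin

lemma finprod_lessThan_add:
  "f \<in> {..<m + n :: nat} \<rightarrow> carrier G \<Longrightarrow>
   finprod G f {..<m + n} = finprod G f {..<m} \<otimes> finprod G (\<lambda>i. f (m + i)) {..<n}"
proof (induction n)
  case (Suc n)
  have f: "f \<in> {..<m} \<rightarrow> carrier G" "f \<in> {..<m + n} \<rightarrow> carrier G" "f (m + n) \<in> carrier G"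
    "(\<lambda>i. f (m + i)) \<in> {..<n} \<rightarrow> carrier G"
    using Suc.prems by auto
  show ?case
    using Suc.IH f by (simp add: lessThan_Suc m_lcomm finprod_closed)
qed simp

lemma gcomb_cong:
  "set xs \<subseteq> carrier G \<Longrightarrow> (\<And>i. i < length xs \<Longrightarrow> c i = c' i) \<Longrightarrow> gcomb G xs c = gcomb G xs c'"
  unfolding gcomb_def by (intro finprod_cong') (auto simp: subset_iff)

lemma gcomb_closed [simp]: "set xs \<subseteq> carrier G \<Longrightarrow> gcomb G xs c \<in> carrier G"
  unfolding gcomb_def by (intro finprod_closed) (auto simp: subset_iff)

lemma gcomb_zero [simp]: "gcomb G xs (\<lambda>i. 0) = \<one>"
  unfolding gcomb_def by (simp add: finprod_one_eqI)

lemma gcomb_Nil [simp]: "gcomb G [] c = \<one>"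
  by (simp add: gcomb_def)

lemma gcomb_add:
  assumes "set xs \<subseteq> carrier G"
  shows "gcomb G xs (\<lambda>i. c i + c' i) = gcomb G xs c \<otimes> gcomb G xs c'"
proof -
  have "gcomb G xs (\<lambda>i. c i + c' i) = finprod G (\<lambda>i. (xs ! i) [^] c i \<otimes> (xs ! i) [^] c' i) {..<length xs}"
    unfolding gcomb_def using assms by (intro finprod_cong') (auto simp: subset_iff int_pow_mult)
  then show ?thesis
    unfolding gcomb_def using assms by (subst finprod_multf[symmetric]) (auto simp: subset_iff)
qed

lemma gcomb_minus:
  assumes "set xs \<subseteq> carrier G"
  shows "gcomb G xs (\<lambda>i. - c i) = inv (gcomb G xs c)"
proof -
  have "gcomb G xs (\<lambda>i. - c i) \<otimes> gcomb G xs c = \<one>"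
    using gcomb_add[OF assms, of "\<lambda>i. - c i" c] by simp
  then show ?thesis
    using assms by (intro inv_equality[symmetric]) auto
qed

lemma gcomb_diff:
  assumes "set xs \<subseteq> carrier G"
  shows "gcomb G xs (\<lambda>i. c i - c' i) = gcomb G xs c \<otimes> inv (gcomb G xs c')"
  using gcomb_add[OF assms, of c "\<lambda>i. - c' i"] gcomb_minus[OF assms] by simp

lemma gcomb_scale:
  assumes "set xs \<subseteq> carrier G"
  shows "gcomb G xs (\<lambda>i. k * c i) = gcomb G xs c [^] k"
proof (induction k rule: int_induct[of _ 0])
  case base
  then show ?case by simp
next
  case (step1 k)
  then show ?case
    using gcomb_add[OF assms, of "\<lambda>i. k * c i" c] assms by (simp add: distrib_right int_pow_mult)
next
  case (step2 k)
  then show ?case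
    using gcomb_diff[OF assms, of "\<lambda>i. k * c i" c] assms by (simp add: left_diff_distrib int_pow_diff)
qed

lemma gcomb_append:
  assumes "set xs \<subseteq> carrier G" "set ys \<subseteq> carrier G"
  shows "gcomb G (xs @ ys) c = gcomb G xs c \<otimes> gcomb G ys (\<lambda>i. c (length xs + i))"
proof -
  let ?f = "\<lambda>i. ((xs @ ys) ! i) [^] c i"
  have "set (xs @ ys) \<subseteq> carrier G" using assms by simp
  then have f: "?f \<in> {..<length xs + length ys} \<rightarrow> carrier G"
    by (intro Pi_I int_pow_closed) (auto simp del: set_append dest: nth_mem)
  have "gcomb G (xs @ ys) c = finprod G ?f {..<length xs} \<otimes> finprod G (\<lambda>i. ?f (length xs + i)) {..<length ys}"
    unfolding gcomb_def length_append by (rule finprod_lessThan_add[OF f])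
  also have "finprod G ?f {..<length xs} = gcomb G xs c"
    unfolding gcomb_def using assms by (intro finprod_cong') (auto simp: nth_append subset_iff)
  finally show ?thesis
    by (simp add: gcomb_def)
qed

lemma gcomb_append':
  assumes "set xs \<subseteq> carrier G" "set ys \<subseteq> carrier G"
  shows "gcomb G xs c \<otimes> gcomb G ys c' = gcomb G (xs @ ys) (\<lambda>i. if i < length xs then c i else c' (i - length xs))"
  using gcomb_cong[OF assms(1), of c "\<lambda>i. if i < length xs then c i else c' (i - length xs)"]
  by (simp add: gcomb_append[OF assms])

lemma gcomb_delta:
  assumes "set xs \<subseteq> carrier G" "j < length xs"
  shows "gcomb G xs (\<lambda>i. if i = j then 1 else 0) = xs ! j"
proof -
  have "gcomb G xs (\<lambda>i. if i = j then 1 else 0) = finprod G (\<lambda>i. if j = i then xs ! i else \<one>) {..<length xs}"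
    unfolding gcomb_def using assms by (intro finprod_cong') (auto simp: subset_iff)
  also have "\<dots> = xs ! j"
    using assms by (intro finprod_singleton) (auto simp: subset_iff)
  finally show ?thesis .
qed

lemma gcomb_mem_subgroup:
  assumes K: "subgroup K G" and xs: "set xs \<subseteq> K"
  shows "gcomb G xs c \<in> K"
proof -
  have "finprod G (\<lambda>i. (xs ! i) [^] c i) {..<n} \<in> K" if "n \<le> length xs" for n
    using that
  proof (induction n)
    case 0
    then show ?case using K by (simp add: subgroup.one_closed)
  next
    case (Suc n)
    have *: "xs ! i \<in> carrier G" if "i \<le> n" for i
      using that Suc.prems xs subgroup.subset[OF K] by (meson Suc_le_lessD le_less_trans nth_mem subsetD)
    have "(xs ! n) [^] c n \<in> K"
      using Suc.prems xs by (intro subgroup_int_pow_closed[OF K]) auto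
    with Suc show ?case
      using * by (simp add: lessThan_Suc subgroup.m_closed[OF K])
  qed
  then show ?thesis by (simp add: gcomb_def)
qed

lemma gcomb_hom:
  assumes H: "comm_group H" and h: "h \<in> hom G H" and xs: "set xs \<subseteq> carrier G"
  shows "h (gcomb G xs c) = gcomb H (map h xs) c"
proof -
  interpret H: comm_group H by (rule H)
  interpret h: group_hom G H h using h by (simp add: group_hom_def group_hom_axioms_def is_group)
  have "h (finprod G (\<lambda>i. (xs ! i) [^] c i) {..<n}) = finprod H (\<lambda>i. h (xs ! i) [^]\<^bsub>H\<^esub> c i) {..<n}" if "n \<le> length xs" for n
    using that
  proof (induction n)
    case (Suc n)
    have *: "xs ! i \<in> carrier G" if "i \<le> n" for i
      using that Suc.prems xs by (meson Suc_le_lessD le_less_trans nth_mem subsetD)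
    have **: "h (xs ! i) \<in> carrier H" if "i \<le> n" for i
      using *[OF that] by simp
    show ?case
      using Suc * ** by (simp add: lessThan_Suc Pi_I finprod_closed h.hom_mult hom_int_pow[OF h _ group_axioms H.is_group])
  qed simp
  from this[of "length xs"] show ?thesis
    unfolding gcomb_def length_map using subsetD[OF xs nth_mem] by (auto intro!: H.finprod_cong')
qed

lemma int_indepD: "int_indep G xs \<Longrightarrow> gcomb G xs c = \<one> \<Longrightarrow> i < length xs \<Longrightarrow> c i = 0"
  by (simp add: int_indep_def)

lemma int_indep_unique:
  assumes "int_indep G xs" "set xs \<subseteq> carrier G" "gcomb G xs c = gcomb G xs c'" "i < length xs"
  shows "c i = c' i"
proof -
  have "gcomb G xs (\<lambda>i. c i - c' i) = \<one>"
    using assms(2,3) by (simp add: gcomb_diff)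
  from int_indepD[OF assms(1) this assms(4)] show ?thesis by simp
qed

text \<open>Replaces unique coordinate lists by independence and generation. The subgroup
  \<open>K\<close> is kept as a parameter because bases of boundaries and of cycles live in the
  ambient chain group.\<close>

lemma int_basis_iff:
  assumes K: "subgroup K G"
  shows "int_basis G K xs \<longleftrightarrow> set xs \<subseteq> K \<and> int_indep G xs \<and> (\<forall>x\<in>K. \<exists>c. x = gcomb G xs c)"
proof
  assume b: "int_basis G K xs"
  then have xs: "set xs \<subseteq> K" by (simp add: int_basis_def)
  have xs': "set xs \<subseteq> carrier G" using xs subgroup.subset[OF K] by simp
  have "int_indep G xs"
    unfolding int_indep_def
  proof (intro allI impI)
    fix c i assume c: "gcomb G xs c = \<one>" and i: "i < length xs"
    have u: "\<exists>!k. length k = length xs \<and> \<one> = int_comb G xs k"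
      using b subgroup.one_closed[OF K] by (simp add: int_basis_def)
    have 1: "int_comb G xs (map c [0..<length xs]) = \<one>"
      unfolding int_comb_eq_gcomb c[symmetric] by (rule gcomb_cong[OF xs']) simp
    have "int_comb G xs (map (\<lambda>_. 0) [0..<length xs]) = gcomb G xs (\<lambda>i. 0)"
      unfolding int_comb_eq_gcomb by (rule gcomb_cong[OF xs']) simp
    then have 2: "int_comb G xs (map (\<lambda>_. 0) [0..<length xs]) = \<one>" by simp
    have "map c [0..<length xs] = map (\<lambda>_. 0) [0..<length xs]"
      using u 1 2 by (metis (no_types, lifting) length_map length_upt minus_nat.diff_0)
    with i show "c i = 0" by simp
  qed
  moreover have "\<forall>x\<in>K. \<exists>c. x = gcomb G xs c"
    using b unfolding int_basis_def int_comb_eq_gcomb by blast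
  ultimately show "set xs \<subseteq> K \<and> int_indep G xs \<and> (\<forall>x\<in>K. \<exists>c. x = gcomb G xs c)"
    using xs by blast
next
  assume a: "set xs \<subseteq> K \<and> int_indep G xs \<and> (\<forall>x\<in>K. \<exists>c. x = gcomb G xs c)"
  then have xs': "set xs \<subseteq> carrier G" using subgroup.subset[OF K] by auto
  show "int_basis G K xs"
    unfolding int_basis_def
  proof (intro conjI ballI)
    fix x assume "x \<in> K"
    then obtain c where c: "x = gcomb G xs c" using a by blast
    show "\<exists>!k. length k = length xs \<and> x = int_comb G xs k"
    proof (rule ex1I)
      show "length (map c [0..<length xs]) = length xs \<and> x = int_comb G xs (map c [0..<length xs])"
        unfolding c int_comb_eq_gcomb by (auto intro!: gcomb_cong[OF xs'])
      fix k assume k: "length k = length xs \<and> x = int_comb G xs k"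
      then have "gcomb G xs ((!) k) = gcomb G xs c"
        by (simp add: int_comb_eq_gcomb c)
      with k show "k = map c [0..<length xs]"
        using int_indep_unique[of xs] a xs' by (intro nth_equalityI) auto
    qed
  qed (use a in auto)
qed

lemmas int_basis_carrier_iff = int_basis_iff[OF subgroup_self]

text \<open>The lifts \<open>ys\<close> split the extension of \<open>B\<close> by \<open>A\<close>:
  the coordinates of \<open>p x\<close> determine the \<open>ys\<close> part of \<open>x\<close>,
  and the rest lies in the kernel and has coordinates in \<open>A\<close>. In this way bases grow
  along exact sequences of triples.\<close>

lemma int_basis_split:
  assumes A: "comm_group A" and B: "comm_group B" and i: "i \<in> hom A G" and p: "p \<in> hom G B"
    and inj: "inj_on i (carrier A)" and ex: "kernel G B p = i ` carrier A"
    and xs: "int_basis A (carrier A) xs" and ys: "set ys \<subseteq> carrier G" "int_basis B (carrier B) (map p ys)"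
  shows "int_basis G (carrier G) (map i xs @ ys)"
proof -
  interpret A: comm_group A by (rule A)
  interpret B: comm_group B by (rule B)
  interpret i: group_hom A G i using i by (simp add: group_hom_def group_hom_axioms_def is_group)
  interpret p: group_hom G B p using p by (simp add: group_hom_def group_hom_axioms_def is_group)
  note xsb = xs[unfolded A.int_basis_carrier_iff]
  note ysb = ys(2)[unfolded B.int_basis_carrier_iff]
  have ixs: "set (map i xs) \<subseteq> carrier G" using xsb by auto
  have xsA: "set xs \<subseteq> carrier A" using xsb by blast
  have pi: "p (i x) = \<one>\<^bsub>B\<^esub>" if "x \<in> carrier A" for x
    using ex that by (auto simp: kernel_def)
  have ig: "gcomb G (map i xs) c = i (gcomb A xs c)" for c
    using A.gcomb_hom[OF comm_group_axioms i xsA] by simp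
  have pg: "p (gcomb G ys c) = gcomb B (map p ys) c" for c
    using gcomb_hom[OF B p ys(1)] by simp
  show ?thesis
    unfolding int_basis_carrier_iff
  proof (intro conjI ballI)
    show "set (map i xs @ ys) \<subseteq> carrier G" using ixs ys by auto
    show "int_indep G (map i xs @ ys)"
      unfolding int_indep_def
    proof (intro allI impI)
      fix c j assume c: "gcomb G (map i xs @ ys) c = \<one>" and j: "j < length (map i xs @ ys)"
      let ?d = "\<lambda>k. c (length xs + k)"
      have e: "i (gcomb A xs c) \<otimes> gcomb G ys ?d = \<one>"
        using c gcomb_append[OF ixs ys(1)] by (simp add: ig)
      then have "p (i (gcomb A xs c) \<otimes> gcomb G ys ?d) = \<one>\<^bsub>B\<^esub>" by simp
      then have "gcomb B (map p ys) ?d = \<one>\<^bsub>B\<^esub>"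
        using xsA ys(1) B.gcomb_closed[of "map p ys"] ysb by (simp add: pi pg)
      then have d: "?d k = 0" if "k < length ys" for k
        using B.int_indepD[of "map p ys" ?d k] ysb that by simp
      then have "gcomb G ys ?d = \<one>"
        using gcomb_cong[OF ys(1), of ?d "\<lambda>_. 0"] by simp
      with e have "i (gcomb A xs c) = i \<one>\<^bsub>A\<^esub>" using xsA by simp
      then have "gcomb A xs c = \<one>\<^bsub>A\<^esub>"
        using inj_onD[OF inj, of "gcomb A xs c" "\<one>\<^bsub>A\<^esub>"] xsA by simp
      then have c0: "c k = 0" if "k < length xs" for k
        using A.int_indepD[of xs c k] xsb that by simp
      show "c j = 0"
        using c0[of j] d[of "j - length xs"] j by (cases "j < length xs") auto
    qed
    fix x assume x: "x \<in> carrier G"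
    then have "p x \<in> carrier B" by simp
    then obtain c where c: "p x = gcomb B (map p ys) c"
      using conjunct2[OF conjunct2[OF ysb]] by blast
    have "x \<otimes> inv (gcomb G ys c) \<in> kernel G B p"
      using x ys(1) gcomb_closed[OF ys(1)] by (simp add: kernel_def pg[symmetric] c)
    then obtain a where a: "a \<in> carrier A" "x \<otimes> inv (gcomb G ys c) = i a"
      unfolding ex by blast
    then obtain c' where c': "a = gcomb A xs c'"
      using conjunct2[OF conjunct2[OF xsb]] by blast
    have "x = i a \<otimes> gcomb G ys c"
      using a x gcomb_closed[OF ys(1), of c] by (simp add: a(2)[symmetric] m_assoc)
    also have "\<dots> = gcomb G (map i xs) c' \<otimes> gcomb G ys c"
      by (simp add: c' ig)
    finally show "\<exists>c. x = gcomb G (map i xs @ ys) c"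
      using gcomb_append'[OF ixs ys(1)] by auto
  qed
qed

lemma int_basis_mon_image:
  assumes H: "comm_group H" and h: "h \<in> hom G H" and inj: "inj_on h (carrier G)"
    and xs: "int_basis G (carrier G) xs"
  shows "int_basis H (h ` carrier G) (map h xs)"
proof -
  interpret H: comm_group H by (rule H)
  interpret h: group_hom G H h using h by (simp add: group_hom_def group_hom_axioms_def is_group)
  note b = xs[unfolded int_basis_carrier_iff]
  have K: "subgroup (h ` carrier G) H" by (rule h.img_is_subgroup)
  have hg: "h (gcomb G xs c) = gcomb H (map h xs) c" for c
    using gcomb_hom[OF H h] b by blast
  show ?thesis
    unfolding H.int_basis_iff[OF K]
  proof (intro conjI)
    show "int_indep H (map h xs)"
      unfolding int_indep_def
    proof (intro allI impI)
      fix c j assume "gcomb H (map h xs) c = \<one>\<^bsub>H\<^esub>" "j < length (map h xs)"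
      then have "h (gcomb G xs c) = h \<one>" "j < length xs" by (auto simp: hg)
      then have "gcomb G xs c = \<one>"
        using inj_onD[OF inj, of "gcomb G xs c" \<one>] b by simp
      then show "c j = 0" using b \<open>j < length xs\<close> by (auto dest: int_indepD)
    qed
    show "\<forall>x\<in>h ` carrier G. \<exists>c. x = gcomb H (map h xs) c"
      unfolding hg[symmetric] using b by (auto intro: arg_cong[of _ _ h])
  qed (use b in auto)
qed

lemma int_basis_iso:
  assumes "comm_group H" "h \<in> iso G H" "int_basis G (carrier G) xs"
  shows "int_basis H (carrier H) (map h xs)"
  using int_basis_mon_image[of H h xs] assms by (auto simp: iso_def bij_betw_def)

lemma gcomb_perm:
  assumes xs: "set xs \<subseteq> carrier G" and "mset xs = mset ys"
  obtains p where "p permutes {..<length xs}" "\<And>c. gcomb G ys c = gcomb G xs (c \<circ> p)"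
proof -
  obtain p where p: "p permutes {..<length xs}" "permute_list p xs = ys"
    using mset_eq_permutation[OF assms(2)[symmetric]] by blast
  note q = permutes_inv[OF p(1)]
  have l: "length ys = length xs" using assms(2) mset_eq_length by metis
  have "gcomb G ys c = gcomb G xs (c \<circ> inv_into UNIV p)" for c
  proof -
    have "gcomb G ys c = finprod G (\<lambda>i. (xs ! p i) [^] c (inv_into UNIV p (p i))) {..<length xs}"
      unfolding gcomb_def l
      using permutes_in_image[OF p(1)] subsetD[OF xs nth_mem] permutes_inverses(2)[OF p(1)] p(1)
      by (intro finprod_cong') (auto simp: p(2)[symmetric] permute_list_nth)
    also have "\<dots> = finprod G (\<lambda>i. (xs ! i) [^] c (inv_into UNIV p i)) (p ` {..<length xs})"
      by (rule finprod_reindex[symmetric])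
        (use subsetD[OF xs nth_mem] permutes_inj_on[OF p(1)] permutes_image[OF p(1)] in auto)
    finally show ?thesis
      by (simp add: gcomb_def permutes_image[OF p(1)])
  qed
  with q show thesis using that by blast
qed

text \<open>In degree \<open>a\<close> the exact sequence lists the cones first, whereas the chain
  basis lists the cells first.\<close>

lemma int_basis_perm:
  assumes "int_basis G (carrier G) xs" and m: "mset xs = mset ys"
  shows "int_basis G (carrier G) ys"
proof -
  note b = assms(1)[unfolded int_basis_carrier_iff]
  obtain p where p: "p permutes {..<length xs}" "\<And>c. gcomb G ys c = gcomb G xs (c \<circ> p)"
    using gcomb_perm[of xs ys] b m by blast
  have l: "length ys = length xs" "set ys = set xs" using m mset_eq_length mset_eq_setD by metis+
  show ?thesis
    unfolding int_basis_carrier_iff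
  proof (intro conjI)
    show "int_indep G ys"
      unfolding int_indep_def
    proof (intro allI impI)
      fix c j assume c: "gcomb G ys c = \<one>" and j: "j < length ys"
      obtain i where i: "i < length xs" "j = p i"
        using permutes_image[OF p(1)] j l by (metis imageE lessThan_iff)
      then show "c j = 0"
        using b c p(2)[of c] int_indepD[of xs "c \<circ> p" i] by simp
    qed
    show "\<forall>x\<in>carrier G. \<exists>c. x = gcomb G ys c"
    proof
      fix x assume "x \<in> carrier G"
      then obtain c where "x = gcomb G xs c" using b by blast
      then have "x = gcomb G ys (c \<circ> inv_into UNIV p)"
        using permutes_inverses(2)[OF p(1)] by (simp add: p(2) comp_def)
      then show "\<exists>c. x = gcomb G ys c" by blast
    qed
  qed (use b l in auto)
qed

end

section \<open>Free groups in coordinates: subgroups and their index\<close>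

lemma int_space_trunc: "(\<lambda>i. if i < n then c i else 0) \<in> int_space n"
  by (simp add: int_space_def)

lemma int_space_eqI: "v \<in> int_space n \<Longrightarrow> w \<in> int_space n \<Longrightarrow> (\<And>i. i < n \<Longrightarrow> v i = w i) \<Longrightarrow> v = w"
proof (rule ext)
  fix i assume "v \<in> int_space n" "w \<in> int_space n" "\<And>i. i < n \<Longrightarrow> v i = w i"
  then show "v i = w i" by (cases "i < n") (simp_all add: int_space_def)
qed

context comm_group
begin

lemma gcomb_trunc: "set xs \<subseteq> carrier G \<Longrightarrow> gcomb G xs (\<lambda>i. if i < length xs then c i else 0) = gcomb G xs c"
  by (rule gcomb_cong) auto

lemma gcomb_singleton: "x \<in> carrier G \<Longrightarrow> gcomb G [x] c = x [^] c 0"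
  by (simp add: gcomb_def lessThan_Suc)

text \<open>The bridge from groups to lattices: coefficient vectors combine by
  \<open>lattice_comb\<close>.\<close>

lemma gcomb_gcomb:
  assumes ss: "set ss \<subseteq> carrier G"
  shows "gcomb G (map (\<lambda>j. gcomb G ss (w j)) [0..<m]) c = gcomb G ss (lattice_comb w m c)"
proof (induction m)
  case 0
  then show ?case by (simp add: lattice_comb_def)
next
  case (Suc m)
  have 1: "set (map (\<lambda>j. gcomb G ss (w j)) [0..<m]) \<subseteq> carrier G" using ss by auto
  have 2: "set [gcomb G ss (w m)] \<subseteq> carrier G" using ss by auto
  show ?case
    using gcomb_append[OF 1 2, of c] Suc ss
    by (simp add: gcomb_singleton lattice_comb_Suc gcomb_add gcomb_scale)
qed

lemma int_basis_coordinates: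
  assumes "int_basis G (carrier G) ss" "x \<in> carrier G"
  obtains c where "c \<in> int_space (length ss)" "x = gcomb G ss c"
proof -
  note b = assms(1)[unfolded int_basis_carrier_iff]
  obtain c where c: "x = gcomb G ss c" using b assms(2) by blast
  have "x = gcomb G ss (\<lambda>i. if i < length ss then c i else 0)"
    unfolding c by (rule gcomb_trunc[symmetric]) (use b in blast)
  then show thesis by (rule that[OF int_space_trunc])
qed

lemma lattice_of_subgroup:
  assumes ss: "set ss \<subseteq> carrier G" and K: "subgroup K G"
  shows "lattice_in (length ss) {c \<in> int_space (length ss). gcomb G ss c \<in> K}"
  unfolding lattice_in_def
proof (intro conjI ballI)
  show "(\<lambda>i. 0) \<in> {c \<in> int_space (length ss). gcomb G ss c \<in> K}"
    using subgroup.one_closed[OF K] by (simp add: int_space_def)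
  fix v w assume "v \<in> {c \<in> int_space (length ss). gcomb G ss c \<in> K}"
    "w \<in> {c \<in> int_space (length ss). gcomb G ss c \<in> K}"
  then show "(\<lambda>i. v i - w i) \<in> {c \<in> int_space (length ss). gcomb G ss c \<in> K}"
    using subgroup.m_closed[OF K] subgroup.m_inv_closed[OF K]
    by (simp add: gcomb_diff[OF ss] int_space_def)
qed auto

text \<open>The coordinate vectors of \<open>K\<close> form a lattice, and a basis of this lattice
  is carried back to \<open>K\<close>. This supplies integral bases of boundaries and of
  cycles.\<close>

lemma subgroup_int_basis_ex:
  assumes ss: "int_basis G (carrier G) ss" and K: "subgroup K G"
  shows "\<exists>ys. int_basis G K ys"
proof -
  note b = ss[unfolded int_basis_carrier_iff]
  have ssG: "set ss \<subseteq> carrier G" using b by blast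
  let ?n = "length ss"
  let ?L = "{c \<in> int_space ?n. gcomb G ss c \<in> K}"
  obtain m y where y: "lattice_basis ?L m y"
    using lattice_basis_ex[OF lattice_of_subgroup[OF ssG K]] by blast
  let ?ys = "map (\<lambda>j. gcomb G ss (y j)) [0..<m]"
  have "set ?ys \<subseteq> K" using lattice_basisD(1)[OF y] by auto
  moreover have "int_indep G ?ys"
    unfolding int_indep_def
  proof (intro allI impI)
    fix c i assume c: "gcomb G ?ys c = \<one>" and i: "i < length ?ys"
    have "lattice_comb y m c \<in> ?L"
      by (rule lattice_comb_mem[OF lattice_of_subgroup[OF ssG K] lattice_basisD(1)[OF y]])
    then have m: "lattice_comb y m c \<in> int_space ?n" by blast
    have e: "gcomb G ss (lattice_comb y m c) = \<one>"
      using c gcomb_gcomb[OF ssG] by simp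
    have "lattice_comb y m c = (\<lambda>i. 0)"
      by (rule int_space_eqI[OF m]) (use int_indepD[OF _ e] b in \<open>auto simp: int_space_def\<close>)
    then show "c i = 0"
      using lattice_basisD(3)[OF y] i by simp
  qed
  moreover have "\<forall>x\<in>K. \<exists>c. x = gcomb G ?ys c"
  proof
    fix x assume x: "x \<in> K"
    then obtain v where v: "v \<in> int_space ?n" "x = gcomb G ss v"
      using int_basis_coordinates[OF ss] subgroup.subset[OF K] by blast
    then have "v \<in> ?L" using x by simp
    then obtain c where "v = lattice_comb y m c"
      using lattice_basisD(2)[OF y] by blast
    then show "\<exists>c. x = gcomb G ?ys c"
      unfolding v(2) gcomb_gcomb[OF ssG] by blast
  qed
  ultimately show ?thesis
    unfolding int_basis_iff[OF K] by blast
qed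

text \<open>This is \<open>lattice_index\<close> read in the coordinates of \<open>ss\<close>, with
  \<open>w j\<close> the coordinates of the basis element \<open>ys ! j\<close> of
  \<open>K\<close>.\<close>

lemma subgroup_index_det:
  assumes ss: "int_basis G (carrier G) ss" and K: "subgroup K G" and ys: "int_basis G K ys"
    and f: "f ` T \<subseteq> carrier G" "\<forall>x\<in>carrier G. \<exists>!t. t \<in> T \<and> x \<otimes> inv (f t) \<in> K"
    and full: "\<And>x. x \<in> carrier G \<Longrightarrow> \<exists>k>0. x [^] (k::int) \<in> K"
    and w: "\<And>j. j < length ys \<Longrightarrow> w j \<in> int_space (length ss) \<and> ys ! j = gcomb G ss (w j)"
  shows "length ys = length ss" "finite T"
    "\<bar>det (kron d (mat (length ss) (length ss) (\<lambda>(i, j). w j i)))\<bar> = int (card T) ^ d"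
proof -
  note b = ss[unfolded int_basis_carrier_iff]
  have ssG: "set ss \<subseteq> carrier G" using b by blast
  note by' = ys[unfolded int_basis_iff[OF K]]
  let ?n = "length ss"
  let ?L = "{c \<in> int_space ?n. gcomb G ss c \<in> K}"
  note L = lattice_of_subgroup[OF ssG K]
  have ysG: "set ys \<subseteq> carrier G" using by' subgroup.subset[OF K] by auto
  have mapw: "map (\<lambda>j. gcomb G ss (w j)) [0..<length ys] = ys"
    using w by (intro nth_equalityI) auto
  have gw: "gcomb G ys c = gcomb G ss (lattice_comb w (length ys) c)" for c
    using gcomb_gcomb[OF ssG, of w "length ys" c] by (simp add: mapw)
  have wsp: "lattice_comb w (length ys) c \<in> int_space ?n" for c
    using w by (auto simp: int_space_def lattice_comb_def)
  have z: "lattice_basis ?L (length ys) w"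
    unfolding lattice_basis_def
  proof (intro conjI allI impI ballI)
    fix j assume j: "j < length ys"
    then have "ys ! j \<in> K" using by' by auto
    with w[OF j] show "w j \<in> ?L" by simp
  next
    fix v assume v: "v \<in> ?L"
    then obtain c where "gcomb G ss v = gcomb G ys c" using by' by blast
    then have "gcomb G ss v = gcomb G ss (lattice_comb w (length ys) c)"
      unfolding gw .
    then have "v = lattice_comb w (length ys) c"
      using v wsp int_indep_unique[of ss v] b by (intro int_space_eqI[of _ ?n]) auto
    then show "\<exists>c. v = lattice_comb w (length ys) c" by (rule exI[of _ c])
  next
    fix c j assume c: "lattice_comb w (length ys) c = (\<lambda>i. 0)" and j: "j < length ys"
    have "gcomb G ys c = \<one>" unfolding gw c by simp
    then show "c j = 0" using by' j by (auto dest: int_indepD)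
  qed
  have fullL: "\<forall>v\<in>int_space ?n. \<exists>k>0. (\<lambda>i. k * v i) \<in> ?L"
  proof
    fix v assume v: "v \<in> int_space ?n"
    obtain k :: int where k: "k > 0" "gcomb G ss v [^] k \<in> K"
      using full[of "gcomb G ss v"] ssG by auto
    then have "(\<lambda>i. k * v i) \<in> ?L"
      using v by (simp add: gcomb_scale[OF ssG] int_space_def)
    then show "\<exists>k>0. (\<lambda>i. k * v i) \<in> ?L" using k by blast
  qed
  have "\<forall>t. \<exists>c. t \<in> T \<longrightarrow> c \<in> int_space ?n \<and> f t = gcomb G ss c"
  proof (intro allI)
    fix t
    show "\<exists>c. t \<in> T \<longrightarrow> c \<in> int_space ?n \<and> f t = gcomb G ss c"
    proof (cases "t \<in> T")
      case True
      then have "f t \<in> carrier G" using f(1) by auto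
      then obtain c where "c \<in> int_space ?n" "f t = gcomb G ss c"
        by (rule int_basis_coordinates[OF ss])
      then show ?thesis by (intro exI[of _ c]) simp
    qed simp
  qed
  then obtain f' where f': "\<forall>t. t \<in> T \<longrightarrow> f' t \<in> int_space ?n \<and> f t = gcomb G ss (f' t)"
    by (rule choice[THEN exE])
  have f1: "f' ` T \<subseteq> int_space ?n" using f' by auto
  have f2: "\<forall>v\<in>int_space ?n. \<exists>!t. t \<in> T \<and> (\<lambda>i. v i - f' t i) \<in> ?L"
  proof
    fix v assume v: "v \<in> int_space ?n"
    have eq: "(t \<in> T \<and> (\<lambda>i. v i - f' t i) \<in> ?L) \<longleftrightarrow> (t \<in> T \<and> gcomb G ss v \<otimes> inv (f t) \<in> K)" for t
    proof (cases "t \<in> T")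
      case True
      then have "f' t \<in> int_space ?n" "f t = gcomb G ss (f' t)" using f' by auto
      then show ?thesis
        using v by (auto simp: gcomb_diff[OF ssG] int_space_def)
    qed simp
    show "\<exists>!t. t \<in> T \<and> (\<lambda>i. v i - f' t i) \<in> ?L"
      unfolding eq by (rule bspec[OF f(2) gcomb_closed[OF ssG]])
  qed
  show "length ys = length ss" "finite T"
    "\<bar>det (kron d (mat (length ss) (length ss) (\<lambda>(i, j). w j i)))\<bar> = int (card T) ^ d"
    using lattice_index[OF L fullL z f1 f2] by auto
qed

text \<open>Unique decomposition into a free and a torsion part amounts to generation modulo torsion
  together with a trivial intersection of the two parts.\<close>

lemma free_part_basisD:
  assumes "free_part_basis G us"
  shows "set us \<subseteq> carrier G"
    and "\<And>x. x \<in> carrier G \<Longrightarrow> \<exists>c t. t \<in> torsion_subgroup G \<and> x = gcomb G us c \<otimes> t"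
    and "\<And>c t. t \<in> torsion_subgroup G \<Longrightarrow> gcomb G us c = t \<Longrightarrow> t = \<one> \<and> (\<forall>i<length us. c i = 0)"
proof -
  show us: "set us \<subseteq> carrier G" using assms by (simp add: free_part_basis_def)
  have ex: "\<exists>!(k, t). length k = length us \<and> t \<in> torsion_subgroup G \<and> x = gcomb G us ((!) k) \<otimes> t" if "x \<in> carrier G" for x
    using assms that unfolding free_part_basis_def int_comb_eq_gcomb by blast
  show "\<exists>c t. t \<in> torsion_subgroup G \<and> x = gcomb G us c \<otimes> t" if "x \<in> carrier G" for x
    using ex[OF that] by blast
  fix c t assume t: "t \<in> torsion_subgroup G" and c: "gcomb G us c = t"
  have one: "\<one> \<in> torsion_subgroup G"
    by (auto simp: torsion_subgroup_def intro: exI[of _ "1::nat"])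
  have tG: "t \<in> carrier G" using t by (simp add: torsion_subgroup_def)
  have l: "gcomb G us ((!) (map e [0..<length us])) = gcomb G us e" for e
    by (rule gcomb_cong[OF us]) simp
  \<comment> \<open>The element \<open>t\<close> decomposes in two ways, with everything in the free
    part or everything in the torsion part; uniqueness identifies them.\<close>
  have "(map c [0..<length us], \<one>) = (map (\<lambda>_. 0) [0..<length us], t)"
  proof -
    have "(case p of (k, t') \<Rightarrow> length k = length us \<and> t' \<in> torsion_subgroup G \<and> t = gcomb G us ((!) k) \<otimes> t') \<Longrightarrow>
        (case q of (k, t') \<Rightarrow> length k = length us \<and> t' \<in> torsion_subgroup G \<and> t = gcomb G us ((!) k) \<otimes> t') \<Longrightarrow> p = q" for p q
      using ex[OF tG] by blast
    from this[of "(map c [0..<length us], \<one>)" "(map (\<lambda>_. 0) [0..<length us], t)"] show ?thesis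
      using t one tG c us by (simp add: l)
  qed
  then show "t = \<one> \<and> (\<forall>i<length us. c i = 0)"
    by simp
qed

lemma torsion_subgroup_subgroup: "subgroup (torsion_subgroup G) G"
proof
  show "torsion_subgroup G \<subseteq> carrier G" by (auto simp: torsion_subgroup_def)
  show "\<one> \<in> torsion_subgroup G"
    by (auto simp: torsion_subgroup_def intro: exI[of _ "1::nat"])
  show "inv x \<in> torsion_subgroup G" if "x \<in> torsion_subgroup G" for x
    using that by (auto simp: torsion_subgroup_def nat_pow_inv)
  fix x y assume xy: "x \<in> torsion_subgroup G" "y \<in> torsion_subgroup G"
  then obtain k l :: nat where kl: "k > 0" "x [^] k = \<one>" "l > 0" "y [^] l = \<one>"
    by (auto simp: torsion_subgroup_def)
  have xyG: "x \<in> carrier G" "y \<in> carrier G" using xy by (auto simp: torsion_subgroup_def)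
  have "x [^] (k * l) = \<one>"
    using kl(2) nat_pow_pow[OF xyG(1), of k l] by simp
  moreover have "y [^] (k * l) = \<one>"
    using kl(4) nat_pow_pow[OF xyG(2), of l k] by (simp add: mult.commute)
  ultimately have "(x \<otimes> y) [^] (k * l) = \<one>"
    using xyG by (simp add: pow_mult_distrib m_comm)
  then show "x \<otimes> y \<in> torsion_subgroup G"
    using kl xyG by (auto simp: torsion_subgroup_def intro!: exI[of _ "k * l"])
qed

end

lemma (in comm_group) adapted_basis_index:
  fixes f :: "'e \<Rightarrow> 'a" and g :: "'a \<Rightarrow> 'c" and \<kappa> :: "'a \<Rightarrow> 'h"
  assumes A: "comm_group A" and B: "comm_group B" and H: "comm_group H"
    and f: "f \<in> hom A G" and g: "g \<in> hom G B" and gf: "\<And>a. a \<in> carrier A \<Longrightarrow> g (f a) = \<one>\<^bsub>B\<^esub>"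
    and \<kappa>: "\<kappa> \<in> hom (subgroup_generated G (kernel G B g)) H" "\<kappa> ` kernel G B g = carrier H"
    "\<And>z. z \<in> kernel G B g \<Longrightarrow> \<kappa> z = \<one>\<^bsub>H\<^esub> \<longleftrightarrow> z \<in> f ` carrier A"
    and \<beta>: "set \<beta> \<subseteq> carrier A" "int_basis G (f ` carrier A) (map f \<beta>)"
    and \<gamma>: "set \<gamma> \<subseteq> carrier G" "int_basis B (g ` carrier G) (map g \<gamma>)"
    and lam: "set lam \<subseteq> kernel G B g" "free_part_basis H (map \<kappa> lam)"
    and ss: "int_basis G (carrier G) ss"
    and w: "\<And>j. j < length (map f \<beta> @ lam @ \<gamma>) \<Longrightarrow>
       w j \<in> int_space (length ss) \<and> (map f \<beta> @ lam @ \<gamma>) ! j = gcomb G ss (w j)"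
  shows "length (map f \<beta> @ lam @ \<gamma>) = length ss" "card (torsion_subgroup H) > 0"
    "\<bar>det (kron d (mat (length ss) (length ss) (\<lambda>(i, j). w j i)))\<bar> = int (card (torsion_subgroup H)) ^ d"
proof -
  interpret A: comm_group A by (rule A)
  interpret B: comm_group B by (rule B)
  interpret H: comm_group H by (rule H)
  interpret f: group_hom A G f using f by (simp add: group_hom_def group_hom_axioms_def is_group)
  interpret g: group_hom G B g using g by (simp add: group_hom_def group_hom_axioms_def is_group)
  let ?Z = "kernel G B g" and ?T = "torsion_subgroup H" and ?ys = "map f \<beta> @ lam @ \<gamma>"
  have Z: "subgroup ?Z G" by (rule g.subgroup_kernel)
  have cZ: "carrier (subgroup_generated G ?Z) = ?Z"
    by (rule subgroup.carrier_subgroup_generated_subgroup[OF Z])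
  interpret GZ: comm_group "subgroup_generated G ?Z"
    by (rule abelian_subgroup_generated[OF comm_group_axioms])
  have idh: "id \<in> hom (subgroup_generated G ?Z) G"
    using subgroup.subset[OF Z] by (auto simp: hom_def cZ)
  have ZG: "z \<in> carrier G" "g z = \<one>\<^bsub>B\<^esub>" if "z \<in> ?Z" for z
    using that by (auto simp: kernel_def)
  have ZI: "z \<in> ?Z" if "z \<in> carrier G" "g z = \<one>\<^bsub>B\<^esub>" for z
    using that by (simp add: kernel_def)
  have \<kappa>m: "\<kappa> (x \<otimes> y) = \<kappa> x \<otimes>\<^bsub>H\<^esub> \<kappa> y" if "x \<in> ?Z" "y \<in> ?Z" for x y
    using \<kappa>(1) that by (auto simp: hom_def cZ)
  have \<kappa>c: "\<kappa> x \<in> carrier H" if "x \<in> ?Z" for x using \<kappa>(2) that by blast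
  have \<kappa>1: "\<kappa> \<one> = \<one>\<^bsub>H\<^esub>"
    using \<kappa>(3)[of \<one>] subgroup.one_closed[OF Z] f.hom_one by (metis A.one_closed image_eqI)
  have \<kappa>i: "\<kappa> (inv x) = inv\<^bsub>H\<^esub> \<kappa> x" if "x \<in> ?Z" for x
  proof -
    have "\<kappa> (inv x) \<otimes>\<^bsub>H\<^esub> \<kappa> x = \<one>\<^bsub>H\<^esub>"
      using \<kappa>m[of "inv x" x] that subgroup.m_inv_closed[OF Z] ZG[OF that] \<kappa>1 by simp
    then show ?thesis
      using \<kappa>c that subgroup.m_inv_closed[OF Z] by (intro H.inv_equality[symmetric]) auto
  qed
  have \<kappa>p: "\<kappa> (x [^] n) = \<kappa> x [^]\<^bsub>H\<^esub> (n::nat)" if "x \<in> ?Z" for x n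
  proof (induction n)
    case (Suc n)
    have "x [^] n \<in> ?Z" using that
      by (metis Z subgroup_int_pow_closed int_pow_int)
    then show ?case using Suc \<kappa>m that by simp
  qed (simp add: \<kappa>1)
  have fZ: "f a \<in> ?Z" if "a \<in> carrier A" for a
    using that gf by (simp add: kernel_def)
  have \<beta>G: "set (map f \<beta>) \<subseteq> carrier G" using \<beta>(1) by auto
  have lamG: "set lam \<subseteq> carrier G" using lam(1) ZG by auto
  note \<beta>b = \<beta>(2)[unfolded int_basis_iff[OF f.img_is_subgroup]]
  note \<gamma>b = \<gamma>(2)[unfolded B.int_basis_iff[OF g.img_is_subgroup]]
  note fp = H.free_part_basisD[OF lam(2)]
  have gl: "gcomb G lam c \<in> ?Z" "\<kappa> (gcomb G lam c) = gcomb H (map \<kappa> lam) c" for c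
  proof -
    show "gcomb G lam c \<in> ?Z" by (rule gcomb_mem_subgroup[OF Z lam(1)])
    have "gcomb (subgroup_generated G ?Z) lam c = gcomb G lam c"
      using GZ.gcomb_hom[OF comm_group_axioms idh, of lam c] lam(1) cZ by simp
    then show "\<kappa> (gcomb G lam c) = gcomb H (map \<kappa> lam) c"
      using GZ.gcomb_hom[OF H \<kappa>(1), of lam c] lam(1) cZ by simp
  qed
  have gb: "gcomb G (map f \<beta>) c \<in> f ` carrier A" "gcomb G (map f \<beta>) c \<in> ?Z"
    "\<kappa> (gcomb G (map f \<beta>) c) = \<one>\<^bsub>H\<^esub>" for c
  proof -
    show 1: "gcomb G (map f \<beta>) c \<in> f ` carrier A"
      by (rule gcomb_mem_subgroup[OF f.img_is_subgroup]) (use \<beta>b in blast)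
    then show 2: "gcomb G (map f \<beta>) c \<in> ?Z" using fZ by auto
    show "\<kappa> (gcomb G (map f \<beta>) c) = \<one>\<^bsub>H\<^esub>" using \<kappa>(3)[OF 2] 1 by simp
  qed
  have gg: "g (gcomb G \<gamma> c) = gcomb B (map g \<gamma>) c" for c
    by (rule gcomb_hom[OF B g \<gamma>(1)])
  have ysG: "set ?ys \<subseteq> carrier G" using \<beta>G lamG \<gamma>(1) by auto
  have ysc: "gcomb G ?ys c = gcomb G (map f \<beta>) c \<otimes> (gcomb G lam (\<lambda>i. c (length \<beta> + i)) \<otimes>
      gcomb G \<gamma> (\<lambda>i. c (length \<beta> + (length lam + i))))" for c
    using gcomb_append[OF \<beta>G, of "lam @ \<gamma>" c] gcomb_append[OF lamG \<gamma>(1), of "\<lambda>i. c (length \<beta> + i)"]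
      lamG \<gamma>(1) by simp
  have ysI: "gcomb G (map f \<beta>) a \<otimes> (gcomb G lam b \<otimes> gcomb G \<gamma> c) =
     gcomb G ?ys (\<lambda>i. if i < length \<beta> then a i else if i < length \<beta> + length lam then b (i - length \<beta>)
        else c (i - (length \<beta> + length lam)))" for a b c
    unfolding ysc by (intro arg_cong2[of _ _ _ _ "(\<otimes>)"] gcomb_cong[OF \<beta>G] gcomb_cong[OF lamG] gcomb_cong[OF \<gamma>(1)]) auto
  \<comment> \<open>A combination that is a cycle has no \<open>\<gamma>\<close> part, because
    \<open>map g \<gamma>\<close> is independent; its class then depends on the coefficients of
    \<open>lam\<close> alone.\<close>
  have key: "(\<forall>i<length \<gamma>. c (length \<beta> + (length lam + i)) = 0) \<and>
      \<kappa> (gcomb G ?ys c) = gcomb H (map \<kappa> lam) (\<lambda>i. c (length \<beta> + i)) \<and>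
      gcomb G ?ys c = gcomb G (map f \<beta>) c \<otimes> gcomb G lam (\<lambda>i. c (length \<beta> + i))"
    if c: "gcomb G ?ys c \<in> ?Z" for c
  proof -
    let ?c3 = "\<lambda>i. c (length \<beta> + (length lam + i))"
    have "g (gcomb G ?ys c) = gcomb B (map g \<gamma>) ?c3"
      unfolding ysc using ZG[OF gb(2)] ZG[OF gl(1)] gcomb_closed[OF \<gamma>(1)]
      by (simp add: gg[symmetric])
    then have "gcomb B (map g \<gamma>) ?c3 = \<one>\<^bsub>B\<^esub>" using ZG(2)[OF c] by simp
    then have 0: "\<forall>i<length \<gamma>. ?c3 i = 0"
      using \<gamma>b by (auto dest: B.int_indepD)
    then have "gcomb G \<gamma> ?c3 = gcomb G \<gamma> (\<lambda>_. 0)"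
      by (intro gcomb_cong[OF \<gamma>(1)]) auto
    then have "gcomb G ?ys c = gcomb G (map f \<beta>) c \<otimes> gcomb G lam (\<lambda>i. c (length \<beta> + i))"
      unfolding ysc using lamG by simp
    moreover have "\<kappa> \<dots> = gcomb H (map \<kappa> lam) (\<lambda>i. c (length \<beta> + i))"
      using \<kappa>m[OF gb(2) gl(1)] gb(3) gl(2) \<kappa>c[OF gl(1)] fp(1) by simp
    ultimately show ?thesis using 0 by simp
  qed
  define K where "K = range (gcomb G ?ys)"
  have K: "subgroup K G"
  proof
    show "K \<subseteq> carrier G" using ysG by (auto simp: K_def simp del: set_append)
    show "\<one> \<in> K" unfolding K_def by (rule range_eqI[of _ _ "\<lambda>_. 0"]) simp
    show "x \<otimes> y \<in> K" if "x \<in> K" "y \<in> K" for x y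
      using that gcomb_add[OF ysG, symmetric] by (auto simp: K_def)
    show "inv x \<in> K" if "x \<in> K" for x
      using that gcomb_minus[OF ysG, symmetric] by (auto simp: K_def)
  qed
  have one_T: "\<one>\<^bsub>H\<^esub> \<in> ?T" by (rule subgroup.one_closed[OF H.torsion_subgroup_subgroup])
  have TH: "t \<in> carrier H" if "t \<in> ?T" for t
    using that subgroup.subset[OF H.torsion_subgroup_subgroup] by blast
  have "int_indep G ?ys"
    unfolding int_indep_def
  proof (intro allI impI)
    fix c i assume c: "gcomb G ?ys c = \<one>" and i: "i < length ?ys"
    then have cZ: "gcomb G ?ys c \<in> ?Z" using subgroup.one_closed[OF Z] by simp
    note k = key[OF cZ]
    have "gcomb H (map \<kappa> lam) (\<lambda>i. c (length \<beta> + i)) = \<one>\<^bsub>H\<^esub>" using k c \<kappa>1 by simp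
    then have l: "\<forall>i<length lam. c (length \<beta> + i) = 0" using fp(3)[OF one_T] by simp
    then have "gcomb G lam (\<lambda>i. c (length \<beta> + i)) = gcomb G lam (\<lambda>_. 0)"
      by (intro gcomb_cong[OF lamG]) auto
    then have "gcomb G (map f \<beta>) c = \<one>" using k c gcomb_closed[OF \<beta>G] by simp
    then have b: "\<forall>i<length \<beta>. c i = 0" using \<beta>b by (auto dest: int_indepD)
    show "c i = 0"
    proof (cases "i < length \<beta>")
      case False
      then obtain j where j: "i = length \<beta> + j" using le_Suc_ex not_less by blast
      show ?thesis
      proof (cases "j < length lam")
        case False
        then obtain m where "j = length lam + m" using le_Suc_ex not_less by blast
        then show ?thesis using k i j by simp
      qed (use l j in simp)
    qed (use b in simp)
  qed
  moreover have "set ?ys \<subseteq> K"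
    unfolding K_def
  proof
    fix x assume "x \<in> set ?ys"
    then obtain j where "j < length ?ys" "x = ?ys ! j" by (metis in_set_conv_nth)
    then show "x \<in> range (gcomb G ?ys)" using gcomb_delta[OF ysG, of j] by (metis rangeI)
  qed
  ultimately have ysK: "int_basis G K ?ys"
    unfolding int_basis_iff[OF K] by (auto simp: K_def)
  \<comment> \<open>Cycles chosen in the torsion classes; they turn out to represent the cosets of
    \<open>K\<close>.\<close>
  have "\<forall>t. \<exists>z. t \<in> ?T \<longrightarrow> z \<in> ?Z \<and> \<kappa> z = t"
    using \<kappa>(2) TH by (metis imageE)
  then obtain rep where "\<forall>t. t \<in> ?T \<longrightarrow> rep t \<in> ?Z \<and> \<kappa> (rep t) = t"
    by (rule choice[THEN exE])
  then have rep: "rep t \<in> ?Z" "\<kappa> (rep t) = t" if "t \<in> ?T" for t using that by auto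
  \<comment> \<open>Removing the \<open>\<gamma>\<close> part of \<open>x\<close> leaves a cycle.
    Its class is a combination of the free part times a torsion element, and after both are removed
    the rest is a boundary.\<close>
  have ex: "\<exists>t\<in>?T. x \<otimes> inv (rep t) \<in> K" if x: "x \<in> carrier G" for x
  proof -
    have "g x \<in> g ` carrier G" using x by blast
    then obtain c3 where c3: "g x = gcomb B (map g \<gamma>) c3" using \<gamma>b by blast
    define z where "z = x \<otimes> inv (gcomb G \<gamma> c3)"
    have z: "z \<in> ?Z"
      unfolding z_def using x gcomb_closed[OF \<gamma>(1), of c3] by (intro ZI) (simp_all add: gg[symmetric] c3)
    obtain c2 t where t: "t \<in> ?T" "\<kappa> z = gcomb H (map \<kappa> lam) c2 \<otimes>\<^bsub>H\<^esub> t"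
      using fp(2)[OF \<kappa>c[OF z]] by blast
    define u where "u = z \<otimes> inv (gcomb G lam c2) \<otimes> inv (rep t)"
    have uZ: "u \<in> ?Z" unfolding u_def using z gl(1) rep(1)[OF t(1)]
      by (intro subgroup.m_closed[OF Z] subgroup.m_inv_closed[OF Z]) auto
    have hc: "gcomb H (map \<kappa> lam) c2 \<in> carrier H" using fp(1) by simp
    have "\<kappa> u = gcomb H (map \<kappa> lam) c2 \<otimes>\<^bsub>H\<^esub> t \<otimes>\<^bsub>H\<^esub> inv\<^bsub>H\<^esub> gcomb H (map \<kappa> lam) c2 \<otimes>\<^bsub>H\<^esub> inv\<^bsub>H\<^esub> t"
      unfolding u_def using z gl rep[OF t(1)] t(2)
      by (simp add: \<kappa>m \<kappa>i subgroup.m_closed[OF Z] subgroup.m_inv_closed[OF Z])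
    also have "\<dots> = \<one>\<^bsub>H\<^esub>"
      using hc TH[OF t(1)] by (simp add: H.m_comm[of "gcomb H (map \<kappa> lam) c2" t] H.m_assoc)
    finally have "u \<in> f ` carrier A" using \<kappa>(3)[OF uZ] by simp
    then obtain c1 where c1: "u = gcomb G (map f \<beta>) c1" using \<beta>b by blast
    have rG: "rep t \<in> carrier G" using ZG rep(1)[OF t(1)] by blast
    have cG: "gcomb G \<gamma> c3 \<in> carrier G" "gcomb G lam c2 \<in> carrier G"
      using \<gamma>(1) lamG by auto
    have "u \<otimes> (gcomb G lam c2 \<otimes> gcomb G \<gamma> c3) = x \<otimes> inv (rep t)"
    proof -
      have "u \<otimes> (gcomb G lam c2 \<otimes> gcomb G \<gamma> c3) = x \<otimes> (inv (gcomb G \<gamma> c3) \<otimes> gcomb G \<gamma> c3) \<otimes>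
          (inv (gcomb G lam c2) \<otimes> gcomb G lam c2) \<otimes> inv (rep t)"
        unfolding u_def z_def using x rG cG by (simp only: m_ac inv_closed m_closed)
      then show ?thesis using x rG cG by simp
    qed
    then have "x \<otimes> inv (rep t) = gcomb G (map f \<beta>) c1 \<otimes> (gcomb G lam c2 \<otimes> gcomb G \<gamma> c3)"
      by (simp add: c1)
    then have "x \<otimes> inv (rep t) \<in> K"
      unfolding ysI K_def by simp
    then show ?thesis using t(1) by blast
  qed
  have repG: "rep ` ?T \<subseteq> carrier G" using rep(1) ZG by auto
  \<comment> \<open>If \<open>rep s\<close> and \<open>rep t\<close> are congruent modulo
    \<open>K\<close>, then \<open>s\<close> and \<open>t\<close> differ by an element that is both
    torsion and a combination of the free part, hence trivial.\<close>
  have uniq: "\<forall>x\<in>carrier G. \<exists>!t. t \<in> ?T \<and> x \<otimes> inv (rep t) \<in> K"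
  proof
    fix x assume x: "x \<in> carrier G"
    show "\<exists>!t. t \<in> ?T \<and> x \<otimes> inv (rep t) \<in> K"
    proof (rule ex_ex1I)
      show "\<exists>t. t \<in> ?T \<and> x \<otimes> inv (rep t) \<in> K" using ex[OF x] by blast
      fix s t assume s: "s \<in> ?T \<and> x \<otimes> inv (rep s) \<in> K" and t: "t \<in> ?T \<and> x \<otimes> inv (rep t) \<in> K"
      have sZ: "rep s \<in> ?Z" and tZ: "rep t \<in> ?Z" using rep s t by auto
      note sG = ZG(1)[OF sZ] and tG = ZG(1)[OF tZ]
      have "inv (x \<otimes> inv (rep s)) \<otimes> (x \<otimes> inv (rep t)) \<in> K"
        using s t subgroup.m_closed[OF K] subgroup.m_inv_closed[OF K] by blast
      also have "inv (x \<otimes> inv (rep s)) \<otimes> (x \<otimes> inv (rep t)) = (inv x \<otimes> x) \<otimes> (rep s \<otimes> inv (rep t))"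
        using x sG tG by (simp only: inv_mult inv_inv m_ac inv_closed m_closed)
      also have "\<dots> = rep s \<otimes> inv (rep t)" using x sG tG by simp
      finally obtain c where c: "rep s \<otimes> inv (rep t) = gcomb G ?ys c" unfolding K_def by blast
      have cZ': "gcomb G ?ys c \<in> ?Z"
        unfolding c[symmetric] using sZ tZ by (intro subgroup.m_closed[OF Z] subgroup.m_inv_closed[OF Z])
      have "gcomb H (map \<kappa> lam) (\<lambda>i. c (length \<beta> + i)) = s \<otimes>\<^bsub>H\<^esub> inv\<^bsub>H\<^esub> t"
        using key[OF cZ'] c[symmetric] sZ tZ rep s t by (simp add: \<kappa>m \<kappa>i subgroup.m_inv_closed[OF Z])
      moreover have "s \<otimes>\<^bsub>H\<^esub> inv\<^bsub>H\<^esub> t \<in> ?T"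
        using s t subgroup.m_closed[OF H.torsion_subgroup_subgroup] subgroup.m_inv_closed[OF H.torsion_subgroup_subgroup] by blast
      ultimately have "s \<otimes>\<^bsub>H\<^esub> inv\<^bsub>H\<^esub> t = \<one>\<^bsub>H\<^esub>" using fp(3) by blast
      then show "s = t" using TH s t by (metis H.inv_closed H.inv_equality H.inv_inv)
    qed
  qed
  \<comment> \<open>If \<open>t\<close> has order dividing \<open>m\<close>, the power
    \<open>rep t [^] m\<close> is a boundary and lies in \<open>K\<close>; so the \<open>m\<close>th
    power of \<open>x\<close> lies in \<open>K\<close>.\<close>
  have full: "\<exists>k>0. x [^] (k::int) \<in> K" if x: "x \<in> carrier G" for x
  proof -
    obtain t where t: "t \<in> ?T" "x \<otimes> inv (rep t) \<in> K" using ex[OF x] by blast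
    obtain m :: nat where m: "m > 0" "t [^]\<^bsub>H\<^esub> m = \<one>\<^bsub>H\<^esub>" using t(1) by (auto simp: torsion_subgroup_def)
    have rZ: "rep t \<in> ?Z" using rep t by blast
    note rG = ZG(1)[OF rZ]
    have rmZ: "rep t [^] m \<in> ?Z" by (metis Z rZ subgroup_int_pow_closed int_pow_int)
    have "\<kappa> (rep t [^] m) = \<one>\<^bsub>H\<^esub>" using \<kappa>p[OF rZ] rep t m by simp
    then have "rep t [^] m \<in> f ` carrier A" using \<kappa>(3)[OF rmZ] by simp
    then obtain a where "rep t [^] m = gcomb G (map f \<beta>) a" using \<beta>b by blast
    also have "\<dots> = gcomb G (map f \<beta>) a \<otimes> (gcomb G lam (\<lambda>_. 0) \<otimes> gcomb G \<gamma> (\<lambda>_. 0))"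
      using gcomb_closed[OF \<beta>G] by simp
    finally have 1: "rep t [^] m \<in> K" unfolding ysI K_def by simp
    have 2: "(x \<otimes> inv (rep t)) [^] m \<in> K" by (metis K t(2) subgroup_int_pow_closed int_pow_int)
    have "(x \<otimes> inv (rep t)) [^] m \<otimes> rep t [^] m = ((x \<otimes> inv (rep t)) \<otimes> rep t) [^] m"
      using x rG by (intro pow_mult_distrib[symmetric] m_comm) auto
    also have "(x \<otimes> inv (rep t)) \<otimes> rep t = x" using x rG by (simp add: m_assoc)
    finally have "x [^] m \<in> K" using subgroup.m_closed[OF K 2 1] by simp
    then show ?thesis using m(1) by (intro exI[of _ "int m"]) (simp add: int_pow_int)
  qed
  note r = subgroup_index_det[OF ss K ysK repG uniq full w]
  show "length ?ys = length ss" "\<bar>det (kron d (mat (length ss) (length ss) (\<lambda>(i, j). w j i)))\<bar> = int (card ?T) ^ d"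
    using r(1,3) by auto
  show "card ?T > 0" using r(2) one_T by (auto simp: card_gt_0_iff)
qed

section \<open>Tensor products\<close>

text \<open>The inverse \<open>N\<close> of the coordinate matrix yields both the independence of
  \<open>zs\<close> and an expression of \<open>xs\<close> through \<open>zs\<close>.\<close>

lemma real_basis_by_det:
  assumes xs: "real_basis W xs" and zs: "length zs = length xs" "set zs \<subseteq> W"
    and det: "det (base_change {0} zs xs) \<noteq> 0"
  shows "real_basis W zs"
proof -
  define M where "M = base_change {0} zs xs"
  let ?n = "length xs"
  have M: "M \<in> carrier_mat ?n ?n"
    using base_change_carrier[of "{0}" zs xs] zs by (simp add: M_def)
  have "M \<in> Units (ring_mat TYPE(real) ?n ())"
    using det_non_zero_imp_unit[OF M] det by (simp add: M_def)
  then obtain N where N: "N \<in> carrier_mat ?n ?n" "N * M = 1\<^sub>m ?n" "M * N = 1\<^sub>m ?n"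
    unfolding Units_def ring_mat_def by auto
  have e: "(\<Sum>k<?n. A $$ (i, k) * B $$ (k, j)) = (A * B) $$ (i, j)"
    if "A \<in> carrier_mat ?n ?n" "B \<in> carrier_mat ?n ?n" "i < ?n" "j < ?n" for A B :: "real mat" and i j
    using that by (simp add: scalar_prod_def lessThan_atLeast0)
  have z: "zs ! j = list_comb xs (\<lambda>i. M $$ (i, j))" if "j < ?n" for j
    unfolding M_def using that zs by (intro base_change_nth[OF xs]) auto
  have lz: "list_comb zs f = list_comb xs (\<lambda>i. \<Sum>j<?n. M $$ (i, j) * f j)" for f
    using list_comb_list_comb[of zs xs "\<lambda>i j. M $$ (i, j)" f] z zs by simp
  have "indep_list zs"
    unfolding indep_list_def
  proof (intro allI impI)
    fix f i assume f: "list_comb zs f = 0" and i: "i < length zs"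
    have 0: "(\<Sum>j<?n. M $$ (k, j) * f j) = 0" if "k < ?n" for k
      using f xs that unfolding lz real_basis_iff indep_list_def by blast
    have "f i = (\<Sum>j<?n. (N * M) $$ (i, j) * f j)"
      using i zs by (simp add: N(2) if_distrib[of "\<lambda>x. x * _"] cong: if_cong)
    also have "\<dots> = (\<Sum>j<?n. (\<Sum>k<?n. N $$ (i, k) * M $$ (k, j)) * f j)"
      using i zs by (intro sum.cong refl arg_cong2[of _ _ _ _ "(*)"] e[symmetric] N M) auto
    also have "\<dots> = (\<Sum>k<?n. N $$ (i, k) * (\<Sum>j<?n. M $$ (k, j) * f j))"
      by (simp add: sum_distrib_left sum_distrib_right mult.assoc) (rule sum.swap)
    also have "\<dots> = 0" by (intro sum.neutral) (simp add: 0)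
    finally show "f i = 0" .
  qed
  moreover have "set xs \<subseteq> span (set zs)"
  proof
    fix x assume "x \<in> set xs"
    then obtain i where i: "i < ?n" "x = xs ! i" by (metis in_set_conv_nth)
    have "list_comb zs (\<lambda>j. N $$ (j, i)) = list_comb xs (\<lambda>k. (M * N) $$ (k, i))"
      unfolding lz using i by (intro list_comb_cong e M N)
    also have "\<dots> = list_comb xs (\<lambda>k. if k = i then 1 else 0)"
      using i by (intro list_comb_cong) (simp add: N(3))
    finally have "x = list_comb zs (\<lambda>j. N $$ (j, i))"
      using i by (simp add: list_comb_delta)
    then show "x \<in> span (set zs)"
      unfolding span_set_list by simp
  qed
  ultimately show ?thesis
    using xs zs(2) unfolding real_basis_iff span_set_list[symmetric]
    by (metis span_eq span_minimal subspace_span)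
qed

section \<open>Tensor products with a free group\<close>

lemma sum_fun_eval: "(sum f A) x = (\<Sum>a\<in>A. f a x)"
  by (induction A rule: infinite_finite_induct) auto

lemma tensor_basis_Nil [simp]: "tensor_basis G vs [] = []"
  and tensor_basis_Cons: "tensor_basis G vs (s # ss) = map (\<lambda>v. pure_tensor G v s) vs @ tensor_basis G vs ss"
  by (simp_all add: tensor_basis_def)

lemma tensor_basis_append: "tensor_basis G vs (xs @ ys) = tensor_basis G vs xs @ tensor_basis G vs ys"
  by (simp add: tensor_basis_def)

lemma length_tensor_basis [simp]: "length (tensor_basis G vs ss) = length ss * length vs"
  by (induction ss) (simp_all add: tensor_basis_Cons)

text \<open>Group elements vary slowly and vectors quickly, in agreement with the index convention
  of \<open>kron\<close>.\<close>

lemma tensor_basis_nth: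
  "a < length ss \<Longrightarrow> i < length vs \<Longrightarrow> tensor_basis G vs ss ! (a * length vs + i) = pure_tensor G (vs ! i) (ss ! a)"
proof (induction ss arbitrary: a)
  case (Cons s ss)
  then show ?case
    by (cases a) (auto simp: tensor_basis_Cons nth_append)
qed simp

lemma set_tensor_basis: "set (tensor_basis G vs ss) = (\<Union>s\<in>set ss. (\<lambda>v. pure_tensor G v s) ` set vs)"
  by (induction ss) (auto simp: tensor_basis_Cons)

lemma list_comb_tensor_basis:
  "list_comb (tensor_basis G vs ss) f =
     (\<Sum>a<length ss. \<Sum>i<length vs. f (a * length vs + i) *\<^sub>R pure_tensor G (vs ! i) (ss ! a))"
  unfolding list_comb_def length_tensor_basis sum_lessThan_mult
  by (intro sum.cong refl) (simp add: tensor_basis_nth)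

lemma pure_tensor_mem: "g \<in> carrier G \<Longrightarrow> pure_tensor G v g \<in> tensor_space G"
  unfolding tensor_space_def by (intro span_base) blast

lemma tensor_basis_mem: "set ss \<subseteq> carrier G \<Longrightarrow> set (tensor_basis G vs ss) \<subseteq> tensor_space G"
  by (auto simp: set_tensor_basis intro!: pure_tensor_mem)

lemma subspace_tensor_space: "subspace (tensor_space G)"
  by (simp add: tensor_space_def)

lemma pure_tensor_scaleR: "g \<in> carrier G \<Longrightarrow> pure_tensor G (r *\<^sub>R v) g = r *\<^sub>R pure_tensor G v g"
  using linear_scale[of "\<lambda>v. _ v g" r v]
  by (intro ext) (auto simp: pure_tensor_def bilinear_forms_def scaleR_fun_def)

lemma pure_tensor_add: "g \<in> carrier G \<Longrightarrow> pure_tensor G (u + v) g = pure_tensor G u g + pure_tensor G v g"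
  using linear_add[of "\<lambda>v. _ v g" u v]
  by (intro ext) (auto simp: pure_tensor_def bilinear_forms_def)

lemma pure_tensor_list_comb:
  assumes "g \<in> carrier G"
  shows "pure_tensor G (list_comb vs r) g = (\<Sum>i<length vs. r i *\<^sub>R pure_tensor G (vs ! i) g)"
proof -
  have "pure_tensor G 0 g = 0"
    using pure_tensor_scaleR[OF assms, of 0 0] by simp
  then have "pure_tensor G (\<Sum>i<n. r i *\<^sub>R vs ! i) g = (\<Sum>i<n. r i *\<^sub>R pure_tensor G (vs ! i) g)" for n
    by (induction n) (simp_all add: pure_tensor_add[OF assms] pure_tensor_scaleR[OF assms])
  then show ?thesis by (simp add: list_comb_def)
qed

context comm_group
begin

lemma pure_tensor_mult: "g \<in> carrier G \<Longrightarrow> h \<in> carrier G \<Longrightarrow>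
    pure_tensor G v (g \<otimes> h) = pure_tensor G v g + pure_tensor G v h"
  by (rule ext) (auto simp: pure_tensor_def bilinear_forms_def)

lemma pure_tensor_one: "pure_tensor G v \<one> = 0"
  using pure_tensor_mult[of \<one> \<one> v] by simp

lemma pure_tensor_inv: "g \<in> carrier G \<Longrightarrow> pure_tensor G v (inv g) = - pure_tensor G v g"
  using pure_tensor_mult[of g "inv g" v] by (simp add: pure_tensor_one eq_neg_iff_add_eq_0 add.commute)

lemma pure_tensor_int_pow:
  assumes "g \<in> carrier G"
  shows "pure_tensor G v (g [^] (k::int)) = of_int k *\<^sub>R pure_tensor G v g"
proof (induction k rule: int_induct[of _ 0])
  case base
  then show ?case by (simp add: pure_tensor_one)
next
  case (step1 k)
  then show ?case using assms by (simp add: int_pow_mult pure_tensor_mult scaleR_add_left)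
next
  case (step2 k)
  then show ?case using assms by (simp add: int_pow_diff pure_tensor_mult pure_tensor_inv scaleR_diff_left)
qed

lemma pure_tensor_gcomb:
  assumes xs: "set xs \<subseteq> carrier G"
  shows "pure_tensor G v (gcomb G xs c) = (\<Sum>a<length xs. of_int (c a) *\<^sub>R pure_tensor G v (xs ! a))"
proof -
  have "pure_tensor G v (finprod G (\<lambda>i. (xs ! i) [^] c i) {..<n}) = (\<Sum>a<n. of_int (c a) *\<^sub>R pure_tensor G v (xs ! a))"
    if "n \<le> length xs" for n
    using that
  proof (induction n)
    case (Suc n)
    have *: "xs ! i \<in> carrier G" if "i \<le> n" for i
      using that Suc.prems subsetD[OF xs nth_mem] by simp
    show ?case
      using Suc * by (simp add: lessThan_Suc Pi_I finprod_closed pure_tensor_mult pure_tensor_int_pow)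
  qed (simp add: pure_tensor_one)
  then show ?thesis by (simp add: gcomb_def)
qed

text \<open>Independence is tested against the forms \<open>\<beta> a i\<close>, each the product of
  an integral coordinate on \<open>G\<close> and a real coordinate on the vector space; they are
  dual to the tensors of basis elements. Their existence is where freeness of \<open>G\<close>
  enters.\<close>

lemma tensor_real_basis:
  fixes vs :: "'v::real_vector list"
  assumes vs: "real_basis UNIV vs" and ss: "int_basis G (carrier G) ss"
  shows "real_basis (tensor_space G) (tensor_basis G vs ss)"
proof -
  note b = ss[unfolded int_basis_carrier_iff]
  have ssG: "set ss \<subseteq> carrier G" using b by blast
  let ?d = "length vs" and ?tb = "tensor_basis G vs ss"
  \<comment> \<open>Only the values below \<open>length ss\<close> are determined by
    \<open>x\<close>; beyond that the chosen function is arbitrary and is never read.\<close>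
  define crd where "crd = (\<lambda>x. SOME c. x = gcomb G ss c)"
  have crd: "x = gcomb G ss (crd x)" if "x \<in> carrier G" for x
  proof -
    obtain c where "x = gcomb G ss c" using b \<open>x \<in> carrier G\<close> by blast
    then show ?thesis unfolding crd_def by (rule someI[of "\<lambda>c. x = gcomb G ss c"])
  qed
  have crd_add: "crd (x \<otimes> y) a = crd x a + crd y a" if "x \<in> carrier G" "y \<in> carrier G" "a < length ss" for x y a
  proof -
    have "gcomb G ss (crd (x \<otimes> y)) = gcomb G ss (\<lambda>a. crd x a + crd y a)"
      using that by (simp add: gcomb_add[OF ssG] crd[symmetric])
    then show ?thesis using int_indep_unique[OF _ ssG _ that(3)] b by blast
  qed
  have crd_ss: "crd (ss ! j) a = (if a = j then 1 else 0)" if "j < length ss" "a < length ss" for j a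
  proof -
    have "gcomb G ss (crd (ss ! j)) = gcomb G ss (\<lambda>a. if a = j then 1 else 0)"
      using that ssG by (simp add: gcomb_delta crd[symmetric] subsetD)
    then show ?thesis using int_indep_unique[OF _ ssG _ that(2)] b by blast
  qed
  have dv: "distinct vs" "independent (set vs)" "span (set vs) = UNIV"
    using vs by (auto simp: real_basis_def)
  define \<beta> where "\<beta> = (\<lambda>a i v g. representation (set vs) v (vs ! i) * of_int (crd g a))"
  have \<beta>: "\<beta> a i \<in> bilinear_forms G" if "a < length ss" for a i
    unfolding bilinear_forms_def \<beta>_def
    using dv crd_add that
    by (auto intro!: linearI simp: representation_add representation_scale distrib_right distrib_left)
  have ev: "pure_tensor G (vs ! j) (ss ! b) (\<beta> a i) = (if a = b \<and> i = j then 1 else 0)"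
    if "a < length ss" "b < length ss" "i < ?d" "j < ?d" for a b i j
    using that \<beta>[of a i] dv
    by (auto simp: pure_tensor_def \<beta>_def crd_ss representation_basis nth_eq_iff_index_eq)
  have "indep_list ?tb"
    unfolding indep_list_def
  proof (intro allI impI)
    fix f k assume f: "list_comb ?tb f = 0" and k: "k < length ?tb"
    define a i where "a = k div ?d" "i = k mod ?d"
    have d: "?d > 0" using k by (cases "?d") auto
    have ai: "a < length ss" "i < ?d" "k = a * ?d + i"
      using k d by (auto simp: a_i_def less_mult_imp_div_less)
    have "0 = list_comb ?tb f (\<beta> a i)" using f by simp
    also have "\<dots> = (\<Sum>b<length ss. \<Sum>j<?d. f (b * ?d + j) * pure_tensor G (vs ! j) (ss ! b) (\<beta> a i))"
      unfolding list_comb_tensor_basis by (simp add: sum_fun_eval scaleR_fun_def)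
    also have "\<dots> = (\<Sum>b<length ss. \<Sum>j<?d. if b = a then (if j = i then f (b * ?d + j) else 0) else 0)"
      using ai by (intro sum.cong refl) (simp add: ev)
    also have "\<dots> = (\<Sum>b<length ss. if b = a then (\<Sum>j<?d. if j = i then f (b * ?d + j) else 0) else 0)"
      by (intro sum.cong refl) auto
    also have "\<dots> = f k" using ai by simp
    finally show "f k = 0" by simp
  qed
  moreover have "range (list_comb ?tb) = tensor_space G"
  proof
    show "range (list_comb ?tb) \<subseteq> tensor_space G"
      using list_comb_mem[OF subspace_tensor_space tensor_basis_mem[OF ssG]] by blast
    have "{pure_tensor G v g |v g. g \<in> carrier G} \<subseteq> span (set ?tb)"
    proof safe
      fix v :: 'v and g assume g: "g \<in> carrier G"
      obtain r where r: "v = list_comb vs r"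
        using vs unfolding real_basis_iff by blast
      have "pure_tensor G v g = (\<Sum>i<?d. r i *\<^sub>R (\<Sum>a<length ss. of_int (crd g a) *\<^sub>R pure_tensor G (vs ! i) (ss ! a)))"
        unfolding r pure_tensor_list_comb[OF g] by (subst crd[OF g]) (simp add: pure_tensor_gcomb[OF ssG])
      also have "\<dots> \<in> span (set ?tb)"
        by (intro span_sum span_scale span_base) (force simp: set_tensor_basis)
      finally show "pure_tensor G v g \<in> span (set ?tb)" .
    qed
    then show "tensor_space G \<subseteq> range (list_comb ?tb)"
      unfolding tensor_space_def span_set_list[symmetric] by (intro span_minimal) auto
  qed
  ultimately show ?thesis by (simp add: real_basis_iff)
qed

text \<open>The integer coordinates \<open>w\<close> are the same for every vector of
  \<open>vs\<close>, so real determinants become determinants of \<open>kron\<close> of an integer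
  matrix.\<close>

lemma base_change_tensor_basis:
  assumes vs: "real_basis UNIV vs" and ss: "int_basis G (carrier G) ss"
    and w: "\<And>j. j < length ys \<Longrightarrow> ys ! j = gcomb G ss (w j)"
  shows "base_change {0} (tensor_basis G vs ys) (tensor_basis G vs ss) =
     map_mat of_int (kron (length vs) (mat (length ss) (length ys) (\<lambda>(i, j). w j i)))"
proof (rule base_change_eqI)
  note b = ss[unfolded int_basis_carrier_iff]
  have ssG: "set ss \<subseteq> carrier G" using b by blast
  let ?d = "length vs"
  show "indep_list (tensor_basis G vs ss)"
    using tensor_real_basis[OF vs ss] real_basis_iff by blast
  show "map_mat real_of_int (kron ?d (mat (length ss) (length ys) (\<lambda>(i, j). w j i)))
     \<in> carrier_mat (length (tensor_basis G vs ss)) (length (tensor_basis G vs ys))"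
    by (simp add: kron_def)
  fix k assume k: "k < length (tensor_basis G vs ys)"
  define j i where "j = k div ?d" "i = k mod ?d"
  have d: "?d > 0" using k by (cases "?d") auto
  have ji: "j < length ys" "i < ?d" "k = j * ?d + i"
    using k d by (auto simp: j_i_def less_mult_imp_div_less)
  have "tensor_basis G vs ys ! k = (\<Sum>a<length ss. of_int (w j a) *\<^sub>R pure_tensor G (vs ! i) (ss ! a))"
    using ji by (simp add: tensor_basis_nth w pure_tensor_gcomb[OF ssG])
  also have "\<dots> = (\<Sum>a<length ss. \<Sum>b<?d. (if b = i then of_int (w j a) else 0) *\<^sub>R pure_tensor G (vs ! b) (ss ! a))"
    using ji by (intro sum.cong refl) (simp add: if_distrib[of "\<lambda>x. x *\<^sub>R _"] cong: if_cong)
  also have "\<dots> = list_comb (tensor_basis G vs ss) (\<lambda>l. map_mat real_of_int (kron ?d (mat (length ss) (length ys) (\<lambda>(i, j). w j i))) $$ (l, k))"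
    unfolding list_comb_tensor_basis
  proof (intro sum.cong refl arg_cong2[of _ _ _ _ scaleR])
    fix a b assume ab: "a \<in> {..<length ss}" "b \<in> {..<?d}"
    then have "a * ?d + b < length ss * ?d"
      using mult_le_mono1[of "Suc a" "length ss" ?d] by auto
    moreover have "(a * ?d + b) div ?d = a"
      using ab d by (subst div_mult_self3) auto
    ultimately show "(if b = i then of_int (w j a) else 0) = map_mat real_of_int (kron ?d (mat (length ss) (length ys) (\<lambda>(i, j). w j i))) $$ (a * ?d + b, k)"
      using k ab ji(1,2) by (auto simp: kron_def simp flip: j_i_def)
  qed
  finally show "tensor_basis G vs ys ! k = \<dots>" .
qed

end

section \<open>Induced maps of tensor products\<close>

lemma tensor_map_add: "tensor_map H \<phi> (S + T) = tensor_map H \<phi> S + tensor_map H \<phi> T"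
  and tensor_map_scaleR: "tensor_map H \<phi> (r *\<^sub>R T) = r *\<^sub>R tensor_map H \<phi> T"
  and tensor_map_zero: "tensor_map H \<phi> 0 = 0"
  by (auto simp: tensor_map_def scaleR_fun_def fun_eq_iff)

lemma tensor_map_list_comb: "tensor_map H \<phi> (list_comb xs f) = list_comb (map (tensor_map H \<phi>) xs) f"
proof -
  have "tensor_map H \<phi> (\<Sum>i<n. f i *\<^sub>R xs ! i) = (\<Sum>i<n. f i *\<^sub>R tensor_map H \<phi> (xs ! i))" for n
    by (induction n)
      (simp_all only: sum.lessThan_Suc lessThan_0 sum.empty tensor_map_add tensor_map_scaleR tensor_map_zero)
  then show ?thesis by (simp add: list_comb_def)
qed

text \<open>A form on \<open>H\<close> pulls back along \<open>\<phi>\<close> to a form on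
  \<open>G\<close>, which is what makes evaluation in the double dual functorial.\<close>

lemma tensor_map_pure:
  assumes "\<phi> \<in> hom G H" "g \<in> carrier G"
  shows "tensor_map H \<phi> (pure_tensor G v g) = pure_tensor H v (\<phi> g)"
proof -
  have "(\<lambda>v g. \<beta> v (\<phi> g)) \<in> bilinear_forms G" if "\<beta> \<in> bilinear_forms H" for \<beta>
    using that assms(1) by (auto simp: bilinear_forms_def hom_def Pi_iff)
  then show ?thesis
    by (auto simp: tensor_map_def pure_tensor_def fun_eq_iff)
qed

lemma tensor_map_tensor_basis:
  assumes "\<phi> \<in> hom G H" "set xs \<subseteq> carrier G"
  shows "map (tensor_map H \<phi>) (tensor_basis G vs xs) = tensor_basis H vs (map \<phi> xs)"
  using assms by (induction xs) (simp_all add: tensor_basis_Cons tensor_map_pure)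

lemma tensor_map_image:
  assumes "\<phi> \<in> hom G H"
  shows "tensor_map H \<phi> ` tensor_space G \<subseteq> tensor_space H"
proof -
  have "tensor_map H \<phi> T \<in> tensor_space H" if "T \<in> tensor_space G" for T :: "('v::real_vector, 'a) tensor"
    using that unfolding tensor_space_def[of G]
  proof (induction rule: span_induct_alt)
    case base
    show ?case unfolding tensor_map_zero by (rule subspace_0[OF subspace_tensor_space])
  next
    case (step c x y)
    then obtain v g where "x = pure_tensor G v g" "g \<in> carrier G" by blast
    then have "tensor_map H \<phi> x \<in> tensor_space H"
      using assms by (auto simp: tensor_map_pure intro!: pure_tensor_mem dest: hom_in_carrier)
    then show ?case
      unfolding tensor_map_add tensor_map_scaleR
      using step by (intro subspace_add[OF subspace_tensor_space] subspace_scale[OF subspace_tensor_space])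
  qed
  then show ?thesis by blast
qed

section \<open>Complexes of free abelian groups\<close>

lemma dim_real_basis: "real_basis (UNIV :: 'v::real_vector set) vs \<Longrightarrow> dim (UNIV :: 'v set) = length vs"
  unfolding real_basis_def by (metis dim_eq_card_independent dim_span distinct_card)

text \<open>Degrees are integers so that the boundary out of degree 0 is an ordinary homomorphism,
  into the trivial group \<open>G (-1)\<close>. Finiteness and freeness concern the nonnegative
  degrees, which are the ones that get tensored.\<close>

locale integral_complex =
  fixes G :: "int \<Rightarrow> ('g, 'm) monoid_scheme" and bd :: "int \<Rightarrow> 'g \<Rightarrow> 'g"
    and vs :: "'v::real_vector list"
  assumes vs: "real_basis UNIV vs"
    and cg: "\<And>q. comm_group (G q)"
    and bd: "\<And>q. bd q \<in> hom (G q) (G (q - 1))"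
    and bdbd: "\<And>q x. x \<in> carrier (G (q + 1)) \<Longrightarrow> bd q (bd (q + 1) x) = \<one>\<^bsub>G (q - 1)\<^esub>"
    and neg: "carrier (G (-1)) = {\<one>\<^bsub>G (-1)\<^esub>}"
    and fin: "finite {q::nat. carrier (G (int q)) \<noteq> {\<one>\<^bsub>G (int q)\<^esub>}}"
    and free: "\<And>q::nat. \<exists>ss. int_basis (G (int q)) (carrier (G (int q))) ss"
begin

definition D :: "nat \<Rightarrow> ('v, 'g) tensor set" where "D q = tensor_space (G (int q))"
definition d :: "nat \<Rightarrow> ('v, 'g) tensor \<Rightarrow> ('v, 'g) tensor" where
  "d q = tensor_map (G (int q - 1)) (bd (int q))"

lemma tensor_space_trivial:
  assumes "comm_group K" "carrier K = {\<one>\<^bsub>K\<^esub>}"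
  shows "(tensor_space K :: ('u::real_vector, 'k) tensor set) = {0}"
proof -
  interpret K: comm_group K by fact
  have "{pure_tensor K v g |v g. g \<in> carrier K} \<subseteq> {0 :: ('u, 'k) tensor}"
    using assms(2) K.pure_tensor_one by auto
  then have "tensor_space K \<subseteq> {0 :: ('u, 'k) tensor}"
    unfolding tensor_space_def by (intro span_minimal) (auto simp: subspace_def)
  then show ?thesis
    using subspace_0[OF subspace_tensor_space] by blast
qed

lemma bd_Suc: "bd (1 + int q) \<in> hom (G (1 + int q)) (G (int q))"
  using bd[of "1 + int q"] by simp

lemma map_d_tensor_basis:
  "set xs \<subseteq> carrier (G (int q)) \<Longrightarrow>
    map (d q) (tensor_basis (G (int q)) vs xs) = tensor_basis (G (int q - 1)) vs (map (bd (int q)) xs)"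
  unfolding d_def by (rule tensor_map_tensor_basis[OF bd])

lemma real_complex_D: "real_complex D d"
  unfolding real_complex_def
proof (intro conjI allI ballI)
  show "finite {q. D q \<noteq> {0}}"
    by (rule finite_subset[OF _ fin]) (auto simp: D_def tensor_space_trivial[OF cg])
  show "\<exists>bs. real_basis (D q) bs" for q
    using free[of q] comm_group.tensor_real_basis[OF cg vs] unfolding D_def by blast
  show "d q (x + y) = d q x + d q y" for q x y
    by (simp add: d_def tensor_map_add)
  show "d q (r *\<^sub>R x) = r *\<^sub>R d q x" for q r x
    by (simp add: d_def tensor_map_scaleR)
  show "d 0 x = 0" if "x \<in> D 0" for x
    using that tensor_map_image[OF bd[of 0]] tensor_space_trivial[OF cg neg] by (auto simp: d_def D_def)
  fix q x assume x: "x \<in> D (Suc q)"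
  show "d (Suc q) x \<in> D q"
    using x tensor_map_image[OF bd_Suc] by (auto simp: d_def D_def)
  interpret Gq: comm_group "G (int q - 1)" by (rule cg)
  \<comment> \<open>The composite is evaluated on a tensor basis, where each value is a pure tensor
    with the neutral element.\<close>
  obtain ss where ss: "int_basis (G (int (Suc q))) (carrier (G (int (Suc q)))) ss" using free by blast
  have ssG: "set ss \<subseteq> carrier (G (1 + int q))" using ss by (simp add: int_basis_def)
  obtain f where f: "x = list_comb (tensor_basis (G (1 + int q)) vs ss) f"
    using comm_group.tensor_real_basis[OF cg vs ss] x unfolding D_def real_basis_iff by auto
  have bss: "set (map (bd (1 + int q)) ss) \<subseteq> carrier (G (int q))"
    using ssG bd_Suc by (auto dest!: hom_in_carrier)
  have "map (d q) (map (d (Suc q)) (tensor_basis (G (1 + int q)) vs ss)) =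
      tensor_basis (G (int q - 1)) vs (map (bd (int q)) (map (bd (1 + int q)) ss))"
    using map_d_tensor_basis[of ss "Suc q"] ssG map_d_tensor_basis[OF bss] by simp
  moreover have "map (bd (int q)) (map (bd (1 + int q)) ss) = map (\<lambda>_. \<one>\<^bsub>G (int q - 1)\<^esub>) ss"
    using ssG bdbd[of _ "int q"] by (auto simp: add.commute)
  moreover have "list_comb (tensor_basis (G (int q - 1)) vs (map (\<lambda>_. \<one>\<^bsub>G (int q - 1)\<^esub>) ss)) f = 0"
    unfolding list_comb_tensor_basis by (intro sum.neutral ballI) (simp add: Gq.pure_tensor_one)
  moreover have "d q (d (Suc q) x) = list_comb (map (d q) (map (d (Suc q)) (tensor_basis (G (1 + int q)) vs ss))) f"
    by (simp only: f d_def tensor_map_list_comb)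
  ultimately show "d q (d (Suc q) x) = 0"
    by (simp only:)
qed

text \<open>Boundaries form a subgroup of a free group, so they have an integral basis, of which
  preimages are chosen. In degree 0 the target is the trivial group \<open>G (-1)\<close>, and the
  empty list does.\<close>

lemma bounding_lifts_ex:
  "\<exists>\<beta>. \<beta> 0 = [] \<and> (\<forall>q::nat. set (\<beta> q) \<subseteq> carrier (G (int q)) \<and>
     int_basis (G (int q - 1)) (bd (int q) ` carrier (G (int q))) (map (bd (int q)) (\<beta> q)))"
proof -
  have sub: "subgroup (bd q ` carrier (G q)) (G (q - 1))" for q
    using group_hom.img_is_subgroup[of "G q" "G (q - 1)" "bd q"] bd cg
    by (auto simp: group_hom_def group_hom_axioms_def comm_group_def)
  have "\<forall>q. \<exists>b. (q = 0 \<longrightarrow> b = []) \<and> set b \<subseteq> carrier (G (int q)) \<and>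
     int_basis (G (int q - 1)) (bd (int q) ` carrier (G (int q))) (map (bd (int q)) b)"
  proof
    fix q
    show "\<exists>b. (q = 0 \<longrightarrow> b = []) \<and> set b \<subseteq> carrier (G (int q)) \<and>
     int_basis (G (int q - 1)) (bd (int q) ` carrier (G (int q))) (map (bd (int q)) b)"
    proof (cases q)
      case 0
      interpret N: comm_group "G (-1)" by (rule cg)
      have "bd 0 ` carrier (G 0) \<subseteq> {\<one>\<^bsub>G (-1)\<^esub>}"
        using bd[of 0] neg by (auto dest!: hom_in_carrier)
      then have "int_basis (G (- 1)) (bd 0 ` carrier (G 0)) []"
        using sub[of 0] by (auto simp: N.int_basis_iff int_indep_def)
      then show ?thesis using 0 by (intro exI[of _ "[]"]) simp
    next
      case (Suc p)
      obtain ss where "int_basis (G (int p)) (carrier (G (int p))) ss" using free by blast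
      moreover have "subgroup (bd (int q) ` carrier (G (int q))) (G (int p))"
        using sub[of "int q"] Suc by simp
      ultimately obtain ys where ys: "int_basis (G (int p)) (bd (int q) ` carrier (G (int q))) ys"
        using comm_group.subgroup_int_basis_ex[OF cg] by blast
      then have s: "set ys \<subseteq> bd (int q) ` carrier (G (int q))" by (simp add: int_basis_def)
      define b where "b = map (inv_into (carrier (G (int q))) (bd (int q))) ys"
      have "map (bd (int q)) b = ys"
        unfolding b_def map_map comp_def using s by (intro map_idI) (auto simp: f_inv_into_f)
      moreover have "set b \<subseteq> carrier (G (int q))"
        unfolding b_def using s by (auto intro!: inv_into_into)
      ultimately show ?thesis using ys Suc by (intro exI[of _ b]) simp
    qed
  qed
  from choice[OF this] show ?thesis by metis
qed

text \<open>The adapted integral lists tensored with \<open>vs\<close> give the reference basis.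
  That they are real bases is inferred from the determinant formula itself, since the order of a
  finite torsion subgroup is not 0. The value is the same for every integral basis
  \<open>ss\<close>.\<close>

theorem split_complex_ex:
  fixes H :: "nat \<Rightarrow> ('h, 'n) monoid_scheme" and \<kappa> :: "nat \<Rightarrow> 'g \<Rightarrow> 'h" and lam :: "nat \<Rightarrow> 'g list"
  assumes H: "\<And>q. comm_group (H q)"
    and \<kappa>: "\<And>q. \<kappa> q \<in> hom (subgroup_generated (G (int q)) (kernel (G (int q)) (G (int q - 1)) (bd (int q)))) (H q)"
      "\<And>q. \<kappa> q ` kernel (G (int q)) (G (int q - 1)) (bd (int q)) = carrier (H q)"
      "\<And>q z. z \<in> kernel (G (int q)) (G (int q - 1)) (bd (int q)) \<Longrightarrow>
         \<kappa> q z = \<one>\<^bsub>H q\<^esub> \<longleftrightarrow> z \<in> bd (int q + 1) ` carrier (G (int q + 1))"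
    and lam: "\<And>q. set (lam q) \<subseteq> kernel (G (int q)) (G (int q - 1)) (bd (int q))"
      "\<And>q. free_part_basis (H q) (map (\<kappa> q) (lam q))"
  obtains b0 where "split_complex D d b0 (\<lambda>q. tensor_basis (G (int q)) vs (lam q))"
    and "\<And>q. card (torsion_subgroup (H q)) > 0"
    and "\<And>q ss. int_basis (G (int q)) (carrier (G (int q))) ss \<Longrightarrow>
       \<bar>det (base_change {0} (map (d (Suc q)) (b0 (Suc q)) @ tensor_basis (G (int q)) vs (lam q) @ b0 q)
          (tensor_basis (G (int q)) vs ss))\<bar> = real (card (torsion_subgroup (H q))) ^ length vs"
proof -
  obtain \<beta> where \<beta>0: "\<beta> 0 = []" and \<beta>: "\<And>q::nat. set (\<beta> q) \<subseteq> carrier (G (int q))"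
    "\<And>q::nat. int_basis (G (int q - 1)) (bd (int q) ` carrier (G (int q))) (map (bd (int q)) (\<beta> q))"
    using bounding_lifts_ex by blast
  define b0 where "b0 = (\<lambda>q. tensor_basis (G (int q)) vs (\<beta> q))"
  let ?ys = "\<lambda>q. map (bd (int q + 1)) (\<beta> (Suc q)) @ lam q @ \<beta> q"
  let ?R = "\<lambda>q. map (d (Suc q)) (b0 (Suc q)) @ tensor_basis (G (int q)) vs (lam q) @ b0 q"
  have R: "?R q = tensor_basis (G (int q)) vs (?ys q)" for q
    using map_d_tensor_basis[OF \<beta>(1)[of "Suc q"]] by (simp add: b0_def tensor_basis_append add.commute)
  have lamG: "set (lam q) \<subseteq> carrier (G (int q))" for q
    using lam(1)[of q] by (auto simp: kernel_def)
  have main: "card (torsion_subgroup (H q)) > 0 \<and> real_basis (D q) (?R q) \<and>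
      \<bar>det (base_change {0} (?R q) (tensor_basis (G (int q)) vs ss))\<bar> = real (card (torsion_subgroup (H q))) ^ length vs"
    if ss: "int_basis (G (int q)) (carrier (G (int q))) ss" for q ss
  proof -
    interpret Gq: comm_group "G (int q)" by (rule cg)
    have ysG: "set (?ys q) \<subseteq> carrier (G (int q))"
      using \<beta>(1)[of q] \<beta>(1)[of "Suc q"] lamG[of q] bd_Suc[of q] by (auto simp: add.commute dest!: hom_in_carrier)
    have "\<forall>j. \<exists>w. j < length (?ys q) \<longrightarrow> w \<in> int_space (length ss) \<and> ?ys q ! j = gcomb (G (int q)) ss w"
    proof
      fix j
      show "\<exists>w. j < length (?ys q) \<longrightarrow> w \<in> int_space (length ss) \<and> ?ys q ! j = gcomb (G (int q)) ss w"
      proof (cases "j < length (?ys q)")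
        case True
        then have "?ys q ! j \<in> carrier (G (int q))" using ysG nth_mem by blast
        then obtain w where "w \<in> int_space (length ss)" "?ys q ! j = gcomb (G (int q)) ss w"
          by (rule Gq.int_basis_coordinates[OF ss])
        then show ?thesis by (intro exI[of _ w]) simp
      qed simp
    qed
    then obtain w where "\<forall>j. j < length (?ys q) \<longrightarrow> w j \<in> int_space (length ss) \<and> ?ys q ! j = gcomb (G (int q)) ss (w j)"
      by (rule choice[THEN exE])
    then have w: "\<And>j. j < length (?ys q) \<Longrightarrow> w j \<in> int_space (length ss) \<and> ?ys q ! j = gcomb (G (int q)) ss (w j)"
      by blast
    have f: "bd (int q + 1) \<in> hom (G (int q + 1)) (G (int q))"
      using bd_Suc[of q] by (simp add: add.commute)
    have \<beta>1: "set (\<beta> (Suc q)) \<subseteq> carrier (G (int q + 1))"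
      "int_basis (G (int q)) (bd (int q + 1) ` carrier (G (int q + 1))) (map (bd (int q + 1)) (\<beta> (Suc q)))"
      using \<beta>[of "Suc q"] by (simp_all add: add.commute)
    note idx = Gq.adapted_basis_index[where A = "G (int q + 1)" and B = "G (int q - 1)" and H = "H q"
      and f = "bd (int q + 1)" and g = "bd (int q)" and \<kappa> = "\<kappa> q" and \<beta> = "\<beta> (Suc q)" and \<gamma> = "\<beta> q"
      and lam = "lam q" and ss = ss and w = w,
      OF cg cg H f bd bdbd[of _ "int q"] \<kappa>(1) \<kappa>(2) \<kappa>(3)[of _ q] \<beta>1 \<beta>(1) \<beta>(2) lam(1) lam(2) ss w, simplified]
    have len: "length (?ys q) = length ss" using idx(1) by simp
    note pos = idx(2)
    have det: "\<bar>det (kron (length vs) (mat (length ss) (length ss) (\<lambda>(i, j). w j i)))\<bar> = int (card (torsion_subgroup (H q))) ^ length vs"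
      using idx(3)[where d = "length vs"] by simp
    have "base_change {0} (?R q) (tensor_basis (G (int q)) vs ss) =
        map_mat of_int (kron (length vs) (mat (length ss) (length ss) (\<lambda>(i, j). w j i)))"
      unfolding R using Gq.base_change_tensor_basis[OF vs ss, of "?ys q" w] w len by simp
    then have "\<bar>det (base_change {0} (?R q) (tensor_basis (G (int q)) vs ss))\<bar> =
        real_of_int \<bar>det (kron (length vs) (mat (length ss) (length ss) (\<lambda>(i, j). w j i)))\<bar>"
      by (simp add: of_int_hom.hom_det)
    also have "\<dots> = real (card (torsion_subgroup (H q))) ^ length vs"
      unfolding det by simp
    finally have det': "\<bar>det (base_change {0} (?R q) (tensor_basis (G (int q)) vs ss))\<bar> = real (card (torsion_subgroup (H q))) ^ length vs" .
    have "real_basis (D q) (?R q)"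
    proof (rule real_basis_by_det)
      show "real_basis (D q) (tensor_basis (G (int q)) vs ss)"
        unfolding D_def by (rule Gq.tensor_real_basis[OF vs ss])
      show "length (?R q) = length (tensor_basis (G (int q)) vs ss)"
        unfolding R length_tensor_basis len ..
      show "set (?R q) \<subseteq> D q"
        unfolding R D_def by (rule tensor_basis_mem[OF ysG])
      show "det (base_change {0} (?R q) (tensor_basis (G (int q)) vs ss)) \<noteq> 0"
        using det' pos by auto
    qed
    with pos det' show ?thesis by blast
  qed
  show thesis
  proof (rule that)
    show "split_complex D d b0 (\<lambda>q. tensor_basis (G (int q)) vs (lam q))"
    proof
      show "real_complex D d" by (rule real_complex_D)
      show "real_basis (D q) (?R q)" for q using main[of q] free[of q] by blast
      show "b0 0 = []" by (simp add: b0_def \<beta>0)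
      show "d q x = 0" if "x \<in> set (tensor_basis (G (int q)) vs (lam q))" for q x
      proof -
        obtain s v where s: "s \<in> set (lam q)" "x = pure_tensor (G (int q)) v s"
          using \<open>x \<in> _\<close> by (auto simp: set_tensor_basis)
        have "d q x = pure_tensor (G (int q - 1)) v (bd (int q) s)"
          unfolding d_def s(2) using s(1) lamG by (intro tensor_map_pure[OF bd]) auto
        also have "bd (int q) s = \<one>\<^bsub>G (int q - 1)\<^esub>"
          using lam(1)[of q] s(1) by (auto simp: kernel_def)
        also have "pure_tensor (G (int q - 1)) v \<one>\<^bsub>G (int q - 1)\<^esub> = 0"
          by (rule comm_group.pure_tensor_one[OF cg])
        finally show ?thesis .
      qed
    qed
  qed (use main free in blast)+
qed

end

section \<open>Homology bases and their representatives\<close>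

lemma lift_memD: "lift zs hs \<Longrightarrow> x \<in> set zs \<Longrightarrow> \<exists>h\<in>set hs. x \<in> h"
proof -
  assume l: "lift zs hs" and "x \<in> set zs"
  then obtain i where "i < length zs" "x = zs ! i" by (auto simp: in_set_conv_nth)
  with l show ?thesis
    unfolding lift_def list_all2_conv_all_nth by (intro bexI[of _ "hs ! i"]) auto
qed

text \<open>Only the cycles and boundaries of the single degree \<open>q\<close> are compared, since
  the two complexes agree only below the cut. The further conclusions control the lifts of the image
  basis, over which the torsion values range.\<close>

lemma homology_basis_transfer:
  fixes \<Phi> :: "'w::real_vector \<Rightarrow> 'u::real_vector"
  assumes lin: "linear \<Phi>" and C: "subspace (C q)" and inj: "inj_on \<Phi> (C q)"
    and cyc: "\<Phi> ` cycles C dC q = cycles D d q" and bou: "\<Phi> ` boundaries C dC q = boundaries D d q"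
    and sub: "boundaries C dC q \<subseteq> C q" "subspace (boundaries C dC q)"
    and hs: "homology_basis C dC q hs"
  shows "homology_basis D d q (map (image \<Phi>) hs)"
    and "\<And>zs. lift zs (map (image \<Phi>) hs) \<Longrightarrow> \<exists>zs'. lift zs' hs \<and> zs = map \<Phi> zs'"
    and "\<And>zs'. lift zs' hs \<Longrightarrow> set zs' \<subseteq> C q"
    and "\<exists>zs. lift zs hs"
    and "\<And>x. x \<in> C q \<Longrightarrow> \<Phi> x \<in> boundaries D d q \<longleftrightarrow> x \<in> boundaries C dC q"
proof -
  have bb: "\<Phi> x \<in> boundaries D d q \<longleftrightarrow> x \<in> boundaries C dC q" if "x \<in> C q" for x
    using inj that sub(1) unfolding bou[symmetric] by (auto dest: inj_onD)
  then show "\<And>x. x \<in> C q \<Longrightarrow> \<Phi> x \<in> boundaries D d q \<longleftrightarrow> x \<in> boundaries C dC q" .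
  have cls: "\<Phi> ` homology_class C dC q z = homology_class D d q (\<Phi> z)" for z
    unfolding homology_class_def bou[symmetric] by (auto simp: image_image linear_add[OF lin])
  have hsc: "set hs \<subseteq> homology_class C dC q ` cycles C dC q"
    using hs by (simp add: homology_basis_def)
  show lft: "\<exists>zs'. lift zs' hs \<and> zs = map \<Phi> zs'" if "lift zs (map (image \<Phi>) hs)" for zs
  proof -
    have l: "list_all2 (\<lambda>z h. z \<in> \<Phi> ` h) zs hs"
      using that by (simp add: lift_def list_all2_map2)
    define zs' where "zs' = map2 (\<lambda>z h. SOME y. y \<in> h \<and> z = \<Phi> y) zs hs"
    have len: "length zs = length hs" using l by (rule list_all2_lengthD)
    have "zs' ! i \<in> hs ! i \<and> zs ! i = \<Phi> (zs' ! i)" if "i < length hs" for i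
    proof -
      have "\<exists>y. y \<in> hs ! i \<and> zs ! i = \<Phi> y"
        using l that len by (auto simp: list_all2_conv_all_nth)
      from someI_ex[OF this] show ?thesis using that len by (simp add: zs'_def)
    qed
    then have "lift zs' hs" "zs = map \<Phi> zs'"
      unfolding lift_def list_all2_conv_all_nth using len
      by (auto simp: zs'_def intro!: nth_equalityI)
    then show ?thesis by blast
  qed
  have cycC: "cycles C dC q \<subseteq> C q" by (auto simp: cycles_def)
  show setC: "set zs' \<subseteq> C q" if l: "lift zs' hs" for zs'
  proof
    fix x assume "x \<in> set zs'"
    then obtain h where "h \<in> set hs" "x \<in> h"
      using lift_memD[OF l] by blast
    then obtain z b where "z \<in> cycles C dC q" "b \<in> boundaries C dC q" "x = z + b"
      using hsc by (auto simp: homology_class_def)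
    then show "x \<in> C q" using cycC sub(1) C by (auto intro: subspace_add)
  qed
  show "\<exists>zs. lift zs hs"
  proof -
    have "h \<noteq> {}" if "h \<in> set hs" for h
      using hsc that subspace_0[OF sub(2)] by (auto simp: homology_class_def)
    then have "lift (map (\<lambda>h. SOME z. z \<in> h) hs) hs"
      unfolding lift_def list_all2_conv_all_nth by (auto intro!: some_in_eq[THEN iffD2])
    then show ?thesis by blast
  qed
  show "homology_basis D d q (map (image \<Phi>) hs)"
    unfolding homology_basis_def
  proof (intro conjI allI impI ballI)
    show "set (map (image \<Phi>) hs) \<subseteq> homology_class D d q ` cycles D d q"
    proof
      fix k assume "k \<in> set (map (image \<Phi>) hs)"
      then obtain h where h: "h \<in> set hs" "k = \<Phi> ` h" by auto
      then obtain z where z: "z \<in> cycles C dC q" "h = homology_class C dC q z" using hsc by blast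
      then have "k = homology_class D d q (\<Phi> z)" using h cls by simp
      moreover have "\<Phi> z \<in> cycles D d q" using z(1) cyc by blast
      ultimately show "k \<in> homology_class D d q ` cycles D d q" by blast
    qed
    fix zs z assume "lift zs (map (image \<Phi>) hs)" and z: "z \<in> cycles D d q"
    then obtain zs' where zs': "lift zs' hs" "zs = map \<Phi> zs'" using lft by blast
    obtain z' where z': "z' \<in> cycles C dC q" "z = \<Phi> z'" using z cyc by blast
    have u: "\<exists>!r. length r = length zs' \<and> z' - (\<Sum>i<length zs'. (r ! i) *\<^sub>R (zs' ! i)) \<in> boundaries C dC q"
      using hs zs'(1) z'(1) by (simp add: homology_basis_def)
    have "z - (\<Sum>i<length zs. (r ! i) *\<^sub>R (zs ! i)) = \<Phi> (z' - (\<Sum>i<length zs'. (r ! i) *\<^sub>R (zs' ! i)))" for r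
      by (simp add: zs' z' linear_diff[OF lin] linear_sum[OF lin] linear_scale[OF lin])
    moreover have "z' - (\<Sum>i<length zs'. (r ! i) *\<^sub>R (zs' ! i)) \<in> C q" for r
      using z' cycC setC[OF zs'(1)] by (intro subspace_diff[OF C] subspace_sum[OF C] subspace_scale[OF C]) auto
    ultimately show "\<exists>!r. length r = length zs \<and> z - (\<Sum>i<length zs. (r ! i) *\<^sub>R (zs ! i)) \<in> boundaries D d q"
      using u bb zs'(2) by simp
  qed
qed

text \<open>The definition of a homology basis does not mention its length. Both \<open>l0 q\<close>
  and \<open>zs\<close> complete \<open>db (Suc q)\<close> to a basis of the cycles, so they are
  equally long.\<close>

lemma (in split_complex) homology_basis_length:
  assumes hs: "homology_basis D d q hs" and zs: "lift zs hs"
  shows "length zs = length (l0 q)"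
proof -
  have hsc: "set hs \<subseteq> homology_class D d q ` cycles D d q"
    and u: "\<And>z. z \<in> cycles D d q \<Longrightarrow> \<exists>!r. length r = length zs \<and>
        z - (\<Sum>i<length zs. (r ! i) *\<^sub>R (zs ! i)) \<in> boundaries D d q"
    using hs zs by (auto simp: homology_basis_def)
  have lc: "(\<Sum>i<length zs. (map f [0..<length zs] ! i) *\<^sub>R (zs ! i)) = list_comb zs f" for f
    by (simp add: list_comb_def)
  have Zc: "cycles D d q = range (list_comb (db (Suc q) @ l0 q))"
  proof (intro equalityI subsetI)
    fix x assume "x \<in> cycles D d q"
    then obtain f g where "x = list_comb (db (Suc q)) f + list_comb (l0 q) g"
      unfolding cycles_eq by (elim exE)
    then show "x \<in> range (list_comb (db (Suc q) @ l0 q))"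
      by (simp add: list_comb_append')
  next
    fix x assume "x \<in> range (list_comb (db (Suc q) @ l0 q))"
    then obtain f where "x = list_comb (db (Suc q) @ l0 q) f" by (elim rangeE)
    then show "x \<in> cycles D d q"
      unfolding cycles_eq list_comb_append by (intro exI)
  qed
  have sZ: "subspace (cycles D d q)"
    unfolding Zc span_set_list[symmetric] by (rule subspace_span)
  have bZ: "boundaries D d q \<subseteq> cycles D d q"
  proof
    fix x assume "x \<in> boundaries D d q"
    then obtain f where "x = list_comb (db (Suc q)) f"
      unfolding boundaries_eq by (elim rangeE)
    then have "x = list_comb (db (Suc q)) f + list_comb (l0 q) (\<lambda>_. 0)" by simp
    then show "x \<in> cycles D d q" unfolding cycles_eq by (intro exI)
  qed
  have z: "set zs \<subseteq> cycles D d q"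
  proof
    fix x assume "x \<in> set zs"
    then obtain h where "h \<in> set hs" "x \<in> h"
      using lift_memD[OF zs] by blast
    then obtain z b where "z \<in> cycles D d q" "b \<in> boundaries D d q" "x = z + b"
      using hsc by (auto simp: homology_class_def)
    then show "x \<in> cycles D d q" using bZ sZ by (auto intro: subspace_add)
  qed
  have 1: "real_basis (cycles D d q) (db (Suc q) @ l0 q)"
    unfolding real_basis_iff using Zc indep_list_append(1)[of "db (Suc q) @ l0 q" "b0 q"] indep_R[of q] by simp
  have 2: "real_basis (cycles D d q) (db (Suc q) @ zs)"
    unfolding real_basis_iff
  proof
    show "indep_list (db (Suc q) @ zs)"
      unfolding indep_list_def
    proof (intro allI impI)
      fix f i assume f: "list_comb (db (Suc q) @ zs) f = 0" and i: "i < length (db (Suc q) @ zs)"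
      let ?g = "\<lambda>i. f (length (db (Suc q)) + i)"
      have e: "list_comb (db (Suc q)) f + list_comb zs ?g = 0"
        using f by (simp add: list_comb_append)
      have "0 - list_comb zs ?g = list_comb (db (Suc q)) f"
        using minus_unique[OF e[unfolded add.commute[of "list_comb (db (Suc q)) f"]]] by simp
      then have "0 - list_comb zs ?g \<in> boundaries D d q" "0 - list_comb zs (\<lambda>_. 0) \<in> boundaries D d q"
        using subspace_0[OF subspace_boundaries] by (simp_all add: boundaries_eq)
      \<comment> \<open>The zero cycle has the coordinate list 0; uniqueness makes every other
        relation modulo boundaries trivial.\<close>
      define P where "P = (\<lambda>r. length r = length zs \<and> 0 - (\<Sum>i<length zs. (r ! i) *\<^sub>R (zs ! i)) \<in> boundaries D d q)"
      have "P (map ?g [0..<length zs])" "P (map (\<lambda>_. 0) [0..<length zs])"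
        using \<open>0 - list_comb zs ?g \<in> _\<close> \<open>0 - list_comb zs (\<lambda>_. 0) \<in> _\<close> unfolding P_def lc by simp_all
      moreover have "\<exists>!r. P r" unfolding P_def by (rule u[OF subspace_0[OF sZ]])
      ultimately have "map ?g [0..<length zs] = map (\<lambda>_. 0) [0..<length zs]" by blast
      then have g0: "\<forall>i<length zs. ?g i = 0" by simp
      then have "list_comb zs ?g = 0" by (simp add: list_comb_def)
      then have "list_comb (db (Suc q)) f = 0" using e by simp
      then have f0: "\<forall>i<length (db (Suc q)). f i = 0"
        using indep_db[of "Suc q"] unfolding indep_list_def by blast
      show "f i = 0"
      proof (cases "i < length (db (Suc q))")
        case False
        then obtain k where "i = length (db (Suc q)) + k" using le_Suc_ex not_less by blast
        then show ?thesis using g0 i by simp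
      qed (use f0 in blast)
    qed
    show "range (list_comb (db (Suc q) @ zs)) = cycles D d q"
    proof
      show "range (list_comb (db (Suc q) @ zs)) \<subseteq> cycles D d q"
        using real_basis_nth_mem[OF 1] z by (intro image_subsetI list_comb_mem[OF sZ]) auto
      show "cycles D d q \<subseteq> range (list_comb (db (Suc q) @ zs))"
      proof
        fix x assume "x \<in> cycles D d q"
        then obtain r where "length r = length zs" "x - (\<Sum>i<length zs. (r ! i) *\<^sub>R (zs ! i)) \<in> boundaries D d q"
          using u[OF \<open>x \<in> cycles D d q\<close>] by (elim ex1E conjE)
        then obtain f where "x - list_comb zs ((!) r) = list_comb (db (Suc q)) f"
          unfolding boundaries_eq list_comb_def[symmetric] by (elim rangeE)
        then have "x = list_comb (db (Suc q)) f + list_comb zs ((!) r)" by (simp add: algebra_simps)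
        then show "x \<in> range (list_comb (db (Suc q) @ zs))"
          unfolding list_comb_append' by simp
      qed
    qed
  qed
  show ?thesis using real_basis_lengths[OF 1 2] by simp
qed

lemma tensor_space_induct [consumes 1, case_names zero add pure]:
  assumes "T \<in> tensor_space G"
    and "P 0" and "\<And>S T r. P S \<Longrightarrow> P T \<Longrightarrow> P (r *\<^sub>R S + T)"
    and "\<And>v g. g \<in> carrier G \<Longrightarrow> P (pure_tensor G v g)"
  shows "P T"
  using assms(1) unfolding tensor_space_def
proof (induction rule: span_induct_alt)
  case base
  show ?case by (rule assms(2))
next
  case (step c x y)
  then obtain v g where "x = pure_tensor G v g" "g \<in> carrier G" by blast
  then have "P x" by (simp only: assms(4))
  then show ?case by (rule assms(3)[OF _ step(2)])
qed

lemma tensor_map_inverse: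
  assumes "\<phi> \<in> hom G H" "\<psi> \<in> hom H G" "\<And>x. x \<in> carrier G \<Longrightarrow> \<psi> (\<phi> x) = x" "T \<in> tensor_space G"
  shows "tensor_map G \<psi> (tensor_map H \<phi> T) = T"
  using assms(4)
proof (induction rule: tensor_space_induct)
  case (pure v g)
  then show ?case
    using assms by (simp add: tensor_map_pure[OF assms(1)] tensor_map_pure[OF assms(2)] hom_in_carrier[OF assms(1)])
qed (simp_all only: tensor_map_add tensor_map_scaleR tensor_map_zero)

lemma tensor_map_iso:
  assumes "group G" "\<phi> \<in> iso G H"
  shows "bij_betw (tensor_map H \<phi>) (tensor_space G) (tensor_space H)"
proof -
  interpret group G by fact
  have \<phi>: "\<phi> \<in> hom G H" "inv_into (carrier G) \<phi> \<in> hom H G" "bij_betw \<phi> (carrier G) (carrier H)"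
    using assms(2) iso_set_sym[OF assms(2)] by (auto simp: iso_def)
  show ?thesis
  proof (rule bij_betw_byWitness[where f' = "tensor_map G (inv_into (carrier G) \<phi>)"])
    show "\<forall>T\<in>tensor_space G. tensor_map G (inv_into (carrier G) \<phi>) (tensor_map H \<phi> T) = T"
      using \<phi> by (auto intro!: tensor_map_inverse simp: bij_betw_inv_into_left)
    show "\<forall>T\<in>tensor_space H. tensor_map H \<phi> (tensor_map G (inv_into (carrier G) \<phi>) T) = T"
      using \<phi> by (auto intro!: tensor_map_inverse simp: bij_betw_inv_into_right)
    show "tensor_map H \<phi> ` tensor_space G \<subseteq> tensor_space H"
      by (rule tensor_map_image[OF \<phi>(1)])
    show "tensor_map G (inv_into (carrier G) \<phi>) ` tensor_space H \<subseteq> tensor_space G"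
      by (rule tensor_map_image[OF \<phi>(2)])
  qed
qed

lemma linear_tensor_map: "linear (tensor_map H \<phi>)"
  by (rule linearI) (simp_all only: tensor_map_add tensor_map_scaleR)

text \<open>The model of homology from degree \<open>a - 1\<close> on: it contributes neither basis
  elements nor torsion.\<close>

lemma free_part_basis_trivial:
  "free_part_basis (singleton_group x) []" "card (torsion_subgroup (singleton_group x)) = 1"
proof -
  have t: "torsion_subgroup (singleton_group x) = {x}"
    by (auto simp: torsion_subgroup_def singleton_group_def intro!: exI[of _ "1::nat"])
  show "free_part_basis (singleton_group x) []"
    using t[unfolded singleton_group_def]
    by (auto simp: free_part_basis_def singleton_group_def)
  show "card (torsion_subgroup (singleton_group x)) = 1" by (simp add: t)
qed

text \<open>Shaped like \<open>filt_homology\<close>, to which it reduces by unfolding once the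
  complex of a filtration is inserted.\<close>

definition complex_homology :: "(int \<Rightarrow> ('g, 'm) monoid_scheme) \<Rightarrow> (int \<Rightarrow> 'g \<Rightarrow> 'g) \<Rightarrow> int \<Rightarrow> 'g set monoid" where
  "complex_homology G b q = subgroup_generated (G q) (kernel (G q) (G (q - 1)) (b q)) Mod (b (q + 1) ` carrier (G (q + 1)))"

text \<open>Here \<open>G\<close> stands for the intersection complex and \<open>GC\<close> for the
  complex of the base. The map \<open>\<eta>\<close> is invertible below degree \<open>a\<close>, so
  boundaries can be compared only if the degree above them is below \<open>a\<close> as well. Hence
  homology is identified for \<open>q + 2 \<le> a\<close>, and \<open>exact\<close> takes over from
  degree \<open>a - 1\<close>.\<close>

locale truncated_complex = integral_complex G bd vs
  for G :: "int \<Rightarrow> 'g monoid" and bd :: "int \<Rightarrow> 'g \<Rightarrow> 'g" and vs :: "'v::real_vector list" +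
  fixes GC :: "int \<Rightarrow> 'k monoid" and bC :: "int \<Rightarrow> 'k \<Rightarrow> 'k" and \<eta> :: "int \<Rightarrow> 'k \<Rightarrow> 'g" and a :: nat
  assumes cgC: "\<And>q. comm_group (GC q)"
    and bC: "\<And>q. bC q \<in> hom (GC q) (GC (q - 1))"
    and bCbC: "\<And>q x. x \<in> carrier (GC (q + 1)) \<Longrightarrow> bC q (bC (q + 1) x) = \<one>\<^bsub>GC (q - 1)\<^esub>"
    and negC: "carrier (GC (-1)) = {\<one>\<^bsub>GC (-1)\<^esub>}"
    and \<eta>: "\<And>q::nat. q < a \<Longrightarrow> \<eta> (int q) \<in> iso (GC (int q)) (G (int q))"
    and \<eta>b: "\<And>(q::nat) x. Suc q < a \<Longrightarrow> x \<in> carrier (GC (int q + 1)) \<Longrightarrow>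
       \<eta> (int q) (bC (int q + 1) x) = bd (int q + 1) (\<eta> (int q + 1) x)"
    and exact: "\<And>q::nat. a \<le> Suc q \<Longrightarrow>
       kernel (G (int q)) (G (int q - 1)) (bd (int q)) \<subseteq> bd (int q + 1) ` carrier (G (int q + 1))"
begin

abbreviation "kerJ q \<equiv> kernel (G (int q)) (G (int q - 1)) (bd (int q))"
abbreviation "kerC q \<equiv> kernel (GC (int q)) (GC (int q - 1)) (bC (int q))"
abbreviation "imJ q \<equiv> bd (int q + 1) ` carrier (G (int q + 1))"
abbreviation "imC q \<equiv> bC (int q + 1) ` carrier (GC (int q + 1))"
definition C :: "nat \<Rightarrow> ('v, 'k) tensor set" where "C q = tensor_space (GC (int q))"
definition dC :: "nat \<Rightarrow> ('v, 'k) tensor \<Rightarrow> ('v, 'k) tensor" where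
  "dC q = tensor_map (GC (int q - 1)) (bC (int q))"
definition \<Phi> :: "nat \<Rightarrow> ('v, 'k) tensor \<Rightarrow> ('v, 'g) tensor" where
  "\<Phi> q = tensor_map (G (int q)) (\<eta> (int q))"

lemma groups: "group (G q)" "group (GC q)"
  using cg cgC by (auto simp: comm_group_def)

lemma \<eta>_bij: "q < a \<Longrightarrow> bij_betw (\<eta> (int q)) (carrier (GC (int q))) (carrier (G (int q)))"
  and \<eta>_hom: "q < a \<Longrightarrow> \<eta> (int q) \<in> hom (GC (int q)) (G (int q))"
  using \<eta> by (auto simp: iso_def)

lemma \<eta>_one: "q < a \<Longrightarrow> \<eta> (int q) \<one>\<^bsub>GC (int q)\<^esub> = \<one>\<^bsub>G (int q)\<^esub>"
  using hom_one[OF \<eta>_hom groups(2) groups(1)] .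

text \<open>Cycles involve the degree below and not the one above, so they correspond for all
  \<open>q < a\<close>, one degree further than boundaries. In degree 0 everything is a cycle,
  because both groups in degree \<open>-1\<close> are trivial.\<close>

lemma \<eta>_kernel: "q < a \<Longrightarrow> \<eta> (int q) ` kerC q = kerJ q"
proof -
  assume q: "q < a"
  have "\<eta> (int q) x \<in> kerJ q \<longleftrightarrow> x \<in> kerC q" if x: "x \<in> carrier (GC (int q))" for x
  proof (cases q)
    case 0
    have "bC 0 x \<in> carrier (GC (-1))" using hom_in_carrier[OF bC[of 0]] x 0 by simp
    moreover have "\<eta> 0 x \<in> carrier (G 0)" using hom_in_carrier[OF \<eta>_hom[OF q]] x 0 by simp
    moreover from this have "bd 0 (\<eta> 0 x) \<in> carrier (G (-1))" using hom_in_carrier[OF bd[of 0]] by simp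
    ultimately show ?thesis using neg negC x 0 by (simp add: kernel_def)
  next
    case (Suc p)
    have x': "x \<in> carrier (GC (int p + 1))" using x Suc by (simp add: add.commute)
    have b: "bC (int p + 1) x \<in> carrier (GC (int p))" using hom_in_carrier[OF bC x'] by simp
    have e: "\<eta> (int p) (bC (int p + 1) x) = bd (int p + 1) (\<eta> (int p + 1) x)"
      using \<eta>b[OF _ x'] q Suc by simp
    have "bd (int p + 1) (\<eta> (int p + 1) x) = \<one>\<^bsub>G (int p)\<^esub> \<longleftrightarrow> bC (int p + 1) x = \<one>\<^bsub>GC (int p)\<^esub>"
      unfolding e[symmetric]
      using inj_onD[OF bij_betw_imp_inj_on[OF \<eta>_bij], of p "bC (int p + 1) x" "\<one>\<^bsub>GC (int p)\<^esub>"] b q Suc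
        \<eta>_one[of p] monoid.one_closed[OF group.is_monoid[OF groups(2)]] by auto
    moreover have "\<eta> (int p + 1) x \<in> carrier (G (int p + 1))"
      using hom_in_carrier[OF \<eta>_hom[OF q] x] Suc by (simp add: add.commute)
    ultimately show ?thesis using x' Suc by (simp add: kernel_def add.commute)
  qed
  moreover have "kerC q \<subseteq> carrier (GC (int q))" "kerJ q \<subseteq> \<eta> (int q) ` carrier (GC (int q))"
    using \<eta>_bij[OF q] by (auto simp: kernel_def bij_betw_def)
  ultimately show ?thesis by blast
qed

lemma \<eta>_image: "Suc q < a \<Longrightarrow> \<eta> (int q) ` imC q = imJ q"
proof -
  assume q: "Suc q < a"
  have "carrier (G (int q + 1)) = \<eta> (int q + 1) ` carrier (GC (int q + 1))"
    using \<eta>_bij[OF q] by (simp add: bij_betw_def add.commute)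
  then show ?thesis
    using \<eta>b[OF q] by (simp add: image_image cong: image_cong)
qed

lemma subspace_C: "subspace (C q)"
  by (simp add: C_def subspace_tensor_space)

lemma dC_mem: "x \<in> C (Suc q) \<Longrightarrow> dC (Suc q) x \<in> C q"
  using tensor_map_image[OF bC[of "int (Suc q)"]] by (auto simp: C_def dC_def)

lemma \<Phi>_bij: "q < a \<Longrightarrow> bij_betw (\<Phi> q) (C q) (D q)"
  unfolding \<Phi>_def C_def D_def by (rule tensor_map_iso[OF groups(2) \<eta>])

lemma \<Phi>_dC: "Suc q < a \<Longrightarrow> x \<in> C (Suc q) \<Longrightarrow> \<Phi> q (dC (Suc q) x) = d (Suc q) (\<Phi> (Suc q) x)"
proof -
  assume q: "Suc q < a" and "x \<in> C (Suc q)"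
  then have "x \<in> tensor_space (GC (int (Suc q)))" by (simp add: C_def)
  then show ?thesis
  proof (induction rule: tensor_space_induct)
  case (pure v g)
  note pure = pure q
  have g: "g \<in> carrier (GC (1 + int q))" using pure by simp
  have e: "\<eta> (int q) (bC (1 + int q) g) = bd (1 + int q) (\<eta> (1 + int q) g)"
    using \<eta>b[of q g] pure by (simp add: add.commute)
  have "\<eta> (1 + int q) g \<in> carrier (G (1 + int q))"
    using hom_in_carrier[OF \<eta>_hom[of "Suc q"]] pure by simp
  moreover have "bC (1 + int q) g \<in> carrier (GC (int q))"
    using hom_in_carrier[OF bC[of "1 + int q"] g] by simp
  moreover have "dC (Suc q) (pure_tensor (GC (1 + int q)) v g) = pure_tensor (GC (int q)) v (bC (1 + int q) g)"
    using tensor_map_pure[OF bC[of "1 + int q"] g, of v] by (simp add: dC_def)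
  moreover have "\<Phi> q (pure_tensor (GC (int q)) v y) = pure_tensor (G (int q)) v (\<eta> (int q) y)"
    if "y \<in> carrier (GC (int q))" for y
    unfolding \<Phi>_def using q that by (intro tensor_map_pure[OF \<eta>_hom]) auto
  moreover have "\<Phi> (Suc q) (pure_tensor (GC (1 + int q)) v g) = pure_tensor (G (1 + int q)) v (\<eta> (1 + int q) g)"
    using tensor_map_pure[OF \<eta>_hom[OF q], of g v] g by (simp add: \<Phi>_def)
  moreover have "d (Suc q) (pure_tensor (G (1 + int q)) v y) = pure_tensor (G (int q)) v (bd (1 + int q) y)"
    if "y \<in> carrier (G (1 + int q))" for y
    using tensor_map_pure[OF bd[of "1 + int q"] that, of v] by (simp add: d_def)
  ultimately show ?case
    using e by simp
  qed (simp_all only: \<Phi>_def dC_def d_def tensor_map_add tensor_map_scaleR tensor_map_zero)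
qed

lemma dC_0: "x \<in> C 0 \<Longrightarrow> dC 0 x = 0"
  using tensor_map_image[OF bC[of 0]] tensor_space_trivial[OF cgC negC] by (auto simp: C_def dC_def)

lemma d_0: "x \<in> D 0 \<Longrightarrow> d 0 x = 0"
  using real_complex_D by (simp add: real_complex_def)

lemma \<Phi>_cycles: "q < a \<Longrightarrow> \<Phi> q ` cycles C dC q = cycles D d q"
proof -
  assume q: "q < a"
  have "d q (\<Phi> q x) = 0 \<longleftrightarrow> dC q x = 0" if x: "x \<in> C q" for x
  proof (cases q)
    case 0
    then show ?thesis using x dC_0 d_0 \<Phi>_bij[OF q] by (auto simp: bij_betw_def)
  next
    case (Suc p)
    have "dC q x \<in> C p" using dC_mem x Suc by simp
    then have "\<Phi> p (dC q x) = \<Phi> p 0 \<longleftrightarrow> dC q x = 0"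
      using inj_onD[OF bij_betw_imp_inj_on[OF \<Phi>_bij[of p]], of "dC q x" 0] subspace_0[OF subspace_C] q Suc by auto
    moreover have "\<Phi> p 0 = 0" by (simp only: \<Phi>_def tensor_map_zero)
    ultimately show ?thesis using \<Phi>_dC[of p x] x q Suc by simp
  qed
  moreover have "D q = \<Phi> q ` C q" using \<Phi>_bij[OF q] by (simp add: bij_betw_def)
  ultimately show ?thesis unfolding cycles_def by auto
qed

lemma \<Phi>_boundaries: "Suc q < a \<Longrightarrow> \<Phi> q ` boundaries C dC q = boundaries D d q"
proof -
  assume q: "Suc q < a"
  have "D (Suc q) = \<Phi> (Suc q) ` C (Suc q)" using \<Phi>_bij[OF q] by (simp add: bij_betw_def)
  then show ?thesis
    unfolding boundaries_def using \<Phi>_dC[OF q] by (simp add: image_image cong: image_cong)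
qed

lemma boundaries_C: "boundaries C dC q \<subseteq> C q" "subspace (boundaries C dC q)"
  using dC_mem linear_subspace_image[OF linear_tensor_map subspace_C[of "Suc q"]]
  by (auto simp: boundaries_def dC_def)

lemma linear_\<Phi>: "linear (\<Phi> q)"
  unfolding \<Phi>_def by (rule linear_tensor_map)

lemmas transfer = homology_basis_transfer[OF linear_\<Phi> subspace_C bij_betw_imp_inj_on[OF \<Phi>_bij] \<Phi>_cycles \<Phi>_boundaries boundaries_C]

abbreviation "HC q \<equiv> complex_homology GC bC (int q)"
text \<open>The quotient map from cycles to homology; composed with the inverse of
  \<open>\<eta>\<close> it becomes the map \<open>\<kappa>\<close> of
  \<open>split_complex_ex\<close>.\<close>

definition "cokernel_class q x = imC q #>\<^bsub>subgroup_generated (GC (int q)) (kerC q)\<^esub> x"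

lemma subgroup_kerC: "subgroup (kerC q) (GC (int q))"
  using bC groups by (intro group_hom.subgroup_kernel) (simp add: group_hom_def group_hom_axioms_def)

lemma carrier_kerC: "carrier (subgroup_generated (GC (int q)) (kerC q)) = kerC q"
  by (rule subgroup.carrier_subgroup_generated_subgroup[OF subgroup_kerC])

lemma imC_normal: "imC q \<lhd> subgroup_generated (GC (int q)) (kerC q)"
proof -
  have "subgroup (imC q) (GC (int q))"
    using group_hom.img_is_subgroup[of "GC (int q + 1)" "GC (int q)" "bC (int q + 1)"] bC[of "int q + 1"] groups
    by (simp add: group_hom_def group_hom_axioms_def)
  moreover have "imC q \<subseteq> kerC q"
    using bC[of "int q + 1"] bCbC[of _ "int q"] by (auto simp: kernel_def dest!: hom_in_carrier)
  ultimately have "subgroup (imC q) (subgroup_generated (GC (int q)) (kerC q))"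
    using group.subgroup_subgroup_generated_iff[OF groups(2)] carrier_kerC by metis
  then show ?thesis
    using comm_group.normal_iff_subgroup[OF group.abelian_subgroup_generated[OF groups(2) cgC]] by blast
qed

lemma comm_group_HC: "comm_group (HC q)"
  unfolding complex_homology_def
  by (rule comm_group.abelian_FactGroup[OF group.abelian_subgroup_generated[OF groups(2) cgC]])
    (use imC_normal normal_imp_subgroup in blast)

lemma cokernel_class:
  "cokernel_class q \<in> hom (subgroup_generated (GC (int q)) (kerC q)) (HC q)"
  "cokernel_class q ` kerC q = carrier (HC q)"
  "z \<in> kerC q \<Longrightarrow> cokernel_class q z = \<one>\<^bsub>HC q\<^esub> \<longleftrightarrow> z \<in> imC q"
proof -
  interpret N: normal "imC q" "subgroup_generated (GC (int q)) (kerC q)" by (rule imC_normal)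
  show "cokernel_class q \<in> hom (subgroup_generated (GC (int q)) (kerC q)) (HC q)"
    unfolding complex_homology_def cokernel_class_def[abs_def] by (rule N.r_coset_hom_Mod)
  show "cokernel_class q ` kerC q = carrier (HC q)"
    unfolding complex_homology_def cokernel_class_def[abs_def] FactGroup_def RCOSETS_def
    by (auto simp: carrier_kerC)
  assume z: "z \<in> kerC q"
  show "cokernel_class q z = \<one>\<^bsub>HC q\<^esub> \<longleftrightarrow> z \<in> imC q"
    using z N.rcos_self[OF _ normal_imp_subgroup[OF imC_normal], of z] N.rcos_const[of z] carrier_kerC
    by (auto simp: complex_homology_def cokernel_class_def FactGroup_def N.is_group)
qed

text \<open>A homology class is a coset, that is a set of cycles, so whatever element is picked from
  it represents it. The standard basis makes its choice in this way.\<close>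

lemma cokernel_class_some:
  assumes "u \<in> carrier (HC q)"
  shows "(SOME z. z \<in> u) \<in> kerC q" "cokernel_class q (SOME z. z \<in> u) = u"
proof -
  interpret N: normal "imC q" "subgroup_generated (GC (int q)) (kerC q)" by (rule imC_normal)
  obtain x where x: "x \<in> kerC q" "u = cokernel_class q x"
    using assms cokernel_class(2) by blast
  have "x \<in> u" using x N.rcos_self[OF _ normal_imp_subgroup[OF imC_normal], of x] carrier_kerC by (simp add: cokernel_class_def)
  then have s: "(SOME z. z \<in> u) \<in> u" by (rule someI)
  have "u \<subseteq> kerC q"
    using x N.r_coset_subset_G[of "imC q" x] N.subset carrier_kerC by (simp add: cokernel_class_def)
  with s show k: "(SOME z. z \<in> u) \<in> kerC q" by blast
  have "imC q #>\<^bsub>subgroup_generated (GC (int q)) (kerC q)\<^esub> x = imC q #>\<^bsub>subgroup_generated (GC (int q)) (kerC q)\<^esub> (SOME z. z \<in> u)"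
    using s x carrier_kerC N.repr_independence[of "SOME z. z \<in> u" "imC q" x] N.is_subgroup
    by (simp add: cokernel_class_def)
  then show "cokernel_class q (SOME z. z \<in> u) = u"
    using x by (simp add: cokernel_class_def)
qed

definition std_basis :: "nat \<Rightarrow> ('v, 'k) tensor set list \<Rightarrow> bool" where
  "std_basis q ns \<longleftrightarrow> (\<exists>us. free_part_basis (HC q) us \<and>
      ns = [homology_class C dC q (pure_tensor (GC (int q)) v (SOME z. z \<in> u)). u \<leftarrow> us, v \<leftarrow> vs])"

definition Ih :: "(nat \<Rightarrow> ('v, 'k) tensor set list) \<Rightarrow> nat \<Rightarrow> ('v, 'g) tensor set list" where
  "Ih h q = (if q + 2 \<le> a then map (image (\<Phi> q)) (h q) else [])"

text \<open>The chosen representatives of the standard basis, carried over by \<open>\<eta>\<close>,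
  serve as \<open>lam\<close>. Then the coordinates of \<open>h\<close> modulo boundaries form the
  matrix from \<open>n\<close> to \<open>h\<close>, and the remaining determinant is the power of
  the torsion order.\<close>

theorem torsion_formula:
  assumes n: "\<And>q. std_basis q (n q)" and h: "\<And>q. homology_basis C dC q (h q)"
  shows "\<And>q. homology_basis D d q (Ih h q)"
    and "\<And>ss. (\<And>q. int_basis (G (int q)) (carrier (G (int q))) (ss q)) \<Longrightarrow>
      (\<exists>!t. torsion_value D d (\<lambda>q. tensor_basis (G (int q)) vs (ss q)) (Ih h) t) \<and>
      R_torsion D d (\<lambda>q. tensor_basis (G (int q)) vs (ss q)) (Ih h) =
        (\<Prod>q | q + 2 \<le> a. \<bar>det (homology_base_change C dC q (h q) (n q))\<bar> powi ((-1) ^ q)) *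
        (\<Prod>q | q + 2 \<le> a. (real (card (torsion_subgroup (HC q))) ^ length vs) powi ((-1) ^ q))"
proof -
  have "\<forall>q. \<exists>us. free_part_basis (HC q) us \<and>
      n q = [homology_class C dC q (pure_tensor (GC (int q)) v (SOME z. z \<in> u)). u \<leftarrow> us, v \<leftarrow> vs]"
    using n unfolding std_basis_def by simp
  from choice[OF this] obtain us where "\<forall>q. free_part_basis (HC q) (us q) \<and>
      n q = [homology_class C dC q (pure_tensor (GC (int q)) v (SOME z. z \<in> u)). u \<leftarrow> us q, v \<leftarrow> vs]" ..
  then have us: "\<And>q. free_part_basis (HC q) (us q)"
    and ns: "\<And>q. n q = [homology_class C dC q (pure_tensor (GC (int q)) v (SOME z. z \<in> u)). u \<leftarrow> us q, v \<leftarrow> vs]"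
    by simp_all
  define reps where "reps = (\<lambda>q. map (\<lambda>u. SOME z. z \<in> u) (us q))"
  have usH: "set (us q) \<subseteq> carrier (HC q)" for q using us by (simp add: free_part_basis_def)
  have reps: "set (reps q) \<subseteq> kerC q" "map (cokernel_class q) (reps q) = us q" for q
    using usH[of q] cokernel_class_some[of _ q] by (auto simp: reps_def intro!: map_idI)
  have repsG: "set (reps q) \<subseteq> carrier (GC (int q))" for q using reps(1)[of q] by (auto simp: kernel_def)
  have kC: "kerC q \<subseteq> carrier (GC (int q))" for q by (auto simp: kernel_def)
  \<comment> \<open>Outside \<open>q + 2 \<le> a\<close> the list is empty, and homology is modelled
    by a group with one element.\<close>
  define lam where "lam = (\<lambda>q. if q + 2 \<le> a then map (\<eta> (int q)) (reps q) else [])"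
  define \<iota> where "\<iota> = (\<lambda>q. inv_into (carrier (GC (int q))) (\<eta> (int q)))"
  define \<kappa> where "\<kappa> = (\<lambda>q x. if q + 2 \<le> a then cokernel_class q (\<iota> q x) else undefined)"
  define H where "H = (\<lambda>q. if q + 2 \<le> a then HC q else singleton_group undefined)"
  have \<iota>\<eta>: "\<iota> q (\<eta> (int q) x) = x" if "q < a" "x \<in> carrier (GC (int q))" for q x
    using \<eta>_bij[OF that(1)] that(2) by (simp add: \<iota>_def bij_betw_inv_into_left)
  have Hcg: "comm_group (H q)" for q
    by (simp add: H_def comm_group_HC singleton_abelian_group)
  have kerJ: "carrier (subgroup_generated (G (int q)) (kerJ q)) = kerJ q" for q
    using bd groups
    by (intro subgroup.carrier_subgroup_generated_subgroup group_hom.subgroup_kernel) (simp add: group_hom_def group_hom_axioms_def)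
  have \<kappa>1: "\<kappa> q \<in> hom (subgroup_generated (G (int q)) (kerJ q)) (H q)"
    and \<kappa>2: "\<kappa> q ` kerJ q = carrier (H q)"
    and \<kappa>3: "z \<in> kerJ q \<Longrightarrow> \<kappa> q z = \<one>\<^bsub>H q\<^esub> \<longleftrightarrow> z \<in> bd (int q + 1) ` carrier (G (int q + 1))" for q z
  proof -
    have "\<one>\<^bsub>G (int q)\<^esub> \<in> kerJ q"
      using hom_one[OF bd groups(1) groups(1)] monoid.one_closed[OF group.is_monoid[OF groups(1)]] by (simp add: kernel_def)
    then have ne: "kerJ q \<noteq> {}" by blast
    have z: "\<iota> q z \<in> kerC q \<and> \<eta> (int q) (\<iota> q z) = z" if "z \<in> kerJ q" "q + 2 \<le> a" for z
    proof -
      have "z \<in> \<eta> (int q) ` kerC q" using \<eta>_kernel[of q] that by simp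
      then obtain x where "x \<in> kerC q" "z = \<eta> (int q) x" by blast
      moreover from this have "x \<in> carrier (GC (int q))" using kC by blast
      ultimately show ?thesis using \<iota>\<eta>[of q x] that(2) by auto
    qed
    show "\<kappa> q \<in> hom (subgroup_generated (G (int q)) (kerJ q)) (H q)"
    proof (cases "q + 2 \<le> a")
      case True
      show ?thesis
      proof (rule homI)
        fix x y assume xy: "x \<in> carrier (subgroup_generated (G (int q)) (kerJ q))" "y \<in> carrier (subgroup_generated (G (int q)) (kerJ q))"
        then have xyk: "x \<in> kerJ q" "y \<in> kerJ q" using kerJ by auto
        note xz = z[OF xyk(1) True] z[OF xyk(2) True]
        show "\<kappa> q x \<in> carrier (H q)"
          using cokernel_class(2)[of q] xz True by (auto simp: \<kappa>_def H_def)
        have "\<eta> (int q) (\<iota> q x \<otimes>\<^bsub>GC (int q)\<^esub> \<iota> q y) = x \<otimes>\<^bsub>G (int q)\<^esub> y"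
          using hom_mult[OF \<eta>_hom[of q], of "\<iota> q x" "\<iota> q y"] xz kC[of q] True by (simp add: subset_iff)
        then have "\<iota> q (x \<otimes>\<^bsub>G (int q)\<^esub> y) = \<iota> q x \<otimes>\<^bsub>GC (int q)\<^esub> \<iota> q y"
          using \<iota>\<eta>[of q "\<iota> q x \<otimes>\<^bsub>GC (int q)\<^esub> \<iota> q y"] True
            subsetD[OF kC[of q] subgroup.m_closed[OF subgroup_kerC conjunct1[OF xz(1)] conjunct1[OF xz(2)]]] by simp
        then show "\<kappa> q (x \<otimes>\<^bsub>subgroup_generated (G (int q)) (kerJ q)\<^esub> y) = \<kappa> q x \<otimes>\<^bsub>H q\<^esub> \<kappa> q y"
          using hom_mult[OF cokernel_class(1)[of q]] xz True by (simp add: \<kappa>_def H_def carrier_kerC)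
      qed
    qed (auto simp: \<kappa>_def H_def hom_def singleton_group_def)
    show "\<kappa> q ` kerJ q = carrier (H q)"
    proof (cases "q + 2 \<le> a")
      case True
      have "\<kappa> q ` kerJ q = cokernel_class q ` \<iota> q ` \<eta> (int q) ` kerC q"
        using True \<eta>_kernel[of q] by (auto simp: \<kappa>_def image_image)
      also have "\<iota> q ` \<eta> (int q) ` kerC q = kerC q"
        using \<iota>\<eta>[of q] kC True by (force simp: image_image)
      finally show ?thesis using True by (simp add: H_def cokernel_class(2))
    qed (use ne in \<open>auto simp: \<kappa>_def H_def\<close>)
    show "\<kappa> q z = \<one>\<^bsub>H q\<^esub> \<longleftrightarrow> z \<in> bd (int q + 1) ` carrier (G (int q + 1))" if zk: "z \<in> kerJ q"
    proof (cases "q + 2 \<le> a")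
      case True
      note zz = z[OF zk True]
      have "z \<in> imJ q \<longleftrightarrow> \<iota> q z \<in> imC q"
      proof
        assume "z \<in> imJ q"
        then have "z \<in> \<eta> (int q) ` imC q" using \<eta>_image[of q] True by simp
        then obtain x where x: "x \<in> imC q" "z = \<eta> (int q) x" by blast
        moreover have "x \<in> carrier (GC (int q))" using x(1) hom_in_carrier[OF bC[of "int q + 1"]] by auto
        ultimately show "\<iota> q z \<in> imC q" using \<iota>\<eta>[of q x] True by simp
      next
        assume "\<iota> q z \<in> imC q"
        then have "\<eta> (int q) (\<iota> q z) \<in> \<eta> (int q) ` imC q" by (rule imageI)
        then show "z \<in> imJ q" using zz \<eta>_image[of q] True by simp
      qed
      then show ?thesis using True cokernel_class(3)[of "\<iota> q z" q] zz by (simp add: \<kappa>_def H_def)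
    next
      case False
      then show ?thesis using exact[of q] zk by (auto simp: \<kappa>_def H_def singleton_group_def)
    qed
  qed
  have lam1: "set (lam q) \<subseteq> kerJ q" for q
  proof (cases "q + 2 \<le> a")
    case True
    then have "\<eta> (int q) ` set (reps q) \<subseteq> kerJ q"
      using \<eta>_kernel[of q] image_mono[OF reps(1)[of q], of "\<eta> (int q)"] by simp
    then show ?thesis using True by (simp add: lam_def)
  qed (simp add: lam_def)
  have lam2: "free_part_basis (H q) (map (\<kappa> q) (lam q))" for q
  proof (cases "q + 2 \<le> a")
    case True
    have "map (\<kappa> q) (lam q) = map (cokernel_class q) (reps q)"
      using True \<iota>\<eta>[of q] repsG[of q] by (auto simp: lam_def \<kappa>_def)
    then show ?thesis using us reps(2) True by (simp add: H_def)
  qed (simp add: lam_def H_def free_part_basis_trivial)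
  obtain b0 where sc: "split_complex D d b0 (\<lambda>q. tensor_basis (G (int q)) vs (lam q))"
    and pos: "\<And>q. card (torsion_subgroup (H q)) > 0"
    and det: "\<And>q ss. int_basis (G (int q)) (carrier (G (int q))) ss \<Longrightarrow>
       \<bar>det (base_change {0} (map (d (Suc q)) (b0 (Suc q)) @ tensor_basis (G (int q)) vs (lam q) @ b0 q)
          (tensor_basis (G (int q)) vs ss))\<bar> = real (card (torsion_subgroup (H q))) ^ length vs"
    using split_complex_ex[OF Hcg \<kappa>1 \<kappa>2 \<kappa>3 lam1 lam2] by blast
  interpret S: split_complex D d b0 "\<lambda>q. tensor_basis (G (int q)) vs (lam q)" by (rule sc)
  let ?l0 = "\<lambda>q. tensor_basis (G (int q)) vs (lam q)"
  let ?nr = "\<lambda>q. tensor_basis (GC (int q)) vs (reps q)"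
  have l0: "?l0 q = map (\<Phi> q) (?nr q)" if "q + 2 \<le> a" for q
    using tensor_map_tensor_basis[OF \<eta>_hom[of q] repsG[of q], of vs] that by (simp add: lam_def \<Phi>_def)
  have Ihb: "homology_basis D d q (Ih h q)" for q
  proof (cases "q + 2 \<le> a")
    case True
    then show ?thesis unfolding Ih_def using transfer(1)[OF _ _ _ h[of q]] by simp
  next
    case False
    then have "lam q = []" by (simp add: lam_def)
    then have "z \<in> boundaries D d q" if "z \<in> cycles D d q" for z
      using that S.cycles_eq[of z q] by (auto simp: S.boundaries_eq)
    then show ?thesis using False by (auto simp: homology_basis_def Ih_def lift_def)
  qed
  then show "\<And>q. homology_basis D d q (Ih h q)" .
  \<comment> \<open>The identity of size 0 stands for the empty homology basis from degree
    \<open>a - 1\<close> on.\<close>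
  define M where "M = (\<lambda>q. if q + 2 \<le> a then homology_base_change C dC q (h q) (n q) else 1\<^sub>m 0)"
  have nsq: "n q = map (homology_class C dC q) (?nr q)" for q
    unfolding ns tensor_basis_def reps_def by (simp add: map_concat comp_def)
  \<comment> \<open>Whatever lift is chosen, its coordinates modulo boundaries form
    \<open>M q\<close>. The matrix is defined through representatives picked by \<open>SOME\<close>,
    which differ from the ones used here by boundaries.\<close>
  have main: "length zs = length (?l0 q) \<and> M q \<in> carrier_mat (length (?l0 q)) (length (?l0 q)) \<and>
       (\<forall>j<length (?l0 q). zs ! j - list_comb (?l0 q) (\<lambda>i. M q $$ (i, j)) \<in> boundaries D d q)"
    if zs: "lift zs (Ih h q)" for q zs
  proof (cases "q + 2 \<le> a")
    case False
    then show ?thesis using zs by (simp add: Ih_def lift_def M_def lam_def)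
  next
    case True
    then have qa: "q < a" "Suc q < a" by auto
    note tr = transfer[OF qa(1) qa(1) qa(2) h[of q]]
    have lin: "linear (\<Phi> q)" unfolding \<Phi>_def by (rule linear_tensor_map)
    have \<Phi>c: "\<Phi> q (list_comb xs f) = list_comb (map (\<Phi> q) xs) f" for xs f
      unfolding \<Phi>_def by (rule tensor_map_list_comb)
    let ?B = "boundaries C dC q" and ?m = "length (?l0 q)"
    have len: "length zs = ?m" by (rule S.homology_basis_length[OF Ihb zs])
    have nrC: "set (?nr q) \<subseteq> C q" unfolding C_def by (rule tensor_basis_mem[OF repsG])
    have lnr: "length (?nr q) = ?m" using True by (simp add: lam_def)
    obtain zs' where zs': "lift zs' (h q)" "zs = map (\<Phi> q) zs'"
      using tr(2)[of zs] zs True by (auto simp: Ih_def)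
    define hr where "hr = map (\<lambda>C. SOME z. z \<in> C) (h q)"
    define nr' where "nr' = map (\<lambda>C. SOME z. z \<in> C) (n q)"
    have hne: "k \<noteq> {}" if k: "k \<in> set (h q)" for k
    proof -
      obtain zs where "lift zs (h q)" using tr(4) by blast
      moreover obtain i where "i < length (h q)" "k = h q ! i" using k by (auto simp: in_set_conv_nth)
      ultimately have "zs ! i \<in> k" by (auto simp: lift_def list_all2_conv_all_nth)
      then show ?thesis by blast
    qed
    have lhr: "lift hr (h q)"
      unfolding lift_def hr_def list_all2_conv_all_nth using hne by (auto intro!: some_in_eq[THEN iffD2])
    have hrC: "set hr \<subseteq> C q" by (rule tr(3)[OF lhr])
    have lenh: "length (h q) = ?m" "length hr = ?m" "length zs' = ?m"
      using len zs' by (auto simp: hr_def lift_def dest: list_all2_lengthD)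
    have lnr': "length nr' = ?m" unfolding nr'_def nsq by (simp only: length_map lnr)
    have nr': "nr' ! i - ?nr q ! i \<in> ?B" if i: "i < ?m" for i
    proof -
      have "?nr q ! i \<in> homology_class C dC q (?nr q ! i)"
        unfolding homology_class_def by (rule image_eqI[OF _ subspace_0[OF boundaries_C(2)]]) simp
      then have "(SOME z. z \<in> homology_class C dC q (?nr q ! i)) \<in> homology_class C dC q (?nr q ! i)"
        by (rule someI[where P = "\<lambda>z. z \<in> homology_class C dC q (?nr q ! i)"])
      moreover have "nr' ! i = (SOME z. z \<in> homology_class C dC q (?nr q ! i))"
      proof -
        have "i < length (?nr q)" using i lnr by (simp only:)
        then show ?thesis unfolding nr'_def nsq map_map by (simp only: nth_map o_apply)
      qed
      ultimately show ?thesis by (auto simp: homology_class_def)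
    qed
    have nr'c: "list_comb nr' f - list_comb (?nr q) f \<in> ?B" for f
    proof -
      have "list_comb nr' f - list_comb (?nr q) f = (\<Sum>i<?m. f i *\<^sub>R (nr' ! i - ?nr q ! i))"
        unfolding list_comb_def lnr lnr' by (simp only: scaleR_diff_right sum_subtractf)
      also have "\<dots> \<in> ?B" using nr' by (intro subspace_sum[OF boundaries_C(2)] subspace_scale[OF boundaries_C(2)]) auto
      finally show ?thesis .
    qed
    have nrc: "list_comb (?nr q) f \<in> C q" for f by (rule list_comb_mem[OF subspace_C nrC])
    \<comment> \<open>Independence modulo boundaries is inherited from the other complex, where the
      image of \<open>?nr q\<close> is a block of the reference basis.\<close>
    have indep: "\<forall>i<length nr'. g i = 0" if g: "list_comb nr' g \<in> ?B" for g
    proof -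
      have "list_comb (?nr q) g \<in> ?B"
        using subspace_diff[OF boundaries_C(2) g nr'c[of g]] by simp
      then have "\<Phi> q (list_comb (?nr q) g) \<in> boundaries D d q" using tr(5)[OF nrc] by simp
      then have "list_comb (?l0 q) g \<in> boundaries D d q" using \<Phi>c l0[OF True] by simp
      then have "list_comb (S.db (Suc q)) (\<lambda>_. 0) + list_comb (?l0 q) g - list_comb (?l0 q) (\<lambda>_. 0) \<in> boundaries D d q"
        by simp
      then show ?thesis using S.cycles_minus_boundary_iff[OF refl, of q "\<lambda>_. 0" g "\<lambda>_. 0"] lnr' by auto
    qed
    \<comment> \<open>Representatives are exchanged modulo boundaries one after another:
      \<open>zs' ! j\<close> for \<open>hr ! j\<close>, then for \<open>z\<close>, then for
      combinations of \<open>?nr q\<close> and of \<open>nr'\<close>.\<close>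
    have col: "zs ! j - list_comb (?l0 q) (\<lambda>i. M q $$ (i, j)) \<in> boundaries D d q" if j: "j < ?m" for j
    proof -
      have hrj: "hr ! j \<in> h q ! j" "zs' ! j \<in> h q ! j"
        using lhr zs'(1) j lenh by (auto simp: lift_def list_all2_conv_all_nth)
      obtain z where z: "z \<in> cycles C dC q" "h q ! j = homology_class C dC q z"
      proof -
        have "h q ! j \<in> set (h q)" using j lenh(1) by simp
        then have "h q ! j \<in> homology_class C dC q ` cycles C dC q"
          using h[of q] unfolding homology_basis_def by blast
        then show ?thesis using that by (elim imageE)
      qed
      have zh: "zs' ! j - hr ! j \<in> ?B" "hr ! j - z \<in> ?B"
        using hrj subspace_diff[OF boundaries_C(2)] unfolding z(2) homology_class_def by auto
      have zC: "z \<in> C q" "hr ! j \<in> C q" "zs' ! j \<in> C q"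
        using z(1) hrC tr(3)[OF zs'(1)] j lenh by (auto simp: cycles_def)
      have "\<Phi> q z \<in> cycles D d q" using \<Phi>_cycles[OF qa(1)] z(1) by blast
      then obtain f g where fg: "\<Phi> q z = list_comb (S.db (Suc q)) f + list_comb (?l0 q) g"
        unfolding S.cycles_eq by (elim exE)
      then have "\<Phi> q z - list_comb (?l0 q) g \<in> boundaries D d q" by (simp add: S.boundaries_eq)
      then have "\<Phi> q (z - list_comb (?nr q) g) \<in> boundaries D d q"
        using l0[OF True] \<Phi>c by (simp add: linear_diff[OF lin])
      then have zg: "z - list_comb (?nr q) g \<in> ?B"
        using tr(5) subspace_diff[OF subspace_C zC(1) nrc] by blast
      have "(hr ! j - z) + ((z - list_comb (?nr q) g) - (list_comb nr' g - list_comb (?nr q) g)) \<in> ?B"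
        by (intro subspace_add[OF boundaries_C(2)] subspace_diff[OF boundaries_C(2)] zh zg nr'c)
      then have "hr ! j - list_comb nr' g \<in> ?B" by simp
      then have "coordinates_mod ?B nr' (hr ! j) = map g [0..<length nr']"
        by (intro coordinates_mod_eqI indep boundaries_C(2))
      then have "M q $$ (i, j) = g i" if "i < ?m" for i
        using that j lenh lnr' True
        by (simp add: M_def homology_base_change_def base_change_def nr'_def[symmetric] hr_def[symmetric])
      then have "list_comb (?l0 q) (\<lambda>i. M q $$ (i, j)) = list_comb (?l0 q) g"
        by (intro list_comb_cong) auto
      moreover have "(zs' ! j - hr ! j) + ((hr ! j - z) + (z - list_comb (?nr q) g)) \<in> ?B"
        by (intro subspace_add[OF boundaries_C(2)] zh zg)
      then have "zs' ! j - list_comb (?nr q) g \<in> ?B" by simp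
      then have "\<Phi> q (zs' ! j - list_comb (?nr q) g) \<in> boundaries D d q"
        using tr(5) subspace_diff[OF subspace_C zC(3) nrc] by blast
      then have "zs ! j - list_comb (?l0 q) g \<in> boundaries D d q"
        using l0[OF True] \<Phi>c zs'(2) j lenh by (simp add: linear_diff[OF lin])
      ultimately show ?thesis by simp
    qed
    have "M q \<in> carrier_mat ?m ?m"
      using lenh lnr' True
      by (simp add: M_def homology_base_change_def base_change_def nr'_def[symmetric] hr_def[symmetric])
    then show ?thesis using len col by blast
  qed
  have lex: "\<exists>zs. lift zs (Ih h q)" for q
  proof (cases "q + 2 \<le> a")
    case True
    then have "\<exists>zs. lift zs (h q)" using transfer(4)[OF _ _ _ h[of q]] by simp
    then obtain zs where "lift zs (h q)" by blast
    then have "lift (map (\<Phi> q) zs) (Ih h q)"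
      using True by (auto simp: lift_def Ih_def list_all2_conv_all_nth)
    then show ?thesis by blast
  qed (simp add: Ih_def lift_def)
  have Mc: "M q \<in> carrier_mat (length (?l0 q)) (length (?l0 q))" for q
    using lex[of q] main by blast
  fix ss assume ss: "\<And>q. int_basis (G (int q)) (carrier (G (int q))) (ss q)"
  let ?c = "\<lambda>q. tensor_basis (G (int q)) vs (ss q)"
  let ?F = "\<lambda>q. (real (card (torsion_subgroup (H q))) ^ length vs * \<bar>det (M q)\<bar>) powi ((-1) ^ q)"
  let ?P = "(\<Prod>q | q + 2 \<le> a. \<bar>det (homology_base_change C dC q (h q) (n q))\<bar> powi ((-1) ^ q)) *
        (\<Prod>q | q + 2 \<le> a. (real (card (torsion_subgroup (HC q))) ^ length vs) powi ((-1) ^ q))"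
  have c: "real_basis (D q) (?c q)" for q
    unfolding D_def by (rule comm_group.tensor_real_basis[OF cg vs ss])
  have val: "t = ?P" if t: "torsion_value D d ?c (Ih h) t" for t
  proof -
    have "t = (\<Prod>q | D q \<noteq> {0}. ?F q)"
      using S.torsion_value_eq[OF c _ Mc t] main by (simp only: det[OF ss]) blast
    \<comment> \<open>The torsion is a product over the nonzero groups, the formula one over
      \<open>q + 2 \<le> a\<close>; in a degree that belongs to only one of these sets the factor is
      1.\<close>
    also have "\<dots> = (\<Prod>q\<in>{q. D q \<noteq> {0}} \<union> {q. q + 2 \<le> a}. ?F q)"
    proof (rule prod.mono_neutral_left)
      have "{q. q + 2 \<le> a} \<subseteq> {..a}" by auto
      then have "finite {q. q + 2 \<le> a}" using finite_subset by blast
      moreover have "finite {q. D q \<noteq> {0}}" using real_complex_D by (simp add: real_complex_def)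
      ultimately show "finite ({q. D q \<noteq> {0}} \<union> {q. q + 2 \<le> a})" by simp
      show "\<forall>i\<in>{q. D q \<noteq> {0}} \<union> {q. q + 2 \<le> a} - {q. D q \<noteq> {0}}. ?F i = 1"
      proof
        fix i assume "i \<in> {q. D q \<noteq> {0}} \<union> {q. q + 2 \<le> a} - {q. D q \<noteq> {0}}"
        then have i: "D i = {0}" by blast
        have "?c i = []" using real_basis_singleton_0 c[of i] i by metis
        moreover have "map (d (Suc i)) (b0 (Suc i)) @ ?l0 i @ b0 i = []"
          using S.b0_trivial[OF i] by simp
        \<comment> \<open>For a zero chain group the determinant is that of an empty matrix, so the
          torsion factor is 1.\<close>
        ultimately have "real (card (torsion_subgroup (H i))) ^ length vs = 1"
          using det[OF ss, of i] by (simp add: base_change_def)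
        moreover have "det (M i) = 1" using Mc[of i] S.b0_trivial[OF i] by (simp add: det_dim_zero)
        ultimately show "?F i = 1" by simp
      qed
    qed auto
    also have "\<dots> = (\<Prod>q | q + 2 \<le> a. ?F q)"
    proof (rule prod.mono_neutral_right)
      have "{q. q + 2 \<le> a} \<subseteq> {..a}" by auto
      then have "finite {q. q + 2 \<le> a}" using finite_subset by blast
      moreover have "finite {q. D q \<noteq> {0}}" using real_complex_D by (simp add: real_complex_def)
      ultimately show "finite ({q. D q \<noteq> {0}} \<union> {q. q + 2 \<le> a})" by simp
    qed (auto simp: H_def M_def free_part_basis_trivial)
    also have "\<dots> = ?P"
      unfolding prod.distrib[symmetric]
      by (intro prod.cong) (auto simp: H_def M_def power_int_mult_distrib mult.commute)
    finally show ?thesis .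
  qed
  have "\<exists>t. torsion_value D d ?c (Ih h) t"
    by (rule S.torsion_value_ex) (rule lex)
  then obtain t where t: "torsion_value D d ?c (Ih h) t" ..
  have ex1: "\<exists>!t. torsion_value D d ?c (Ih h) t"
  proof (rule ex1I[where a = t])
    show "torsion_value D d ?c (Ih h) t" by (rule t)
    fix s assume "torsion_value D d ?c (Ih h) s"
    then show "s = t" using val[of s] val[OF t] by simp
  qed
  moreover have "R_torsion D d ?c (Ih h) = ?P"
    unfolding R_torsion_def using t val by (intro the_equality) auto
  ultimately show "(\<exists>!t. torsion_value D d ?c (Ih h) t) \<and> R_torsion D d ?c (Ih h) = ?P" by blast
qed

end

section \<open>The homology of an attached cell\<close>

text \<open>Two out of three for isomorphisms; the next lemma cancels on the other side.\<close>

lemma iso_cancel_left: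
  assumes g: "g \<in> iso B C" and h: "h \<in> iso A C" and f: "f \<in> hom A B"
    and e: "\<And>x. x \<in> carrier A \<Longrightarrow> g (f x) = h x"
  shows "f \<in> iso A B"
proof -
  have gb: "bij_betw g (carrier B) (carrier C)" and hb: "bij_betw h (carrier A) (carrier C)"
    using g h by (auto simp: iso_def)
  have "bij_betw (inv_into (carrier B) g \<circ> h) (carrier A) (carrier B)"
    by (rule bij_betw_trans[OF hb bij_betw_inv_into[OF gb]])
  moreover have "(inv_into (carrier B) g \<circ> h) x = f x" if "x \<in> carrier A" for x
    using that e[OF that] bij_betw_inv_into_left[OF gb hom_in_carrier[OF f that]] by simp
  ultimately have "bij_betw f (carrier A) (carrier B)"
    using bij_betw_cong by metis
  with f show ?thesis by (simp add: iso_def)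
qed

lemma iso_cancel_right:
  assumes f: "f \<in> iso A B" and h: "h \<in> iso A C" and g: "g \<in> hom B C"
    and e: "\<And>x. x \<in> carrier A \<Longrightarrow> g (f x) = h x"
  shows "g \<in> iso B C"
proof -
  have fb: "bij_betw f (carrier A) (carrier B)" and hb: "bij_betw h (carrier A) (carrier C)"
    using f h by (auto simp: iso_def)
  have "bij_betw (h \<circ> inv_into (carrier A) f) (carrier B) (carrier C)"
    by (rule bij_betw_trans[OF bij_betw_inv_into[OF fb] hb])
  moreover have "(h \<circ> inv_into (carrier A) f) y = g y" if y: "y \<in> carrier B" for y
  proof -
    have "inv_into (carrier A) f y \<in> carrier A" "f (inv_into (carrier A) f y) = y"
      using y fb bij_betw_inv_into_right[OF fb y] bij_betwE[OF bij_betw_inv_into[OF fb]] by auto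
    then show ?thesis using e[of "inv_into (carrier A) f y"] by simp
  qed
  ultimately have "bij_betw g (carrier B) (carrier C)"
    using bij_betw_cong by metis
  with g show ?thesis by (simp add: iso_def)
qed

section \<open>Balls and spheres in coordinates\<close>

definition ball_norm :: "nat \<Rightarrow> (nat \<Rightarrow> real) \<Rightarrow> real" where
  "ball_norm q x = sqrt (\<Sum>i<q. (x i)\<^sup>2)"

lemma ball_norm_nonneg [simp]: "0 \<le> ball_norm q x"
  by (simp add: ball_norm_def sum_nonneg)

lemma ball_norm_scale: "ball_norm q (\<lambda>i. c * x i) = \<bar>c\<bar> * ball_norm q x"
  by (simp add: ball_norm_def power_mult_distrib real_sqrt_mult flip: sum_distrib_left)

lemma topspace_cell_ball: "topspace (cell_ball q) = {x. (\<forall>i\<ge>q. x i = 0) \<and> ball_norm q x \<le> 1}"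
  by (auto simp: cell_ball_def topspace_Euclidean_space ball_norm_def)

lemma open_cell_ball_eq: "open_cell_ball q = {x. (\<forall>i\<ge>q. x i = 0) \<and> ball_norm q x < 1}"
  by (auto simp: open_cell_ball_def topspace_Euclidean_space ball_norm_def)

text \<open>Inside the full product, continuity of maps into the ball is a matter of coordinates,
  and compactness follows from Tychonoff's theorem.\<close>

lemma cell_ball_eq: "cell_ball q = subtopology (powertop_real UNIV) (topspace (cell_ball q))"
  unfolding topspace_cell_ball
  by (auto simp: cell_ball_def Euclidean_space_def subtopology_subtopology ball_norm_def Int_def intro!: arg_cong2[of _ _ _ _ subtopology])

lemma continuous_map_into_cell_ball:
  "continuous_map X (cell_ball q) f \<longleftrightarrow>
     (\<forall>k. continuous_map X euclideanreal (\<lambda>x. f x k)) \<and> f \<in> topspace X \<rightarrow> topspace (cell_ball q)"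
  by (subst cell_ball_eq) (simp add: continuous_map_in_subtopology continuous_map_componentwise_UNIV)

lemma continuous_map_cell_ball_coordinate: "continuous_map (cell_ball q) euclideanreal (\<lambda>x. x k)"
  by (subst cell_ball_eq) (intro continuous_map_from_subtopology continuous_map_product_projection, simp)

lemma continuous_map_ball_norm:
  assumes "\<And>k. continuous_map X euclideanreal (\<lambda>x. f x k)"
  shows "continuous_map X euclideanreal (\<lambda>x. ball_norm q (f x))"
proof -
  have "continuous_map X euclideanreal (\<lambda>x. \<Sum>i<q. (f x i)\<^sup>2)"
    using assms by (intro continuous_map_sum continuous_map_real_pow) auto
  from continuous_map_compose[OF this, of euclideanreal sqrt] show ?thesis
    by (simp add: ball_norm_def comp_def continuous_on_real_sqrt)
qed

lemma compact_space_cell_ball: "compact_space (cell_ball q)"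
proof -
  let ?S = "topspace (cell_ball q)"
  have "closed {x :: nat \<Rightarrow> real. (\<Sum>i<q. (x i)\<^sup>2) \<le> 1}"
    by (intro closed_Collect_le continuous_intros continuous_on_product_coordinates)
  moreover have "closed (topspace (Euclidean_space q))"
    using closedin_Euclidean_space[of q] by (simp add: euclidean_product_topology)
  moreover have "?S = topspace (Euclidean_space q) \<inter> {x. (\<Sum>i<q. (x i)\<^sup>2) \<le> 1}"
    by (simp add: cell_ball_def)
  ultimately have cl: "closedin (powertop_real UNIV) ?S"
    by (simp add: euclidean_product_topology closed_Int)
  have "compactin (powertop_real UNIV) (PiE UNIV (\<lambda>_. {-1..1}))"
    by (simp add: compactin_PiE)
  moreover have "?S \<subseteq> PiE UNIV (\<lambda>_. {-1..1})"
  proof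
    fix x assume x: "x \<in> ?S"
    have "x i \<in> {-1..1}" for i
    proof (cases "i < q")
      case True
      have "(x i)\<^sup>2 \<le> (\<Sum>i<q. (x i)\<^sup>2)"
        using True by (intro member_le_sum) auto
      also have "\<dots> \<le> 1" using x by (simp add: cell_ball_def)
      finally show ?thesis by (simp add: abs_square_le_1 abs_le_iff)
    qed (use x in \<open>simp add: topspace_cell_ball\<close>)
    then show "x \<in> PiE UNIV (\<lambda>_. {-1..1})" by (auto simp: PiE_iff)
  qed
  ultimately have "compactin (powertop_real UNIV) ?S"
    using cl closed_compactin by blast
  then show ?thesis
    by (subst cell_ball_eq) (simp add: compact_space_subtopology)
qed

lemma continuous_map_prod_fst_real:
  "continuous_map (prod_topology (top_of_set {0..1::real}) Z) euclideanreal fst"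
  using continuous_map_fst[of "top_of_set {0..1::real}" Z] continuous_map_into_fulltopology by blast

lemma contractible_space_cell_ball: "contractible_space (cell_ball q)"
proof -
  let ?h = "\<lambda>z :: real \<times> (nat \<Rightarrow> real). \<lambda>i. (1 - fst z) * snd z i"
  have "continuous_map (prod_topology (top_of_set {0..1::real}) (cell_ball q)) (cell_ball q) ?h"
    unfolding continuous_map_into_cell_ball
  proof (intro conjI allI Pi_I)
    fix k
    have "continuous_map (prod_topology (top_of_set {0..1::real}) (cell_ball q)) euclideanreal (\<lambda>z. snd z k)"
      using continuous_map_compose[OF continuous_map_snd continuous_map_cell_ball_coordinate[of q k]]
      by (simp add: comp_def)
    then show "continuous_map (prod_topology (top_of_set {0..1::real}) (cell_ball q)) euclideanreal (\<lambda>z. ?h z k)"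
      by (intro continuous_map_real_mult continuous_map_diff continuous_map_prod_fst_real) auto
  next
    fix z assume z: "z \<in> topspace (prod_topology (top_of_set {0..1::real}) (cell_ball q))"
    then have "(1 - fst z) * ball_norm q (snd z) \<le> 1 * 1"
      by (intro mult_mono) (auto simp: topspace_cell_ball)
    then show "?h z \<in> topspace (cell_ball q)"
      using z by (auto simp: topspace_cell_ball ball_norm_scale)
  qed
  then have "homotopic_with (\<lambda>_. True) (cell_ball q) (cell_ball q) id (\<lambda>_. (\<lambda>_. 0))"
    unfolding homotopic_with_def by (intro exI[of _ ?h]) auto
  then show ?thesis by (auto simp: contractible_space_def)
qed

abbreviation cell_sphere :: "nat \<Rightarrow> (nat \<Rightarrow> real) set" where
  "cell_sphere q \<equiv> topspace (cell_ball q) - open_cell_ball q"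

lemma cell_sphere_eq: "cell_sphere q = {x. (\<forall>i\<ge>q. x i = 0) \<and> ball_norm q x = 1}"
  by (auto simp: topspace_cell_ball open_cell_ball_eq)

lemma subtopology_cell_sphere: "subtopology (cell_ball (Suc q)) (cell_sphere (Suc q)) = nsphere q"
proof -
  have "{x. (\<Sum>i<Suc q. (x i)\<^sup>2) \<le> 1} \<inter> {x. (\<Sum>i<Suc q. (x i)\<^sup>2) = 1} = {x. (\<Sum>i\<le>q. (x i)\<^sup>2) = (1::real)}"
    by (auto simp: lessThan_Suc_atMost)
  moreover have "cell_sphere (Suc q) = topspace (Euclidean_space (Suc q)) \<inter> {x. (\<Sum>i<Suc q. (x i)\<^sup>2) = 1}"
    unfolding cell_sphere_eq topspace_Euclidean_space by (auto simp: ball_norm_def)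
  ultimately show ?thesis
    unfolding cell_ball_def nsphere_def
    by (metis Int_assoc Int_left_commute subtopology_restrict subtopology_subtopology)
qed

lemma cell_sphere_nonempty: "cell_sphere (Suc q) \<noteq> {}"
proof -
  have "(\<lambda>i. if i = 0 then 1 else 0) \<in> cell_sphere (Suc q)"
    unfolding cell_sphere_eq
    by (auto simp: ball_norm_def if_distrib[of "\<lambda>x. x ^ 2"] cong: if_cong)
  then show ?thesis by blast
qed

text \<open>In positive dimension the ball is contractible, which leaves the reduced homology of its
  boundary sphere. In dimension 0 the sphere is empty and the dimension axiom applies.\<close>

lemma cell_homology:
  shows "relative_homology_group (int q) (cell_ball q) (cell_sphere q) \<cong> integer_group"
    and "p \<noteq> int q \<Longrightarrow> trivial_group (relative_homology_group p (cell_ball q) (cell_sphere q))"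
proof -
  have "relative_homology_group (int q) (cell_ball q) (cell_sphere q) \<cong> integer_group \<and>
    (p \<noteq> int q \<longrightarrow> trivial_group (relative_homology_group p (cell_ball q) (cell_sphere q)))"
  proof (cases q)
    case 0
    have t: "topspace (cell_ball 0) = {\<lambda>_. 0}" by (auto simp: topspace_cell_ball ball_norm_def)
    moreover have "cell_sphere 0 = {}" by (auto simp: cell_sphere_eq ball_norm_def)
    ultimately show ?thesis
      using 0 homology_coefficients[OF t] homology_dimension_axiom[OF t] by simp
  next
    case (Suc n)
    have i: "relative_homology_group r (cell_ball q) (cell_sphere q) \<cong> reduced_homology_group (r - 1) (nsphere n)" for r
      using isomorphic_group_relative_homology_of_contractible[OF contractible_space_cell_ball, of q "cell_sphere q" r]
        cell_sphere_nonempty[of n] subtopology_cell_sphere[of n] Suc by (simp add: Int_absorb1 Diff_subset)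
    have "relative_homology_group (int q) (cell_ball q) (cell_sphere q) \<cong> reduced_homology_group (int n) (nsphere n)"
      using i[of "int q"] Suc by simp
    then have "relative_homology_group (int q) (cell_ball q) (cell_sphere q) \<cong> integer_group"
      using iso_trans reduced_homology_group_nsphere(1) by blast
    moreover have "trivial_group (relative_homology_group p (cell_ball q) (cell_sphere q))" if "p \<noteq> int q"
      using isomorphic_group_triviality[OF i[of p]] reduced_homology_group_nsphere(2)[of "p - 1" n] that Suc by simp
    ultimately show ?thesis by blast
  qed
  then show "relative_homology_group (int q) (cell_ball q) (cell_sphere q) \<cong> integer_group"
    "p \<noteq> int q \<Longrightarrow> trivial_group (relative_homology_group p (cell_ball q) (cell_sphere q))" by auto
qed

text \<open>Radial stretching by the factor \<open>1 + t\<close>, capped so that points stop at the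
  sphere. At \<open>t = 1\<close> the factor is 2 and all points of norm at least 1/2 have arrived,
  whence the 1/2 in \<open>collar\<close>.\<close>

definition ball_push :: "nat \<Rightarrow> real \<Rightarrow> (nat \<Rightarrow> real) \<Rightarrow> nat \<Rightarrow> real" where
  "ball_push q t x = (\<lambda>i. ((1 + t) / max 1 ((1 + t) * ball_norm q x)) * x i)"

lemma ball_norm_push: "0 \<le> t \<Longrightarrow> ball_norm q (ball_push q t x) = min 1 ((1 + t) * ball_norm q x)"
  unfolding ball_push_def ball_norm_scale by (auto simp: max_def min_def)

lemma ball_push_mem: "0 \<le> t \<Longrightarrow> x \<in> topspace (cell_ball q) \<Longrightarrow> ball_push q t x \<in> topspace (cell_ball q)"
  by (simp add: topspace_cell_ball ball_norm_push) (simp add: ball_push_def)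

lemma ball_push_0: "x \<in> topspace (cell_ball q) \<Longrightarrow> ball_push q 0 x = x"
  by (auto simp: ball_push_def topspace_cell_ball max_def)

lemma ball_push_sphere: "0 \<le> t \<Longrightarrow> ball_norm q x = 1 \<Longrightarrow> ball_push q t x = x"
  by (simp add: ball_push_def max_def)

lemma ball_push_mono: "0 \<le> t \<Longrightarrow> r \<le> 1 \<Longrightarrow> r \<le> ball_norm q x \<Longrightarrow> r \<le> ball_norm q (ball_push q t x)"
  using mult_right_mono[of 1 "1 + t" "ball_norm q x"] by (simp add: ball_norm_push)

lemma continuous_map_ball_push:
  "continuous_map (prod_topology (top_of_set {0..1::real}) (cell_ball q)) (cell_ball q) (\<lambda>(t, x). ball_push q t x)"
  (is "continuous_map ?P _ _")
  unfolding continuous_map_into_cell_ball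
proof (intro conjI allI Pi_I)
  have c: "continuous_map ?P euclideanreal (\<lambda>z. snd z k)" for k
    using continuous_map_compose[OF continuous_map_snd continuous_map_cell_ball_coordinate[of q k]]
    by (simp add: comp_def)
  have n: "continuous_map ?P euclideanreal (\<lambda>z. ball_norm q (snd z))"
    by (rule continuous_map_ball_norm[OF c])
  have m: "continuous_map ?P euclideanreal (\<lambda>z. max 1 ((1 + fst z) * ball_norm q (snd z)))"
    by (intro continuous_map_real_max continuous_map_real_mult continuous_map_add n continuous_map_prod_fst_real) auto
  fix k
  show "continuous_map ?P euclideanreal (\<lambda>z. (case z of (t, x) \<Rightarrow> ball_push q t x) k)"
    unfolding ball_push_def case_prod_beta
    by (intro continuous_map_real_mult continuous_map_real_divide continuous_map_add c m continuous_map_prod_fst_real)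
      (auto simp: max_def)
qed (auto intro: ball_push_mem)

text \<open>One closed cell attached to a closed set \<open>A\<close>. The map \<open>\<phi>\<close>
  is an embedding by regularity, so the closed cell is itself a ball inside \<open>X\<close> and no
  quotient has to be formed.\<close>

locale cell_attachment =
  fixes X :: "'a topology" and A :: "'a set" and q :: nat and \<phi> :: "(nat \<Rightarrow> real) \<Rightarrow> 'a"
  assumes haus: "Hausdorff_space X" and closed: "closedin X A"
    and emb: "embedding_map (cell_ball q) X \<phi>"
    and disj: "\<phi> ` open_cell_ball q \<inter> A = {}" and sphere: "\<phi> ` cell_sphere q \<subseteq> A"
begin

definition "K = \<phi> ` topspace (cell_ball q)"
definition "\<psi> = (SOME g. homeomorphic_maps (cell_ball q) (subtopology X K) \<phi> g)"
text \<open>The set \<open>A\<close> thickened by the outer half of the cell: a neighbourhood of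
  \<open>A\<close> in \<open>Z\<close> that can be pushed back into \<open>A\<close>, as excision
  requires.\<close>

definition "collar = A \<union> \<phi> ` {x \<in> topspace (cell_ball q). 1/2 \<le> ball_norm q x}"
abbreviation "Z \<equiv> subtopology X (A \<union> K)"

lemma homeo: "homeomorphic_maps (cell_ball q) (subtopology X K) \<phi> \<psi>"
proof -
  have "homeomorphic_map (cell_ball q) (subtopology X K) \<phi>"
    using emb by (simp add: embedding_map_def K_def)
  then have "\<exists>g. homeomorphic_maps (cell_ball q) (subtopology X K) \<phi> g"
    by (simp add: homeomorphic_map_maps)
  then show ?thesis unfolding \<psi>_def by (rule someI_ex)
qed

lemma cont_\<phi>: "continuous_map (cell_ball q) X \<phi>"
  using homeo continuous_map_into_fulltopology by (auto simp: homeomorphic_maps_def)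

lemma K_sub: "K \<subseteq> topspace X"
  using continuous_map_image_subset_topspace[OF cont_\<phi>] by (simp add: K_def)

lemma A_sub: "A \<subseteq> topspace X"
  by (rule closedin_subset[OF closed])

lemma \<psi>\<phi>: "x \<in> topspace (cell_ball q) \<Longrightarrow> \<psi> (\<phi> x) = x"
  using homeo by (simp add: homeomorphic_maps_def)

lemma inj_\<phi>: "inj_on \<phi> (topspace (cell_ball q))"
  using \<psi>\<phi> by (rule inj_on_inverseI)

lemma compact_image_closed:
  assumes S: "closedin (cell_ball q) S" shows "closedin X (\<phi> ` S)"
  using image_compactin[OF closedin_compact_space[OF compact_space_cell_ball S] cont_\<phi>] haus
  by (simp add: compactin_imp_closedin)

lemma closed_K: "closedin X K"
  unfolding K_def by (rule compact_image_closed) simp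

lemma ball_split: "topspace (cell_ball q) = open_cell_ball q \<union> cell_sphere q"
  by (auto simp: topspace_cell_ball open_cell_ball_eq)

lemma K_minus_A: "(A \<union> K) - A = \<phi> ` open_cell_ball q"
proof -
  have "K = \<phi> ` open_cell_ball q \<union> \<phi> ` cell_sphere q"
    unfolding K_def image_Un[symmetric] using ball_split by simp
  then show ?thesis using disj sphere by auto
qed

text \<open>The push carried over to \<open>Z\<close> and extended by the identity on
  \<open>A\<close>. The two formulas agree where both apply, because the push fixes the
  sphere.\<close>

definition "h = (\<lambda>z :: real \<times> 'a. if snd z \<in> A then snd z else \<phi> (ball_push q (fst z) (\<psi> (snd z))))"

lemma h_\<phi>: "0 \<le> t \<Longrightarrow> x \<in> topspace (cell_ball q) \<Longrightarrow> h (t, \<phi> x) = \<phi> (ball_push q t x)"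
proof -
  assume t: "0 \<le> t" and x: "x \<in> topspace (cell_ball q)"
  show ?thesis
  proof (cases "\<phi> x \<in> A")
    case True
    then have "x \<notin> open_cell_ball q" using disj by blast
    then have "ball_norm q x = 1" using x by (auto simp: topspace_cell_ball open_cell_ball_eq)
    then show ?thesis using True ball_push_sphere[OF t] by (simp add: h_def)
  qed (simp add: h_def \<psi>\<phi> x)
qed

lemma continuous_h: "continuous_map (prod_topology (top_of_set {0..1::real}) Z) Z h"
proof (rule continuous_map_into_subtopology)
  have sZA: "subtopology Z A = subtopology X A" and sZK: "subtopology Z K = subtopology X K"
    by (auto simp: subtopology_subtopology intro!: arg_cong2[of _ _ _ _ subtopology])
  have P: "subtopology (prod_topology (top_of_set {0..1::real}) Z) ({0..1} \<times> S) =
      prod_topology (top_of_set {0..1::real}) (subtopology Z S)" for S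
    by (simp add: subtopology_Times subtopology_subtopology)
  show "continuous_map (prod_topology (top_of_set {0..1::real}) Z) X h"
  proof (rule pasting_lemma_closed[where I = "UNIV :: bool set" and T = "\<lambda>b. {0..1} \<times> (if b then A else K)"
        and f = "\<lambda>b. if b then snd else (\<lambda>z. \<phi> (ball_push q (fst z) (\<psi> (snd z))))"])
    show "closedin (prod_topology (top_of_set {0..1::real}) Z) ({0..1} \<times> (if b then A else K))" for b
      using closed closed_K by (auto simp: closedin_prod_Times_iff closedin_subtopology)
    show "continuous_map (subtopology (prod_topology (top_of_set {0..1::real}) Z) ({0..1} \<times> (if b then A else K))) X
        (if b then snd else (\<lambda>z. \<phi> (ball_push q (fst z) (\<psi> (snd z)))))" for b
    proof (cases b)
      case True
      have "continuous_map (prod_topology (top_of_set {0..1::real}) (subtopology X A)) X snd"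
        using continuous_map_snd continuous_map_into_fulltopology by blast
      then show ?thesis using True by (simp add: P sZA)
    next
      case False
      have "continuous_map (subtopology X K) (cell_ball q) \<psi>"
        using homeo by (simp add: homeomorphic_maps_def)
      then have "continuous_map (prod_topology (top_of_set {0..1::real}) (subtopology X K))
          (prod_topology (top_of_set {0..1::real}) (cell_ball q)) (\<lambda>z. (fst z, \<psi> (snd z)))"
        using continuous_map_compose[OF continuous_map_snd, of "subtopology X K" "cell_ball q" \<psi> "top_of_set {0..1::real}"]
        by (intro continuous_map_pairedI continuous_map_fst) (simp add: comp_def)
      from continuous_map_compose[OF continuous_map_compose[OF this continuous_map_ball_push] cont_\<phi>]
      show ?thesis using False by (simp add: P sZK comp_def)
    qed
    show "(if i then snd else (\<lambda>z. \<phi> (ball_push q (fst z) (\<psi> (snd z))))) x =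
        (if j then snd else (\<lambda>z. \<phi> (ball_push q (fst z) (\<psi> (snd z))))) x"
      if "x \<in> topspace (prod_topology (top_of_set {0..1::real}) Z) \<inter> ({0..1} \<times> (if i then A else K)) \<inter> ({0..1} \<times> (if j then A else K))" for i j x
    proof -
      have *: "\<phi> (ball_push q (fst x) (\<psi> (snd x))) = snd x" if "snd x \<in> A" "snd x \<in> K" "0 \<le> fst x"
      proof -
        obtain y where y: "y \<in> topspace (cell_ball q)" "snd x = \<phi> y" using \<open>snd x \<in> K\<close> by (auto simp: K_def)
        then have "h (fst x, \<phi> y) = snd x" using \<open>snd x \<in> A\<close> by (simp add: h_def)
        then show ?thesis using h_\<phi>[OF \<open>0 \<le> fst x\<close> y(1)] y by (simp add: \<psi>\<phi>)
      qed
      show ?thesis using that * by (cases i; cases j) auto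
    qed
    show "\<exists>j. j \<in> UNIV \<and> x \<in> {0..1} \<times> (if j then A else K) \<and> h x = (if j then snd else (\<lambda>z. \<phi> (ball_push q (fst z) (\<psi> (snd z))))) x"
      if "x \<in> topspace (prod_topology (top_of_set {0..1::real}) Z)" for x
      using that by (intro exI[of _ "snd x \<in> A"]) (auto simp: h_def)
  qed simp
  show "h \<in> topspace (prod_topology (top_of_set {0..1::real}) Z) \<rightarrow> A \<union> K"
  proof
    fix z assume z: "z \<in> topspace (prod_topology (top_of_set {0..1::real}) Z)"
    obtain t y where ty: "z = (t, y)" "0 \<le> t" "y \<in> A \<union> K" using z by (cases z) auto
    show "h z \<in> A \<union> K"
    proof (cases "y \<in> A")
      case False
      then obtain x where "x \<in> topspace (cell_ball q)" "y = \<phi> x" using ty by (auto simp: K_def)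
      then show ?thesis using h_\<phi>[OF ty(2)] ball_push_mem[OF ty(2)] ty by (auto simp: K_def)
    qed (simp add: h_def ty)
  qed
qed

text \<open>At time 1 the homotopy takes the collar into \<open>A\<close>, and at all times it
  preserves both \<open>A\<close> and the collar; so its end map inverts the inclusion of pairs up
  to homotopy.\<close>

lemma collar_iso:
  "hom_induced p Z A Z collar id \<in> iso (relative_homology_group p Z A) (relative_homology_group p Z collar)"
proof -
  have h0: "h (0, y) = y" if y: "y \<in> topspace Z" for y
  proof (cases "y \<in> A")
    case False
    then obtain x where "x \<in> topspace (cell_ball q)" "y = \<phi> x" using y by (auto simp: K_def)
    then show ?thesis using h_\<phi>[of 0 x] by (simp add: ball_push_0)
  qed (simp add: h_def)
  have hA: "(\<lambda>y. h (t, y)) \<in> A \<rightarrow> A" for t by (simp add: h_def)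
  have hcol: "(\<lambda>y. h (t, y)) \<in> collar \<rightarrow> collar" if t: "t \<in> {0..1}" for t
  proof
    fix y assume "y \<in> collar"
    then consider "y \<in> A" | x where "x \<in> topspace (cell_ball q)" "1/2 \<le> ball_norm q x" "y = \<phi> x"
      by (auto simp: collar_def)
    then show "h (t, y) \<in> collar"
    proof cases
      case 2
      then show ?thesis using t h_\<phi>[of t x] ball_push_mem[of t x] ball_push_mono[of t "1/2" q x]
        by (auto simp: collar_def)
    qed (simp add: h_def collar_def)
  qed
  have h1: "(\<lambda>y. h (1, y)) \<in> collar \<rightarrow> A"
  proof
    fix y assume "y \<in> collar"
    then consider "y \<in> A" | x where "x \<in> topspace (cell_ball q)" "1/2 \<le> ball_norm q x" "y = \<phi> x"
      by (auto simp: collar_def)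
    then show "h (1, y) \<in> A"
    proof cases
      case 2
      then have "ball_norm q (ball_push q 1 x) = 1" by (simp add: ball_norm_push min_def)
      moreover have "ball_push q 1 x \<in> topspace (cell_ball q)" using 2 by (simp add: ball_push_mem)
      ultimately have "ball_push q 1 x \<in> cell_sphere q" unfolding cell_sphere_eq by (simp add: topspace_cell_ball)
      then show ?thesis using 2 h_\<phi>[of 1 x] sphere by auto
    qed (simp add: h_def)
  qed
  have hom: "homotopic_with P Z Z (\<lambda>y. h (1, y)) id"
    if P: "\<And>f g. (\<And>x. x \<in> topspace Z \<Longrightarrow> f x = g x) \<Longrightarrow> P f \<longleftrightarrow> P g" and Ph: "\<And>t. t \<in> {0..1} \<Longrightarrow> P (\<lambda>y. h (t, y))" for P
  proof (rule homotopic_with_symD)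
    show "homotopic_with P Z Z id (\<lambda>y. h (1, y))"
    proof (subst homotopic_with)
      show "P f \<longleftrightarrow> P g" if "\<And>x. x \<in> topspace Z \<Longrightarrow> f x = g x" for f g
        by (rule P) (rule that)
    qed (use continuous_h h0 Ph in \<open>intro exI[of _ h], auto\<close>)
  qed
  have AZ: "A \<subseteq> topspace Z" "collar \<subseteq> topspace Z"
    using A_sub K_sub by (auto simp: collar_def K_def)
  have c1: "continuous_map Z Z (\<lambda>y. h (1, y))"
    using hom[of "\<lambda>_. True"] homotopic_with_imp_continuous_maps by blast
  show ?thesis
  proof (rule homotopy_equivalence_relative_homology_group_isomorphism)
    show "homotopic_with (\<lambda>h. h \<in> A \<rightarrow> A) Z Z ((\<lambda>y. h (1, y)) \<circ> id) id"
      unfolding o_id by (rule hom[OF Pi_cong]) (use AZ hA subsetD[OF AZ(1)] in blast)+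
    show "homotopic_with (\<lambda>h. h \<in> collar \<rightarrow> collar) Z Z (id \<circ> (\<lambda>y. h (1, y))) id"
      unfolding id_o by (rule hom[OF Pi_cong]) (use hcol subsetD[OF AZ(2)] in blast)+
  qed (use c1 h1 in \<open>auto simp: collar_def\<close>)
qed

lemma collar_minus_A: "collar - A = \<phi> ` {x \<in> open_cell_ball q. 1/2 \<le> ball_norm q x}"
proof -
  have "{x \<in> topspace (cell_ball q). 1/2 \<le> ball_norm q x} =
      {x \<in> open_cell_ball q. 1/2 \<le> ball_norm q x} \<union> {x \<in> cell_sphere q. 1/2 \<le> ball_norm q x}"
    using ball_split by blast
  then have "collar = A \<union> \<phi> ` {x \<in> open_cell_ball q. 1/2 \<le> ball_norm q x} \<union> \<phi> ` {x \<in> cell_sphere q. 1/2 \<le> ball_norm q x}"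
    unfolding collar_def by (simp add: image_Un Un_assoc)
  moreover have "\<phi> ` {x \<in> cell_sphere q. 1/2 \<le> ball_norm q x} \<subseteq> A" using sphere by blast
  moreover have "\<phi> ` {x \<in> open_cell_ball q. 1/2 \<le> ball_norm q x} \<inter> A = {}" using disj by blast
  ultimately show ?thesis by blast
qed

text \<open>Excision of \<open>A\<close>: its closure lies in the interior of the collar, because
  the image of the inner half ball is compact, hence closed, and misses \<open>A\<close>.\<close>

lemma excision_iso:
  "hom_induced p (subtopology X (\<phi> ` open_cell_ball q)) (\<phi> ` {x \<in> open_cell_ball q. 1/2 \<le> ball_norm q x}) Z collar id
   \<in> iso (relative_homology_group p (subtopology X (\<phi> ` open_cell_ball q)) (\<phi> ` {x \<in> open_cell_ball q. 1/2 \<le> ball_norm q x}))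
       (relative_homology_group p Z collar)"
proof -
  have "closedin (cell_ball q) {x \<in> topspace (cell_ball q). ball_norm q x \<in> {..1/2}}"
    by (rule closedin_continuous_map_preimage[OF continuous_map_ball_norm[OF continuous_map_cell_ball_coordinate]]) simp
  then have c: "closedin X (\<phi> ` {x \<in> topspace (cell_ball q). ball_norm q x \<in> {..1/2}})" (is "closedin X ?C")
    by (rule compact_image_closed)
  have "Z closure_of A \<subseteq> Z interior_of collar"
  proof -
    have "closedin Z A" using closed by (auto simp: closedin_subtopology)
    then have "Z closure_of A = A" by (simp add: closure_of_eq)
    also have "A \<subseteq> topspace Z - ?C"
    proof -
      have "?C \<subseteq> \<phi> ` open_cell_ball q" by (auto simp: topspace_cell_ball open_cell_ball_eq)
      then show ?thesis using disj A_sub by auto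
    qed
    also have "\<dots> \<subseteq> Z interior_of collar"
    proof (rule interior_of_maximal)
      show "topspace Z - ?C \<subseteq> collar"
      proof
        fix y assume y: "y \<in> topspace Z - ?C"
        show "y \<in> collar"
        proof (cases "y \<in> A")
          case False
          then obtain x where x: "x \<in> topspace (cell_ball q)" "y = \<phi> x" using y by (auto simp: K_def)
          then have "1/2 \<le> ball_norm q x" using y by force
          then show ?thesis using x by (auto simp: collar_def)
        qed (simp add: collar_def)
      qed
      have "openin X (topspace X - ?C)" using c by (simp add: openin_diff)
      moreover have "topspace Z - ?C = (topspace X - ?C) \<inter> (A \<union> K)" by auto
      ultimately show "openin Z (topspace Z - ?C)" by (auto simp: openin_subtopology)
    qed
    finally show ?thesis .
  qed
  moreover have "collar \<subseteq> topspace Z" using A_sub K_sub by (auto simp: collar_def K_def)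
  ultimately have ex: "hom_induced p (subtopology Z (topspace Z - A)) (collar - A) (subtopology Z (topspace Z)) collar id
     \<in> iso (relative_homology_group p (subtopology Z (topspace Z - A)) (collar - A))
          (relative_homology_group p (subtopology Z (topspace Z)) collar)"
    by (rule homology_excision_axiom)
  have "topspace Z - A = \<phi> ` open_cell_ball q"
    using K_minus_A A_sub K_sub by auto
  moreover have "subtopology Z (\<phi> ` open_cell_ball q) = subtopology X (\<phi> ` open_cell_ball q)"
    unfolding subtopology_subtopology using K_minus_A by (intro arg_cong2[of _ _ _ _ subtopology]) auto
  ultimately show ?thesis
    using ex by (simp only: collar_minus_A subtopology_topspace)
qed

text \<open>The closed cell arises by attaching the cell to its own boundary, so the two preceding
  isomorphisms also apply to the closed cell.\<close>

lemma boundary_attachment: "cell_attachment X (\<phi> ` cell_sphere q) q \<phi>"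
proof
  have "openin (cell_ball q) (open_cell_ball q)"
  proof -
    have "openin (cell_ball q) {x \<in> topspace (cell_ball q). ball_norm q x \<in> {..<1}}"
      by (rule openin_continuous_map_preimage[OF continuous_map_ball_norm[OF continuous_map_cell_ball_coordinate]]) simp
    moreover have "{x \<in> topspace (cell_ball q). ball_norm q x \<in> {..<1}} = open_cell_ball q"
      by (auto simp: topspace_cell_ball open_cell_ball_eq)
    ultimately show ?thesis by simp
  qed
  then show "closedin X (\<phi> ` cell_sphere q)"
    by (intro compact_image_closed) auto
  show "\<phi> ` open_cell_ball q \<inter> \<phi> ` cell_sphere q = {}"
    using disj sphere by blast
qed (use haus emb in auto)

text \<open>Each of the two pairs is compared with its collar pair, and excision identifies both
  collar pairs with one pair inside the open cell.\<close>

theorem attach_iso: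
  "hom_induced p (subtopology X K) (\<phi> ` cell_sphere q) Z A id
   \<in> iso (relative_homology_group p (subtopology X K) (\<phi> ` cell_sphere q)) (relative_homology_group p Z A)"
proof -
  interpret B: cell_attachment X "\<phi> ` cell_sphere q" q \<phi> by (rule boundary_attachment)
  have SK: "\<phi> ` cell_sphere q \<union> K = K" by (auto simp: K_def)
  let ?e = "\<phi> ` open_cell_ball q" and ?a = "\<phi> ` {x \<in> open_cell_ball q. 1/2 \<le> ball_norm q x}"
  note Bc = B.collar_iso[of p, unfolded SK] and Be = B.excision_iso[of p, unfolded SK]
  have eK: "?e \<subseteq> K" unfolding K_def using ball_split by blast
  have "{x \<in> open_cell_ball q. 1/2 \<le> ball_norm q x} \<subseteq> {x \<in> topspace (cell_ball q). 1/2 \<le> ball_norm q x}"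
    using ball_split by blast
  then have aB: "?a \<subseteq> B.collar" unfolding B.collar_def by blast
  have colsub: "B.collar \<subseteq> collar" using sphere by (auto simp: B.collar_def collar_def)
  have j: "hom_induced p (subtopology X K) B.collar Z collar id \<in>
      iso (relative_homology_group p (subtopology X K) B.collar) (relative_homology_group p Z collar)"
  proof (rule iso_cancel_right[OF Be excision_iso[of p] hom_induced_hom])
    show "hom_induced p (subtopology X K) B.collar Z collar id (hom_induced p (subtopology X ?e) ?a (subtopology X K) B.collar id x) =
        hom_induced p (subtopology X ?e) ?a Z collar id x" for x
      using eK aB colsub
      by (subst hom_induced_compose') (auto simp: continuous_map_in_subtopology continuous_map_from_subtopology)
  qed
  have "hom_induced p (subtopology X K) B.collar Z collar id \<circ> hom_induced p (subtopology X K) (\<phi> ` cell_sphere q) (subtopology X K) B.collar id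
     \<in> iso (relative_homology_group p (subtopology X K) (\<phi> ` cell_sphere q)) (relative_homology_group p Z collar)"
    by (rule iso_set_trans[OF Bc j])
  then show ?thesis
  proof (rule iso_cancel_left[OF collar_iso[of p] _ hom_induced_hom])
    fix x
    have "hom_induced p Z A Z collar id (hom_induced p (subtopology X K) (\<phi> ` cell_sphere q) Z A id x) =
        hom_induced p (subtopology X K) (\<phi> ` cell_sphere q) Z collar id x"
      using sphere by (subst hom_induced_compose') (auto simp: continuous_map_in_subtopology continuous_map_from_subtopology collar_def)
    moreover have "hom_induced p (subtopology X K) B.collar Z collar id (hom_induced p (subtopology X K) (\<phi> ` cell_sphere q) (subtopology X K) B.collar id x) =
        hom_induced p (subtopology X K) (\<phi> ` cell_sphere q) Z collar id x"
      using colsub by (subst hom_induced_compose') (auto simp: continuous_map_in_subtopology continuous_map_from_subtopology B.collar_def)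
    ultimately show "hom_induced p Z A Z collar id (hom_induced p (subtopology X K) (\<phi> ` cell_sphere q) Z A id x) =
      (hom_induced p (subtopology X K) B.collar Z collar id \<circ> hom_induced p (subtopology X K) (\<phi> ` cell_sphere q) (subtopology X K) B.collar id) x"
      by simp
  qed
qed

lemma closed_cell_iso:
  "hom_induced p (cell_ball q) (cell_sphere q) (subtopology X K) (\<phi> ` cell_sphere q) \<phi>
   \<in> iso (relative_homology_group p (cell_ball q) (cell_sphere q)) (relative_homology_group p (subtopology X K) (\<phi> ` cell_sphere q))"
proof (rule homeomorphic_map_relative_homology_iso)
  show "homeomorphic_map (cell_ball q) (subtopology X K) \<phi>"
    using emb by (simp add: embedding_map_def K_def)
qed auto

text \<open>Every boundary point is approached along its radius. Orientations are defined through
  the topological closure of a cell, so it has to be recognised as the embedded ball.\<close>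

lemma closure_cell: "X closure_of (\<phi> ` open_cell_ball q) = K"
proof
  show "X closure_of (\<phi> ` open_cell_ball q) \<subseteq> K"
    by (rule closure_of_minimal[OF _ closed_K]) (use ball_split in \<open>unfold K_def, blast\<close>)
  show "K \<subseteq> X closure_of (\<phi> ` open_cell_ball q)"
  proof
    fix y assume "y \<in> K"
    then obtain x where x: "x \<in> topspace (cell_ball q)" "y = \<phi> x" by (auto simp: K_def)
    have xt: "(\<lambda>i. t * x i) \<in> topspace (cell_ball q)" if "t \<in> {0..1}" for t
      using x(1) that mult_mono[of t 1 "ball_norm q x" 1] by (auto simp: topspace_cell_ball ball_norm_scale)
    have "continuous_map (top_of_set {0..1::real}) (cell_ball q) (\<lambda>t i. t * x i)"
      unfolding continuous_map_into_cell_ball using xt by (auto intro!: continuous_intros)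
    then have ct: "continuous_map (top_of_set {0..1::real}) X (\<lambda>t. \<phi> (\<lambda>i. t * x i))"
      using continuous_map_compose[OF _ cont_\<phi>] by (auto simp: comp_def)
    show "y \<in> X closure_of (\<phi> ` open_cell_ball q)"
      unfolding in_closure_of
    proof (intro conjI allI impI)
      show "y \<in> topspace X" using \<open>y \<in> K\<close> K_sub by blast
      fix U assume U: "y \<in> U \<and> openin X U"
      have "openin (top_of_set {0..1::real}) {t \<in> topspace (top_of_set {0..1::real}). \<phi> (\<lambda>i. t * x i) \<in> U}"
        using openin_continuous_map_preimage[OF ct] U by blast
      then obtain V where V: "open V" "{t \<in> {0..1}. \<phi> (\<lambda>i. t * x i) \<in> U} = V \<inter> {0..1}"
        by (auto simp: openin_subtopology)
      have "1 \<in> {t \<in> {0..1}. \<phi> (\<lambda>i. t * x i) \<in> U}" using U x(2) by simp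
      then have "1 \<in> V" unfolding V(2) by blast
      then obtain d where d: "d > 0" "ball 1 d \<subseteq> V" using V(1) open_contains_ball by blast
      \<comment> \<open>A parameter below 1 and within \<open>d\<close> of 1; the maximum keeps it
        in the unit interval.\<close>
      define t where "t = max 0 (1 - d / 2)"
      have t: "t \<in> {0..1}" "t < 1" "t \<in> ball 1 d" using d(1) by (auto simp: t_def dist_real_def max_def)
      then have "t \<in> V \<inter> {0..1}" using d(2) by blast
      then have "\<phi> (\<lambda>i. t * x i) \<in> U" unfolding V(2)[symmetric] by blast
      moreover have "t * ball_norm q x < 1"
        using t x(1) mult_left_mono[of "ball_norm q x" 1 t] by (auto simp: topspace_cell_ball)
      then have "(\<lambda>i. t * x i) \<in> open_cell_ball q"
        using xt[OF t(1)] t(1) by (auto simp: open_cell_ball_eq topspace_cell_ball ball_norm_scale)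
      ultimately show "\<exists>y. y \<in> \<phi> ` open_cell_ball q \<and> y \<in> U" by blast
    qed
  qed
qed

lemma K_minus_cell: "K - \<phi> ` open_cell_ball q = \<phi> ` cell_sphere q"
  using disj sphere by (auto simp: K_def)

end

section \<open>Bases of relative homology groups\<close>

text \<open>The group is infinite. If a nontrivial power of the generator vanished, finitely many
  powers would exhaust the group.\<close>

lemma (in comm_group) int_basis_generator:
  assumes iso: "G \<cong> integer_group" and g: "g \<in> carrier G" "generate G {g} = carrier G"
  shows "int_basis G (carrier G) [g]"
proof -
  have gen: "carrier G = range (\<lambda>k::int. g [^] k)"
    using generate_pow[OF g(1)] g(2) by (auto simp: full_SetCompr_eq)
  obtain f where "f \<in> iso G integer_group" using iso by (auto simp: is_iso_def)
  then have "bij_betw f (carrier G) (UNIV :: int set)" by (auto simp: iso_def integer_group_def)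
  then have inf: "infinite (carrier G)" using bij_betw_finite infinite_UNIV_int by blast
  have "k = 0" if k: "g [^] (k::int) = \<one>" for k
  proof (rule ccontr)
    assume "k \<noteq> 0"
    have "g [^] (m::int) \<in> (\<lambda>i::int. g [^] i) ` {0..<\<bar>k\<bar>}" for m
    proof -
      have a: "g [^] \<bar>k\<bar> = \<one>" using k g(1) by (cases "k \<ge> 0") (auto simp: int_pow_neg)
      have "g [^] m = g [^] (\<bar>k\<bar> * (m div \<bar>k\<bar>) + m mod \<bar>k\<bar>)" by simp
      also have "\<dots> = g [^] (m mod \<bar>k\<bar>)"
        unfolding int_pow_mult[OF g(1)] int_pow_pow[OF g(1), symmetric] a using g(1) by simp
      finally show ?thesis using \<open>k \<noteq> 0\<close> by (intro image_eqI[of _ _ "m mod \<bar>k\<bar>"]) auto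
    qed
    then have "carrier G \<subseteq> (\<lambda>i::int. g [^] i) ` {0..<\<bar>k\<bar>}" unfolding gen by auto
    then show False using inf finite_subset by blast
  qed
  then have "int_indep G [g]" using g(1) by (auto simp: int_indep_def gcomb_singleton)
  moreover have "\<exists>c. x = gcomb G [g] c" if "x \<in> carrier G" for x
  proof -
    have "x \<in> range (\<lambda>k::int. g [^] k)" using \<open>x \<in> carrier G\<close> unfolding gen .
    then obtain k :: int where "x = g [^] k" by blast
    then show ?thesis using g(1) by (intro exI[of _ "\<lambda>_. k"]) (simp add: gcomb_singleton)
  qed
  ultimately show ?thesis unfolding int_basis_carrier_iff using g(1) by auto
qed

lemma relative_exact:
  assumes "T \<subseteq> S"
  shows "kernel (relative_homology_group p X S) (relative_homology_group (p - 1) (subtopology X S) T) (hom_relboundary p X S T)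
      = hom_induced p X T X S id ` carrier (relative_homology_group p X T)"
    and "kernel (relative_homology_group (p - 1) (subtopology X S) T) (relative_homology_group (p - 1) X T) (hom_induced (p - 1) (subtopology X S) T X T id)
      = hom_relboundary p X S T ` carrier (relative_homology_group p X S)"
    and "kernel (relative_homology_group p X T) (relative_homology_group p X S) (hom_induced p X T X S id)
      = hom_induced p (subtopology X S) T X T id ` carrier (relative_homology_group p (subtopology X S) T)"
  using homology_exactness_triple_1[OF assms] homology_exactness_triple_2[OF assms] homology_exactness_triple_3[OF assms]
  by simp_all

lemma inclusion_compose:
  assumes "X' \<subseteq> Y'" "Y' \<subseteq> Z'" "S \<subseteq> T" "T \<subseteq> U"
  shows "hom_induced p (subtopology X Y') T (subtopology X Z') U id (hom_induced p (subtopology X X') S (subtopology X Y') T id x)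
     = hom_induced p (subtopology X X') S (subtopology X Z') U id x"
  using assms by (subst hom_induced_compose') (auto simp: continuous_map_in_subtopology continuous_map_from_subtopology)

lemma inj_on_kernel_trivial:
  assumes "group G" "group H" "h \<in> hom G H" "kernel G H h \<subseteq> {\<one>\<^bsub>G\<^esub>}"
  shows "inj_on h (carrier G)"
proof -
  interpret group_hom G H h using assms by (simp add: group_hom_def group_hom_axioms_def)
  have "\<one>\<^bsub>G\<^esub> \<in> kernel G H h" by (simp add: kernel_def)
  then show ?thesis using assms(4) inj_iff_trivial_ker by blast
qed

text \<open>In the exact sequence of the triple \<open>F\<close>, \<open>S\<close>, \<open>T\<close>
  the vanishing of the group of \<open>(F, S)\<close> in degree \<open>p + 1\<close> makes the map
  from \<open>(S, T)\<close> injective, and the lifts \<open>ys\<close> split the sequence.\<close>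

lemma relative_basis_split:
  assumes sub: "T \<subseteq> S" "S \<subseteq> F" and van: "trivial_group (relative_homology_group (p + 1) (subtopology X F) S)"
    and xs: "int_basis (relative_homology_group p (subtopology X S) T) (carrier (relative_homology_group p (subtopology X S) T)) xs"
    and ys: "set ys \<subseteq> carrier (relative_homology_group p (subtopology X F) T)"
      "int_basis (relative_homology_group p (subtopology X F) S) (carrier (relative_homology_group p (subtopology X F) S))
         (map (hom_induced p (subtopology X F) T (subtopology X F) S id) ys)"
  shows "int_basis (relative_homology_group p (subtopology X F) T) (carrier (relative_homology_group p (subtopology X F) T))
     (map (hom_induced p (subtopology X S) T (subtopology X F) T id) xs @ ys)"
proof -
  let ?Y = "subtopology X F"
  have SS: "subtopology ?Y S = subtopology X S" using sub by (simp add: subtopology_subtopology Int_absorb1)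
  interpret G: comm_group "relative_homology_group p ?Y T" by simp
  have "kernel (relative_homology_group p (subtopology X S) T) (relative_homology_group p ?Y T) (hom_induced p (subtopology X S) T ?Y T id)
      = hom_relboundary (p + 1) ?Y S T ` carrier (relative_homology_group (p + 1) ?Y S)"
    using relative_exact(2)[OF sub(1), of "p + 1" ?Y] by (simp add: SS)
  also have "carrier (relative_homology_group (p + 1) ?Y S) = {\<one>\<^bsub>relative_homology_group (p + 1) ?Y S\<^esub>}"
    using van by (simp add: trivial_group_def)
  also have "hom_relboundary (p + 1) ?Y S T ` {\<one>\<^bsub>relative_homology_group (p + 1) ?Y S\<^esub>} = {\<one>\<^bsub>relative_homology_group p (subtopology X S) T\<^esub>}"
    using hom_one[OF group_homomorphism_hom_relboundary[of "p + 1" ?Y S T]] by (simp add: SS)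
  finally have k: "kernel (relative_homology_group p (subtopology X S) T) (relative_homology_group p ?Y T) (hom_induced p (subtopology X S) T ?Y T id)
      = {\<one>\<^bsub>relative_homology_group p (subtopology X S) T\<^esub>}" .
  have inj: "inj_on (hom_induced p (subtopology X S) T ?Y T id) (carrier (relative_homology_group p (subtopology X S) T))"
    by (rule inj_on_kernel_trivial[OF group_relative_homology_group group_relative_homology_group hom_induced_hom eq_refl[OF k]])
  have ex: "kernel (relative_homology_group p ?Y T) (relative_homology_group p ?Y S) (hom_induced p ?Y T ?Y S id)
      = hom_induced p (subtopology X S) T ?Y T id ` carrier (relative_homology_group p (subtopology X S) T)"
    using relative_exact(3)[OF sub(1), of p ?Y] by (simp add: SS)
  show ?thesis
    by (rule G.int_basis_split[OF _ _ hom_induced_hom hom_induced_hom inj ex xs ys]) auto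
qed

lemma relative_trivial_triple:
  assumes sub: "T \<subseteq> S" "S \<subseteq> F" and FS: "trivial_group (relative_homology_group p (subtopology X F) S)"
    and ST: "trivial_group (relative_homology_group p (subtopology X S) T)"
  shows "trivial_group (relative_homology_group p (subtopology X F) T)"
proof -
  let ?Y = "subtopology X F"
  have SS: "subtopology ?Y S = subtopology X S" using sub by (simp add: subtopology_subtopology Int_absorb1)
  have FS1: "carrier (relative_homology_group p ?Y S) = {\<one>\<^bsub>relative_homology_group p ?Y S\<^esub>}"
    and ST1: "carrier (relative_homology_group p (subtopology X S) T) = {\<one>\<^bsub>relative_homology_group p (subtopology X S) T\<^esub>}"
    using FS ST unfolding trivial_group_def by blast+
  have "hom_induced p ?Y T ?Y S id x = \<one>\<^bsub>relative_homology_group p ?Y S\<^esub>" for x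
    using hom_induced_carrier[of p ?Y T ?Y S id x] unfolding FS1 by (rule singletonD)
  then have "carrier (relative_homology_group p ?Y T)
      = kernel (relative_homology_group p ?Y T) (relative_homology_group p ?Y S) (hom_induced p ?Y T ?Y S id)"
    unfolding kernel_def by blast
  also have "\<dots> = hom_induced p (subtopology X S) T ?Y T id ` carrier (relative_homology_group p (subtopology X S) T)"
    using relative_exact(3)[OF sub(1), of p ?Y] unfolding SS .
  also have "\<dots> = {\<one>\<^bsub>relative_homology_group p ?Y T\<^esub>}"
    unfolding ST1 using hom_one[OF hom_induced_hom[of p "subtopology X S" T ?Y T id]] by simp
  finally show ?thesis unfolding trivial_group_def by simp
qed

section \<open>Attaching finitely many cells of one dimension\<close>

definition cell_generator :: "'a topology \<Rightarrow> nat \<Rightarrow> 'a set \<Rightarrow> 'a chain set \<Rightarrow> bool" where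
  "cell_generator X q e g \<longleftrightarrow>
     (let G = relative_homology_group (int q) (subtopology X (X closure_of e)) (X closure_of e - e) in
      g \<in> carrier G \<and> generate G {g} = carrier G)"

text \<open>Disjointness from \<open>A\<close> is left out, so that a cell attached to
  \<open>A\<close> is also attached to every larger set.\<close>

definition attached_cell :: "'a topology \<Rightarrow> 'a set \<Rightarrow> nat \<Rightarrow> 'a set \<Rightarrow> bool" where
  "attached_cell X A q e \<longleftrightarrow> (\<exists>\<phi>. embedding_map (cell_ball q) X \<phi> \<and> \<phi> ` open_cell_ball q = e \<and> \<phi> ` cell_sphere q \<subseteq> A)"

text \<open>The boundary goes into \<open>A\<close> while the cell is added to a possibly larger
  \<open>F\<close>: this is the situation after other cells of the same dimension have been
  added.\<close>

lemma attached_cell_facts: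
  assumes X: "Hausdorff_space X" "closedin X F" and A: "A \<subseteq> F" and e: "attached_cell X A q e" "e \<inter> F = {}"
  shows "closedin X (F \<union> e)" "X closure_of e \<subseteq> A \<union> e" "e \<subseteq> X closure_of e" "X closure_of e - e \<subseteq> A"
    and "p \<noteq> int q \<Longrightarrow> trivial_group (relative_homology_group p (subtopology X (F \<union> e)) F)"
    and "\<exists>g. cell_generator X q e g"
    and "\<And>g. cell_generator X q e g \<Longrightarrow>
      int_basis (relative_homology_group (int q) (subtopology X (F \<union> e)) F)
        (carrier (relative_homology_group (int q) (subtopology X (F \<union> e)) F))
        [hom_induced (int q) (subtopology X (X closure_of e)) (X closure_of e - e) (subtopology X (F \<union> e)) F id g]"
proof -
  obtain \<phi> where \<phi>: "embedding_map (cell_ball q) X \<phi>" "\<phi> ` open_cell_ball q = e" "\<phi> ` cell_sphere q \<subseteq> A"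
    using e by (auto simp: attached_cell_def)
  interpret cell_attachment X F q \<phi>
    by standard (use X \<phi> A e in auto)
  have cK: "X closure_of e = K" and Ke: "K - e = \<phi> ` cell_sphere q"
    using closure_cell K_minus_cell \<phi> by auto
  have "open_cell_ball q \<subseteq> topspace (cell_ball q)" using ball_split by (rule equalityD2[THEN subset_trans[OF Un_upper1]])
  then have eK: "e \<subseteq> K" unfolding K_def \<phi>(2)[symmetric] by (rule image_mono)
  have FK: "F \<union> K = F \<union> e" using eK Ke \<phi>(3) A by blast
  show "closedin X (F \<union> e)" using closedin_Un[OF X(2) closed_K] by (simp add: FK)
  show "X closure_of e \<subseteq> A \<union> e" "e \<subseteq> X closure_of e" "X closure_of e - e \<subseteq> A"
    using cK Ke \<phi>(3) eK by auto
  note att = attach_iso[unfolded FK]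
  have ball_iso: "relative_homology_group p (cell_ball q) (cell_sphere q) \<cong> relative_homology_group p (subtopology X K) (K - e)" for p
    using closed_cell_iso[of p] by (auto simp: Ke is_iso_def)
  show "trivial_group (relative_homology_group p (subtopology X (F \<union> e)) F)" if "p \<noteq> int q"
  proof -
    have "trivial_group (relative_homology_group p (subtopology X K) (\<phi> ` cell_sphere q))"
      using isomorphic_group_triviality[OF ball_iso[of p]] cell_homology(2)[OF that] by (simp add: Ke)
    then show ?thesis
      using isomorphic_group_triviality[OF is_isoI[OF att[of p]]] by simp
  qed
  have Zi: "relative_homology_group (int q) (subtopology X K) (K - e) \<cong> integer_group"
    using iso_trans[OF group.iso_sym[OF _ ball_iso[of "int q"]] cell_homology(1)[of q]] by simp
  show "\<exists>g. cell_generator X q e g"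
  proof -
    have "cyclic_group (relative_homology_group (int q) (subtopology X K) (K - e))"
      using isomorphic_group_cyclicity[OF Zi] cyclic_integer_group by simp
    then obtain g where "g \<in> carrier (relative_homology_group (int q) (subtopology X K) (K - e))"
      "subgroup_generated (relative_homology_group (int q) (subtopology X K) (K - e)) {g} = relative_homology_group (int q) (subtopology X K) (K - e)"
      unfolding cyclic_group_def by blast
    moreover from this have "generate (relative_homology_group (int q) (subtopology X K) (K - e)) {g} = carrier (relative_homology_group (int q) (subtopology X K) (K - e))"
      by (metis carrier_subgroup_generated Int_absorb1 empty_subsetI insert_subset)
    ultimately show ?thesis by (auto simp: cell_generator_def Let_def cK)
  qed
  fix g assume "cell_generator X q e g"
  then have g: "g \<in> carrier (relative_homology_group (int q) (subtopology X K) (K - e))"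
    "generate (relative_homology_group (int q) (subtopology X K) (K - e)) {g} = carrier (relative_homology_group (int q) (subtopology X K) (K - e))"
    by (simp_all add: cell_generator_def Let_def cK)
  have "int_basis (relative_homology_group (int q) (subtopology X K) (K - e)) (carrier (relative_homology_group (int q) (subtopology X K) (K - e))) [g]"
    by (rule comm_group.int_basis_generator[OF _ Zi g]) simp
  from comm_group.int_basis_iso[OF _ _ att[of "int q", folded Ke] this]
  show "int_basis (relative_homology_group (int q) (subtopology X (F \<union> e)) F)
        (carrier (relative_homology_group (int q) (subtopology X (F \<union> e)) F))
        [hom_induced (int q) (subtopology X (X closure_of e)) (X closure_of e - e) (subtopology X (F \<union> e)) F id g]"
    by (simp add: cK)
qed

definition push_cell :: "'a topology \<Rightarrow> nat \<Rightarrow> 'a set \<Rightarrow> 'a set \<Rightarrow> 'a set \<Rightarrow> 'a chain set \<Rightarrow> 'a chain set" where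
  "push_cell X q F A e g = hom_induced (int q) (subtopology X (X closure_of e)) (X closure_of e - e) (subtopology X F) A id g"

text \<open>Cells are added one at a time. Every boundary lies in \<open>A\<close> and not in the
  other cells, so earlier generators are simply included into the larger space, and each new pair
  has homology only in degree \<open>q\<close>, so that the sequence of the triple splits.\<close>

theorem attached_cells:
  assumes X: "Hausdorff_space X" "closedin X A"
    and es: "distinct es" "\<And>e. e \<in> set es \<Longrightarrow> attached_cell X A q e \<and> e \<inter> A = {}"
    "\<And>e f. e \<in> set es \<Longrightarrow> f \<in> set es \<Longrightarrow> e \<noteq> f \<Longrightarrow> e \<inter> f = {}"
    and gs: "list_all2 (cell_generator X q) es gs"
  shows "closedin X (A \<union> \<Union>(set es)) \<and>
    (\<forall>p. p \<noteq> int q \<longrightarrow> trivial_group (relative_homology_group p (subtopology X (A \<union> \<Union>(set es))) A)) \<and>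
    int_basis (relative_homology_group (int q) (subtopology X (A \<union> \<Union>(set es))) A)
      (carrier (relative_homology_group (int q) (subtopology X (A \<union> \<Union>(set es))) A))
      (map2 (push_cell X q (A \<union> \<Union>(set es)) A) es gs)"
  using es gs
proof (induction es arbitrary: gs rule: rev_induct)
  case Nil
  have t: "trivial_group (relative_homology_group p (subtopology X A) A)" for p
    using trivial_relative_homology_group_topspace[of p "subtopology X A"] closedin_subset[OF X(2)]
    by (simp add: Int_absorb1 topspace_subtopology_subset)
  interpret G: comm_group "relative_homology_group (int q) (subtopology X A) A" by simp
  have "int_basis (relative_homology_group (int q) (subtopology X A) A) (carrier (relative_homology_group (int q) (subtopology X A) A)) []"
    unfolding G.int_basis_carrier_iff using t[of "int q"] by (auto simp: int_indep_def trivial_group_def)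
  then show ?case using t X by simp
next
  case (snoc e es)
  obtain gs' g where gs: "gs = gs' @ [g]" "list_all2 (cell_generator X q) es gs'" "cell_generator X q e g"
    using snoc.prems(4) by (auto simp: list_all2_append1 list_all2_Cons1)
  let ?F = "A \<union> \<Union>(set es)" and ?F' = "A \<union> \<Union>(set (es @ [e]))"
  have FF: "?F' = ?F \<union> e" by auto
  have IH: "closedin X ?F" "\<And>p. p \<noteq> int q \<Longrightarrow> trivial_group (relative_homology_group p (subtopology X ?F) A)"
    "int_basis (relative_homology_group (int q) (subtopology X ?F) A) (carrier (relative_homology_group (int q) (subtopology X ?F) A))
      (map2 (push_cell X q ?F A) es gs')"
    using snoc.IH[OF _ _ _ gs(2)] snoc.prems by auto
  have e1: "attached_cell X A q e" "e \<inter> A = {}" using snoc.prems(2)[of e] by simp_all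
  have "e \<inter> f = {}" if "f \<in> set es" for f
    using snoc.prems(1) that by (intro snoc.prems(3)) auto
  with e1 have e: "attached_cell X A q e" "e \<inter> ?F = {}" by blast+
  note at = attached_cell_facts[OF X(1) IH(1) _ e]
  have len: "length es = length gs'" using gs(2) by (rule list_all2_lengthD)
  have cl: "X closure_of f - f \<subseteq> A" "X closure_of f \<subseteq> A \<union> f" if "f \<in> set (es @ [e])" for f
    using attached_cell_facts(4,2)[OF X order_refl, of q f] snoc.prems(2)[OF that] by auto
  have pushes: "map (hom_induced (int q) (subtopology X ?F) A (subtopology X (?F \<union> e)) A id) (map2 (push_cell X q ?F A) es gs') =
      map2 (push_cell X q (?F \<union> e) A) es gs'"
  proof (rule nth_equalityI)
    fix i assume "i < length (map (hom_induced (int q) (subtopology X ?F) A (subtopology X (?F \<union> e)) A id) (map2 (push_cell X q ?F A) es gs'))"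
    then have i: "i < length es" by simp
    then have "es ! i \<in> set es" by simp
    then have "X closure_of (es ! i) \<subseteq> ?F" "X closure_of (es ! i) - es ! i \<subseteq> A"
      using cl[of "es ! i"] by auto
    then show "map (hom_induced (int q) (subtopology X ?F) A (subtopology X (?F \<union> e)) A id) (map2 (push_cell X q ?F A) es gs') ! i =
      map2 (push_cell X q (?F \<union> e) A) es gs' ! i"
      using i len by (simp add: push_cell_def inclusion_compose)
  qed simp
  have "int_basis (relative_homology_group (int q) (subtopology X (?F \<union> e)) A) (carrier (relative_homology_group (int q) (subtopology X (?F \<union> e)) A))
     (map (hom_induced (int q) (subtopology X ?F) A (subtopology X (?F \<union> e)) A id) (map2 (push_cell X q ?F A) es gs') @ [push_cell X q (?F \<union> e) A e g])"
  proof (rule relative_basis_split[OF _ _ _ IH(3)])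
    show "trivial_group (relative_homology_group (int q + 1) (subtopology X (?F \<union> e)) ?F)"
      by (rule at(5)) auto
    show "set [push_cell X q (?F \<union> e) A e g] \<subseteq> carrier (relative_homology_group (int q) (subtopology X (?F \<union> e)) A)"
      by (simp add: push_cell_def hom_induced_carrier)
    have "hom_induced (int q) (subtopology X (?F \<union> e)) A (subtopology X (?F \<union> e)) ?F id (push_cell X q (?F \<union> e) A e g) =
        push_cell X q (?F \<union> e) ?F e g"
      unfolding push_cell_def using cl[of e] by (intro inclusion_compose) auto
    then show "int_basis (relative_homology_group (int q) (subtopology X (?F \<union> e)) ?F) (carrier (relative_homology_group (int q) (subtopology X (?F \<union> e)) ?F))
       (map (hom_induced (int q) (subtopology X (?F \<union> e)) A (subtopology X (?F \<union> e)) ?F id) [push_cell X q (?F \<union> e) A e g])"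
      using at(7)[OF _ gs(3)] by (simp add: push_cell_def)
  qed auto
  then have B: "int_basis (relative_homology_group (int q) (subtopology X (?F \<union> e)) A) (carrier (relative_homology_group (int q) (subtopology X (?F \<union> e)) A))
     (map2 (push_cell X q (?F \<union> e) A) (es @ [e]) gs)"
    unfolding pushes using len gs(1) by simp
  have V: "trivial_group (relative_homology_group p (subtopology X (?F \<union> e)) A)" if "p \<noteq> int q" for p
    by (rule relative_trivial_triple[of A ?F]) (use at(5)[OF _ that] IH(2)[OF that] in auto)
  show ?case
    unfolding FF using at(1) V B by simp
qed

section \<open>The cone over a compact Hausdorff space\<close>

abbreviation "cyl X \<equiv> prod_topology X (top_of_set {0..1::real})"

definition cone_set :: "'a set \<Rightarrow> ('a \<times> real) set" where
  "cone_set S = cone_map ` (S \<times> {0..1})"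

lemma cone_set_eq: "cone_set S = (if S = {} then {} else {apex} \<union> S \<times> {0<..1})"
proof (cases "S = {}")
  case False
  then obtain s where s: "s \<in> S" by blast
  have "apex \<in> cone_map ` (S \<times> {0..1})"
    by (rule image_eqI[of _ _ "(s, 0)"]) (use s in \<open>auto simp: cone_map_def\<close>)
  moreover have "S \<times> {0<..1} \<subseteq> cone_map ` (S \<times> {0..1})"
  proof
    fix z assume "z \<in> S \<times> {0<..1::real}"
    then have "z \<in> S \<times> {0..1}" "cone_map z = z" by (auto simp: cone_map_def)
    then show "z \<in> cone_map ` (S \<times> {0..1})" by (metis imageI)
  qed
  moreover have "cone_map ` (S \<times> {0..1}) \<subseteq> {apex} \<union> S \<times> {0<..1}"
    by (auto simp: cone_map_def)
  ultimately show ?thesis using False by (auto simp: cone_set_def)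
qed (simp add: cone_set_def)

lemma topspace_cone: "topspace (cone_topology X) = cone_set (topspace X)"
  using quotient_imp_surjective_map[OF quotient_map_cone[of X]] by (simp add: cone_set_def)

lemma continuous_map_cone_map: "continuous_map (cyl X) (cone_topology X) cone_map"
  using quotient_map_cone quotient_imp_continuous_map by blast

lemma continuous_map_cone_height: "continuous_map (cone_topology X) euclideanreal snd"
proof (rule continuous_compose_quotient_map[OF quotient_map_cone])
  have "continuous_map (cyl X) euclideanreal snd"
    using continuous_map_snd continuous_map_into_fulltopology by blast
  then show "continuous_map (cyl X) euclideanreal (snd \<circ> cone_map)"
    by (rule continuous_map_eq) (auto simp: cone_map_def apex_def)
qed

lemma openin_cone_product:
  assumes U: "openin X U" shows "openin (cone_topology X) (U \<times> {0<..1})"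
  unfolding openin_cone_topology
proof
  have sub: "U \<subseteq> topspace X" using U openin_subset by blast
  show "U \<times> {0<..1} \<subseteq> cone_map ` topspace (cyl X)"
    using sub cone_set_eq[of "topspace X"] unfolding cone_set_def by (auto split: if_splits)
  have "{z \<in> topspace (cyl X). cone_map z \<in> U \<times> {0<..1}} = U \<times> {0<..1}"
    using sub by (auto simp: cone_map_def apex_def)
  moreover have "openin (top_of_set {0..1::real}) {0<..1}"
    by (auto simp: openin_subtopology intro!: exI[of _ "{0<..}"])
  ultimately show "openin (cyl X) {z \<in> topspace (cyl X). cone_map z \<in> U \<times> {0<..1}}"
    using U by (simp add: openin_prod_Times_iff)
qed

text \<open>Points at different heights are separated by height, which descends to the quotient.
  Distinct points at the same height are away from the apex, where the cone is a product.\<close>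

lemma Hausdorff_cone:
  assumes X: "Hausdorff_space X" shows "Hausdorff_space (cone_topology X)"
  unfolding Hausdorff_space_def
proof (intro allI impI)
  fix y z assume yz: "y \<in> topspace (cone_topology X) \<and> z \<in> topspace (cone_topology X) \<and> y \<noteq> z"
  show "\<exists>U V. openin (cone_topology X) U \<and> openin (cone_topology X) V \<and> y \<in> U \<and> z \<in> V \<and> disjnt U V"
  proof (cases "snd y = snd z")
    case False
    then obtain U V where UV: "open U" "open V" "snd y \<in> U" "snd z \<in> V" "U \<inter> V = {}"
      using hausdorff[OF False] by blast
    let ?p = "\<lambda>W. {x \<in> topspace (cone_topology X). snd x \<in> W}"
    have "openin (cone_topology X) (?p U)" "openin (cone_topology X) (?p V)"
      using openin_continuous_map_preimage[OF continuous_map_cone_height[of X]] UV(1,2) by (simp_all only: open_openin)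
    then show ?thesis using yz UV by (intro exI[of _ "?p U"] exI[of _ "?p V"]) (auto simp: disjnt_def)
  next
    case True
    have "y \<noteq> apex \<and> z \<noteq> apex"
      using yz True unfolding topspace_cone cone_set_eq by (auto simp: apex_def split: if_splits)
    then have m: "y \<in> topspace X \<times> {0<..1}" "z \<in> topspace X \<times> {0<..1}"
      using yz unfolding topspace_cone cone_set_eq by (auto split: if_splits)
    then have "fst y \<noteq> fst z" using yz True by (auto simp: prod_eq_iff)
    then obtain U V where UV: "openin X U" "openin X V" "fst y \<in> U" "fst z \<in> V" "disjnt U V"
      using X m unfolding Hausdorff_space_def by (metis mem_Times_iff)
    show ?thesis
      using UV m openin_cone_product
      by (intro exI[of _ "U \<times> {0<..1}"] exI[of _ "V \<times> {0<..1}"]) (auto simp: disjnt_def)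
  qed
qed

text \<open>A homotopy descends to the cone if the product of the interval with the quotient map is
  again a quotient map; compactness and the Hausdorff property make that product a closed map. The
  condition \<open>f s 0 = 0\<close> keeps the apex fixed.\<close>

lemma continuous_map_cone_reparametrization:
  fixes f :: "real \<Rightarrow> real \<Rightarrow> real"
  assumes X: "compact_space X" "Hausdorff_space X" and f: "continuous_on ({0..1} \<times> {0..1}) (\<lambda>(s, t). f s t)"
    and f0: "\<And>s. s \<in> {0..1} \<Longrightarrow> f s 0 = 0" and f1: "\<And>s t. s \<in> {0..1} \<Longrightarrow> t \<in> {0..1} \<Longrightarrow> f s t \<in> {0..1}"
  shows "continuous_map (prod_topology (top_of_set {0..1}) (cone_topology X)) (cone_topology X)
     (\<lambda>(s, y). cone_map (fst y, f s (snd y)))"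
proof (rule continuous_compose_quotient_map)
  let ?I = "top_of_set {0..1::real}"
  show "quotient_map (prod_topology ?I (cyl X)) (prod_topology ?I (cone_topology X)) (\<lambda>(s, z). (s, cone_map z))"
  proof (rule continuous_closed_imp_quotient_map)
    show c: "continuous_map (prod_topology ?I (cyl X)) (prod_topology ?I (cone_topology X)) (\<lambda>(s, z). (s, cone_map z))"
      unfolding case_prod_beta
      by (intro continuous_map_pairedI continuous_map_fst
        continuous_map_compose[OF continuous_map_snd continuous_map_cone_map, unfolded comp_def])
    show "closed_map (prod_topology ?I (cyl X)) (prod_topology ?I (cone_topology X)) (\<lambda>(s, z). (s, cone_map z))"
    proof (rule continuous_imp_closed_map[OF c])
      have I: "compact_space ?I" "Hausdorff_space ?I"
        by (simp_all add: compact_space_subtopology Hausdorff_space_subtopology)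
      show "compact_space (prod_topology ?I (cyl X))"
        unfolding compact_space_prod_topology using X(1) I(1) by blast
      show "Hausdorff_space (prod_topology ?I (cone_topology X))"
        unfolding Hausdorff_space_prod_topology using Hausdorff_cone[OF X(2)] I(2) by blast
    qed
    show "(\<lambda>(s, z). (s, cone_map z)) ` topspace (prod_topology ?I (cyl X)) = topspace (prod_topology ?I (cone_topology X))"
    proof -
      have "(\<lambda>(s, z). (s, g z)) ` (A \<times> B) = A \<times> g ` B" for g :: "'a \<times> real \<Rightarrow> 'a \<times> real" and A :: "real set" and B
        by force
      then show ?thesis
        unfolding topspace_prod_topology[of ?I "cyl X"] topspace_prod_topology[of ?I "cone_topology X"]
          quotient_imp_surjective_map[OF quotient_map_cone[of X], symmetric] .
    qed
  qed
  let ?P = "prod_topology ?I (cyl X)"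
  have c2: "continuous_map ?P (prod_topology ?I ?I) (\<lambda>w. (fst w, snd (snd w)))"
    by (intro continuous_map_pairedI continuous_map_fst continuous_map_compose[OF continuous_map_snd continuous_map_snd, unfolded comp_def])
  have "continuous_map (prod_topology ?I ?I) ?I (\<lambda>(s, t). f s t)"
    using f f1 by (auto simp: continuous_map_in_subtopology)
  from continuous_map_compose[OF c2 this]
  have "continuous_map ?P (cyl X) (\<lambda>w. (fst (snd w), f (fst w) (snd (snd w))))"
    using continuous_map_compose[OF continuous_map_snd[of ?I "cyl X"] continuous_map_fst[of X ?I]]
    by (intro continuous_map_pairedI) (auto simp: comp_def)
  from continuous_map_compose[OF this continuous_map_cone_map]
  show "continuous_map ?P (cone_topology X) ((\<lambda>(s, y). cone_map (fst y, f s (snd y))) \<circ> (\<lambda>(s, z). (s, cone_map z)))"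
  proof (rule continuous_map_eq)
    fix w assume "w \<in> topspace ?P"
    then show "(cone_map \<circ> (\<lambda>w. (fst (snd w), f (fst w) (snd (snd w))))) w =
        ((\<lambda>(s, y). cone_map (fst y, f s (snd y))) \<circ> (\<lambda>(s, z). (s, cone_map z))) w"
      using f0 by (cases "snd (snd w) = 0") (auto simp: cone_map_def apex_def)
  qed
qed

lemma embedding_map_compact_Hausdorff:
  assumes "continuous_map X Y f" "compact_space X" "Hausdorff_space Y" "inj_on f (topspace X)"
  shows "embedding_map X Y f"
  unfolding embedding_map_def
proof (rule continuous_imp_homeomorphic_map)
  show "Hausdorff_space (subtopology Y (f ` topspace X))"
    using assms(3) by (rule Hausdorff_space_subtopology)
  show "continuous_map X (subtopology Y (f ` topspace X)) f"
    using assms(1) by (auto intro: continuous_map_into_subtopology)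
  show "f ` topspace X = topspace (subtopology Y (f ` topspace X))"
    using continuous_map_image_subset_topspace[OF assms(1)] by auto
qed (use assms in auto)

locale cone_space =
  fixes X :: "'a topology"
  assumes compact: "compact_space X" and haus: "Hausdorff_space X"
begin

abbreviation "Y \<equiv> cone_topology X"

lemma haus_Y: "Hausdorff_space Y"
  by (rule Hausdorff_cone[OF haus])

lemma closed_cone_set:
  assumes S: "closedin X S" shows "closedin Y (cone_set S)"
proof -
  have "compactin X S" using closedin_compact_space[OF compact S] .
  then have "compactin (cyl X) (S \<times> {0..1})"
    by (simp add: compactin_Times compactin_subtopology)
  then have "compactin Y (cone_map ` (S \<times> {0..1}))"
    using image_compactin continuous_map_cone_map by blast
  then show ?thesis using compactin_imp_closedin haus_Y unfolding cone_set_def by blast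
qed

lemma continuous_base_incl: "continuous_map X Y base_incl"
proof -
  have "continuous_map X (cyl X) (\<lambda>x. (x, 1))" by (auto intro!: continuous_map_pairedI)
  from continuous_map_compose[OF this continuous_map_cone_map]
  show ?thesis by (rule continuous_map_eq) (auto simp: base_incl_def cone_map_def)
qed

lemma closed_base:
  assumes S: "closedin X S" shows "closedin Y (base_incl ` S)"
  using compactin_imp_closedin[OF haus_Y image_compactin[OF closedin_compact_space[OF compact S] continuous_base_incl]] .

lemma embedding_base_incl: "embedding_map X Y base_incl"
  by (rule embedding_map_compact_Hausdorff[OF continuous_base_incl compact haus_Y]) (auto simp: inj_on_def base_incl_def)

lemma base_iso:
  assumes "S \<subseteq> T" "T \<subseteq> topspace X"
  shows "hom_induced p (subtopology X T) S (subtopology Y (base_incl ` T)) (base_incl ` S) base_incl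
    \<in> iso (relative_homology_group p (subtopology X T) S) (relative_homology_group p (subtopology Y (base_incl ` T)) (base_incl ` S))"
proof (rule homeomorphic_map_relative_homology_iso)
  have "homeomorphic_map X (subtopology Y (base_incl ` topspace X)) base_incl"
    using embedding_base_incl unfolding embedding_map_def .
  from homeomorphic_map_subtopologies_alt[OF this, of "base_incl ` T" T]
  have "homeomorphic_map (subtopology X T) (subtopology (subtopology Y (base_incl ` topspace X)) (base_incl ` T)) base_incl"
    by (auto simp: base_incl_def)
  moreover have "base_incl ` topspace X \<inter> base_incl ` T = base_incl ` T" using assms(2) by blast
  ultimately show "homeomorphic_map (subtopology X T) (subtopology Y (base_incl ` T)) base_incl"
    by (simp only: subtopology_subtopology)
  show "S \<subseteq> topspace (subtopology X T)" using assms unfolding topspace_subtopology by blast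
qed (rule refl)

lemma cone_set_mono: "S \<subseteq> T \<Longrightarrow> cone_set S \<subseteq> cone_set T"
  unfolding cone_set_def by (intro image_mono) auto

lemma base_sub_cone: "base_incl ` S \<subseteq> cone_set S"
  by (auto simp: cone_set_eq base_incl_def)

text \<open>Scaling heights by \<open>1 - s\<close> moves every point to the apex without leaving
  the cone over \<open>S\<close>.\<close>

lemma contractible_cone:
  assumes S: "S \<subseteq> topspace X" shows "contractible_space (subtopology Y (cone_set S))"
proof -
  let ?k = "\<lambda>(s, y). cone_map (fst y, (1 - s) * snd y :: real)"
  have "continuous_map (prod_topology (top_of_set {0..1}) Y) Y ?k"
    by (rule continuous_map_cone_reparametrization[OF compact haus])
      (auto simp: case_prod_beta mult_le_one intro!: continuous_intros)
  then have "continuous_map (prod_topology (top_of_set {0..1}) (subtopology Y (cone_set S))) Y ?k"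
    unfolding prod_topology_subtopology(2) by (rule continuous_map_from_subtopology)
  moreover have kS: "cone_map (fst y, (1 - s) * snd y) \<in> cone_set S" if y: "y \<in> cone_set S" and s: "s \<in> {0..1}" for y s
  proof -
    obtain x t where xt: "x \<in> S" "t \<in> {0..1}" "y = cone_map (x, t)" using y unfolding cone_set_def by blast
    have "cone_map (fst y, (1 - s) * snd y) = cone_map (x, (1 - s) * t)"
      using xt by (cases "t = 0") (auto simp: cone_map_def apex_def)
    moreover have "(1 - s) * t \<in> {0..1}" using xt s by (auto simp: mult_le_one)
    ultimately show ?thesis using xt unfolding cone_set_def by blast
  qed
  ultimately have "continuous_map (prod_topology (top_of_set {0..1}) (subtopology Y (cone_set S))) (subtopology Y (cone_set S)) ?k"
    by (intro continuous_map_into_subtopology) auto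
  moreover have "?k (0, y) = y" if "y \<in> cone_set S" for y
    using that by (auto simp: cone_set_def cone_map_def apex_def)
  moreover have "?k (1, y) = apex" for y by (simp add: cone_map_def)
  ultimately have "homotopic_with (\<lambda>_. True) (subtopology Y (cone_set S)) (subtopology Y (cone_set S)) id (\<lambda>_. apex)"
    by (subst homotopic_with) (auto intro!: exI[of _ ?k])
  then show ?thesis unfolding contractible_space_def by (rule exI)
qed

lemma cone_homology_trivial:
  assumes "S \<subseteq> topspace X" "p \<noteq> 0"
  shows "trivial_group (homology_group p (subtopology Y (cone_set S)))"
  using trivial_reduced_homology_group_contractible_space[OF contractible_cone[OF assms(1)], of p] un_reduced_homology_group[OF assms(2)]
  by metis

text \<open>With the \<open>k\<close>-skeleton for \<open>A\<close> and the
  \<open>(k - 1)\<close>-skeleton for \<open>B\<close> this is the \<open>k\<close>-skeleton of the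
  cone, for positive \<open>k\<close>.\<close>

definition partial_cone :: "'a set \<Rightarrow> 'a set \<Rightarrow> ('a \<times> real) set" where
  "partial_cone A B = base_incl ` A \<union> cone_set B"

end

section \<open>A ball as the cone over the ball of one dimension less\<close>

lemma ball_norm_Suc_squared: "(ball_norm (Suc m) x)\<^sup>2 = (ball_norm m x)\<^sup>2 + (x m)\<^sup>2"
  by (simp add: ball_norm_def sum_nonneg)

lemma ball_norm_cong: "(\<And>i. i < q \<Longrightarrow> x i = y i) \<Longrightarrow> ball_norm q x = ball_norm q y"
  by (simp add: ball_norm_def)

lemma ball_norm_eq_0D: "ball_norm q x = 0 \<Longrightarrow> i < q \<Longrightarrow> x i = 0"
  by (simp add: ball_norm_def sum_nonneg_eq_0_iff)

lemma continuous_map_real_sqrt: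
  assumes "continuous_map X euclideanreal f" shows "continuous_map X euclideanreal (\<lambda>x. sqrt (f x))"
  using continuous_map_compose[OF assms, of euclideanreal sqrt] by (simp add: comp_def continuous_on_real_sqrt)

text \<open>The height fixes the product of \<open>t\<close> and \<open>1 + u\<close>, and then the
  radius fixes their sum. Two numbers with given sum and product can only be swapped, and
  \<open>t' \<le> 1 \<le> 1 + u\<close> leaves no room for a proper swap.\<close>

lemma chart_parameters_unique:
  fixes t u t' u' :: real
  assumes t: "0 < t" "t \<le> 1" "0 < t'" "t' \<le> 1" and u: "0 \<le> u" "0 \<le> u'"
    and s: "t - 1 + t * u = t' - 1 + t' * u'" and r: "t * (2 - t) * (1 - u\<^sup>2) = t' * (2 - t') * (1 - u'\<^sup>2)"
  shows "t = t' \<and> u = u'"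
proof -
  define c where "c = t * (1 + u)"
  have c': "c = t' * (1 + u')" using s by (simp add: c_def algebra_simps)
  have c0: "0 < c" using t u by (simp add: c_def)
  \<comment> \<open>Once the product \<open>c\<close> is known, the squared radius is an affine
    function of the sum.\<close>
  have e: "t * (2 - t) * (1 - u\<^sup>2) = c * (4 + c - 2 * ((1 + u) + t))"
    by (simp add: c_def power2_eq_square algebra_simps)
  have e': "t' * (2 - t') * (1 - u'\<^sup>2) = c * (4 + c - 2 * ((1 + u') + t'))"
    by (simp add: c' power2_eq_square algebra_simps)
  have "c * (4 + c - 2 * ((1 + u) + t)) = c * (4 + c - 2 * ((1 + u') + t'))"
    using r unfolding e e' .
  then have S: "u + t = u' + t'" using c0 by simp
  have P: "t * (1 + u) = t' * (1 + u')" using c' c_def by simp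
  have uu: "u' = u + t - t'" using S by simp
  have "((1 + u) - (1 + u')) * ((1 + u) - t') = 0"
    using P unfolding uu by (simp add: algebra_simps)
  then have "u = u' \<or> 1 + u = t'" by auto
  then show ?thesis
  proof
    assume "u = u'" then show ?thesis using S by simp
  next
    assume "1 + u = t'" then show ?thesis using t u S by linarith
  qed
qed

text \<open>The numbers \<open>t\<close> and \<open>w = 1 + u\<close> are the roots of
  \<open>X^2 - M X + c\<close>, where the height prescribes the product \<open>c\<close> and the
  radius the sum \<open>M\<close>. The two bounds on \<open>M\<close> say that 1 lies between the
  roots and that the larger root is at most 2.\<close>

lemma chart_parameters_exist:
  fixes R s :: real
  assumes R: "0 \<le> R" and s: "- 1 < s" and Rs: "R + s\<^sup>2 \<le> 1"
  obtains t u where "0 < t" "t \<le> 1" "0 \<le> u" "u \<le> 1" "t - 1 + t * u = s" "t * (2 - t) * (1 - u\<^sup>2) = R"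
proof -
  define c where "c = 1 + s"
  define M where "M = (4 + c - R / c) / 2"
  define D where "D = sqrt (M\<^sup>2 - 4 * c)"
  have c0: "0 < c" using s by (simp add: c_def)
  have "s\<^sup>2 \<le> 1" using R Rs by linarith
  then have "s \<le> 1" by (simp add: abs_square_le_1)
  then have c2: "c \<le> 2" by (simp add: c_def)
  have "R \<le> (2 - c) * c" using Rs by (simp add: c_def power2_eq_square algebra_simps)
  then have "R / c \<le> 2 - c" using c0 by (simp add: pos_divide_le_eq)
  then have M1: "1 + c \<le> M" by (simp add: M_def)
  have "0 \<le> R / c" using R c0 by simp
  then have M2: "M \<le> 2 + c / 2" by (simp add: M_def)
  \<comment> \<open>Equivalent to \<open>1 + c \<le> M\<close>. It makes the discriminant
    nonnegative and \<open>D\<close> so large that 1 lies between the roots.\<close>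
  have disc: "(M - 2)\<^sup>2 \<le> M\<^sup>2 - 4 * c" using M1 by (simp add: power2_eq_square algebra_simps)
  then have d0: "0 \<le> M\<^sup>2 - 4 * c" using zero_le_power2[of "M - 2"] by linarith
  have D0: "0 \<le> D" and D2: "D\<^sup>2 = M\<^sup>2 - 4 * c" using d0 by (simp_all add: D_def)
  have absD: "\<bar>M - 2\<bar> \<le> D" using real_sqrt_le_mono[OF disc] by (simp add: D_def)
  have "D\<^sup>2 \<le> (4 - M)\<^sup>2" unfolding D2 using M2 by (simp add: power2_eq_square algebra_simps)
  then have D4: "D \<le> 4 - M" by (rule power2_le_imp_le) (use M2 c2 in linarith)
  define w where "w = (M + D) / 2"
  define t where "t = (M - D) / 2"
  have "w * t = (M\<^sup>2 - D\<^sup>2) / 4" by (simp add: w_def t_def power2_eq_square field_simps)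
  then have wt: "w * t = c" by (simp add: D2)
  have w1: "1 \<le> w" and w2: "w \<le> 2" and t1: "t \<le> 1" using absD D4 by (simp_all add: w_def t_def abs_le_iff)
  have t0: "0 < t" using wt c0 w1 zero_less_mult_pos[of w t] by simp
  have "t * (2 - t) * (1 - (w - 1)\<^sup>2) = (w * t) * (4 + w * t - 2 * (w + t))"
    by (simp add: power2_eq_square algebra_simps)
  also have "w + t = M" by (simp add: w_def t_def field_simps)
  also have "w * t * (4 + w * t - 2 * M) = c * (4 + c - 2 * M)" unfolding wt ..
  also have "\<dots> = R" using c0 by (simp add: M_def field_simps)
  finally have r: "t * (2 - t) * (1 - (w - 1)\<^sup>2) = R" .
  have "t - 1 + t * (w - 1) = s" using wt by (simp add: c_def algebra_simps)
  from that[OF t0 t1 _ _ this r] w1 w2 show ?thesis by simp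
qed

text \<open>With \<open>u = sqrt (1 - |z|\<^sup>2)\<close> the point \<open>(sqrt (t (2 - t)) z, t - 1 + t u)\<close> has squared norm
  \<open>1 - 2 t (1 - t) u (1 + u)\<close>.  So this map identifies the cone over the ball, with vertex at
  \<open>t = 0\<close>, with the ball of the next dimension.\<close>

definition cone_chart :: "nat \<Rightarrow> (nat \<Rightarrow> real) \<times> real \<Rightarrow> nat \<Rightarrow> real" where
  "cone_chart m w = (\<lambda>i. if i < m then sqrt (snd w * (2 - snd w)) * fst w i
     else if i = m then snd w - 1 + snd w * sqrt (1 - (ball_norm m (fst w))\<^sup>2) else 0)"

lemma cone_chart_ball_norm:
  assumes "t \<in> {0..1}"
  shows "ball_norm m (cone_chart m (z, t)) = sqrt (t * (2 - t)) * ball_norm m z"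
proof -
  have "ball_norm m (cone_chart m (z, t)) = ball_norm m (\<lambda>i. sqrt (t * (2 - t)) * z i)"
    by (rule ball_norm_cong) (simp add: cone_chart_def)
  then show ?thesis using assms by (simp add: ball_norm_scale)
qed

lemma cone_chart_height: "cone_chart m (z, t) m = t - 1 + t * sqrt (1 - (ball_norm m z)\<^sup>2)"
  by (simp add: cone_chart_def)

lemma ball_height:
  assumes "z \<in> topspace (cell_ball m)"
  shows "0 \<le> sqrt (1 - (ball_norm m z)\<^sup>2)" "(ball_norm m z)\<^sup>2 = 1 - (sqrt (1 - (ball_norm m z)\<^sup>2))\<^sup>2"
proof -
  have "(ball_norm m z)\<^sup>2 \<le> 1"
    using assms by (simp add: topspace_cell_ball power_le_one)
  then show "0 \<le> sqrt (1 - (ball_norm m z)\<^sup>2)" "(ball_norm m z)\<^sup>2 = 1 - (sqrt (1 - (ball_norm m z)\<^sup>2))\<^sup>2"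
    by simp_all
qed

lemma cone_chart_norm:
  assumes z: "z \<in> topspace (cell_ball m)" and t: "t \<in> {0..1}"
  shows "(ball_norm (Suc m) (cone_chart m (z, t)))\<^sup>2 =
    1 - 2 * t * (1 - t) * sqrt (1 - (ball_norm m z)\<^sup>2) * (1 + sqrt (1 - (ball_norm m z)\<^sup>2))"
proof -
  define u where "u = sqrt (1 - (ball_norm m z)\<^sup>2)"
  have "0 \<le> t * (2 - t)" using t by simp
  then have "(ball_norm (Suc m) (cone_chart m (z, t)))\<^sup>2 = t * (2 - t) * (ball_norm m z)\<^sup>2 + (t - 1 + t * u)\<^sup>2"
    unfolding ball_norm_Suc_squared cone_chart_ball_norm[OF t] cone_chart_height u_def[symmetric]
    by (simp add: power_mult_distrib)
  also have "(ball_norm m z)\<^sup>2 = 1 - u\<^sup>2" using ball_height(2)[OF z] by (simp only: u_def)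
  also have "t * (2 - t) * (1 - u\<^sup>2) + (t - 1 + t * u)\<^sup>2 = 1 - 2 * t * (1 - t) * u * (1 + u)"
    by (simp add: power2_eq_square algebra_simps)
  finally show ?thesis unfolding u_def .
qed

text \<open>The norm formula subtracts a product of nonnegative factors from 1; the image is
  interior exactly if none of these factors vanishes.\<close>

lemma cone_chart_in_ball:
  assumes z: "z \<in> topspace (cell_ball m)" and t: "t \<in> {0..1}"
  shows "cone_chart m (z, t) \<in> topspace (cell_ball (Suc m))"
    and "cone_chart m (z, t) \<in> open_cell_ball (Suc m) \<longleftrightarrow> 0 < t \<and> t < 1 \<and> z \<in> open_cell_ball m"
proof -
  define u where "u = sqrt (1 - (ball_norm m z)\<^sup>2)"
  let ?B = "ball_norm (Suc m) (cone_chart m (z, t))"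
  have u0: "0 \<le> u" using ball_height(1)[OF z] by (simp add: u_def)
  have z0: "\<forall>i\<ge>m. z i = 0" "ball_norm m z \<le> 1" using z by (simp_all add: topspace_cell_ball)
  have n: "?B\<^sup>2 = 1 - 2 * t * (1 - t) * u * (1 + u)"
    using cone_chart_norm[OF z t] unfolding u_def .
  have "0 \<le> 2 * t * (1 - t) * u * (1 + u)" using t u0 by simp
  then have "?B\<^sup>2 \<le> 1\<^sup>2" using n by simp
  then have B1: "?B \<le> 1" by (rule power2_le_imp_le) simp
  have ze: "\<forall>i\<ge>Suc m. cone_chart m (z, t) i = 0" by (simp add: cone_chart_def)
  show "cone_chart m (z, t) \<in> topspace (cell_ball (Suc m))"
    using B1 ze by (simp add: topspace_cell_ball)
  have "?B < 1 \<longleftrightarrow> ?B\<^sup>2 < 1"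
    using power2_less_imp_less[of ?B 1] power_strict_mono[of ?B 1 2] by auto
  also have "\<dots> \<longleftrightarrow> 0 < 2 * t * (1 - t) * u * (1 + u)" using n by simp
  also have "\<dots> \<longleftrightarrow> 0 < t \<and> t < 1 \<and> 0 < u"
    using t u0 by (auto simp: zero_less_mult_iff)
  also have "0 < u \<longleftrightarrow> ball_norm m z < 1"
  proof -
    have "0 < u \<longleftrightarrow> (ball_norm m z)\<^sup>2 < 1" by (simp add: u_def)
    then show ?thesis using power2_less_imp_less[of "ball_norm m z" 1] power_strict_mono[of "ball_norm m z" 1 2] by auto
  qed
  finally show "cone_chart m (z, t) \<in> open_cell_ball (Suc m) \<longleftrightarrow> 0 < t \<and> t < 1 \<and> z \<in> open_cell_ball m"
    using ze z0 by (simp add: open_cell_ball_eq)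
qed

lemma cone_chart_zero: "cone_chart m (z, 0) = cone_chart m (z', 0)"
  by (simp add: cone_chart_def fun_eq_iff)

text \<open>Height and radius of the image determine \<open>t\<close> and the value
  \<open>u\<close>. Away from \<open>t = 0\<close> the scaling factor is nonzero, so the first
  \<open>m\<close> coordinates then determine \<open>z\<close>.\<close>

lemma cone_chart_injective:
  assumes z: "z \<in> topspace (cell_ball m)" "z' \<in> topspace (cell_ball m)" and t: "t \<in> {0..1}" "t' \<in> {0..1}"
    and e: "cone_chart m (z, t) = cone_chart m (z', t')"
  shows "t = 0 \<and> t' = 0 \<or> z = z' \<and> t = t'"
proof -
  define u u' where "u = sqrt (1 - (ball_norm m z)\<^sup>2)" and "u' = sqrt (1 - (ball_norm m z')\<^sup>2)"
  have u0: "0 \<le> u" "0 \<le> u'" using ball_height(1) z by (simp_all add: u_def u'_def)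
  have N: "(ball_norm m z)\<^sup>2 = 1 - u\<^sup>2" "(ball_norm m z')\<^sup>2 = 1 - u'\<^sup>2"
    using ball_height(2)[OF z(1)] ball_height(2)[OF z(2)] by (simp_all only: u_def u'_def)
  have s: "t - 1 + t * u = t' - 1 + t' * u'"
    using cone_chart_height[of m z t] cone_chart_height[of m z' t'] e by (simp add: u_def u'_def)
  have c: "t * (1 + u) = t' * (1 + u')" using s by (simp add: algebra_simps)
  show ?thesis
  proof (cases "t = 0 \<or> t' = 0")
    case True
    then have "t' * (1 + u') = 0 \<and> t * (1 + u) = 0" using c by auto
    then show ?thesis using u0 by auto
  next
    case False
    then have tp: "0 < t" "t \<le> 1" "0 < t'" "t' \<le> 1" using t by auto
    have nn: "0 \<le> t * (2 - t)" "0 \<le> t' * (2 - t')" using t by simp_all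
    have "(sqrt (t * (2 - t)) * ball_norm m z)\<^sup>2 = (sqrt (t' * (2 - t')) * ball_norm m z')\<^sup>2"
      using cone_chart_ball_norm[OF t(1), of m z] cone_chart_ball_norm[OF t(2), of m z'] e by simp
    then have "t * (2 - t) * (1 - u\<^sup>2) = t' * (2 - t') * (1 - u'\<^sup>2)"
      using nn unfolding power_mult_distrib N by simp
    from chart_parameters_unique[OF tp u0 s this] have tt: "t = t'" by simp
    have k: "sqrt (t * (2 - t)) \<noteq> 0" using tp by simp
    have "z i = z' i" for i
    proof (cases "i < m")
      case True
      then show ?thesis using fun_cong[OF e, of i] k by (simp add: cone_chart_def tt)
    next
      case False
      then show ?thesis using z by (simp add: topspace_cell_ball)
    qed
    then show ?thesis using tt by auto
  qed
qed

text \<open>The pole at height -1 is the image of the vertex. Any other point has height above -1,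
  and its parameters come from the quadratic equation.\<close>

lemma cone_chart_surjective:
  assumes y: "y \<in> topspace (cell_ball (Suc m))"
  obtains z t where "z \<in> topspace (cell_ball m)" "t \<in> {0..1}" "y = cone_chart m (z, t)"
proof -
  let ?R = "(ball_norm m y)\<^sup>2"
  have y0: "\<And>i. Suc m \<le> i \<Longrightarrow> y i = 0" and "ball_norm (Suc m) y \<le> 1"
    using y by (simp_all add: topspace_cell_ball)
  then have "(ball_norm (Suc m) y)\<^sup>2 \<le> 1" by (simp add: power_le_one)
  then have Rs: "?R + (y m)\<^sup>2 \<le> 1" by (simp only: ball_norm_Suc_squared)
  show ?thesis
  proof (cases "y m = - 1")
    case True
    then have "ball_norm m y = 0" using Rs by simp
    then have "y i = 0" if "i < m" for i using ball_norm_eq_0D that by blast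
    then have "y = cone_chart m (\<lambda>i. 0, 0)"
      using True y0 by (auto simp: cone_chart_def fun_eq_iff)
    then show ?thesis by (rule that[rotated 2]) (simp_all add: topspace_cell_ball ball_norm_def)
  next
    case False
    have "(y m)\<^sup>2 \<le> 1" using Rs zero_le_power2[of "ball_norm m y"] by linarith
    then have "- 1 < y m" using False by (simp add: abs_square_le_1 abs_le_iff)
    then obtain t u where tu: "0 < t" "t \<le> 1" "0 \<le> u" "u \<le> 1" "t - 1 + t * u = y m" "t * (2 - t) * (1 - u\<^sup>2) = ?R"
      using chart_parameters_exist[OF zero_le_power2 _ Rs] by blast
    define k where "k = sqrt (t * (2 - t))"
    have k0: "0 < k" and k2: "k\<^sup>2 = t * (2 - t)" using tu by (simp_all add: k_def)
    define z where "z = (\<lambda>i. if i < m then y i / k else 0)"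
    have "ball_norm m z = ball_norm m (\<lambda>i. (1 / k) * y i)" by (rule ball_norm_cong) (simp add: z_def)
    then have "ball_norm m z = ball_norm m y / k" unfolding ball_norm_scale using k0 by simp
    then have "(ball_norm m z)\<^sup>2 = ?R / (t * (2 - t))" by (simp add: power_divide k2)
    also have "\<dots> = 1 - u\<^sup>2" using tu by (simp add: field_simps flip: tu(6))
    finally have N: "(ball_norm m z)\<^sup>2 = 1 - u\<^sup>2" .
    then have "(ball_norm m z)\<^sup>2 \<le> 1\<^sup>2" by simp
    then have "ball_norm m z \<le> 1" by (rule power2_le_imp_le) simp
    then have zb: "z \<in> topspace (cell_ball m)" by (simp add: topspace_cell_ball z_def)
    have "sqrt (1 - (ball_norm m z)\<^sup>2) = u" using tu by (simp add: N)
    then have "y = cone_chart m (z, t)"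
      using tu(5) y0 k0 by (auto simp: cone_chart_def fun_eq_iff z_def k_def[symmetric])
    then show ?thesis by (rule that[rotated 2]) (use zb tu in auto)
  qed
qed

text \<open>Automatic for a continuous surjection of a compact space onto a Hausdorff space; it lets
  maps on the cylinder over a ball descend to a ball.\<close>

lemma quotient_map_cone_chart:
  "quotient_map (prod_topology (cell_ball m) (top_of_set {0..1})) (cell_ball (Suc m)) (cone_chart m)"
proof (rule continuous_imp_quotient_map)
  let ?I = "top_of_set {0..1::real}" let ?P = "prod_topology (cell_ball m) ?I"
  have f: "continuous_map ?P euclideanreal (\<lambda>w. fst w k)" for k
    using continuous_map_compose[OF continuous_map_fst[of "cell_ball m" ?I] continuous_map_cell_ball_coordinate[of m k]]
    by (simp add: comp_def)
  have s: "continuous_map ?P euclideanreal snd"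
    using continuous_map_snd[of "cell_ball m" ?I] by (rule continuous_map_into_fulltopology)
  have n: "continuous_map ?P euclideanreal (\<lambda>w. (ball_norm m (fst w))\<^sup>2)"
    by (intro continuous_map_real_pow continuous_map_ball_norm f)
  show "continuous_map ?P (cell_ball (Suc m)) (cone_chart m)"
    unfolding continuous_map_into_cell_ball
  proof (intro conjI allI)
    fix k
    consider "k < m" | "k = m" | "m < k" by linarith
    then show "continuous_map ?P euclideanreal (\<lambda>w. cone_chart m w k)"
    proof cases
      case 1
      then show ?thesis unfolding cone_chart_def
        by (simp, intro continuous_map_real_mult continuous_map_real_sqrt continuous_map_diff s f) simp
    next
      case 2
      then show ?thesis unfolding cone_chart_def
        by (simp, intro continuous_map_add continuous_map_real_mult continuous_map_real_sqrt continuous_map_diff s n) simp_all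
    next
      case 3
      then show ?thesis by (simp add: cone_chart_def)
    qed
    show "cone_chart m \<in> topspace ?P \<rightarrow> topspace (cell_ball (Suc m))"
    proof
      fix w assume "w \<in> topspace ?P"
      then have "fst w \<in> topspace (cell_ball m)" "snd w \<in> {0..1}" by auto
      from cone_chart_in_ball(1)[OF this] show "cone_chart m w \<in> topspace (cell_ball (Suc m))" by simp
    qed
  qed
  show "compact_space ?P"
    unfolding compact_space_prod_topology using compact_space_cell_ball[of m] by (simp add: compact_space_subtopology)
  have "Hausdorff_space (powertop_real UNIV)" by (simp add: Hausdorff_space_product_topology)
  then show "Hausdorff_space (cell_ball (Suc m))"
    by (subst cell_ball_eq) (rule Hausdorff_space_subtopology)
  show "cone_chart m ` topspace ?P = topspace (cell_ball (Suc m))"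
  proof
    show "cone_chart m ` topspace ?P \<subseteq> topspace (cell_ball (Suc m))"
      using cone_chart_in_ball(1) by auto
    show "topspace (cell_ball (Suc m)) \<subseteq> cone_chart m ` topspace ?P"
    proof
      fix y assume "y \<in> topspace (cell_ball (Suc m))"
      then obtain z t where "z \<in> topspace (cell_ball m)" "t \<in> {0..1}" "y = cone_chart m (z, t)"
        by (rule cone_chart_surjective)
      then show "y \<in> cone_chart m ` topspace ?P" by (intro image_eqI[of _ _ "(z, t)"]) auto
    qed
  qed
qed

lemma cell_sphere_subset: "cell_sphere m \<subseteq> topspace (cell_ball m)" "open_cell_ball m \<subseteq> topspace (cell_ball m)"
  by (auto simp: topspace_cell_ball open_cell_ball_eq)

context cone_space
begin

text \<open>The cone of the characteristic map identifies the same points of the cylinder as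
  \<open>cone_chart\<close>. So it factors through the ball, is injective there, and is an embedding
  by compactness. The sphere is covered by the bottom, the top and the side of the cylinder, which
  accounts for the three parts of the last conclusion.\<close>

lemma cone_cell_characteristic_map:
  assumes \<phi>: "embedding_map (cell_ball m) X \<phi>"
  obtains f where "embedding_map (cell_ball (Suc m)) Y f" "f ` open_cell_ball (Suc m) = cone_cell (\<phi> ` open_cell_ball m)"
    "f ` cell_sphere (Suc m) \<subseteq> insert apex (base_incl ` \<phi> ` topspace (cell_ball m) \<union> cone_set (\<phi> ` cell_sphere m))"
proof -
  let ?I = "top_of_set {0..1::real}" let ?P = "prod_topology (cell_ball m) ?I"
  let ?h = "\<lambda>w. cone_map (\<phi> (fst w), snd w)"
  have hom: "homeomorphic_map (cell_ball m) (subtopology X (\<phi> ` topspace (cell_ball m))) \<phi>"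
    using \<phi> unfolding embedding_map_def .
  have c\<phi>: "continuous_map (cell_ball m) X \<phi>"
    using homeomorphic_imp_continuous_map[OF hom] by (rule continuous_map_into_fulltopology)
  have inj: "inj_on \<phi> (topspace (cell_ball m))"
    using hom by (simp add: homeomorphic_map_def)
  have "continuous_map ?P (cyl X) (\<lambda>w. (\<phi> (fst w), snd w))"
    by (intro continuous_map_pairedI continuous_map_snd continuous_map_compose[OF continuous_map_fst c\<phi>, unfolded comp_def])
  from continuous_map_compose[OF this continuous_map_cone_map]
  have ch: "continuous_map ?P Y ?h" by (simp add: comp_def)
  have P: "w \<in> topspace ?P \<longleftrightarrow> fst w \<in> topspace (cell_ball m) \<and> snd w \<in> {0..1}" for w by (cases w) auto
  have hh: "?h v = ?h w \<longleftrightarrow> cone_chart m v = cone_chart m w" if v: "v \<in> topspace ?P" and w: "w \<in> topspace ?P" for v w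
  proof
    assume "?h v = ?h w"
    then have "snd v = 0 \<and> snd w = 0 \<or> \<phi> (fst v) = \<phi> (fst w) \<and> snd v = snd w"
      by (auto simp: cone_map_def apex_def split: if_splits)
    then show "cone_chart m v = cone_chart m w"
    proof
      assume "snd v = 0 \<and> snd w = 0"
      then show ?thesis using cone_chart_zero[of m "fst v" "fst w"] by (metis prod.collapse)
    next
      assume e: "\<phi> (fst v) = \<phi> (fst w) \<and> snd v = snd w"
      then have "fst v = fst w" using inj v w unfolding P by (auto dest: inj_onD)
      then show ?thesis using e by (metis prod.collapse)
    qed
  next
    assume e: "cone_chart m v = cone_chart m w"
    have "snd v = 0 \<and> snd w = 0 \<or> fst v = fst w \<and> snd v = snd w"
      by (rule cone_chart_injective) (use v w e in \<open>auto simp: P\<close>)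
    then show "?h v = ?h w" by (auto simp: cone_map_def)
  qed
  have fib: "\<And>v w. v \<in> topspace ?P \<Longrightarrow> w \<in> topspace ?P \<Longrightarrow> cone_chart m v = cone_chart m w \<Longrightarrow> ?h v = ?h w"
    by (rule iffD2[OF hh])
  obtain f where f: "continuous_map (cell_ball (Suc m)) Y f" and "f ` topspace (cell_ball (Suc m)) = ?h ` topspace ?P"
    and fh: "\<And>w. w \<in> topspace ?P \<Longrightarrow> f (cone_chart m w) = ?h w"
    by (rule quotient_map_lift_exists[OF quotient_map_cone_chart ch]) (rule fib, assumption+, rule that)
  have ex: "\<exists>w \<in> topspace ?P. y = cone_chart m w" if y: "y \<in> topspace (cell_ball (Suc m))" for y
  proof -
    obtain z t where "z \<in> topspace (cell_ball m)" "t \<in> {0..1}" "y = cone_chart m (z, t)"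
      using cone_chart_surjective[OF y] .
    then show ?thesis by (intro bexI[of _ "(z, t)"]) auto
  qed
  have op: "cone_chart m w \<in> open_cell_ball (Suc m) \<longleftrightarrow> 0 < snd w \<and> snd w < 1 \<and> fst w \<in> open_cell_ball m"
    if "w \<in> topspace ?P" for w
    using cone_chart_in_ball(2)[of "fst w" m "snd w"] that unfolding P by simp
  show ?thesis
  proof (rule that)
    show "embedding_map (cell_ball (Suc m)) Y f"
    proof (rule embedding_map_compact_Hausdorff[OF f compact_space_cell_ball haus_Y])
      show "inj_on f (topspace (cell_ball (Suc m)))"
      proof (rule inj_onI)
        fix x y assume "x \<in> topspace (cell_ball (Suc m))" "y \<in> topspace (cell_ball (Suc m))" and e: "f x = f y"
        then obtain v w where vw: "v \<in> topspace ?P" "x = cone_chart m v" "w \<in> topspace ?P" "y = cone_chart m w"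
          using ex by metis
        then show "x = y" using e hh[OF vw(1,3)] fh by simp
      qed
    qed
    show "f ` open_cell_ball (Suc m) = cone_cell (\<phi> ` open_cell_ball m)"
    proof
      show "f ` open_cell_ball (Suc m) \<subseteq> cone_cell (\<phi> ` open_cell_ball m)"
      proof (rule image_subsetI)
        fix y assume y: "y \<in> open_cell_ball (Suc m)"
        then obtain w where w: "w \<in> topspace ?P" "y = cone_chart m w" using ex cell_sphere_subset(2) by blast
        then show "f y \<in> cone_cell (\<phi> ` open_cell_ball m)"
          using y fh[OF w(1)] op[OF w(1)] by (simp add: cone_map_def cone_cell_def)
      qed
      show "cone_cell (\<phi> ` open_cell_ball m) \<subseteq> f ` open_cell_ball (Suc m)"
      proof
        fix x assume "x \<in> cone_cell (\<phi> ` open_cell_ball m)"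
        then obtain z t where zt: "z \<in> open_cell_ball m" "0 < t" "t < 1" "x = (\<phi> z, t)" by (auto simp: cone_cell_def)
        then have w: "(z, t) \<in> topspace ?P" using cell_sphere_subset(2)[of m] by auto
        show "x \<in> f ` open_cell_ball (Suc m)"
          using op[OF w] fh[OF w] zt by (intro image_eqI[of _ _ "cone_chart m (z, t)"]) (auto simp: cone_map_def)
      qed
    qed
    show "f ` cell_sphere (Suc m) \<subseteq> insert apex (base_incl ` \<phi> ` topspace (cell_ball m) \<union> cone_set (\<phi> ` cell_sphere m))"
    proof (rule image_subsetI)
      fix y assume y: "y \<in> cell_sphere (Suc m)"
      then obtain w where w: "w \<in> topspace ?P" "y = cone_chart m w" using ex by blast
      have fy: "f y = ?h w" using fh w by simp
      consider "snd w = 0" | "snd w = 1" | "fst w \<in> cell_sphere m"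
        using y op[OF w(1)] w by (fastforce simp: P)
      then show "f y \<in> insert apex (base_incl ` \<phi> ` topspace (cell_ball m) \<union> cone_set (\<phi> ` cell_sphere m))"
      proof cases
        case 1 then show ?thesis by (simp add: fy cone_map_def)
      next
        case 2
        then have "f y = base_incl (\<phi> (fst w))" by (simp add: fy cone_map_def base_incl_def)
        moreover have "fst w \<in> topspace (cell_ball m)" using w(1) unfolding P by (rule conjunct1)
        ultimately show ?thesis by blast
      next
        case 3
        then have "f y \<in> cone_set (\<phi> ` cell_sphere m)"
          unfolding fy cone_set_def using w by (intro imageI) (auto simp: P)
        then show ?thesis by blast
      qed
    qed
  qed
qed

end

section \<open>Filtrations and regular complexes\<close>

lemma trivial_group_carrier: "trivial_group G \<Longrightarrow> x \<in> carrier G \<Longrightarrow> x = \<one>\<^bsub>G\<^esub>"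
  by (simp add: trivial_group_def)

lemma kernel_empty_iff:
  "x \<in> kernel G H h \<longleftrightarrow> x \<in> carrier G \<and> h x = \<one>\<^bsub>H\<^esub>"
  by (simp add: kernel_def)

text \<open>Reduces the boundary operators of triples to those of pairs.\<close>

lemma relboundary_factor:
  "hom_relboundary p X S T x =
    hom_induced (p - 1) (subtopology X S) {} (subtopology X S) T id (hom_relboundary p X S {} x)"
  by (simp add: hom_relboundary_def[of p X S T] hom_relboundary_empty)

lemma relboundary_in_carrier:
  "hom_relboundary p X S T x \<in> carrier (relative_homology_group (p - 1) (subtopology X S) T)"
  by (simp add: hom_relboundary_def hom_induced_carrier)

lemma hom_induced_one:
  "hom_induced p X S Y T f \<one>\<^bsub>relative_homology_group p X S\<^esub> = \<one>\<^bsub>relative_homology_group p Y T\<^esub>"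
  using hom_one[OF hom_induced_hom[of p X S Y T f]] by simp

lemma relboundary_induced_one:
  assumes "y \<in> carrier (homology_group p X)"
  shows "hom_relboundary p X T U (hom_induced p X {} X T id y) = \<one>\<^bsub>relative_homology_group (p - 1) (subtopology X T) U\<^esub>"
proof -
  have "hom_induced p X {} X T id y \<in> kernel (relative_homology_group p X T) (homology_group (p - 1) (subtopology X T)) (hom_relboundary p X T {})"
    unfolding relative_exact(1)[OF empty_subsetI] using assms by (rule imageI)
  then have "hom_relboundary p X T {} (hom_induced p X {} X T id y) = \<one>\<^bsub>homology_group (p - 1) (subtopology X T)\<^esub>"
    unfolding kernel_empty_iff by (rule conjunct2)
  then show ?thesis
    by (subst relboundary_factor) (simp only: hom_induced_one)
qed

text \<open>The first boundary factors through an absolute class, and absolute classes have trivial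
  boundary.\<close>

lemma relboundary_relboundary:
  "hom_relboundary (p - 1) (subtopology X S) T U (hom_relboundary p X S T x) =
    \<one>\<^bsub>relative_homology_group (p - 1 - 1) (subtopology (subtopology X S) T) U\<^esub>"
  by (subst relboundary_factor[of p X S T]) (rule relboundary_induced_one[OF relboundary_in_carrier])

lemma relative_trivial_pair:
  assumes X: "trivial_group (homology_group p X)" and T: "trivial_group (homology_group (p - 1) (subtopology X T))"
  shows "trivial_group (relative_homology_group p X T)"
proof -
  have "x = \<one>\<^bsub>relative_homology_group p X T\<^esub>" if x: "x \<in> carrier (relative_homology_group p X T)" for x
  proof -
    have "hom_relboundary p X T {} x = \<one>\<^bsub>homology_group (p - 1) (subtopology X T)\<^esub>"
      by (rule trivial_group_carrier[OF T relboundary_in_carrier])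
    then have "x \<in> kernel (relative_homology_group p X T) (homology_group (p - 1) (subtopology X T)) (hom_relboundary p X T {})"
      unfolding kernel_empty_iff using x by (rule conjI[rotated])
    then obtain y where y: "y \<in> carrier (homology_group p X)" "x = hom_induced p X {} X T id y"
      unfolding relative_exact(1)[OF empty_subsetI] by (rule imageE)
    have "y = \<one>\<^bsub>homology_group p X\<^esub>" by (rule trivial_group_carrier[OF X y(1)])
    then show ?thesis unfolding y(2) by (simp only: hom_induced_one)
  qed
  then have "carrier (relative_homology_group p X T) = {\<one>\<^bsub>relative_homology_group p X T\<^esub>}"
    using monoid.one_closed[OF group.is_monoid[OF group_relative_homology_group[of p X T]]] by blast
  then show ?thesis by (simp add: trivial_group_def)
qed

lemma relative_trivial_self: "trivial_group (relative_homology_group p (subtopology X S) S)"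
proof -
  have "relative_homology_group p (subtopology X S) S = relative_homology_group p (subtopology X S) (topspace (subtopology X S) \<inter> S)"
    by (rule relative_homology_group_restrict[symmetric])
  also have "topspace (subtopology X S) \<inter> S = topspace (subtopology X S)" by auto
  finally show ?thesis using trivial_relative_homology_group_topspace[of p "subtopology X S"] by simp
qed

lemma filt_boundary_hom:
  assumes "F (q - 1) \<subseteq> F q"
  shows "filt_boundary X F q \<in> hom (filt_group X F q) (filt_group X F (q - 1))"
  using group_homomorphism_hom_relboundary[of q "subtopology X (F q)" "F (q - 1)" "F (q - 2)"] assms
  by (simp add: filt_boundary_def filt_group_def subtopology_subtopology Int_absorb1)

lemma filt_boundary_boundary:
  assumes "F (q - 1) \<subseteq> F q" "F q \<subseteq> F (q + 1)"
  shows "filt_boundary X F q (filt_boundary X F (q + 1) x) = \<one>\<^bsub>filt_group X F (q - 1)\<^esub>"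
  using relboundary_relboundary[of "q + 1" "subtopology X (F (q + 1))" "F q" "F (q - 1)" "F (q - 2)" x] assms
  by (simp add: filt_boundary_def filt_group_def subtopology_subtopology Int_absorb1)

text \<open>The boundary of \<open>x\<close> in the homology of \<open>W\<close> dies in
  \<open>(W, U)\<close>, so it comes from \<open>V\<close>, where nothing is left; hence
  \<open>x\<close> lifts to an absolute class.\<close>

lemma kernel_relative_boundary:
  assumes S: "subtopology Y T = W" and U: "subtopology W U = V" and V: "trivial_group (homology_group (q - 1) V)"
    and x: "x \<in> carrier (relative_homology_group q Y T)"
    and b: "hom_relboundary q Y T U x = \<one>\<^bsub>relative_homology_group (q - 1) W U\<^esub>"
  obtains y where "y \<in> carrier (homology_group q Y)" "x = hom_induced q Y {} Y T id y"
proof -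
  let ?y = "hom_relboundary q Y T {} x"
  have yc: "?y \<in> carrier (homology_group (q - 1) W)" using relboundary_in_carrier[of q Y T "{}" x] unfolding S .
  have "hom_induced (q - 1) W {} W U id ?y = \<one>\<^bsub>relative_homology_group (q - 1) W U\<^esub>"
    using b relboundary_factor[of q Y T U x] unfolding S by simp
  with yc have "?y \<in> kernel (homology_group (q - 1) W) (relative_homology_group (q - 1) W U) (hom_induced (q - 1) W {} W U id)"
    unfolding kernel_empty_iff by (rule conjI)
  moreover have "kernel (homology_group (q - 1) W) (relative_homology_group (q - 1) W U) (hom_induced (q - 1) W {} W U id)
      = hom_induced (q - 1) V {} W {} id ` carrier (homology_group (q - 1) V)"
    using relative_exact(3)[OF empty_subsetI, of "q - 1" W U] unfolding U .
  ultimately have "?y \<in> hom_induced (q - 1) V {} W {} id ` carrier (homology_group (q - 1) V)" by (rule back_subst)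
  then obtain z where z: "z \<in> carrier (homology_group (q - 1) V)" "?y = hom_induced (q - 1) V {} W {} id z" by (rule imageE)
  have "?y = \<one>\<^bsub>homology_group (q - 1) W\<^esub>"
    unfolding z(2) trivial_group_carrier[OF V z(1)] by (rule hom_induced_one)
  with x have "x \<in> kernel (relative_homology_group q Y T) (homology_group (q - 1) (subtopology Y T)) (hom_relboundary q Y T {})"
    unfolding kernel_empty_iff S by (rule conjI)
  then show ?thesis
    unfolding relative_exact(1)[OF empty_subsetI] using that by (rule imageE)
qed

text \<open>A cycle lifts to an absolute class of \<open>F q\<close>. If such classes die in
  \<open>F (q + 1)\<close>, they are boundaries of relative classes of the next pair. In the
  application they die because a cone lies in between.\<close>

lemma filt_exact:
  assumes sub: "F (q - 2) \<subseteq> F (q - 1)" "F (q - 1) \<subseteq> F q" "F q \<subseteq> F (q + 1)"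
    and van: "trivial_group (homology_group (q - 1) (subtopology X (F (q - 2))))"
    and zero: "\<And>y. y \<in> carrier (homology_group q (subtopology X (F q))) \<Longrightarrow>
      hom_induced q (subtopology X (F q)) {} (subtopology X (F (q + 1))) {} id y = \<one>\<^bsub>homology_group q (subtopology X (F (q + 1)))\<^esub>"
  shows "kernel (filt_group X F q) (filt_group X F (q - 1)) (filt_boundary X F q)
    \<subseteq> filt_boundary X F (q + 1) ` carrier (filt_group X F (q + 1))"
proof
  let ?Y = "subtopology X (F q)" and ?V = "subtopology X (F (q + 1))"
  fix x assume "x \<in> kernel (filt_group X F q) (filt_group X F (q - 1)) (filt_boundary X F q)"
  then have x: "x \<in> carrier (relative_homology_group q ?Y (F (q - 1)))"
    "hom_relboundary q ?Y (F (q - 1)) (F (q - 2)) x = \<one>\<^bsub>relative_homology_group (q - 1) (subtopology X (F (q - 1))) (F (q - 2))\<^esub>"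
    unfolding kernel_empty_iff filt_group_def filt_boundary_def by (simp_all add: diff_diff_eq)
  have W: "subtopology ?Y (F (q - 1)) = subtopology X (F (q - 1))"
    "subtopology (subtopology X (F (q - 1))) (F (q - 2)) = subtopology X (F (q - 2))"
    "subtopology ?V (F q) = ?Y"
    using sub by (simp_all add: subtopology_subtopology Int_absorb1)
  obtain y where y: "y \<in> carrier (homology_group q ?Y)" "x = hom_induced q ?Y {} ?Y (F (q - 1)) id y"
    using kernel_relative_boundary[OF W(1,2) van x] .
  have "y \<in> kernel (homology_group q ?Y) (homology_group q ?V) (hom_induced q ?Y {} ?V {} id)"
    unfolding kernel_empty_iff using y(1) zero[OF y(1)] by (rule conjI)
  moreover have "kernel (homology_group q ?Y) (homology_group q ?V) (hom_induced q ?Y {} ?V {} id)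
      = hom_relboundary (q + 1) ?V (F q) {} ` carrier (relative_homology_group (q + 1) ?V (F q))"
    using relative_exact(2)[OF empty_subsetI, of "q + 1" ?V "F q"] unfolding W by simp
  ultimately obtain w where w: "w \<in> carrier (relative_homology_group (q + 1) ?V (F q))" "y = hom_relboundary (q + 1) ?V (F q) {} w"
    by auto
  have "filt_boundary X F (q + 1) w = x"
    using relboundary_factor[of "q + 1" ?V "F q" "F (q - 1)" w] w(2) y(2) unfolding filt_boundary_def by (simp add: W)
  moreover have "w \<in> carrier (filt_group X F (q + 1))" using w(1) by (simp add: filt_group_def)
  ultimately show "x \<in> filt_boundary X F (q + 1) ` carrier (filt_group X F (q + 1))" by blast
qed

text \<open>Separates the choice of generators from the chains they induce;
  \<open>oriented_cells\<close> hides this choice inside each entry.\<close>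

lemma list_all2_choose:
  "list_all2 (\<lambda>e s. \<exists>g. P e g \<and> s = f e g) es ss \<longleftrightarrow> (\<exists>gs. list_all2 P es gs \<and> ss = map2 f es gs)"
proof (induction es arbitrary: ss)
  case (Cons e es)
  show ?case
  proof
    assume "list_all2 (\<lambda>e s. \<exists>g. P e g \<and> s = f e g) (e # es) ss"
    then obtain s ss' where s: "ss = s # ss'" "\<exists>g. P e g \<and> s = f e g" "list_all2 (\<lambda>e s. \<exists>g. P e g \<and> s = f e g) es ss'"
      by (auto simp: list_all2_Cons1)
    obtain g where "P e g" "s = f e g" using s(2) by blast
    moreover obtain gs where "list_all2 P es gs" "ss' = map2 f es gs" using s(3) unfolding Cons.IH by blast
    ultimately show "\<exists>gs. list_all2 P (e # es) gs \<and> ss = map2 f (e # es) gs"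
      using s(1) by (intro exI[of _ "g # gs"]) simp
  next
    assume "\<exists>gs. list_all2 P (e # es) gs \<and> ss = map2 f (e # es) gs"
    then obtain g gs where "P e g" "list_all2 P es gs" "ss = f e g # map2 f es gs"
      by (auto simp: list_all2_Cons1)
    then show "list_all2 (\<lambda>e s. \<exists>g. P e g \<and> s = f e g) (e # es) ss"
      using Cons.IH[of "map2 f es gs"] by auto
  qed
qed auto

lemma list_all2_exists:
  assumes "\<And>x. x \<in> set xs \<Longrightarrow> \<exists>y. P x y" shows "\<exists>ys. list_all2 P xs ys"
  using assms
proof (induction xs)
  case (Cons x xs)
  obtain y where "P x y" using Cons.prems[of x] by auto
  moreover obtain ys where "list_all2 P xs ys" using Cons by auto
  ultimately show ?case by (intro exI[of _ "y # ys"]) simp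
qed auto

lemma oriented_cells_iff:
  "oriented_cells X F (int q) A ss \<longleftrightarrow> (\<exists>es gs. distinct es \<and> set es = A \<and>
     list_all2 (cell_generator X q) es gs \<and> ss = map2 (push_cell X q (F (int q)) (F (int q - 1))) es gs)"
proof -
  have "oriented_cell X F (int q) = (\<lambda>e s. \<exists>g. cell_generator X q e g \<and> s = push_cell X q (F (int q)) (F (int q - 1)) e g)"
    by (intro ext) (simp add: oriented_cell_def cell_generator_def push_cell_def Let_def Bex_def conj_assoc)
  then show ?thesis unfolding oriented_cells_def list_all2_choose by (simp only: list_all2_choose ex_simps)
qed

section \<open>Simultaneous attachment of cells\<close>

definition attachable :: "'a topology \<Rightarrow> 'a set \<Rightarrow> nat \<Rightarrow> 'a set set \<Rightarrow> bool" where
  "attachable X A q C \<longleftrightarrow> closedin X A \<and> finite C \<and> (\<forall>e\<in>C. attached_cell X A q e) \<and> (\<forall>e\<in>C. e \<inter> A = {}) \<and>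
     (\<forall>e\<in>C. \<forall>f\<in>C. e \<noteq> f \<longrightarrow> e \<inter> f = {})"

lemma attachableD:
  assumes "attachable X A q C"
  shows "closedin X A" "e \<in> C \<Longrightarrow> e \<inter> A = {}"
  using assms by (simp_all add: attachable_def)

lemma attach_cells:
  assumes X: "Hausdorff_space X" and at: "attachable X A q C" and F: "F = A \<union> \<Union>C"
  shows "closedin X F" "p \<noteq> int q \<Longrightarrow> trivial_group (relative_homology_group p (subtopology X F) A)"
    and "\<exists>es gs. distinct es \<and> set es = C \<and> list_all2 (cell_generator X q) es gs"
    and "distinct es \<Longrightarrow> set es = C \<Longrightarrow> list_all2 (cell_generator X q) es gs \<Longrightarrow>
      int_basis (relative_homology_group (int q) (subtopology X F) A)
        (carrier (relative_homology_group (int q) (subtopology X F) A)) (map2 (push_cell X q F A) es gs)"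
proof -
  have A: "closedin X A" and C: "finite C" and ac: "\<And>e. e \<in> C \<Longrightarrow> attached_cell X A q e" and dj: "\<And>e. e \<in> C \<Longrightarrow> e \<inter> A = {}"
    and dd: "\<And>e f. e \<in> C \<Longrightarrow> f \<in> C \<Longrightarrow> e \<noteq> f \<Longrightarrow> e \<inter> f = {}"
    using at unfolding attachable_def by simp_all
  have main: "closedin X F \<and> (\<forall>p. p \<noteq> int q \<longrightarrow> trivial_group (relative_homology_group p (subtopology X F) A)) \<and>
      int_basis (relative_homology_group (int q) (subtopology X F) A)
        (carrier (relative_homology_group (int q) (subtopology X F) A)) (map2 (push_cell X q F A) es gs)"
    if e: "distinct es" "set es = C" "list_all2 (cell_generator X q) es gs" for es gs
    unfolding F e(2)[symmetric]
    by (rule attached_cells[OF X A e(1) _ _ e(3)]) (simp_all add: e(2) ac dj dd)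
  obtain es0 where es: "distinct es0" "set es0 = C" using finite_distinct_list[OF C] by blast
  have gen: "\<exists>g. cell_generator X q e g" if "e \<in> set es0" for e
    by (rule attached_cell_facts(6)[OF X A order_refl]) (use that es(2) ac dj in simp_all)
  have "\<exists>gs. list_all2 (cell_generator X q) es0 gs" by (rule list_all2_exists) (rule gen)
  then obtain gs0 where gs: "list_all2 (cell_generator X q) es0 gs0" ..
  show "\<exists>es gs. distinct es \<and> set es = C \<and> list_all2 (cell_generator X q) es gs" using es gs by blast
  show "closedin X F" using main[OF es gs] by (rule conjunct1)
  show "trivial_group (relative_homology_group p (subtopology X F) A)" if "p \<noteq> int q"
    using main[OF es gs] that by simp
  show "int_basis (relative_homology_group (int q) (subtopology X F) A)
        (carrier (relative_homology_group (int q) (subtopology X F) A)) (map2 (push_cell X q F A) es gs)"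
    if "distinct es" "set es = C" "list_all2 (cell_generator X q) es gs"
    using main[OF that] by simp
qed

lemma attach_oriented_cells:
  assumes X: "Hausdorff_space X" and at: "attachable X (F (int q - 1)) q C" and F: "F (int q) = F (int q - 1) \<union> \<Union>C"
  shows "oriented_cells X F (int q) C ss \<Longrightarrow> int_basis (filt_group X F (int q)) (carrier (filt_group X F (int q))) ss"
    and "\<exists>ss. oriented_cells X F (int q) C ss"
proof -
  note at = attach_cells[OF X at F]
  show "int_basis (filt_group X F (int q)) (carrier (filt_group X F (int q))) ss" if o: "oriented_cells X F (int q) C ss"
  proof -
    obtain es gs where e: "distinct es" "set es = C" "list_all2 (cell_generator X q) es gs"
      and ss: "ss = map2 (push_cell X q (F (int q)) (F (int q - 1))) es gs"
      using o unfolding oriented_cells_iff by (elim exE conjE)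
    show ?thesis unfolding filt_group_def ss by (rule at(4)[OF e])
  qed
  show "\<exists>ss. oriented_cells X F (int q) C ss"
    using at(3) unfolding oriented_cells_iff by (elim exE conjE) (intro exI conjI, assumption+, rule refl)
qed

section \<open>Skeleta of a finite regular complex\<close>

locale regular_complex =
  fixes X :: "'a topology" and E :: "nat \<Rightarrow> 'a set set"
  assumes cw: "regular_CW_complex X E" and nonempty: "topspace X \<noteq> {}"
begin

abbreviation "N \<equiv> skeleton E"

lemma hausX: "Hausdorff_space X" using cw by (simp add: regular_CW_complex_def)
lemma fin: "finite {(q, e). e \<in> E q}" using cw by (simp add: regular_CW_complex_def)
lemma cover: "(\<Union>q. \<Union>(E q)) = topspace X" using cw by (simp add: regular_CW_complex_def)

lemma disjoint_cells: "e \<in> E j \<Longrightarrow> f \<in> E k \<Longrightarrow> (j, e) \<noteq> (k, f) \<Longrightarrow> e \<inter> f = {}"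
  using cw unfolding regular_CW_complex_def by blast

lemma in_skeleton: "x \<in> N k \<longleftrightarrow> (\<exists>q e. int q \<le> k \<and> e \<in> E q \<and> x \<in> e)"
  by (auto simp: skeleton_def)

lemma characteristic_map:
  assumes "e \<in> E q"
  obtains \<phi> where "embedding_map (cell_ball q) X \<phi>" "\<phi> ` open_cell_ball q = e" "\<phi> ` cell_sphere q \<subseteq> N (int q - 1)"
proof -
  from cw have "\<forall>q. \<forall>e\<in>E q. \<exists>\<phi>. embedding_map (cell_ball q) X \<phi> \<and> \<phi> ` open_cell_ball q = e \<and>
        \<phi> ` cell_sphere q \<subseteq> (\<Union>k<q. \<Union>(E k))"
    unfolding regular_CW_complex_def by (elim conjE)
  from bspec[OF spec[OF this, of q] assms]
  obtain \<phi> where \<phi>: "embedding_map (cell_ball q) X \<phi>" "\<phi> ` open_cell_ball q = e" "\<phi> ` cell_sphere q \<subseteq> (\<Union>k<q. \<Union>(E k))"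
    by (elim exE conjE) (rule that)
  have "(\<Union>k<q. \<Union>(E k)) \<subseteq> N (int q - 1)" by (force simp: in_skeleton)
  with \<phi>(3) have "\<phi> ` cell_sphere q \<subseteq> N (int q - 1)" by (rule subset_trans)
  with \<phi>(1,2) show ?thesis by (rule that)
qed

lemma finite_cells: "finite (E q)"
proof -
  have "Pair q ` E q \<subseteq> {(q, e). e \<in> E q}" by auto
  then have "finite (Pair q ` E q)" using fin finite_subset by blast
  then show ?thesis by (rule finite_imageD) (simp add: inj_on_def)
qed

lemma cells_bounded: obtains d where "\<And>q. d \<le> q \<Longrightarrow> E q = {}"
proof -
  have "finite (fst ` {(q, e). e \<in> E q})" using fin by simp
  then obtain d where "\<forall>q \<in> fst ` {(q, e). e \<in> E q}. q < d" using finite_nat_set_iff_bounded by blast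
  then have "E q = {}" if "d \<le> q" for q using that by (force simp: image_iff)
  then show ?thesis by (rule that)
qed

lemma cell_attached: "e \<in> E q \<Longrightarrow> attached_cell X (N (int q - 1)) q e"
  unfolding attached_cell_def by (erule characteristic_map) (intro exI conjI)

lemma cell_skeleton_disjoint: "e \<in> E q \<Longrightarrow> k < int q \<Longrightarrow> e \<inter> N k = {}"
  using disjoint_cells by (fastforce simp: in_skeleton)

lemma skeleton_mono: "j \<le> k \<Longrightarrow> N j \<subseteq> N k"
  by (force simp: in_skeleton)

lemma skeleton_step: "N (int q) = N (int q - 1) \<union> \<Union>(E q)"
proof -
  have "int j \<le> int q \<longleftrightarrow> int j \<le> int q - 1 \<or> j = q" for j by linarith
  then show ?thesis by (auto simp: in_skeleton set_eq_iff)
qed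

lemma skeleton_neg: "k < 0 \<Longrightarrow> N k = {}"
  by (auto simp: in_skeleton)

lemma skeleton_topspace: "N k \<subseteq> topspace X"
proof
  fix x assume "x \<in> N k"
  then obtain q e where "e \<in> E q" "x \<in> e" unfolding in_skeleton by blast
  then show "x \<in> topspace X" unfolding cover[symmetric] by blast
qed

lemma cell_topspace: "e \<in> E q \<Longrightarrow> e \<subseteq> topspace X"
  unfolding cover[symmetric] by blast

lemma skeleton_attach:
  assumes "closedin X (N (int q - 1))"
  shows "closedin X (N (int q))" "p \<noteq> int q \<Longrightarrow> trivial_group (relative_homology_group p (subtopology X (N (int q))) (N (int q - 1)))"
    and "\<exists>ss. int_basis (filt_group X N (int q)) (carrier (filt_group X N (int q))) ss"
proof -
  have "e \<inter> f = {}" if "e \<in> E q" "f \<in> E q" "e \<noteq> f" for e f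
    by (rule disjoint_cells[OF that(1,2)]) (use that(3) in simp)
  moreover have "e \<inter> N (int q - 1) = {}" if "e \<in> E q" for e
    by (rule cell_skeleton_disjoint[OF that]) simp
  ultimately have "attachable X (N (int q - 1)) q (E q)"
    unfolding attachable_def using assms finite_cells cell_attached by simp
  note at = attach_cells[OF hausX this skeleton_step] attach_oriented_cells[where F = N, OF hausX this skeleton_step]
  show "closedin X (N (int q))" by (rule at(1))
  show "trivial_group (relative_homology_group p (subtopology X (N (int q))) (N (int q - 1)))" if "p \<noteq> int q"
    by (rule at(2)[OF that])
  obtain ss where "oriented_cells X N (int q) (E q) ss" using at(6) ..
  from at(5)[OF this] show "\<exists>ss. int_basis (filt_group X N (int q)) (carrier (filt_group X N (int q))) ss" ..
qed

lemma closed_skeleton_nat: "closedin X (N (int q - 1))"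
proof (induction q)
  case 0
  then show ?case by (simp add: skeleton_neg)
next
  case (Suc q)
  then show ?case using skeleton_attach(1)[of q] by simp
qed

lemma closed_skeleton: "closedin X (N k)"
proof (cases "k < 0")
  case False
  then have "N k = N (int (Suc (nat k)) - 1)" by simp
  then show ?thesis using closed_skeleton_nat by metis
qed (simp add: skeleton_neg)

text \<open>Each step contributes homology in the dimension of its cells only. The shift in
  \<open>int q - 1\<close> lets the induction start at the empty skeleton.\<close>

lemma skeleton_vanish_nat: "int q - 1 < p \<Longrightarrow> trivial_group (homology_group p (subtopology X (N (int q - 1))))"
proof (induction q)
  case 0
  then show ?case by (intro trivial_homology_group_empty) (simp add: skeleton_neg)
next
  case (Suc q)
  have "trivial_group (homology_group p (subtopology X (N (int q))))"
  proof (rule relative_trivial_triple)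
    show "{} \<subseteq> N (int q - 1)" "N (int q - 1) \<subseteq> N (int q)" by (simp_all add: skeleton_mono)
    show "trivial_group (relative_homology_group p (subtopology X (N (int q))) (N (int q - 1)))"
      by (rule skeleton_attach(2)[OF closed_skeleton]) (use Suc.prems in simp)
    show "trivial_group (homology_group p (subtopology X (N (int q - 1))))"
      by (rule Suc.IH) (use Suc.prems in simp)
  qed
  then show ?case by simp
qed

lemma skeleton_vanish:
  assumes "k < p" shows "trivial_group (homology_group p (subtopology X (N k)))"
proof (cases "k < 0")
  case True
  then show ?thesis by (intro trivial_homology_group_empty) (simp add: skeleton_neg)
next
  case False
  then have "k = int (Suc (nat k)) - 1" by simp
  then show ?thesis using skeleton_vanish_nat[of "Suc (nat k)" p] assms by simp
qed

lemma cell_nonempty: assumes "e \<in> E q" shows "e \<noteq> {}"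
proof -
  have "(\<lambda>i. 0) \<in> open_cell_ball q" by (simp add: open_cell_ball_eq ball_norm_def)
  moreover obtain \<phi> where "embedding_map (cell_ball q) X \<phi>" "\<phi> ` open_cell_ball q = e" "\<phi> ` cell_sphere q \<subseteq> N (int q - 1)"
    by (rule characteristic_map[OF assms])
  ultimately show ?thesis by blast
qed

text \<open>A cell of least dimension has its boundary sphere mapped into the empty set, and spheres
  of balls of positive dimension are nonempty; so a nonempty complex has a vertex. It ensures that
  cones over skeleta contain the apex.\<close>

lemma skeleton_nonempty: assumes "0 \<le> k" shows "N k \<noteq> {}"
proof -
  obtain q0 where "E q0 \<noteq> {}" using nonempty unfolding cover[symmetric] by blast
  then have "E (LEAST q. E q \<noteq> {}) \<noteq> {}" by (rule LeastI)
  then obtain q e where q: "q = (LEAST q. E q \<noteq> {})" and e: "e \<in> E q" by blast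
  have "q = 0"
  proof (rule ccontr)
    assume q0: "q \<noteq> 0"
    have "(\<Sum>i<q. (if i = 0 then 1 else 0 :: real)\<^sup>2) = (\<Sum>i<q. if i = 0 then 1 else 0)"
      by (rule sum.cong) auto
    also have "\<dots> = 1" using q0 by (simp add: sum.delta)
    finally have "ball_norm q (\<lambda>i. if i = 0 then 1 else 0) = 1" by (simp add: ball_norm_def)
    then have "(\<lambda>i. if i = 0 then 1 else 0) \<in> cell_sphere q"
      using q0 by (simp add: topspace_cell_ball open_cell_ball_eq)
    moreover obtain \<phi> where "embedding_map (cell_ball q) X \<phi>" "\<phi> ` open_cell_ball q = e" "\<phi> ` cell_sphere q \<subseteq> N (int q - 1)"
      by (rule characteristic_map[OF e])
    ultimately obtain x where "x \<in> N (int q - 1)" by (metis image_subset_iff)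
    then obtain j f where "int j \<le> int q - 1" "f \<in> E j" by (auto simp: in_skeleton)
    then have "j < q" "E j \<noteq> {}" by auto
    then show False using not_less_Least[of j "\<lambda>q. E q \<noteq> {}"] q by simp
  qed
  moreover obtain x where "x \<in> e" using cell_nonempty[OF e] by blast
  ultimately have "x \<in> N k" unfolding in_skeleton using e assms by (intro exI[of _ 0] exI[of _ e]) simp
  then show ?thesis by blast
qed

lemma compactX: "compact_space X"
proof -
  have "\<exists>K. compactin X K \<and> e \<subseteq> K" if e: "e \<in> E q" for q e
  proof -
    obtain \<phi> where \<phi>: "embedding_map (cell_ball q) X \<phi>" "\<phi> ` open_cell_ball q = e" "\<phi> ` cell_sphere q \<subseteq> N (int q - 1)"
      by (rule characteristic_map[OF e])
    have "homeomorphic_map (cell_ball q) (subtopology X (\<phi> ` topspace (cell_ball q))) \<phi>"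
      using \<phi>(1) unfolding embedding_map_def .
    then have "continuous_map (cell_ball q) X \<phi>"
      using homeomorphic_imp_continuous_map continuous_map_into_fulltopology by blast
    then have "compactin X (\<phi> ` topspace (cell_ball q))"
      using compact_space_cell_ball[of q] image_compactin unfolding compact_space_def by blast
    then show ?thesis using \<phi>(2) cell_sphere_subset(2)[of q] by blast
  qed
  then have "\<forall>c \<in> {(q, e). e \<in> E q}. \<exists>K. compactin X K \<and> snd c \<subseteq> K" by auto
  from bchoice[OF this] obtain K where K: "\<forall>c \<in> {(q, e). e \<in> E q}. compactin X (K c) \<and> snd c \<subseteq> K c" ..
  have "compactin X (\<Union>(K ` {(q, e). e \<in> E q}))"
    using K fin by (intro compactin_Union finite_imageI) auto
  moreover have "topspace X \<subseteq> \<Union>(K ` {(q, e). e \<in> E q})"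
  proof
    fix x assume "x \<in> topspace X"
    then obtain q e where "e \<in> E q" "x \<in> e" unfolding cover[symmetric] by blast
    then show "x \<in> \<Union>(K ` {(q, e). e \<in> E q})" using K by fastforce
  qed
  ultimately have "compactin X (topspace X)"
    using compactin_subset_topspace by (metis subset_antisym)
  then show ?thesis by (simp add: compact_space_def)
qed

sublocale cone_space X
  by standard (rule compactX, rule hausX)

end

section \<open>The intersection complex of the cone\<close>

text \<open>Both groups are compared inside \<open>H\<close>, and coordinates pass along the two
  injections. In this way a basis of the cycles of the base becomes a basis of the chains on the
  cone.\<close>

lemma int_basis_pullback:
  assumes A: "comm_group A" and G: "comm_group G" and H: "comm_group H"
    and \<psi>: "\<psi> \<in> hom A H" "inj_on \<psi> (carrier A)" and \<eta>: "\<eta> \<in> hom G H" "inj_on \<eta> (carrier G)"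
    and K: "K \<subseteq> carrier G" "\<psi> ` carrier A = \<eta> ` K"
    and zs: "int_basis G K zs" and us: "set us \<subseteq> carrier A" "map \<psi> us = map \<eta> zs"
  shows "int_basis A (carrier A) us"
  unfolding int_basis_def
proof (intro conjI ballI us(1))
  fix x assume x: "x \<in> carrier A"
  have zK: "set zs \<subseteq> K" and b: "\<And>z. z \<in> K \<Longrightarrow> \<exists>!k. length k = length zs \<and> z = int_comb G zs k"
    using zs unfolding int_basis_def by simp_all
  have zG: "set zs \<subseteq> carrier G" using zK K(1) by (rule subset_trans)
  have len: "length us = length zs" using us(2) by (metis length_map)
  have "\<psi> x \<in> \<eta> ` K" unfolding K(2)[symmetric] using x by (rule imageI)
  then obtain z where z: "z \<in> K" "\<psi> x = \<eta> z" by (rule imageE)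
  have zc: "z \<in> carrier G" using z(1) K(1) by blast
  have "x = int_comb A us k \<longleftrightarrow> z = int_comb G zs k" for k
  proof -
    have cA: "int_comb A us k \<in> carrier A" unfolding int_comb_eq_gcomb by (rule comm_group.gcomb_closed[OF A us(1)])
    have cG: "int_comb G zs k \<in> carrier G" unfolding int_comb_eq_gcomb by (rule comm_group.gcomb_closed[OF G zG])
    have "\<psi> (int_comb A us k) = \<eta> (int_comb G zs k)"
      unfolding int_comb_eq_gcomb comm_group.gcomb_hom[OF A H \<psi>(1) us(1)] comm_group.gcomb_hom[OF G H \<eta>(1) zG] us(2) ..
    then show ?thesis
      using inj_on_eq_iff[OF \<psi>(2) x cA] inj_on_eq_iff[OF \<eta>(2) zc cG] z(2) by simp
  qed
  then show "\<exists>!k. length k = length us \<and> x = int_comb A us k" using b[OF z(1)] len by simp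
qed

locale cone_complex = regular_complex X E for X :: "'a topology" and E +
  fixes p :: "nat \<Rightarrow> int"
  assumes perv: "perversity (cw_dim E + 1) p"
begin

abbreviation "I \<equiv> intersection_skeleton X E p"
abbreviation "a \<equiv> cut_degree E p"
abbreviation "J \<equiv> filt_group Y I"
abbreviation "bJ \<equiv> filt_boundary Y I"
abbreviation "CN \<equiv> filt_group X N"
abbreviation "bN \<equiv> filt_boundary X N"
abbreviation "\<eta> \<equiv> base_hom X E p"
abbreviation "base S \<equiv> base_incl ` S"
abbreviation "base_cells q \<equiv> image base_incl ` E q"

text \<open>A perversity starts at 0 in index 2 and grows by at most 1 per step, so
  \<open>p k \<le> k - 2\<close>. Hence the conversion to a natural number in
  \<open>cut_degree\<close> loses nothing, and the degree is at least 2.\<close>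

lemma cut: "int a = int (cw_dim E + 1) - p (cw_dim E + 1)" "2 \<le> a"
proof -
  let ?n = "cw_dim E + 1"
  have P: "2 \<le> ?n" "p 2 = 0" "\<And>j. 2 \<le> j \<Longrightarrow> j < ?n \<Longrightarrow> p (Suc j) \<in> {p j, p j + 1}"
    using perv by (simp_all add: perversity_def)
  have "k \<le> ?n \<longrightarrow> p k \<le> int k - 2" if "2 \<le> k" for k
    using that
  proof (induction k rule: dec_induct)
    case base
    then show ?case using P(2) by simp
  next
    case (step j)
    then show ?case using P(3)[of j] by auto
  qed
  from this[of ?n] P(1) have le: "2 \<le> int ?n - p ?n" by auto
  then show e: "int a = int ?n - p ?n" by (simp add: cut_degree_def Let_def)
  show "2 \<le> a" using le e by linarith
qed

lemma cone_cells_cases: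
  "c \<in> cone_cells E j \<longleftrightarrow> (j = 0 \<and> c = {apex}) \<or> (\<exists>i e. j = Suc i \<and> e \<in> E i \<and> c = cone_cell e) \<or> (\<exists>e\<in>E j. c = base e)"
  by (cases j) (auto simp: cone_cells_def)

lemma apex_closure_base: assumes "e \<in> E k" shows "apex \<notin> Y closure_of (base e)"
proof -
  have "Y closure_of (base e) \<subseteq> base (topspace X)"
    by (rule closure_of_minimal[OF image_mono[OF cell_topspace[OF assms]] closed_base[OF closedin_topspace]])
  moreover have "apex \<notin> base (topspace X)" by (auto simp: apex_def base_incl_def)
  ultimately show ?thesis by blast
qed

text \<open>The segment over a point of \<open>e\<close> runs into the apex at height 0.\<close>

lemma apex_closure_cone: assumes e: "e \<in> E k" shows "apex \<in> Y closure_of (cone_cell e)"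
proof -
  obtain x where x: "x \<in> e" using cell_nonempty[OF e] by blast
  then have xX: "x \<in> topspace X" using cell_topspace[OF e] by blast
  let ?I = "top_of_set {0..1::real}"
  have "continuous_map ?I (cyl X) (\<lambda>t. (x, t))"
    using xX by (intro continuous_map_pairedI) auto
  from continuous_map_compose[OF this continuous_map_cone_map]
  have c: "continuous_map ?I Y (\<lambda>t. cone_map (x, t))" by (simp add: comp_def)
  have "{0..1} \<inter> {0<..<1} = {0<..<1::real}" by auto
  then have "(0::real) \<in> ?I closure_of {0<..<1}" by (simp add: closure_of_subtopology)
  then have "cone_map (x, 0) \<in> (\<lambda>t. cone_map (x, t)) ` (?I closure_of {0<..<1})" by (rule imageI)
  also have "\<dots> \<subseteq> Y closure_of ((\<lambda>t. cone_map (x, t)) ` {0<..<1})"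
    by (rule continuous_map_image_closure_subset[OF c])
  also have "\<dots> \<subseteq> Y closure_of (cone_cell e)"
    by (rule closure_of_mono) (use x in \<open>auto simp: cone_map_def cone_cell_def\<close>)
  finally show ?thesis by (simp add: cone_map_def)
qed

lemma apex_topspace: "apex \<in> topspace Y"
  using nonempty by (simp add: topspace_cone cone_set_eq)

text \<open>By the formula for the cut degree, the perversity condition on a cell that reaches the
  apex is \<open>a \<le> k\<close>, whatever the cell.\<close>

lemma in_I: "x \<in> I k \<longleftrightarrow> (\<exists>j c. int j \<le> k \<and> c \<in> cone_cells E j \<and> x \<in> c \<and> (apex \<in> Y closure_of c \<longrightarrow> int a \<le> k))"
proof -
  have "0 \<le> k - int (cw_dim E + 1) + p (cw_dim E + 1) \<longleftrightarrow> int a \<le> k" using cut(1) by linarith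
  then show ?thesis unfolding intersection_skeleton_def Let_def by (simp only: Union_iff mem_Collect_eq) blast
qed

lemma I_mono: assumes "j \<le> k" shows "I j \<subseteq> I k"
proof
  fix x assume "x \<in> I j"
  then obtain i c where "int i \<le> j" "c \<in> cone_cells E i" "x \<in> c" "apex \<in> Y closure_of c \<longrightarrow> int a \<le> j"
    unfolding in_I by blast
  then show "x \<in> I k" unfolding in_I using assms by (intro exI[of _ i] exI[of _ c]) auto
qed

text \<open>The apex and the cone cells are excluded because their closures contain the apex, while
  closures of base cells stay in the base.\<close>

lemma I_below: assumes k: "k < int a" shows "I k = base (N k)"
proof
  show "I k \<subseteq> base (N k)"
  proof
    fix x assume "x \<in> I k"
    then obtain j c where c: "int j \<le> k" "c \<in> cone_cells E j" "x \<in> c" "apex \<notin> Y closure_of c"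
      unfolding in_I using k by auto
    have ne: "c \<noteq> {apex}" using c(4) closure_of_subset[of "{apex}" Y] apex_topspace by auto
    have "\<exists>e\<in>E j. c = base e"
      using c(2) unfolding cone_cells_cases
    proof (elim disjE exE conjE)
      assume "c = {apex}"
      with ne show ?thesis by (rule notE)
    next
      fix i e assume "e \<in> E i" "c = cone_cell e"
      with apex_closure_cone[of e i] c(4) show ?thesis by simp
    qed
    then obtain e where "e \<in> E j" "c = base e" by blast
    then show "x \<in> base (N k)" using c(1,3) in_skeleton by blast
  qed
  show "base (N k) \<subseteq> I k"
  proof
    fix x assume "x \<in> base (N k)"
    then obtain y where "y \<in> N k" and x: "x = base_incl y" by blast
    then obtain j e where e: "int j \<le> k" "e \<in> E j" "y \<in> e" unfolding in_skeleton by blast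
    have "base e \<in> cone_cells E j" unfolding cone_cells_cases using e by blast
    then show "x \<in> I k" unfolding in_I using e x apex_closure_base[OF e(2)] by blast
  qed
qed

lemma I_above: assumes k: "int a \<le> k" shows "I k = partial_cone (N k) (N (k - 1))"
proof -
  have k0: "2 \<le> k" using k cut(2) by linarith
  have ne: "N (k - 1) \<noteq> {}" by (rule skeleton_nonempty) (use k0 in simp)
  have cs: "cone_set (N (k - 1)) = {apex} \<union> N (k - 1) \<times> {0<..1}" using ne by (simp add: cone_set_eq)
  have iI: "x \<in> I k \<longleftrightarrow> (\<exists>j c. int j \<le> k \<and> c \<in> cone_cells E j \<and> x \<in> c)" for x
    unfolding in_I using k by blast
  show ?thesis
  proof
    show "I k \<subseteq> partial_cone (N k) (N (k - 1))"
    proof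
      fix x assume "x \<in> I k"
      then obtain j c where c: "int j \<le> k" "c \<in> cone_cells E j" "x \<in> c" unfolding iI by blast
      then consider "x = apex" | i e where "j = Suc i" "e \<in> E i" "x \<in> cone_cell e" | e where "e \<in> E j" "x \<in> base e"
        unfolding cone_cells_cases by blast
      then show "x \<in> partial_cone (N k) (N (k - 1))"
      proof cases
        case 1 then show ?thesis unfolding partial_cone_def cs by blast
      next
        case 2
        then obtain y t where y: "x = (y, t)" "y \<in> e" "0 < t" "t < 1" by (auto simp: cone_cell_def)
        have "y \<in> N (k - 1)" unfolding in_skeleton using 2 y c(1) by (intro exI[of _ i] exI[of _ e]) auto
        then show ?thesis unfolding partial_cone_def cs using y by auto
      next
        case 3
        then have "x \<in> base (N k)" using c(1) in_skeleton by blast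
        then show ?thesis unfolding partial_cone_def by blast
      qed
    qed
    show "partial_cone (N k) (N (k - 1)) \<subseteq> I k"
    proof
      fix x assume "x \<in> partial_cone (N k) (N (k - 1))"
      then consider y where "y \<in> N k" "x = (y, 1)" | "x = apex" | y t where "y \<in> N (k - 1)" "x = (y, t)" "0 < t" "t < 1"
        unfolding partial_cone_def cs using skeleton_mono[of "k - 1" k] by (force simp: base_incl_def)
      then show "x \<in> I k"
      proof cases
        case 1
        then obtain j e where e: "int j \<le> k" "e \<in> E j" "y \<in> e" unfolding in_skeleton by blast
        have "base e \<in> cone_cells E j" unfolding cone_cells_cases using e by blast
        moreover have "x \<in> base e" using 1 e by (auto simp: base_incl_def)
        ultimately show ?thesis unfolding iI using e by blast
      next
        case 2
        have "{apex} \<in> cone_cells E 0" unfolding cone_cells_cases by simp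
        then show ?thesis unfolding iI using k0 2 by (intro exI[of _ 0] exI[of _ "{apex}"]) auto
      next
        case 3
        then obtain j e where e: "int j \<le> k - 1" "e \<in> E j" "y \<in> e" unfolding in_skeleton by blast
        have "cone_cell e \<in> cone_cells E (Suc j)" unfolding cone_cells_cases using e by blast
        moreover have "x \<in> cone_cell e" using 3 e by (auto simp: cone_cell_def)
        ultimately show ?thesis unfolding iI using e by (intro exI[of _ "Suc j"] exI[of _ "cone_cell e"]) auto
      qed
    qed
  qed
qed

section \<open>How the terms of the filtration are built from cells\<close>

lemma base_attached:
  assumes e: "e \<in> E q" and A: "base (N (int q - 1)) \<subseteq> A"
  shows "attached_cell Y A q (base e)"
proof -
  obtain \<phi> where \<phi>: "embedding_map (cell_ball q) X \<phi>" "\<phi> ` open_cell_ball q = e" "\<phi> ` cell_sphere q \<subseteq> N (int q - 1)"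
    by (rule characteristic_map[OF e])
  show ?thesis unfolding attached_cell_def
  proof (intro exI[of _ "base_incl \<circ> \<phi>"] conjI)
    show "embedding_map (cell_ball q) Y (base_incl \<circ> \<phi>)" by (rule embedding_map_compose[OF \<phi>(1) embedding_base_incl])
    show "(base_incl \<circ> \<phi>) ` open_cell_ball q = base e" unfolding image_comp[symmetric] \<phi>(2) ..
    show "(base_incl \<circ> \<phi>) ` cell_sphere q \<subseteq> A"
      unfolding image_comp[symmetric] by (rule subset_trans[OF image_mono[OF \<phi>(3)] A])
  qed
qed

text \<open>The boundary of the cone on a cell consists of the cell, the cone on its boundary and
  the apex. The apex is required separately because \<open>cone_set {}\<close> is empty, which
  matters for the cone on a vertex.\<close>

lemma cone_attached:
  assumes e: "e \<in> E m" and A: "partial_cone (N (int m)) (N (int m - 1)) \<subseteq> A" "apex \<in> A"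
  shows "attached_cell Y A (Suc m) (cone_cell e)"
proof -
  obtain \<phi> where \<phi>: "embedding_map (cell_ball m) X \<phi>" "\<phi> ` open_cell_ball m = e" "\<phi> ` cell_sphere m \<subseteq> N (int m - 1)"
    by (rule characteristic_map[OF e])
  obtain f where f: "embedding_map (cell_ball (Suc m)) Y f" "f ` open_cell_ball (Suc m) = cone_cell (\<phi> ` open_cell_ball m)"
    "f ` cell_sphere (Suc m) \<subseteq> insert apex (base (\<phi> ` topspace (cell_ball m)) \<union> cone_set (\<phi> ` cell_sphere m))"
    by (rule cone_cell_characteristic_map[OF \<phi>(1)])
  have "\<phi> ` topspace (cell_ball m) \<subseteq> e \<union> N (int m - 1)"
  proof (rule image_subsetI)
    fix x assume x: "x \<in> topspace (cell_ball m)"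
    show "\<phi> x \<in> e \<union> N (int m - 1)"
    proof (cases "x \<in> open_cell_ball m")
      case True
      then have "\<phi> x \<in> e" unfolding \<phi>(2)[symmetric] by (rule imageI)
      then show ?thesis by (rule UnI1)
    next
      case False
      then have "\<phi> x \<in> N (int m - 1)" using x by (intro subsetD[OF \<phi>(3)] imageI DiffI)
      then show ?thesis by (rule UnI2)
    qed
  qed
  also have "e \<union> N (int m - 1) \<subseteq> N (int m)" using e unfolding skeleton_step[of m] by (intro Un_least) auto
  finally have K: "\<phi> ` topspace (cell_ball m) \<subseteq> N (int m)" .
  have A1: "base (N (int m)) \<subseteq> A" "cone_set (N (int m - 1)) \<subseteq> A"
    using A(1) unfolding partial_cone_def by simp_all
  have "base (\<phi> ` topspace (cell_ball m)) \<subseteq> A" by (rule subset_trans[OF image_mono[OF K] A1(1)])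
  moreover have "cone_set (\<phi> ` cell_sphere m) \<subseteq> A" by (rule subset_trans[OF cone_set_mono[OF \<phi>(3)] A1(2)])
  ultimately have "insert apex (base (\<phi> ` topspace (cell_ball m)) \<union> cone_set (\<phi> ` cell_sphere m)) \<subseteq> A"
    using A(2) by simp
  with f(3) have "f ` cell_sphere (Suc m) \<subseteq> A" by (rule subset_trans)
  then show ?thesis unfolding attached_cell_def using f(1,2) \<phi>(2) by (intro exI[of _ f]) simp
qed

lemma base_cells_disjoint:
  assumes "c \<in> base_cells q" "c' \<in> base_cells q" "c \<noteq> c'" shows "c \<inter> c' = {}"
proof -
  obtain e f where ef: "e \<in> E q" "f \<in> E q" "c = base e" "c' = base f" using assms(1,2) by blast
  have "e \<inter> f = {}" by (rule disjoint_cells[OF ef(1,2)]) (use assms(3) ef in auto)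
  then show ?thesis unfolding ef(3,4) by (auto simp: base_incl_def)
qed

text \<open>The closed set \<open>A\<close> is a parameter since the lemma serves both below the
  cut, with a skeleton of the base, and at the cut, with a cone over a skeleton.\<close>

lemma base_cells_attachable:
  assumes A: "closedin Y A" "base (N (int q - 1)) \<subseteq> A" "\<And>y. base_incl y \<in> A \<Longrightarrow> y \<in> N (int q - 1)"
  shows "attachable Y A q (base_cells q)"
  unfolding attachable_def
proof (intro conjI ballI impI)
  fix c assume "c \<in> base_cells q"
  then obtain e where e: "e \<in> E q" "c = base e" by blast
  show "attached_cell Y A q c" unfolding e(2) by (rule base_attached[OF e(1) A(2)])
  have "e \<inter> N (int q - 1) = {}" by (rule cell_skeleton_disjoint[OF e(1)]) simp
  then show "c \<inter> A = {}" unfolding e(2) using A(3) by blast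
qed (use A(1) finite_cells base_cells_disjoint in auto)

lemma closed_partial_cone: "closedin Y (partial_cone (N j) (N k))"
  unfolding partial_cone_def by (intro closedin_Un closed_base closed_cone_set closed_skeleton)

lemma below_attach:
  assumes q: "q < a" shows "attachable Y (I (int q - 1)) q (base_cells q)" "I (int q) = I (int q - 1) \<union> \<Union>(base_cells q)"
proof -
  have I: "I (int q - 1) = base (N (int q - 1))" "I (int q) = base (N (int q))"
    using q by (simp_all add: I_below)
  show "attachable Y (I (int q - 1)) q (base_cells q)" unfolding I
    by (rule base_cells_attachable[OF closed_base[OF closed_skeleton] order_refl]) (auto simp: base_incl_def)
  show "I (int q) = I (int q - 1) \<union> \<Union>(base_cells q)" unfolding I skeleton_step[of q] by blast
qed

text \<open>The step into degree \<open>a\<close> adds the apex and the cones on all cells of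
  \<open>N (a - 1)\<close>, so it is not an attachment of \<open>a\<close>-cells to the previous
  term. Relative to the cone over \<open>N (a - 1)\<close>, however, only the \<open>a\<close>-cells
  of the base are new.\<close>

lemma cut_attach:
  "attachable Y (cone_set (N (int a - 1))) a (base_cells a)" "I (int a) = cone_set (N (int a - 1)) \<union> \<Union>(base_cells a)"
proof -
  show "attachable Y (cone_set (N (int a - 1))) a (base_cells a)"
  proof (rule base_cells_attachable)
    show "closedin Y (cone_set (N (int a - 1)))" by (rule closed_cone_set[OF closed_skeleton])
    show "base (N (int a - 1)) \<subseteq> cone_set (N (int a - 1))" by (rule base_sub_cone)
    show "y \<in> N (int a - 1)" if "base_incl y \<in> cone_set (N (int a - 1))" for y
      using that unfolding cone_set_eq by (auto simp: base_incl_def apex_def split: if_splits)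
  qed
  have "I (int a) = partial_cone (N (int a)) (N (int a - 1))" by (rule I_above) simp
  also have "\<dots> = cone_set (N (int a - 1)) \<union> \<Union>(base_cells a)"
    unfolding partial_cone_def skeleton_step[of a] using base_sub_cone[of "N (int a - 1)"] by blast
  finally show "I (int a) = cone_set (N (int a - 1)) \<union> \<Union>(base_cells a)" .
qed

text \<open>Beyond the cut both terms are skeleta of the cone, so the step is an ordinary attachment
  of two kinds of cells: those of the base, and cones on cells of one dimension less.\<close>

lemma above_attach:
  assumes q: "a < q" shows "attachable Y (I (int q - 1)) q (cone_cells E q)" "I (int q) = I (int q - 1) \<union> \<Union>(cone_cells E q)"
proof -
  obtain m where m: "q = Suc m" using q by (cases q) auto
  have am: "a \<le> m" "2 \<le> m" using q cut(2) unfolding m by linarith+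
  have I1: "I (int q - 1) = partial_cone (N (int m)) (N (int m - 1))" unfolding m using am I_above[of "int m"] by simp
  have I2: "I (int q) = partial_cone (N (int q)) (N (int m))" using I_above[of "int q"] q unfolding m by simp
  have ne: "N (int m - 1) \<noteq> {}" "N (int m) \<noteq> {}" using am by (simp_all add: skeleton_nonempty)
  have mem: "x \<in> I (int q - 1) \<longleftrightarrow> x = apex \<or> (\<exists>y\<in>N (int m). x = (y, 1)) \<or> (\<exists>y\<in>N (int m - 1). \<exists>t\<in>{0<..1}. x = (y, t))" for x
    unfolding I1 partial_cone_def cone_set_eq using ne by (auto simp: base_incl_def)
  have apexI: "apex \<in> I (int q - 1)" unfolding mem by simp
  have cells: "c \<in> cone_cells E q \<longleftrightarrow> (\<exists>e\<in>E m. c = cone_cell e) \<or> (\<exists>e\<in>E q. c = base e)" for c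
    unfolding cone_cells_cases by (auto simp: m)
  show "attachable Y (I (int q - 1)) q (cone_cells E q)"
    unfolding attachable_def
  proof (intro conjI ballI impI)
    show "closedin Y (I (int q - 1))" unfolding I1 by (rule closed_partial_cone)
    have "cone_cells E q = cone_cell ` E m \<union> base_cells q" by (simp add: cone_cells_def m)
    then show "finite (cone_cells E q)" using finite_cells by simp
  next
    fix c assume "c \<in> cone_cells E q"
    then consider e where "e \<in> E m" "c = cone_cell e" | e where "e \<in> E q" "c = base e" unfolding cells by blast
    then show "attached_cell Y (I (int q - 1)) q c"
    proof cases
      case 1
      have "attached_cell Y (I (int q - 1)) (Suc m) (cone_cell e)"
        by (rule cone_attached[OF 1(1) _ apexI]) (simp add: I1)
      then show ?thesis unfolding 1(2) m .
    next
      case 2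
      have "int q - 1 = int m" by (simp add: m)
      then have "base (N (int q - 1)) \<subseteq> I (int q - 1)" unfolding I1 partial_cone_def by simp
      then show ?thesis unfolding 2(2) by (rule base_attached[OF 2(1)])
    qed
  next
    fix c assume "c \<in> cone_cells E q"
    then consider e where "e \<in> E m" "c = cone_cell e" | e where "e \<in> E q" "c = base e" unfolding cells by blast
    then show "c \<inter> I (int q - 1) = {}"
    proof cases
      case 1
      have "e \<inter> N (int m - 1) = {}" by (rule cell_skeleton_disjoint[OF 1(1)]) simp
      then show ?thesis unfolding 1(2) cone_cell_def by (auto simp: mem apex_def)
    next
      case 2
      have "e \<inter> N (int m) = {}" by (rule cell_skeleton_disjoint[OF 2(1)]) (simp add: m)
      then have n: "y \<notin> N (int m)" if "y \<in> e" for y using that by blast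
      have "N (int m - 1) \<subseteq> N (int m)" by (rule skeleton_mono) simp
      then have "y \<notin> N (int m - 1)" if "y \<in> e" for y using n[OF that] by blast
      with n show ?thesis unfolding 2(2) by (auto simp: mem apex_def base_incl_def)
    qed
  next
    fix c c' assume cc: "c \<in> cone_cells E q" "c' \<in> cone_cells E q" "c \<noteq> c'"
    have cone: "cone_cell e \<inter> cone_cell f = {}" if "e \<in> E m" "f \<in> E m" "e \<noteq> f" for e f
    proof -
      have "e \<inter> f = {}" by (rule disjoint_cells[OF that(1,2)]) (use that(3) in simp)
      then show ?thesis by (auto simp: cone_cell_def)
    qed
    have bas: "base e \<inter> base f = {}" if "e \<in> E q" "f \<in> E q" "e \<noteq> f" for e f
    proof -
      have "e \<inter> f = {}" by (rule disjoint_cells[OF that(1,2)]) (use that(3) in simp)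
      then show ?thesis by (auto simp: base_incl_def)
    qed
    have mix: "cone_cell e \<inter> base f = {}" for e f by (auto simp: cone_cell_def base_incl_def)
    from cc(1,2) show "c \<inter> c' = {}"
      unfolding cells
    proof (elim disjE bexE)
      fix e f assume "e \<in> E m" "c = cone_cell e" "f \<in> E m" "c' = cone_cell f"
      then show ?thesis using cone[of e f] cc(3) by auto
    next
      fix e f assume "c = cone_cell e" "c' = base f"
      then show ?thesis using mix[of e f] by simp
    next
      fix e f assume "c = base e" "c' = cone_cell f"
      then show ?thesis using mix[of f e] by (simp add: Int_commute)
    next
      fix e f assume "e \<in> E q" "c = base e" "f \<in> E q" "c' = base f"
      then show ?thesis using bas[of e f] cc(3) by auto
    qed
  qed
  show "I (int q) = I (int q - 1) \<union> \<Union>(cone_cells E q)"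
  proof (rule Set.set_eqI)
    fix x
    have Nq: "N (int q) = N (int m) \<union> \<Union>(E q)" using skeleton_step[of q] by (simp add: m)
    have Nm: "N (int m) = N (int m - 1) \<union> \<Union>(E m)" by (rule skeleton_step)
    have 1: "x \<in> I (int q) \<longleftrightarrow> x = apex \<or> (\<exists>y\<in>N (int q). x = (y, 1)) \<or> (\<exists>y\<in>N (int m). \<exists>t\<in>{0<..1}. x = (y, t))"
      unfolding I2 partial_cone_def cone_set_eq using ne by (auto simp: base_incl_def)
    have 2: "x \<in> \<Union>(cone_cells E q) \<longleftrightarrow> (\<exists>y\<in>\<Union>(E m). \<exists>t\<in>{0<..<1}. x = (y, t)) \<or> (\<exists>y\<in>\<Union>(E q). x = (y, 1))"
    proof -
      have "cone_cells E q = cone_cell ` E m \<union> base_cells q" by (simp add: cone_cells_def m)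
      then show ?thesis by (auto simp: cone_cell_def base_incl_def)
    qed
    have 3: "(\<exists>t\<in>{0<..1}. x = (y, t)) \<longleftrightarrow> x = (y, 1) \<or> (\<exists>t\<in>{0<..<1}. x = (y, t))" for y
      by (cases x) (auto simp: less_le)
    show "x \<in> I (int q) \<longleftrightarrow> x \<in> I (int q - 1) \<union> \<Union>(cone_cells E q)"
      unfolding Un_iff 1 2 mem 3 Nq unfolding Nm by blast
  qed
qed

section \<open>Vanishing and exactness\<close>

lemma base_vanish: assumes "k < r" shows "trivial_group (homology_group r (subtopology Y (base (N k))))"
  using isomorphic_group_triviality[OF is_isoI[OF base_iso[OF empty_subsetI skeleton_topspace, of r k]]] skeleton_vanish[OF assms] by simp

lemma subtopology_sub: "S \<subseteq> T \<Longrightarrow> subtopology (subtopology Z T) S = subtopology Z S"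
  by (simp add: subtopology_subtopology Int_absorb1)

lemma cone_skeleton_trivial: "r \<noteq> 0 \<Longrightarrow> trivial_group (homology_group r (subtopology Y (cone_set (N k))))"
  by (rule cone_homology_trivial[OF skeleton_topspace])

text \<open>The triple through the cone over \<open>N (a - 1)\<close>: the upper pair has homology
  only in degree \<open>a\<close>, and the lower pair, the cone being acyclic in positive degrees,
  reduces to an \<open>(a - 1)\<close>-dimensional skeleton.\<close>

lemma cut_relative_vanish: assumes "int a < r" shows "trivial_group (relative_homology_group r (subtopology Y (I (int a))) (I (int a - 1)))"
proof (rule relative_trivial_triple)
  have I1: "I (int a - 1) = base (N (int a - 1))" by (simp add: I_below)
  show "I (int a - 1) \<subseteq> cone_set (N (int a - 1))" unfolding I1 by (rule base_sub_cone)
  show "cone_set (N (int a - 1)) \<subseteq> I (int a)" unfolding cut_attach(2) by simp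
  show "trivial_group (relative_homology_group r (subtopology Y (I (int a))) (cone_set (N (int a - 1))))"
    by (rule attach_cells(2)[OF haus_Y cut_attach]) (use assms in simp)
  show "trivial_group (relative_homology_group r (subtopology Y (cone_set (N (int a - 1)))) (I (int a - 1)))"
  proof (rule relative_trivial_pair)
    show "trivial_group (homology_group r (subtopology Y (cone_set (N (int a - 1)))))"
      by (rule cone_skeleton_trivial) (use assms in simp)
    show "trivial_group (homology_group (r - 1) (subtopology (subtopology Y (cone_set (N (int a - 1)))) (I (int a - 1))))"
      unfolding I1 subtopology_sub[OF base_sub_cone] by (rule base_vanish) (use assms in simp)
  qed
qed

text \<open>Induction over the attachments beyond the cut; the exceptional step at the cut itself is
  \<open>cut_relative_vanish\<close>.\<close>

lemma I_vanish_above: "int (a + j) < r \<Longrightarrow> trivial_group (homology_group r (subtopology Y (I (int (a + j)))))"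
proof (induction j)
  case 0
  have "trivial_group (homology_group r (subtopology Y (I (int a))))"
  proof (rule relative_trivial_triple[OF empty_subsetI I_mono cut_relative_vanish])
    show "trivial_group (homology_group r (subtopology Y (I (int a - 1))))"
      using base_vanish[of "int a - 1" r] 0 by (simp add: I_below)
  qed (use 0 in simp_all)
  then show ?case by simp
next
  case (Suc j)
  have q: "a < a + Suc j" by simp
  have s: "int (a + Suc j) - 1 = int (a + j)" by simp
  have "trivial_group (homology_group r (subtopology Y (I (int (a + Suc j)))))"
  proof (rule relative_trivial_triple[OF empty_subsetI I_mono])
    show "int (a + j) \<le> int (a + Suc j)" by simp
    show "trivial_group (relative_homology_group r (subtopology Y (I (int (a + Suc j)))) (I (int (a + j))))"
      unfolding s[symmetric] by (rule attach_cells(2)[OF haus_Y above_attach[OF q]]) (use Suc.prems in simp)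
    show "trivial_group (homology_group r (subtopology Y (I (int (a + j)))))"
      by (rule Suc.IH) (use Suc.prems in simp)
  qed
  then show ?case .
qed

lemma I_vanish: assumes "k < r" shows "trivial_group (homology_group r (subtopology Y (I k)))"
proof (cases "k < int a")
  case True
  then show ?thesis using base_vanish[OF assms] by (simp add: I_below)
next
  case False
  then have "k = int (a + nat (k - int a))" by simp
  then show ?thesis using I_vanish_above[of "nat (k - int a)" r] assms by simp
qed

text \<open>As soon as \<open>a \<le> q + 1\<close>, the cone over \<open>N q\<close> lies between
  \<open>I q\<close> and \<open>I (q + 1)\<close>. It has no homology in degree \<open>q\<close>,
  which is positive because \<open>a \<ge> 2\<close>, so absolute classes die one step
  later.\<close>

lemma intersection_exact:
  assumes q: "a \<le> Suc q"
  shows "kernel (J (int q)) (J (int q - 1)) (bJ (int q)) \<subseteq> bJ (int q + 1) ` carrier (J (int q + 1))"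
proof (rule filt_exact)
  show "I (int q - 2) \<subseteq> I (int q - 1)" "I (int q - 1) \<subseteq> I (int q)" "I (int q) \<subseteq> I (int q + 1)"
    by (simp_all add: I_mono)
  show "trivial_group (homology_group (int q - 1) (subtopology Y (I (int q - 2))))" by (rule I_vanish) simp
  fix y assume y: "y \<in> carrier (homology_group (int q) (subtopology Y (I (int q))))"
  let ?C = "cone_set (N (int q))"
  have b: "base (N (int q)) \<subseteq> ?C" by (rule base_sub_cone)
  have 1: "I (int q) \<subseteq> ?C"
  proof (cases "q < a")
    case False
    have "cone_set (N (int q - 1)) \<subseteq> ?C" by (rule cone_set_mono[OF skeleton_mono]) simp
    then show ?thesis using b I_above[of "int q"] False by (simp add: partial_cone_def)
  qed (use b I_below[of "int q"] in simp)
  have 2: "?C \<subseteq> I (int q + 1)" using I_above[of "int q + 1"] q by (simp add: partial_cone_def)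
  let ?i = "hom_induced (int q) (subtopology Y (I (int q))) {} (subtopology Y ?C) {} id"
  have "int q \<noteq> 0" using q cut(2) by linarith
  then have "?i y = \<one>\<^bsub>homology_group (int q) (subtopology Y ?C)\<^esub>"
    by (intro trivial_group_carrier[OF cone_skeleton_trivial hom_induced_carrier])
  moreover have "hom_induced (int q) (subtopology Y ?C) {} (subtopology Y (I (int q + 1))) {} id (?i y) =
      hom_induced (int q) (subtopology Y (I (int q))) {} (subtopology Y (I (int q + 1))) {} id y"
    by (rule inclusion_compose[OF 1 2 order_refl order_refl])
  ultimately show "hom_induced (int q) (subtopology Y (I (int q))) {} (subtopology Y (I (int q + 1))) {} id y =
      \<one>\<^bsub>homology_group (int q) (subtopology Y (I (int q + 1)))\<^esub>"
    by (simp only: hom_induced_one)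
qed

section \<open>Comparison with the complex of the base\<close>

lemma base_hom_iso: assumes "k < int a" shows "\<eta> k \<in> iso (CN k) (J k)"
  using base_iso[OF skeleton_mono[of "k - 1" k] skeleton_topspace, of k] assms
  by (simp add: base_hom_def filt_group_def I_below)

text \<open>Naturality of the boundary operator of triples; the degrees \<open>k + 1\<close>,
  \<open>k\<close> and \<open>k - 1\<close> all lie below the cut.\<close>

lemma base_hom_boundary: assumes k: "k + 1 < int a" shows "\<eta> k (bN (k + 1) x) = bJ (k + 1) (\<eta> (k + 1) x)"
proof -
  have s: "k + 1 - 1 = k" "k + 1 - 2 = k - 1" by simp_all
  have I: "I (k + 1) = base (N (k + 1))" "I k = base (N k)" "I (k - 1) = base (N (k - 1))" using k by (simp_all add: I_below)
  have "continuous_map (subtopology X (N (k + 1))) (subtopology Y (base (N (k + 1)))) base_incl"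
    by (rule continuous_map_into_subtopology[OF continuous_map_from_subtopology[OF continuous_base_incl]]) auto
  from fun_cong[OF naturality_hom_induced_relboundary[OF this, of "N k" "base (N k)" "N (k - 1)" "base (N (k - 1))" "k + 1"], of x]
  have "hom_relboundary (k + 1) (subtopology Y (base (N (k + 1)))) (base (N k)) (base (N (k - 1)))
        (hom_induced (k + 1) (subtopology X (N (k + 1))) (N k) (subtopology Y (base (N (k + 1)))) (base (N k)) base_incl x)
      = hom_induced k (subtopology (subtopology X (N (k + 1))) (N k)) (N (k - 1)) (subtopology (subtopology Y (base (N (k + 1)))) (base (N k))) (base (N (k - 1))) base_incl
        (hom_relboundary (k + 1) (subtopology X (N (k + 1))) (N k) (N (k - 1)) x)"
    by (simp add: image_subset_iff_funcset[symmetric] comp_def)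
  moreover have "subtopology (subtopology X (N (k + 1))) (N k) = subtopology X (N k)"
    "subtopology (subtopology Y (base (N (k + 1)))) (base (N k)) = subtopology Y (base (N k))"
    by (simp_all add: subtopology_sub skeleton_mono image_mono)
  ultimately show ?thesis
    unfolding filt_boundary_def base_hom_def s I by simp
qed

text \<open>Cycles are detected one degree lower, where \<open>\<eta>\<close> is injective; so the
  case \<open>k = a - 1\<close>, which the cones in degree \<open>a\<close> require, is
  included.\<close>

lemma base_hom_cycles:
  assumes k: "0 \<le> k" "k < int a" shows "\<eta> k ` filt_cycles X N k = filt_cycles Y I k"
proof -
  have iso: "\<eta> k \<in> iso (CN k) (J k)" "\<eta> (k - 1) \<in> iso (CN (k - 1)) (J (k - 1))"
    using k by (simp_all add: base_hom_iso)
  have bij: "\<eta> k ` carrier (CN k) = carrier (J k)" "inj_on (\<eta> (k - 1)) (carrier (CN (k - 1)))"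
    using iso by (simp_all add: iso_def bij_betw_def)
  have one: "\<eta> (k - 1) \<one>\<^bsub>CN (k - 1)\<^esub> = \<one>\<^bsub>J (k - 1)\<^esub>"
    unfolding base_hom_def filt_group_def by (rule hom_induced_one)
  have e: "bJ k (\<eta> k x) = \<one>\<^bsub>J (k - 1)\<^esub> \<longleftrightarrow> bN k x = \<one>\<^bsub>CN (k - 1)\<^esub>" if x: "x \<in> carrier (CN k)" for x
  proof -
    have c: "bN k x \<in> carrier (CN (k - 1))" "\<one>\<^bsub>CN (k - 1)\<^esub> \<in> carrier (CN (k - 1))"
      using hom_in_carrier[OF filt_boundary_hom[OF skeleton_mono] x]
        monoid.one_closed[OF group.is_monoid[OF group_relative_homology_group]] by (simp_all add: filt_group_def)
    show ?thesis using base_hom_boundary[of "k - 1" x] k inj_on_eq_iff[OF bij(2) c] one by simp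
  qed
  have "filt_cycles Y I k = {y \<in> \<eta> k ` carrier (CN k). bJ k y = \<one>\<^bsub>J (k - 1)\<^esub>}"
    unfolding filt_cycles_def kernel_def bij(1) ..
  also have "\<dots> = \<eta> k ` {x \<in> carrier (CN k). bJ k (\<eta> k x) = \<one>\<^bsub>J (k - 1)\<^esub>}"
    by (rule Compr_image_eq)
  also have "{x \<in> carrier (CN k). bJ k (\<eta> k x) = \<one>\<^bsub>J (k - 1)\<^esub>} = filt_cycles X N k"
    unfolding filt_cycles_def kernel_def by (rule Collect_cong, rule conj_cong[OF refl], rule e)
  finally show ?thesis by (rule sym)
qed

section \<open>The cut degree: cones over cycles\<close>

abbreviation "top_cone \<equiv> subtopology Y (cone_set (N (int a - 1)))"
abbreviation "cone_chains \<equiv> relative_homology_group (int a) top_cone (base (N (int a - 1)))"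
abbreviation "cone_boundary \<equiv> hom_relboundary (int a) top_cone (base (N (int a - 1))) (base (N (int a - 2)))"
abbreviation "cone_include \<equiv> hom_induced (int a) top_cone (base (N (int a - 1))) (subtopology Y (I (int a))) (I (int a - 1)) id"

lemma I_cut: "I (int a - 1) = base (N (int a - 1))" "I (int a - 2) = base (N (int a - 2))" "I (int a - 1 - 1) = base (N (int a - 2))"
  by (simp_all add: I_below)

lemma J_cut: "J (int a - 1) = relative_homology_group (int a - 1) (subtopology Y (base (N (int a - 1)))) (base (N (int a - 2)))"
  unfolding filt_group_def I_cut ..

lemma base_skeleton_sub: "base (N (int a - 2)) \<subseteq> base (N (int a - 1))"
  by (rule image_mono[OF skeleton_mono]) simp

lemma cone_boundary_hom: "cone_boundary \<in> hom cone_chains (J (int a - 1))"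
  using group_homomorphism_hom_relboundary[of "int a" top_cone "base (N (int a - 1))" "base (N (int a - 2))"]
  unfolding subtopology_sub[OF base_sub_cone] J_cut .

text \<open>A kernel element comes from the cone modulo the \<open>(a - 2)\<close>-skeleton of the
  base. That group vanishes in degree \<open>a\<close>: the cone contributes nothing, and the
  skeleton has no homology in degree \<open>a - 1\<close>.\<close>

lemma cone_boundary_inj: "inj_on cone_boundary (carrier cone_chains)"
proof (rule inj_on_kernel_trivial[OF _ _ cone_boundary_hom])
  have T: "base (N (int a - 2)) \<subseteq> cone_set (N (int a - 1))" using base_skeleton_sub base_sub_cone by (rule subset_trans)
  have "trivial_group (relative_homology_group (int a) top_cone (base (N (int a - 2))))"
  proof (rule relative_trivial_pair)
    show "trivial_group (homology_group (int a) top_cone)"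
      by (rule cone_skeleton_trivial) (use cut(2) in simp)
    show "trivial_group (homology_group (int a - 1) (subtopology top_cone (base (N (int a - 2)))))"
      unfolding subtopology_sub[OF T] by (rule base_vanish) simp
  qed
  then have "carrier (relative_homology_group (int a) top_cone (base (N (int a - 2)))) =
      {\<one>\<^bsub>relative_homology_group (int a) top_cone (base (N (int a - 2)))\<^esub>}"
    by (simp add: trivial_group_def)
  moreover have "kernel cone_chains (J (int a - 1)) cone_boundary =
      hom_induced (int a) top_cone (base (N (int a - 2))) top_cone (base (N (int a - 1))) id ` carrier (relative_homology_group (int a) top_cone (base (N (int a - 2))))"
    using relative_exact(1)[OF base_skeleton_sub, of "int a" top_cone] unfolding subtopology_sub[OF base_sub_cone] J_cut .
  ultimately show "kernel cone_chains (J (int a - 1)) cone_boundary \<subseteq> {\<one>\<^bsub>cone_chains\<^esub>}"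
    by (simp only: image_insert image_empty hom_induced_one subset_refl)
qed (simp_all add: J_cut)

text \<open>A cycle lifts to an absolute class of the base skeleton, which dies in the cone;
  exactness of the triple then exhibits the cycle as a boundary. Together with injectivity, each
  cycle has exactly one cone.\<close>

lemma cone_boundary_image: "cone_boundary ` carrier cone_chains = filt_cycles Y I (int a - 1)"
proof
  let ?B = "base (N (int a - 1))" and ?T = "base (N (int a - 2))" and ?U = "I (int a - 1 - 2)"
  have U: "?U \<subseteq> ?T" using I_mono[of "int a - 1 - 2" "int a - 2"] unfolding I_cut by simp
  have W: "subtopology (subtopology Y ?B) ?T = subtopology Y ?T" "subtopology (subtopology Y ?T) ?U = subtopology Y ?U"
    by (rule subtopology_sub[OF base_skeleton_sub], rule subtopology_sub[OF U])
  have J2: "J (int a - 1 - 1) = relative_homology_group (int a - 1 - 1) (subtopology Y ?T) ?U"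
    unfolding filt_group_def I_cut by (simp add: diff_diff_eq)
  have bJ: "bJ (int a - 1) = hom_relboundary (int a - 1) (subtopology Y ?B) ?T ?U"
    unfolding filt_boundary_def I_cut ..
  show "cone_boundary ` carrier cone_chains \<subseteq> filt_cycles Y I (int a - 1)"
  proof (rule image_subsetI)
    fix u assume u: "u \<in> carrier cone_chains"
    have "bJ (int a - 1) (cone_boundary u) = \<one>\<^bsub>J (int a - 1 - 1)\<^esub>"
      using relboundary_relboundary[of "int a" top_cone ?B ?T ?U u]
      unfolding bJ J2 subtopology_sub[OF base_sub_cone] W .
    then show "cone_boundary u \<in> filt_cycles Y I (int a - 1)"
      unfolding filt_cycles_def kernel_empty_iff using hom_in_carrier[OF cone_boundary_hom u] by simp
  qed
  show "filt_cycles Y I (int a - 1) \<subseteq> cone_boundary ` carrier cone_chains"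
  proof
    fix y assume "y \<in> filt_cycles Y I (int a - 1)"
    then have y: "y \<in> carrier (relative_homology_group (int a - 1) (subtopology Y ?B) ?T)"
      "hom_relboundary (int a - 1) (subtopology Y ?B) ?T ?U y = \<one>\<^bsub>relative_homology_group (int a - 1 - 1) (subtopology Y ?T) ?U\<^esub>"
      unfolding filt_cycles_def kernel_empty_iff J_cut J2 bJ by simp_all
    have V: "trivial_group (homology_group (int a - 1 - 1) (subtopology Y ?U))" by (rule I_vanish) simp
    obtain z where z: "z \<in> carrier (homology_group (int a - 1) (subtopology Y ?B))"
      "y = hom_induced (int a - 1) (subtopology Y ?B) {} (subtopology Y ?B) ?T id z"
      by (rule kernel_relative_boundary[OF W V y])
    let ?i = "hom_induced (int a - 1) (subtopology Y ?B) {} top_cone {} id"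
    have "int a - 1 \<noteq> 0" using cut(2) by simp
    then have "?i z = \<one>\<^bsub>homology_group (int a - 1) top_cone\<^esub>"
      by (intro trivial_group_carrier[OF cone_skeleton_trivial hom_induced_carrier])
    then have "hom_induced (int a - 1) top_cone {} top_cone ?T id (?i z) = \<one>\<^bsub>relative_homology_group (int a - 1) top_cone ?T\<^esub>"
      by (simp only: hom_induced_one)
    moreover have "hom_induced (int a - 1) top_cone {} top_cone ?T id (?i z) = hom_induced (int a - 1) (subtopology Y ?B) {} top_cone ?T id z"
      by (rule inclusion_compose[OF base_sub_cone order_refl order_refl empty_subsetI])
    moreover have "hom_induced (int a - 1) (subtopology Y ?B) ?T top_cone ?T id y = hom_induced (int a - 1) (subtopology Y ?B) {} top_cone ?T id z"
      unfolding z(2) by (rule inclusion_compose[OF order_refl base_sub_cone empty_subsetI order_refl])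
    ultimately have "y \<in> kernel (relative_homology_group (int a - 1) (subtopology Y ?B) ?T) (relative_homology_group (int a - 1) top_cone ?T)
        (hom_induced (int a - 1) (subtopology Y ?B) ?T top_cone ?T id)"
      unfolding kernel_empty_iff using y(1) by simp
    then show "y \<in> cone_boundary ` carrier cone_chains"
      using relative_exact(2)[OF base_skeleton_sub, of "int a" top_cone] unfolding subtopology_sub[OF base_sub_cone] by simp
  qed
qed

lemma cone_over_cycle_iff:
  "cone_over_cycle X E p (int a - 1) z w \<longleftrightarrow> (\<exists>u. (u \<in> carrier cone_chains \<and> cone_boundary u = \<eta> (int a - 1) z) \<and> w = cone_include u)"
proof -
  have s: "int a - 1 + 1 = int a" "int a - 1 - 1 = int a - 2" by simp_all
  show ?thesis
    unfolding cone_over_cycle_def Let_def cone_set_def[symmetric] s by blast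
qed

text \<open>Applied to \<open>I a\<close>, the cone over \<open>N (a - 1)\<close> and its base, the
  sequence of the triple splits: \<open>cone_boundary\<close> identifies the lower pair with the
  cycles, so cones over a basis of cycles form a basis there, and the \<open>a\<close>-cells form a
  basis of the upper pair.\<close>

lemma cut_basis:
  assumes o: "oriented_cells Y I (int a) (base_cells a) ss'"
    and zs: "int_basis (CN (int a - 1)) (filt_cycles X N (int a - 1)) zs"
    and ws: "list_all2 (cone_over_cycle X E p (int a - 1)) zs ws"
  shows "int_basis (J (int a)) (carrier (J (int a))) (ss' @ ws)"
proof -
  let ?C = "cone_set (N (int a - 1))" and ?B = "base (N (int a - 1))"
  let ?P = "\<lambda>z u. u \<in> carrier cone_chains \<and> cone_boundary u = \<eta> (int a - 1) z"
  have "cone_over_cycle X E p (int a - 1) = (\<lambda>z w. \<exists>u. ?P z u \<and> w = (\<lambda>z. cone_include) z u)"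
    by (intro ext) (rule cone_over_cycle_iff)
  \<comment> \<open>The relative classes of the cone hidden in \<open>cone_over_cycle\<close> are
    extracted as a list.\<close>
  from ws[unfolded this list_all2_choose] obtain us where us: "list_all2 ?P zs us" "ws = map2 (\<lambda>z. cone_include) zs us"
    by (elim exE conjE)
  have len: "length zs = length us" using us(1) by (rule list_all2_lengthD)
  have u: "us ! i \<in> carrier cone_chains" "cone_boundary (us ! i) = \<eta> (int a - 1) (zs ! i)" if "i < length us" for i
    using list_all2_nthD2[OF us(1) that] by simp_all
  have wsu: "ws = map cone_include us"
    unfolding us(2) by (rule nth_equalityI) (use len in simp_all)
  have sub: "filt_cycles X N (int a - 1) \<subseteq> carrier (CN (int a - 1))" by (auto simp: filt_cycles_def kernel_def)
  have iso: "\<eta> (int a - 1) \<in> iso (CN (int a - 1)) (J (int a - 1))" by (rule base_hom_iso) simp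
  have us_basis: "int_basis cone_chains (carrier cone_chains) us"
  proof (rule int_basis_pullback[OF _ _ _ cone_boundary_hom cone_boundary_inj _ _ sub _ zs])
    show "\<eta> (int a - 1) \<in> hom (CN (int a - 1)) (J (int a - 1))" "inj_on (\<eta> (int a - 1)) (carrier (CN (int a - 1)))"
      using iso by (simp_all add: iso_def bij_betw_def)
    show "cone_boundary ` carrier cone_chains = \<eta> (int a - 1) ` filt_cycles X N (int a - 1)"
      unfolding cone_boundary_image using base_hom_cycles[of "int a - 1"] cut(2) by simp
    show "set us \<subseteq> carrier cone_chains" using u(1) by (auto simp: in_set_conv_nth)
    show "map cone_boundary us = map (\<eta> (int a - 1)) zs"
      by (rule nth_equalityI) (use len u(2) in simp_all)
  qed (simp_all add: filt_group_def)
  obtain es gs where e: "distinct es" "set es = base_cells a" "list_all2 (cell_generator Y a) es gs"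
    and ss': "ss' = map2 (push_cell Y a (I (int a)) (I (int a - 1))) es gs"
    using o unfolding oriented_cells_iff by (elim exE conjE)
  have cl: "Y closure_of c - c \<subseteq> ?B" "Y closure_of c \<subseteq> I (int a)" if c: "c \<in> base_cells a" for c
  proof -
    obtain e where "e \<in> E a" and ce: "c = base e" using c by blast
    then have at: "attached_cell Y ?B a c" using base_attached by simp
    \<comment> \<open>The cell is attached to the whole cone, but its boundary already lies in the
      base; this lets its generator live relative to either set.\<close>
    note f = attached_cell_facts(2,4)[OF haus_Y attachableD(1)[OF cut_attach(1)] base_sub_cone at attachableD(2)[OF cut_attach(1) c]]
    show "Y closure_of c - c \<subseteq> ?B" by (rule f(2))
    show "Y closure_of c \<subseteq> I (int a)" unfolding cut_attach(2)
      by (rule subset_trans[OF f(1) Un_mono[OF base_sub_cone Union_upper[OF c]]])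
  qed
  have lg: "length es = length gs" using e(3) by (rule list_all2_lengthD)
  have push: "map (hom_induced (int a) (subtopology Y (I (int a))) ?B (subtopology Y (I (int a))) ?C id) ss' =
      map2 (push_cell Y a (I (int a)) ?C) es gs"
  proof (rule nth_equalityI)
    fix i assume "i < length (map (hom_induced (int a) (subtopology Y (I (int a))) ?B (subtopology Y (I (int a))) ?C id) ss')"
    then have i: "i < length es" "i < length gs" using lg by (simp_all add: ss')
    have "es ! i \<in> base_cells a" using nth_mem[OF i(1)] unfolding e(2) .
    note c = cl[OF this]
    show "map (hom_induced (int a) (subtopology Y (I (int a))) ?B (subtopology Y (I (int a))) ?C id) ss' ! i =
      map2 (push_cell Y a (I (int a)) ?C) es gs ! i"
      using i inclusion_compose[OF c(2) order_refl c(1) base_sub_cone, of "int a" Y "gs ! i"]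
      by (simp add: ss' push_cell_def I_cut)
  qed (simp add: ss')
  have "int_basis (relative_homology_group (int a) (subtopology Y (I (int a))) ?B)
      (carrier (relative_homology_group (int a) (subtopology Y (I (int a))) ?B)) (map cone_include us @ ss')"
    unfolding I_cut(1)
  proof (rule relative_basis_split[OF base_sub_cone _ _ us_basis])
    show "?C \<subseteq> I (int a)" unfolding cut_attach(2) by simp
    show "trivial_group (relative_homology_group (int a + 1) (subtopology Y (I (int a))) ?C)"
      by (rule attach_cells(2)[OF haus_Y cut_attach]) simp
    show "set ss' \<subseteq> carrier (relative_homology_group (int a) (subtopology Y (I (int a))) ?B)"
      unfolding ss' I_cut by (auto simp: push_cell_def hom_induced_carrier)
    show "int_basis (relative_homology_group (int a) (subtopology Y (I (int a))) ?C)
      (carrier (relative_homology_group (int a) (subtopology Y (I (int a))) ?C))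
      (map (hom_induced (int a) (subtopology Y (I (int a))) ?B (subtopology Y (I (int a))) ?C id) ss')"
      unfolding push by (rule attach_cells(4)[OF haus_Y cut_attach e])
  qed
  then have b: "int_basis (J (int a)) (carrier (J (int a))) (map cone_include us @ ss')"
    unfolding filt_group_def I_cut .
  show ?thesis
    by (rule comm_group.int_basis_perm[OF _ b]) (simp_all add: wsu filt_group_def)
qed

text \<open>Ensures that the statement about all chain bases is not vacuous: cells have generators,
  the cycles form a subgroup of a free group, and every cycle is a boundary in the cone.\<close>

lemma cut_basis_exists:
  "\<exists>ss' zs ws. oriented_cells Y I (int a) (base_cells a) ss' \<and>
     int_basis (CN (int a - 1)) (filt_cycles X N (int a - 1)) zs \<and> list_all2 (cone_over_cycle X E p (int a - 1)) zs ws"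
proof -
  obtain es gs where e: "distinct es" "set es = base_cells a" "list_all2 (cell_generator Y a) es gs"
    using attach_cells(3)[OF haus_Y cut_attach] by (elim exE conjE)
  have o: "oriented_cells Y I (int a) (base_cells a) (map2 (push_cell Y a (I (int a)) (I (int a - 1))) es gs)"
    unfolding oriented_cells_iff by (intro exI[of _ es] exI[of _ gs] conjI e refl)
  \<comment> \<open>The degree \<open>a - 1\<close> as a natural number; the subtraction is genuine
    because \<open>a \<ge> 2\<close>.\<close>
  define b where "b = a - 1"
  have b: "int b = int a - 1" using cut(2) by (simp add: b_def)
  obtain ss where ss: "int_basis (CN (int a - 1)) (carrier (CN (int a - 1))) ss"
    using skeleton_attach(3)[OF closed_skeleton, of b] unfolding b ..
  have h: "group_hom (CN (int a - 1)) (CN (int a - 1 - 1)) (bN (int a - 1))"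
    using filt_boundary_hom[where q = "int a - 1" and X = X and F = N, OF skeleton_mono] by (simp add: group_hom_def group_hom_axioms_def filt_group_def)
  have cg: "comm_group (CN (int a - 1))" by (simp add: filt_group_def)
  obtain zs where zs: "int_basis (CN (int a - 1)) (filt_cycles X N (int a - 1)) zs"
    using comm_group.subgroup_int_basis_ex[OF cg ss group_hom.subgroup_kernel[OF h]] unfolding filt_cycles_def ..
  have ex: "\<exists>w. cone_over_cycle X E p (int a - 1) z w" if "z \<in> set zs" for z
  proof -
    have "z \<in> filt_cycles X N (int a - 1)" using zs that unfolding int_basis_def by blast
    then have "\<eta> (int a - 1) z \<in> \<eta> (int a - 1) ` filt_cycles X N (int a - 1)" by (rule imageI)
    also have "\<dots> = cone_boundary ` carrier cone_chains"
      unfolding cone_boundary_image using base_hom_cycles[of "int a - 1"] cut(2) by simp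
    finally obtain u where "u \<in> carrier cone_chains" "\<eta> (int a - 1) z = cone_boundary u" by (rule imageE) 
    then show ?thesis unfolding cone_over_cycle_iff by (intro exI[of _ "cone_include u"] exI[of _ u]) simp
  qed
  have "\<exists>ws. list_all2 (cone_over_cycle X E p (int a - 1)) zs ws" by (rule list_all2_exists) (rule ex)
  with o zs show ?thesis by (elim exE) (intro exI conjI, assumption+)
qed

lemma intersection_int_basis_is_basis:
  assumes "intersection_int_basis X E p q ss" shows "int_basis (J (int q)) (carrier (J (int q))) ss"
proof (cases q a rule: linorder_cases)
  case less
  then have "oriented_cells Y I (int q) (base_cells q) ss"
    using assms by (simp add: intersection_int_basis_def Let_def)
  then show ?thesis by (rule attach_oriented_cells(1)[OF haus_Y below_attach[OF less]])
next
  case equal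
  then show ?thesis using assms cut_basis by (auto simp: intersection_int_basis_def Let_def)
next
  case greater
  then have "oriented_cells Y I (int q) (cone_cells E q) ss"
    using assms by (simp add: intersection_int_basis_def Let_def)
  then show ?thesis by (rule attach_oriented_cells(1)[OF haus_Y above_attach[OF greater]])
qed

lemma intersection_int_basis_exists: "\<exists>ss. intersection_int_basis X E p q ss"
proof (cases q a rule: linorder_cases)
  case less
  then show ?thesis using attach_oriented_cells(2)[where F = I, OF haus_Y below_attach[OF less]]
    by (simp add: intersection_int_basis_def Let_def)
next
  case equal
  then show ?thesis using cut_basis_exists by (simp add: intersection_int_basis_def Let_def)
next
  case greater
  then show ?thesis using attach_oriented_cells(2)[where F = I, OF haus_Y above_attach[OF greater]]
    by (simp add: intersection_int_basis_def Let_def)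
qed

text \<open>Beyond the dimension of the cone no cells are added, so consecutive terms coincide and
  their relative group is trivial.\<close>

lemma intersection_finite: "finite {q::nat. carrier (J (int q)) \<noteq> {\<one>\<^bsub>J (int q)\<^esub>}}"
proof -
  obtain d where d: "\<And>q. d \<le> q \<Longrightarrow> E q = {}" by (rule cells_bounded) (rule that)
  \<comment> \<open>The bound puts \<open>q\<close> beyond the cut and both \<open>q\<close> and
    \<open>q - 1\<close> beyond the last dimension with cells.\<close>
  have "carrier (J (int q)) = {\<one>\<^bsub>J (int q)\<^esub>}" if q: "a + d + 1 \<le> q" for q
  proof -
    have "q \<noteq> 0" "a < q" using q by simp_all
    moreover have "E (q - 1) = {}" "E q = {}" using q by (simp_all add: d)
    ultimately have "I (int q) = I (int q - 1)" using above_attach(2)[of q] by (simp add: cone_cells_def)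
    then show ?thesis
      using relative_trivial_self[of "int q" Y "I (int q - 1)"] by (simp add: filt_group_def trivial_group_def)
  qed
  then have "{q::nat. carrier (J (int q)) \<noteq> {\<one>\<^bsub>J (int q)\<^esub>}} \<subseteq> {..a + d + 1}"
    by (metis (mono_tags, lifting) atMost_iff linorder_le_cases mem_Collect_eq subsetI)
  then show ?thesis using finite_subset by blast
qed

lemma truncated:
  assumes "real_basis UNIV vs"
  shows "truncated_complex J bJ vs CN bN \<eta> a"
proof (intro truncated_complex.intro integral_complex.intro truncated_complex_axioms.intro)
  show "real_basis UNIV vs" by (rule assms)
  show "comm_group (J q)" "comm_group (CN q)" for q by (simp_all add: filt_group_def)
  show "bJ q \<in> hom (J q) (J (q - 1))" for q by (rule filt_boundary_hom[OF I_mono]) simp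
  show "bN q \<in> hom (CN q) (CN (q - 1))" for q by (rule filt_boundary_hom[OF skeleton_mono]) simp
  show "bJ q (bJ (q + 1) x) = \<one>\<^bsub>J (q - 1)\<^esub>" for q x
    by (rule filt_boundary_boundary[OF I_mono I_mono]) simp_all
  show "bN q (bN (q + 1) x) = \<one>\<^bsub>CN (q - 1)\<^esub>" for q x
    by (rule filt_boundary_boundary[OF skeleton_mono skeleton_mono]) simp_all
  show "carrier (J (-1)) = {\<one>\<^bsub>J (-1)\<^esub>}" "carrier (CN (-1)) = {\<one>\<^bsub>CN (-1)\<^esub>}"
    using trivial_relative_homology_group[of "-1" "subtopology Y (I (-1))" "I (-1 - 1)"]
      trivial_relative_homology_group[of "-1" "subtopology X (N (-1))" "N (-1 - 1)"]
    unfolding filt_group_def trivial_group_def by simp_all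
  show "finite {q::nat. carrier (J (int q)) \<noteq> {\<one>\<^bsub>J (int q)\<^esub>}}" by (rule intersection_finite)
  show "\<exists>ss. int_basis (J (int q)) (carrier (J (int q))) ss" for q :: nat
    using intersection_int_basis_exists[of q] by (elim exE) (rule exI, rule intersection_int_basis_is_basis)
  show "\<eta> (int q) \<in> iso (CN (int q)) (J (int q))" if "q < a" for q :: nat
    by (rule base_hom_iso) (use that in simp)
  show "\<eta> (int q) (bN (int q + 1) x) = bJ (int q + 1) (\<eta> (int q + 1) x)" if "Suc q < a" for q :: nat and x
    by (rule base_hom_boundary) (use that in simp)
  show "kernel (J (int q)) (J (int q - 1)) (bJ (int q)) \<subseteq> bJ (int q + 1) ` carrier (J (int q + 1))" if "a \<le> Suc q" for q :: nat
    by (rule intersection_exact[OF that])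
qed

end

theorem theorem7p7:
  fixes X :: "'a topology" and E :: "nat \<Rightarrow> 'a set set" and p :: "nat \<Rightarrow> int"
    and vs :: "'v::real_vector list"
    and n h :: "nat \<Rightarrow> ('v, 'a chain set) tensor set list"
  defines "C \<equiv> (filt_space X (skeleton E) :: nat \<Rightarrow> ('v, 'a chain set) tensor set)"
    and "dC \<equiv> filt_diff X (skeleton E)"
    and "IC \<equiv> (filt_space (cone_topology X) (intersection_skeleton X E p)
                 :: nat \<Rightarrow> ('v, ('a \<times> real) chain set) tensor set)"
    and "dIC \<equiv> filt_diff (cone_topology X) (intersection_skeleton X E p)"
    and "Ih \<equiv> intersection_homology_basis X E p h"
  assumes "regular_CW_complex X E" and "topspace X \<noteq> {}" and "connected_space X"
    and "perversity (cw_dim E + 1) p"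
    and "real_basis UNIV vs"
    and "\<And>q. standard_basis vs X (skeleton E) q (n q)"
    and "\<And>q. homology_basis C dC q (h q)"
  shows "real_complex IC dIC \<and>
    (\<forall>q. homology_basis IC dIC q (Ih q)) \<and>
    (\<exists>c. \<forall>q. intersection_chain_basis vs X E p q (c q)) \<and>
    (\<forall>c. (\<forall>q. intersection_chain_basis vs X E p q (c q)) \<longrightarrow>
       (\<forall>q. real_basis (IC q) (c q)) \<and>
       (\<exists>!t. torsion_value IC dIC c Ih t) \<and>
       R_torsion IC dIC c Ih =
         (\<Prod>q | q + 2 \<le> cut_degree E p.
            \<bar>det (homology_base_change C dC q (h q) (n q))\<bar> powi ((-1) ^ q)) *
         (\<Prod>q | q + 2 \<le> cut_degree E p.
            (real (card (torsion_subgroup (filt_homology X (skeleton E) (int q))))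
               ^ dim (UNIV :: 'v set)) powi ((-1) ^ q)))"
proof -
  interpret K: cone_complex X E p
    using assms(6,7,9) by (simp add: cone_complex_def regular_complex_def cone_complex_axioms_def)
  interpret T: truncated_complex K.J K.bJ vs K.CN K.bN K.\<eta> K.a
    by (rule K.truncated[OF assms(10)])
  \<comment> \<open>The constants of the locales and those of the theorem unfold to the same
    terms.\<close>
  have eqs: "T.C = C" "T.dC = dC" "T.D = IC" "T.d = dIC"
    unfolding C_def dC_def IC_def dIC_def
    by (intro ext; simp only: T.C_def T.dC_def T.D_def T.d_def filt_space_def filt_diff_def)+
  have H: "complex_homology K.CN K.bN q = filt_homology X (skeleton E) q" for q
    unfolding complex_homology_def filt_homology_def filt_cycles_def ..
  have Ih: "T.Ih h = Ih"
    unfolding Ih_def by (intro ext) (simp only: T.Ih_def T.\<Phi>_def[abs_def] intersection_homology_basis_def)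
  have n: "T.std_basis q (n q)" for q
    using assms(11)[of q] unfolding standard_basis_def T.std_basis_def H eqs C_def dC_def .
  have h: "homology_basis T.C T.dC q (h q)" for q
    unfolding eqs by (rule assms(12))
  note main = T.torsion_formula[OF n h, unfolded eqs Ih H]
  \<comment> \<open>The formula holds for every family of integral bases, so all that is retained of
    a chain basis is that it comes from one.\<close>
  have basis: "\<exists>ss. \<forall>q. int_basis (K.J (int q)) (carrier (K.J (int q))) (ss q) \<and> c q = tensor_basis (K.J (int q)) vs (ss q)"
    if c: "\<forall>q. intersection_chain_basis vs X E p q (c q)" for c
  proof (rule choice, rule allI)
    fix q
    obtain ss where "intersection_int_basis X E p q ss" "c q = tensor_basis (K.J (int q)) vs ss"
      using c unfolding intersection_chain_basis_def by blast
    then show "\<exists>ss. int_basis (K.J (int q)) (carrier (K.J (int q))) ss \<and> c q = tensor_basis (K.J (int q)) vs ss"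
      using K.intersection_int_basis_is_basis by blast
  qed
  show ?thesis
  proof (intro conjI allI impI)
    show "real_complex IC dIC" using T.real_complex_D unfolding eqs .
    show "homology_basis IC dIC q (Ih q)" for q by (rule main(1))
    have "\<forall>q. \<exists>c. intersection_chain_basis vs X E p q c"
      unfolding intersection_chain_basis_def using K.intersection_int_basis_exists by blast
    then show "\<exists>c. \<forall>q. intersection_chain_basis vs X E p q (c q)" by (rule choice)
  next
    fix c q assume "\<forall>q. intersection_chain_basis vs X E p q (c q)"
    then obtain ss where ss: "\<forall>q. int_basis (K.J (int q)) (carrier (K.J (int q))) (ss q) \<and> c q = tensor_basis (K.J (int q)) vs (ss q)"
      using basis by blast
    then show "real_basis (IC q) (c q)"
      using comm_group.tensor_real_basis[OF _ assms(10), of "K.J (int q)" "ss q"] unfolding IC_def filt_space_def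
      by (simp add: filt_group_def)
  next
    fix c assume "\<forall>q. intersection_chain_basis vs X E p q (c q)"
    then obtain ss where ss: "\<forall>q. int_basis (K.J (int q)) (carrier (K.J (int q))) (ss q) \<and> c q = tensor_basis (K.J (int q)) vs (ss q)"
      using basis by blast
    then have c: "c = (\<lambda>q. tensor_basis (K.J (int q)) vs (ss q))" by (intro ext) simp
    note m = main(2)[of ss, folded c]
    show "\<exists>!t. torsion_value IC dIC c Ih t" using m ss by blast
    show "R_torsion IC dIC c Ih =
         (\<Prod>q | q + 2 \<le> cut_degree E p. \<bar>det (homology_base_change C dC q (h q) (n q))\<bar> powi ((-1) ^ q)) *
         (\<Prod>q | q + 2 \<le> cut_degree E p.
            (real (card (torsion_subgroup (filt_homology X (skeleton E) (int q)))) ^ dim (UNIV :: 'v set)) powi ((-1) ^ q))"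
      using m ss unfolding dim_real_basis[OF assms(10)] by blast
  qed
qed

end
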